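(* Let $a\in S^0_{0,0}(\mathbb{R}^{2n})$ and let $W_{\mathcal A}$ be the metaplectic Wigner distribution associated with a metaplectic operator $\hat{\mathcal A}\in \mathrm{Mp}(2n,\mathbb{R})$. Then, for every $f\in L^2(\mathbb{R}^n)$, $$WF_{\mathcal A}(\mathrm{Op}^{\mathrm w}(a)f)\subseteq WF_{\mathcal A}(f).$$
   Context: Metaplectic operators. $\mathrm{Sp}(m,\mathbb{R})$ is the group of $2m\times 2m$ real matrices $S$ with $S^\top JS=J$, $J=\begin{pmatrix}0&I_m\\-I_m&0\end{pmatrix}$. For $x,\xi\in\mathbb{R}^m,\tau\in\mathbb{R}$ let $\rho(x,\xi;\tau)g(y)=e^{2\pi i\tau}e^{-i\pi x\cdot\xi}e^{2\pi i\xi\cdot y}g(y-x)$. A metaplectic operator with projection $S\in \mathrm{Sp}(m,\mathbb{R})$ is a unitary operator $\hat S$ on $L^2(\mathbb{R}^m)$ with $\hat S\rho(x,\xi;\tau)\hat S^{-1}=\rho(S(x,\xi);\tau)$ for all $x,\xi,\tau$; it is determined by $S$ up to a factor of modulus 1. $\mathrm{Mp}(m,\mathbb{R})$ is the metaplectic group, the double cover of $\mathrm{Sp}(m,\mathbb{R})$ consisting of exactly two such operators (differing by sign) for each $S$. Metaplectic Wigner distribution. For $\hat{\mathcal A}\in \mathrm{Mp}(2n,\mathbb{R})$ (acting on $L^2(\mathbb{R}^{2n})$) with projection $\mathcal A\in \mathrm{Sp}(2n,\mathbb{R})$, $W_{\mathcal A}(f,g)=\hat{\mathcal A}(f\otimes\bar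 g)$ for $f,g\in L^2(\mathbb{R}^n)$, where $(f\otimes \bar g)(x,y)=f(x)\overline{g(y)}$; $W_{\mathcal A}f=W_{\mathcal A}(f,f)$. Symbols. $a\in S^0_{0,0}(\mathbb{R}^{2n})$ means $a\in C^\infty(\mathbb{R}^{2n})$ (complex-valued) and all partial derivatives of $a$ of every order (including order 0) are bounded. The Weyl operator is $\mathrm{Op}^{\mathrm w}(a)f(x)=\int_{\mathbb{R}^{2n}}e^{2\pi i(x-y)\cdot\xi}a(\frac{x+y}2,\xi)f(y)\,dy\,d\xi$ for $f\in\mathcal S(\mathbb{R}^n)$ (oscillatory integral), extended to a bounded operator on $L^2(\mathbb{R}^n)$. Wave front set. Let $\langle X\rangle=(1+|X|^2)^{1/2}$, and let $F\in L^2_{v_s}(\Gamma)$ mean $\int_\Gamma\langle X\rangle^{2s}|F(X)|^2dX<\infty$. A cone is a subset of $\mathbb{R}^{2n}\setminus\{0\}$ invariant under multiplication by positive reals. For $f\in L^2(\mathbb{R}^n)$, $WF_{\mathcal A}(f)\subseteq\mathbb{R}^{2n}\setminus\{0\}$ is defined by: $0\neq X_0\notin WF_{\mathcal A}(f)$ iff there is an open cone $\Gamma_{X_0}\subseteq\mathbb{R}^{2n}\setminus\{0\}$ containing $X_0$ such that $W_{\mathcal A}f\in\bigcap_{s\ge0}L^2_{v_s}(\Gamma_{X_0})$. *)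

theory Defs
  imports "HOL-Analysis.Analysis"
begin

text \<open>
  The space of dimension \<open>2m\<close> is \<open>real^('m + 'm)\<close>; a point is written \<open>(x, \<xi>)\<close> with
  the first \<open>m\<close> coordinates indexed by \<open>Inl\<close> and the last \<open>m\<close> by \<open>Inr\<close>.
\<close>

definition vjoin :: "real^'m::finite \<Rightarrow> real^'m \<Rightarrow> real^('m + 'm)" where
  "vjoin x \<xi> = (\<chi> i. case i of Inl j \<Rightarrow> x $ j | Inr j \<Rightarrow> \<xi> $ j)"

definition vfst :: "real^('m + 'm) \<Rightarrow> real^'m" where
  "vfst z = (\<chi> j. z $ Inl j)"

definition vsnd :: "real^('m + 'm) \<Rightarrow> real^'m" where
  "vsnd z = (\<chi> j. z $ Inr j)"

definition symplectic_J :: "real^('m::finite + 'm)^('m + 'm)" where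
  "symplectic_J = (\<chi> i j. case i of
       Inl k \<Rightarrow> (case j of Inl l \<Rightarrow> 0 | Inr l \<Rightarrow> if k = l then 1 else 0)
     | Inr k \<Rightarrow> (case j of Inl l \<Rightarrow> if k = l then - 1 else 0 | Inr l \<Rightarrow> 0))"

definition Sp :: "(real^('m::finite + 'm)^('m + 'm)) set" where
  "Sp = {S. transpose S ** symplectic_J ** S = symplectic_J}"

text \<open>
  Elements of \<open>L\<^sup>2\<close> are represented by Borel measurable functions (every class has such a
  representative), and operators on \<open>L\<^sup>2\<close> by maps on representatives. All identities between
  elements of \<open>L\<^sup>2\<close> are therefore identities almost everywhere. A linear operator in the sense
  below that is bounded or isometric sends almost everywhere equal functions to almost everywhere
  equal functions, hence descends to classes.
\<close>

definition L2 :: "('a::euclidean_space \<Rightarrow> complex) set" where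
  "L2 = {f \<in> borel_measurable lborel. integrable lborel (\<lambda>x. (cmod (f x))\<^sup>2)}"

definition ae_eq :: "('a::euclidean_space \<Rightarrow> complex) \<Rightarrow> ('a \<Rightarrow> complex) \<Rightarrow> bool" where
  "ae_eq f g \<longleftrightarrow> (AE x in lborel. f x = g x)"

definition L2_inner :: "('a::euclidean_space \<Rightarrow> complex) \<Rightarrow> ('a \<Rightarrow> complex) \<Rightarrow> complex" where
  "L2_inner f g = (LINT x|lborel. f x * cnj (g x))"

definition L2_norm :: "('a::euclidean_space \<Rightarrow> complex) \<Rightarrow> real" where
  "L2_norm f = sqrt (LINT x|lborel. (cmod (f x))\<^sup>2)"

type_synonym 'a operator = "('a \<Rightarrow> complex) \<Rightarrow> ('a \<Rightarrow> complex)"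

definition L2_linear :: "'a::euclidean_space operator \<Rightarrow> bool" where
  "L2_linear T \<longleftrightarrow>
     (\<forall>f\<in>L2. T f \<in> L2) \<and>
     (\<forall>f\<in>L2. \<forall>g\<in>L2. ae_eq (T (\<lambda>x. f x + g x)) (\<lambda>x. T f x + T g x)) \<and>
     (\<forall>c. \<forall>f\<in>L2. ae_eq (T (\<lambda>x. c * f x)) (\<lambda>x. c * T f x))"

definition L2_bounded_linear :: "'a::euclidean_space operator \<Rightarrow> bool" where
  "L2_bounded_linear T \<longleftrightarrow>
     L2_linear T \<and> (\<exists>C. \<forall>f\<in>L2. L2_norm (T f) \<le> C * L2_norm f)"

definition L2_unitary :: "'a::euclidean_space operator \<Rightarrow> bool" where
  "L2_unitary T \<longleftrightarrow>
     L2_linear T \<and>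
     (\<forall>f\<in>L2. \<forall>g\<in>L2. L2_inner (T f) (T g) = L2_inner f g) \<and>
     (\<forall>g\<in>L2. \<exists>f\<in>L2. ae_eq (T f) g)"

definition op_eq :: "'a::euclidean_space operator \<Rightarrow> 'a operator \<Rightarrow> bool" where
  "op_eq T U \<longleftrightarrow> (\<forall>f\<in>L2. T f \<in> L2 \<and> U f \<in> L2 \<and> ae_eq (T f) (U f))"

definition rho :: "real^('m::finite + 'm) \<Rightarrow> real \<Rightarrow> (real^'m) operator" where
  "rho z \<tau> g y = cis (2 * pi * \<tau>) * cis (- pi * (vfst z \<bullet> vsnd z))
                   * cis (2 * pi * (vsnd z \<bullet> y)) * g (y - vfst z)"

text \<open>
  The relation \<open>T \<rho>(z;\<tau>) T\<^sup>-\<^sup>1 = \<rho>(Sz;\<tau>)\<close> is written as \<open>T \<rho>(z;\<tau>) = \<rho>(Sz;\<tau>) T\<close>.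
\<close>

definition metaplectic_operator ::
    "real^('m::finite + 'm)^('m + 'm) \<Rightarrow> (real^'m) operator \<Rightarrow> bool" where
  "metaplectic_operator S T \<longleftrightarrow>
     S \<in> Sp \<and> L2_unitary T \<and>
     (\<forall>z \<tau>. \<forall>g\<in>L2. ae_eq (T (rho z \<tau> g)) (rho (S *v z) \<tau> (T g)))"

text \<open>
  A group (modulo \<open>op_eq\<close>) of metaplectic operators which contains, for each symplectic \<open>S\<close>,
  exactly two operators with projection \<open>S\<close>, and these differ by sign. The last clause also
  makes \<open>M\<close> closed under \<open>op_eq\<close>.
\<close>

definition metaplectic_double_cover :: "(real^'m::finite) operator set \<Rightarrow> bool" where
  "metaplectic_double_cover M \<longleftrightarrow>
     (\<forall>U\<in>M. \<exists>S\<in>Sp. metaplectic_operator S U) \<and>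
     (\<lambda>f. f) \<in> M \<and>
     (\<forall>U\<in>M. \<forall>V\<in>M. U \<circ> V \<in> M) \<and>
     (\<forall>U\<in>M. \<exists>V\<in>M. op_eq (U \<circ> V) (\<lambda>f. f) \<and> op_eq (V \<circ> U) (\<lambda>f. f)) \<and>
     (\<forall>S\<in>Sp. \<exists>U\<in>M. metaplectic_operator S U \<and>
        {V \<in> M. metaplectic_operator S V} =
          {V. op_eq V U \<or> op_eq V (\<lambda>f x. - U f x)})"

text \<open>
  There is exactly one such group: two of them differ by a homomorphism from the symplectic
  group to the circle, which is trivial since the symplectic group is perfect. The union below
  thus merely names the unique set with this property.
\<close>

definition Mp :: "(real^'m::finite) operator set" where
  "Mp = \<Union> {M. metaplectic_double_cover M}"

definition partial_deriv :: "'m::finite \<Rightarrow> (real^'m \<Rightarrow> complex) \<Rightarrow> real^'m \<Rightarrow> complex" where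
  "partial_deriv i f x = vector_derivative (\<lambda>t. f (x + t *\<^sub>R axis i 1)) (at 0)"

definition partial_derivs :: "'m::finite list \<Rightarrow> (real^'m \<Rightarrow> complex) \<Rightarrow> real^'m \<Rightarrow> complex" where
  "partial_derivs \<alpha> f = foldr partial_deriv \<alpha> f"

text \<open>
  Total differentiability of every iterated partial derivative (including \<open>f\<close> itself) makes all
  of them exist and be continuous.
\<close>

definition smooth :: "(real^'m::finite \<Rightarrow> complex) \<Rightarrow> bool" where
  "smooth f \<longleftrightarrow> (\<forall>\<alpha>. partial_derivs \<alpha> f differentiable_on UNIV)"

definition S000 :: "(real^'m::finite \<Rightarrow> complex) set" where
  "S000 = {a. smooth a \<and> (\<forall>\<alpha>. bounded (range (partial_derivs \<alpha> a)))}"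

definition schwartz :: "(real^'m::finite \<Rightarrow> complex) set" where
  "schwartz = {f. smooth f \<and>
     (\<forall>\<alpha> k. \<exists>C. \<forall>x. norm x ^ k * cmod (partial_derivs \<alpha> f x) \<le> C)}"

text \<open>
  The oscillatory integral of \<open>F\<close> has value \<open>I\<close> if \<open>\<integral> \<phi>(\<epsilon>Z) F(Z) dZ\<close> tends to \<open>I\<close> as \<open>\<epsilon> \<down> 0\<close>,
  for every Schwartz cutoff \<open>\<phi>\<close> with \<open>\<phi>(0) = 1\<close>.
\<close>

definition has_oscillatory_integral :: "(real^'m::finite \<Rightarrow> complex) \<Rightarrow> complex \<Rightarrow> bool" where
  "has_oscillatory_integral F I \<longleftrightarrow>
     (\<forall>\<phi>\<in>schwartz. \<phi> 0 = 1 \<longrightarrow>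
        (\<forall>\<epsilon>>0. integrable lborel (\<lambda>Z. \<phi> (\<epsilon> *\<^sub>R Z) * F Z)) \<and>
        ((\<lambda>\<epsilon>. LINT Z|lborel. \<phi> (\<epsilon> *\<^sub>R Z) * F Z) \<longlongrightarrow> I) (at_right 0))"

definition weyl_integrand ::
    "(real^('n::finite + 'n) \<Rightarrow> complex) \<Rightarrow> (real^'n \<Rightarrow> complex) \<Rightarrow> real^'n \<Rightarrow> real^('n + 'n) \<Rightarrow> complex"
  where
  "weyl_integrand a f x Z =
     (let y = vfst Z; \<xi> = vsnd Z in
        cis (2 * pi * ((x - y) \<bullet> \<xi>)) * a (vjoin ((1/2) *\<^sub>R (x + y)) \<xi>) * f y)"

text \<open>
  For \<open>a \<in> S000\<close> the bounded extension from Schwartz functions to \<open>L2\<close> exists by the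
  Calderon-Vaillancourt theorem and is unique up to \<open>op_eq\<close> by density, so the choice operator
  only selects representatives.
\<close>

definition weyl_op :: "(real^('n::finite + 'n) \<Rightarrow> complex) \<Rightarrow> (real^'n) operator" where
  "weyl_op a = (SOME T. L2_bounded_linear T \<and>
     (\<forall>f\<in>schwartz. AE x in lborel. has_oscillatory_integral (weyl_integrand a f x) (T f x)))"

definition tensor :: "(real^'n \<Rightarrow> complex) \<Rightarrow> (real^'n \<Rightarrow> complex) \<Rightarrow> real^('n::finite + 'n) \<Rightarrow> complex"
  where "tensor f h z = f (vfst z) * h (vsnd z)"

definition wigner :: "(real^('n::finite + 'n)) operator \<Rightarrow>
    (real^'n \<Rightarrow> complex) \<Rightarrow> (real^'n \<Rightarrow> complex) \<Rightarrow> real^('n + 'n) \<Rightarrow> complex" where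
  "wigner A f g = A (tensor f (\<lambda>y. cnj (g y)))"

definition japanese :: "'a::real_normed_vector \<Rightarrow> real" where
  "japanese X = sqrt (1 + (norm X)\<^sup>2)"

definition weighted_L2_on :: "real \<Rightarrow> 'a::euclidean_space set \<Rightarrow> ('a \<Rightarrow> complex) \<Rightarrow> bool" where
  "weighted_L2_on s \<Gamma> F \<longleftrightarrow>
     (\<integral>\<^sup>+X\<in>\<Gamma>. ennreal (japanese X powr (2 * s) * (cmod (F X))\<^sup>2) \<partial>lborel) < \<infinity>"

text \<open>Unlike the library's \<open>cone\<close>, these cones do not contain the origin.\<close>

definition punctured_cone :: "'a::real_vector set \<Rightarrow> bool" where
  "punctured_cone \<Gamma> \<longleftrightarrow> 0 \<notin> \<Gamma> \<and> (\<forall>X\<in>\<Gamma>. \<forall>c>0. c *\<^sub>R X \<in> \<Gamma>)"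

definition WF :: "(real^('n::finite + 'n)) operator \<Rightarrow> (real^'n \<Rightarrow> complex) \<Rightarrow> (real^('n + 'n)) set"
  where
  "WF A f = {X\<^sub>0. X\<^sub>0 \<noteq> 0 \<and>
     \<not> (\<exists>\<Gamma>. open \<Gamma> \<and> punctured_cone \<Gamma> \<and> X\<^sub>0 \<in> \<Gamma> \<and>
          (\<forall>s\<ge>0. weighted_L2_on s \<Gamma> (wigner A f f)))}"

end

theory Submission
  imports Defs "HOL-Probability.Characteristic_Functions" "HOL-Probability.Sinc_Integral"
begin

text \<open>
  The Weyl form \<open>\<langle>Op(a) P, H\<rangle>\<close> is written as an absolutely convergent integral of the Gaussian
  short-time Fourier transforms of \<open>a\<close>, \<open>P\<close> and \<open>H\<close>; for \<open>a \<in> S\<^sup>0\<^sub>0\<^sub>0\<close> the transform of \<open>a\<close> decays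
  rapidly in the frequency variable, which gives boundedness on \<open>L\<^sup>2\<close> (Calderon-Vaillancourt).
  Since \<open>(Tf) \<otimes> cnj (Tf)\<close>, for \<open>T = Op(a)\<close>, is again a Weyl operator with symbol \<open>b\<close> in \<open>S\<^sup>0\<^sub>0\<^sub>0\<close>
  applied to \<open>f \<otimes> cnj f\<close>, one has \<open>W(Tf) = B (Wf)\<close> with \<open>B = A Op(b) A\<^sup>-\<^sup>1\<close>. The metaplectic
  covariance turns modulations into phase-space translations, so the commutator of \<open>B\<close> with
  multiplication by a coordinate is \<open>A Op(\<partial>b) A\<^sup>-\<^sup>1\<close> up to a constant, hence bounded. Iterating this,
  \<open>B\<close> has rapidly decaying blocks between sets separated in some coordinate. Covering a small conic
  neighbourhood by shells of radius \<open>k\<close> that sit in cubes of side comparable to \<open>k\<close>, rapid decay of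
  \<open>Wf\<close> in a cone passes to \<open>W(Tf)\<close> in a smaller cone.
\<close>

section \<open>The space \<open>L\<^sup>2\<close>\<close>

text \<open>Operators act on representatives and \<open>weyl_op\<close> comes from a choice, so the
  argument runs on sesquilinear forms. The \<xi>-integral of the Weyl formula is not absolutely
  convergent in general, hence cannot be exchanged directly with the inversion formula for the
  symbol. A Gaussian damping in the centre W of the window makes all integrals absolute; integrated
  out, it becomes a Gaussian cutoff in the Weyl integral, and both sides converge when it is
  removed. Bounded commutators give decay as follows. If p lives where |x_j - \<kappa>| >= 2r and q
  where |x_j - \<kappa>| <= r, then dividing p and multiplying q by x_j - \<kappa> halves the
  product of their norms; the commutator error is the form of a derivative of the symbol with a gain
  of 1/r. Iteration removes the a priori bound geometrically, and each derivative contributes one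
  factor 1/r. Coordinates see only axis-parallel separation, hence cubes; since cones are
  homogeneous, the side of the cubes can grow like the distance k from the origin, and r^-N becomes
  k^-N up to a constant.\<close>

lemma borel_measurable_cnj [measurable]:
  "f \<in> borel_measurable M \<Longrightarrow> (\<lambda>x. cnj (f x)) \<in> borel_measurable M"
  by (rule borel_measurable_continuous_on[of cnj]) (auto intro: continuous_intros)

lemma L2_measurable [measurable_dest]: "f \<in> L2 \<Longrightarrow> f \<in> borel_measurable borel"
  by (simp add: L2_def)

lemma L2_square_integrable: "f \<in> L2 \<Longrightarrow> integrable lborel (\<lambda>x. (cmod (f x))\<^sup>2)"
  by (simp add: L2_def)

lemma L2I: "f \<in> borel_measurable borel \<Longrightarrow> integrable lborel (\<lambda>x. (cmod (f x))\<^sup>2) \<Longrightarrow> f \<in> L2"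
  by (simp add: L2_def)

lemma L2_dominated:
  assumes [measurable]: "f \<in> borel_measurable borel" and g: "g \<in> L2"
    and le: "\<And>x. cmod (f x) \<le> C * cmod (g x)"
  shows "f \<in> L2"
proof (rule L2I)
  show "integrable lborel (\<lambda>x. (cmod (f x))\<^sup>2)"
  proof (rule Bochner_Integration.integrable_bound)
    show "integrable lborel (\<lambda>x. C\<^sup>2 * (cmod (g x))\<^sup>2)"
      using L2_square_integrable[OF g] by simp
    show "AE x in lborel. norm ((cmod (f x))\<^sup>2) \<le> norm (C\<^sup>2 * (cmod (g x))\<^sup>2)"
    proof (rule AE_I2)
      fix x
      have "(cmod (f x))\<^sup>2 \<le> (C * cmod (g x))\<^sup>2"
        using le[of x] by (intro power_mono) auto
      then show "norm ((cmod (f x))\<^sup>2) \<le> norm (C\<^sup>2 * (cmod (g x))\<^sup>2)"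
        by (simp add: power_mult_distrib)
    qed
  qed simp
qed fact

lemma L2_zero [simp]: "(\<lambda>x. 0) \<in> L2"
  by (rule L2I) simp_all

lemma L2_cmult: "f \<in> L2 \<Longrightarrow> (\<lambda>x. c * f x) \<in> L2"
  by (rule L2_dominated[where g=f and C="cmod c"]) (auto simp: norm_mult)

lemma L2_cnj: "f \<in> L2 \<Longrightarrow> (\<lambda>x. cnj (f x)) \<in> L2"
  by (rule L2_dominated[where g=f and C=1]) auto

lemma L2_mult_bounded:
  assumes "f \<in> L2" "u \<in> borel_measurable borel" "\<And>x. cmod (u x) \<le> C"
  shows "(\<lambda>x. u x * f x) \<in> L2"
proof (rule L2_dominated[where g=f and C=C])
  show "(\<lambda>x. u x * f x) \<in> borel_measurable borel"
    using L2_measurable[OF assms(1)] assms(2) by (rule borel_measurable_times[rotated])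
  show "cmod (u x * f x) \<le> C * cmod (f x)" for x
    unfolding norm_mult by (intro mult_right_mono assms(3)) simp
qed fact

lemma L2_add:
  assumes f: "f \<in> L2" and g: "g \<in> L2"
  shows "(\<lambda>x. f x + g x) \<in> L2"
proof (rule L2I)
  note [measurable] = L2_measurable[OF f] L2_measurable[OF g]
  show "(\<lambda>x. f x + g x) \<in> borel_measurable borel" by simp
  show "integrable lborel (\<lambda>x. (cmod (f x + g x))\<^sup>2)"
  proof (rule Bochner_Integration.integrable_bound)
    show "integrable lborel (\<lambda>x. 2 * (cmod (f x))\<^sup>2 + 2 * (cmod (g x))\<^sup>2)"
      using L2_square_integrable[OF f] L2_square_integrable[OF g] by simp
    show "AE x in lborel. norm ((cmod (f x + g x))\<^sup>2) \<le> norm (2 * (cmod (f x))\<^sup>2 + 2 * (cmod (g x))\<^sup>2)"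
    proof (rule AE_I2)
      fix x
      have "(cmod (f x + g x))\<^sup>2 \<le> (cmod (f x) + cmod (g x))\<^sup>2"
        by (intro power_mono norm_triangle_ineq) auto
      also have "\<dots> \<le> 2 * (cmod (f x))\<^sup>2 + 2 * (cmod (g x))\<^sup>2"
        using sum_squares_bound[of "cmod (f x)" "cmod (g x)"] by (simp add: power2_sum)
      finally show "norm ((cmod (f x + g x))\<^sup>2) \<le> norm (2 * (cmod (f x))\<^sup>2 + 2 * (cmod (g x))\<^sup>2)"
        by simp
    qed
  qed simp
qed

lemma L2_diff: "f \<in> L2 \<Longrightarrow> g \<in> L2 \<Longrightarrow> (\<lambda>x. f x - g x) \<in> L2"
  using L2_add[of f "\<lambda>x. (-1) * g x"] L2_cmult[of g "-1"] by simp

lemma L2_norm_nonneg [simp]: "0 \<le> L2_norm f"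
  by (simp add: L2_norm_def)

lemma L2_norm_square: "(L2_norm f)\<^sup>2 = (LINT x|lborel. (cmod (f x))\<^sup>2)"
  by (simp add: L2_norm_def)

lemma L2_norm_nn: "f \<in> L2 \<Longrightarrow> (\<integral>\<^sup>+x. (ennreal (cmod (f x)))\<^sup>2 \<partial>lborel) = ennreal ((L2_norm f)\<^sup>2)"
  unfolding L2_norm_square using L2_square_integrable[of f]
  by (subst nn_integral_eq_integral[symmetric]) (auto simp: ennreal_power)

lemma L2_normI:
  assumes [measurable]: "f \<in> borel_measurable borel" and C: "0 \<le> C"
    and le: "(\<integral>\<^sup>+x. (ennreal (cmod (f x)))\<^sup>2 \<partial>lborel) \<le> ennreal (C\<^sup>2)"
  shows "f \<in> L2" "L2_norm f \<le> C"
proof -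
  show f: "f \<in> L2"
  proof (rule L2I)
    show "integrable lborel (\<lambda>x. (cmod (f x))\<^sup>2)"
      unfolding integrable_iff_bounded using le
      by (auto simp: ennreal_power intro: le_less_trans)
  qed fact
  have "(L2_norm f)\<^sup>2 \<le> C\<^sup>2"
    using le by (simp add: L2_norm_nn[OF f])
  then show "L2_norm f \<le> C"
    using C by (simp add: power_mono_iff)
qed

lemma L2_norm_cong_AE: "f \<in> L2 \<Longrightarrow> g \<in> L2 \<Longrightarrow> ae_eq f g \<Longrightarrow> L2_norm f = L2_norm g"
  unfolding L2_norm_def ae_eq_def
  by (intro arg_cong[where f=sqrt] integral_cong_AE) auto

lemma L2_norm_cmult: "L2_norm (\<lambda>x. c * f x) = cmod c * L2_norm f"
  by (simp add: L2_norm_def norm_mult power_mult_distrib real_sqrt_mult)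

lemma L2_mult_integrable:
  assumes f: "f \<in> L2" and g: "g \<in> L2"
  shows "integrable lborel (\<lambda>x. f x * g x)"
proof (rule Bochner_Integration.integrable_bound)
  note [measurable] = L2_measurable[OF f] L2_measurable[OF g]
  show "integrable lborel (\<lambda>x. (cmod (f x))\<^sup>2 + (cmod (g x))\<^sup>2)"
    using L2_square_integrable[OF f] L2_square_integrable[OF g] by simp
  show "AE x in lborel. norm (f x * g x) \<le> norm ((cmod (f x))\<^sup>2 + (cmod (g x))\<^sup>2)"
  proof (rule AE_I2)
    fix x
    have "cmod (f x) * cmod (g x) \<le> 2 * cmod (f x) * cmod (g x)" by simp
    also have "\<dots> \<le> (cmod (f x))\<^sup>2 + (cmod (g x))\<^sup>2"
      by (rule sum_squares_bound)
    finally show "norm (f x * g x) \<le> norm ((cmod (f x))\<^sup>2 + (cmod (g x))\<^sup>2)"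
      by (simp add: norm_mult)
  qed
  show "(\<lambda>x. f x * g x) \<in> borel_measurable lborel" by simp
qed

lemma L2_Cauchy_Schwarz:
  assumes f: "f \<in> L2" and g: "g \<in> L2"
  shows "(LINT x|lborel. cmod (f x) * cmod (g x)) \<le> L2_norm f * L2_norm g"
proof -
  note [measurable] = L2_measurable[OF f] L2_measurable[OF g]
  let ?I = "LINT x|lborel. cmod (f x) * cmod (g x)"
  have int: "integrable lborel (\<lambda>x. cmod (f x) * cmod (g x))"
    using integrable_norm[OF L2_mult_integrable[OF f g]] by (simp add: norm_mult)
  have I: "(\<integral>\<^sup>+x. ennreal (cmod (f x)) * ennreal (cmod (g x)) \<partial>lborel) = ennreal ?I"
    by (subst nn_integral_eq_integral[symmetric, OF int]) (auto simp: ennreal_mult)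
  have "(\<integral>\<^sup>+x. ennreal (cmod (f x)) * ennreal (cmod (g x)) \<partial>lborel)\<^sup>2 \<le>
      (\<integral>\<^sup>+x. (ennreal (cmod (f x)))\<^sup>2 \<partial>lborel) * (\<integral>\<^sup>+x. (ennreal (cmod (g x)))\<^sup>2 \<partial>lborel)"
    by (rule Cauchy_Schwarz_nn_integral) auto
  then have "ennreal (?I\<^sup>2) \<le> ennreal ((L2_norm f * L2_norm g)\<^sup>2)"
    unfolding I L2_norm_nn[OF f] L2_norm_nn[OF g]
    by (simp add: ennreal_power ennreal_mult[symmetric] power_mult_distrib)
  then have "?I\<^sup>2 \<le> (L2_norm f * L2_norm g)\<^sup>2"
    by (simp add: ennreal_le_iff)
  then show ?thesis
    by (rule power2_le_imp_le) simp
qed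

lemma L2_inner_bound:
  assumes f: "f \<in> L2" and g: "g \<in> L2"
  shows "cmod (L2_inner f g) \<le> L2_norm f * L2_norm g"
proof -
  have "cmod (L2_inner f g) \<le> (LINT x|lborel. cmod (f x * cnj (g x)))"
    unfolding L2_inner_def by (rule integral_norm_bound)
  also have "\<dots> = (LINT x|lborel. cmod (f x) * cmod (g x))"
    by (simp add: norm_mult)
  also have "\<dots> \<le> L2_norm f * L2_norm g"
    by (rule L2_Cauchy_Schwarz[OF f g])
  finally show ?thesis .
qed

lemma L2_inner_integrable: "f \<in> L2 \<Longrightarrow> g \<in> L2 \<Longrightarrow> integrable lborel (\<lambda>x. f x * cnj (g x))"
  by (intro L2_mult_integrable L2_cnj)

lemma L2_inner_add_left:
  "f \<in> L2 \<Longrightarrow> g \<in> L2 \<Longrightarrow> h \<in> L2 \<Longrightarrow> L2_inner (\<lambda>x. f x + g x) h = L2_inner f h + L2_inner g h"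
  unfolding L2_inner_def using L2_inner_integrable[of f h] L2_inner_integrable[of g h]
  by (simp add: distrib_right)

lemma L2_inner_diff_left:
  "f \<in> L2 \<Longrightarrow> g \<in> L2 \<Longrightarrow> h \<in> L2 \<Longrightarrow> L2_inner (\<lambda>x. f x - g x) h = L2_inner f h - L2_inner g h"
  unfolding L2_inner_def using L2_inner_integrable[of f h] L2_inner_integrable[of g h]
  by (simp add: left_diff_distrib)

lemma L2_inner_cmult_left: "L2_inner (\<lambda>x. c * f x) h = c * L2_inner f h"
  unfolding L2_inner_def by (simp add: mult.assoc)

lemma L2_inner_self: "L2_inner f f = of_real ((L2_norm f)\<^sup>2)"
  unfolding L2_inner_def L2_norm_square
  by (subst integral_complex_of_real[symmetric]) (simp add: complex_norm_square[symmetric])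

lemma L2_inner_cong_AE:
  assumes "f \<in> L2" "f' \<in> L2" "g \<in> L2" "g' \<in> L2" "ae_eq f f'" "ae_eq g g'"
  shows "L2_inner f g = L2_inner f' g'"
  unfolding L2_inner_def
proof (rule integral_cong_AE)
  note [measurable] = assms(1-4)[THEN L2_measurable]
  show "(\<lambda>x. f x * cnj (g x)) \<in> borel_measurable lborel" "(\<lambda>x. f' x * cnj (g' x)) \<in> borel_measurable lborel"
    by measurable
  show "AE x in lborel. f x * cnj (g x) = f' x * cnj (g' x)"
    using assms(5,6) unfolding ae_eq_def by eventually_elim simp
qed

lemma ae_eq_refl [simp]: "ae_eq f f"
  by (simp add: ae_eq_def)

lemma ae_eq_sym: "ae_eq f g \<Longrightarrow> ae_eq g f"
  unfolding ae_eq_def by (simp add: eq_commute)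

lemma ae_eq_trans [trans]: "ae_eq f g \<Longrightarrow> ae_eq g h \<Longrightarrow> ae_eq f h"
  unfolding ae_eq_def by (drule (1) eventually_conj, erule eventually_mono) simp

lemma ae_eq_add: "ae_eq f g \<Longrightarrow> ae_eq f' g' \<Longrightarrow> ae_eq (\<lambda>x. f x + f' x) (\<lambda>x. g x + g' x)"
  unfolding ae_eq_def by (drule (1) eventually_conj, erule eventually_mono) simp

lemma ae_eq_diff: "ae_eq f g \<Longrightarrow> ae_eq f' g' \<Longrightarrow> ae_eq (\<lambda>x. f x - f' x) (\<lambda>x. g x - g' x)"
  unfolding ae_eq_def by (drule (1) eventually_conj, erule eventually_mono) simp

lemma ae_eq_cmult: "ae_eq f g \<Longrightarrow> ae_eq (\<lambda>x. c * f x) (\<lambda>x. c * g x)"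
  unfolding ae_eq_def by (erule eventually_mono) simp

lemma L2_norm_triangle:
  assumes f: "f \<in> L2" and g: "g \<in> L2"
  shows "L2_norm (\<lambda>x. f x + g x) \<le> L2_norm f + L2_norm g"
proof -
  have int: "integrable lborel (\<lambda>x. cmod (f x) * cmod (g x))"
    using integrable_norm[OF L2_mult_integrable[OF f g]] by (simp add: norm_mult)
  have "(L2_norm (\<lambda>x. f x + g x))\<^sup>2 = (LINT x|lborel. (cmod (f x + g x))\<^sup>2)"
    by (rule L2_norm_square)
  also have "\<dots> \<le> (LINT x|lborel. (cmod (f x))\<^sup>2 + 2 * (cmod (f x) * cmod (g x)) + (cmod (g x))\<^sup>2)"
  proof (rule integral_mono)
    fix x
    have "(cmod (f x + g x))\<^sup>2 \<le> (cmod (f x) + cmod (g x))\<^sup>2"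
      by (intro power_mono norm_triangle_ineq) auto
    then show "(cmod (f x + g x))\<^sup>2 \<le> (cmod (f x))\<^sup>2 + 2 * (cmod (f x) * cmod (g x)) + (cmod (g x))\<^sup>2"
      by (simp add: power2_sum)
  qed (intro L2_square_integrable L2_add Bochner_Integration.integrable_add integrable_mult_right int f g)+
  also have "\<dots> = (L2_norm f)\<^sup>2 + 2 * (LINT x|lborel. cmod (f x) * cmod (g x)) + (L2_norm g)\<^sup>2"
    unfolding L2_norm_square
    by (simp only: Bochner_Integration.integral_add L2_square_integrable[OF f] L2_square_integrable[OF g]
        Bochner_Integration.integrable_add integrable_mult_right[OF int] integral_mult_right_zero)
  also have "\<dots> \<le> (L2_norm f)\<^sup>2 + 2 * (L2_norm f * L2_norm g) + (L2_norm g)\<^sup>2"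
    using mult_left_mono[OF L2_Cauchy_Schwarz[OF f g], of 2] by linarith
  also have "\<dots> = (L2_norm f + L2_norm g)\<^sup>2"
    by (simp add: power2_sum)
  finally show ?thesis
    by (rule power2_le_imp_le) simp
qed

lemma L2_norm_minus_commute: "L2_norm (\<lambda>x. f x - g x) = L2_norm (\<lambda>x. g x - f x)"
  unfolding L2_norm_def by (simp only: norm_minus_commute)

lemma L2_norm_triangle_diff:
  assumes "f \<in> L2" "g \<in> L2" "h \<in> L2"
  shows "L2_norm (\<lambda>x. f x - h x) \<le> L2_norm (\<lambda>x. f x - g x) + L2_norm (\<lambda>x. g x - h x)"
  using L2_norm_triangle[OF L2_diff[OF assms(1,2)] L2_diff[OF assms(2,3)]] by simp

lemma L2_norm_le_diff:
  assumes "f \<in> L2" "g \<in> L2"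
  shows "L2_norm f \<le> L2_norm g + L2_norm (\<lambda>x. f x - g x)"
  using L2_norm_triangle[OF assms(2) L2_diff[OF assms]] by simp

lemma L2_norm_mono:
  assumes "f \<in> borel_measurable borel" "g \<in> L2" "\<And>x. cmod (f x) \<le> cmod (g x)"
  shows "L2_norm f \<le> L2_norm g"
proof -
  have f: "f \<in> L2"
    by (rule L2_dominated[where g=g and C=1]) (simp_all add: assms)
  have "(LINT x|lborel. (cmod (f x))\<^sup>2) \<le> (LINT x|lborel. (cmod (g x))\<^sup>2)"
    by (intro integral_mono L2_square_integrable f assms(2) power_mono assms(3)) simp
  then show ?thesis
    by (simp add: L2_norm_def)
qed

lemma L2_norm_mult_le:
  assumes "f \<in> L2" "u \<in> borel_measurable borel" "\<And>x. cmod (u x) \<le> C" "0 \<le> C"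
  shows "L2_norm (\<lambda>x. u x * f x) \<le> C * L2_norm f"
proof -
  have "L2_norm (\<lambda>x. u x * f x) \<le> L2_norm (\<lambda>x. of_real C * f x)"
  proof (rule L2_norm_mono)
    show "(\<lambda>x. u x * f x) \<in> borel_measurable borel"
      using L2_measurable[OF assms(1)] assms(2) by (rule borel_measurable_times[rotated])
    show "cmod (u x * f x) \<le> cmod (of_real C * f x)" for x
      using mult_right_mono[OF assms(3)[of x] norm_ge_zero[of "f x"]] assms(4) by (simp add: norm_mult)
  qed (intro L2_cmult assms(1))
  then show ?thesis
    using assms(4) by (simp add: L2_norm_cmult)
qed

lemma L2_norm_zero_iff:
  assumes "f \<in> L2"
  shows "L2_norm f = 0 \<longleftrightarrow> ae_eq f (\<lambda>x. 0)"
proof -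
  have "L2_norm f = 0 \<longleftrightarrow> (LINT x|lborel. (cmod (f x))\<^sup>2) = 0"
    by (simp add: L2_norm_def)
  also have "\<dots> \<longleftrightarrow> (AE x in lborel. (cmod (f x))\<^sup>2 = 0)"
    by (rule integral_nonneg_eq_0_iff_AE[OF L2_square_integrable[OF assms]]) simp
  finally show ?thesis
    by (simp add: ae_eq_def)
qed

lemma ae_eq_iff_L2_norm:
  assumes "f \<in> L2" "g \<in> L2"
  shows "ae_eq f g \<longleftrightarrow> L2_norm (\<lambda>x. f x - g x) = 0"
  unfolding L2_norm_zero_iff[OF L2_diff[OF assms]] by (simp add: ae_eq_def)

section \<open>Convergence and completeness in L2\<close>

lemma L2_dominated_convergence:
  fixes s :: "nat \<Rightarrow> 'a::euclidean_space \<Rightarrow> complex"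
  assumes s: "\<And>n. s n \<in> borel_measurable borel" and f: "f \<in> borel_measurable borel"
    and g: "g \<in> L2"
    and lim: "AE x in lborel. (\<lambda>n. s n x) \<longlonglongrightarrow> f x"
    and le: "\<And>n x. cmod (s n x - f x) \<le> cmod (g x)"
  shows "(\<lambda>n. L2_norm (\<lambda>x. s n x - f x)) \<longlonglongrightarrow> 0"
proof -
  note [measurable] = s f L2_measurable[OF g]
  have "(\<lambda>n. LINT x|lborel. (cmod (s n x - f x))\<^sup>2) \<longlonglongrightarrow> (LINT x::'a|lborel. (0::real))"
  proof (rule integral_dominated_convergence[where w="\<lambda>x. (cmod (g x))\<^sup>2"])
    show "AE x in lborel. (\<lambda>n. (cmod (s n x - f x))\<^sup>2) \<longlonglongrightarrow> 0"
      using lim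
    proof eventually_elim
      case (elim x)
      have "(\<lambda>n. (cmod (s n x - f x))\<^sup>2) \<longlonglongrightarrow> (cmod (f x - f x))\<^sup>2"
        by (intro tendsto_intros elim)
      then show ?case by simp
    qed
    show "AE x in lborel. norm ((cmod (s n x - f x))\<^sup>2) \<le> (cmod (g x))\<^sup>2" for n
      by (intro AE_I2) (simp add: power_mono le)
  qed (use L2_square_integrable[OF g] in auto)
  then show ?thesis
    unfolding L2_norm_def using tendsto_real_sqrt[where x=0] by fastforce
qed

text \<open>Riesz-Fischer. Along indices with consecutive distances below 4^-k the squared
  increments, weighted by 4^k, have summable integrals. Their sum is finite almost everywhere, which
  bounds the increments by a multiple of 2^-k and gives a pointwise limit; Fatou's lemma turns it
  into a limit in norm.\<close>

lemma L2_complete: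
  fixes f :: "nat \<Rightarrow> 'a::euclidean_space \<Rightarrow> complex"
  assumes f: "\<And>n. f n \<in> L2"
    and Cauchy: "\<And>e. 0 < e \<Longrightarrow> \<exists>N. \<forall>m\<ge>N. \<forall>n\<ge>N. L2_norm (\<lambda>x. f m x - f n x) < e"
  shows "\<exists>F\<in>L2. (\<lambda>n. L2_norm (\<lambda>x. f n x - F x)) \<longlonglongrightarrow> 0"
proof -
  note [measurable] = f[THEN L2_measurable]
  obtain N where N: "\<And>k m n. m \<ge> N k \<Longrightarrow> n \<ge> N k \<Longrightarrow> L2_norm (\<lambda>x. f m x - f n x) < (1/4)^k"
    using Cauchy[of "(1/4)^_"] by (simp add: choice_iff) metis
  \<comment> \<open>A running maximum makes the indices monotone while keeping
    \<open>N k \<le> r k\<close>.\<close>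
  define r where "r k = Max (N ` {..k})" for k
  have rN: "N k \<le> r k" for k by (simp add: r_def)
  have r_mono: "r k \<le> r (Suc k)" for k
    unfolding r_def by (intro Max_mono) auto
  have rle: "i \<le> k \<Longrightarrow> r i \<le> r k" for i k
    by (rule lift_Suc_mono_le[of r]) (use r_mono in auto)
  define d where "d k x = cmod (f (r (Suc k)) x - f (r k) x)" for k x
  have [measurable]: "d k \<in> borel_measurable borel" for k
    unfolding d_def by measurable
  have dn: "(\<integral>\<^sup>+x. (ennreal (d k x))\<^sup>2 \<partial>lborel) \<le> ennreal ((1/16)^k)" for k
  proof -
    have "(\<integral>\<^sup>+x. (ennreal (d k x))\<^sup>2 \<partial>lborel) = ennreal ((L2_norm (\<lambda>x. f (r (Suc k)) x - f (r k) x))\<^sup>2)"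
      unfolding d_def by (intro L2_norm_nn L2_diff f)
    also have "\<dots> \<le> ennreal (((1/4)^k)\<^sup>2)"
      using N[of k "r (Suc k)" "r k"] rN[of k] r_mono[of k]
      by (intro ennreal_leI power_mono) auto
    also have "((1/4)^k)\<^sup>2 = ((1/16)^k :: real)"
      unfolding power2_eq_square power_mult_distrib[symmetric] by simp
    finally show ?thesis .
  qed
  have "(\<integral>\<^sup>+x. (\<Sum>k. ennreal (4^k) * (ennreal (d k x))\<^sup>2) \<partial>lborel) = (\<Sum>k. \<integral>\<^sup>+x. ennreal (4^k) * (ennreal (d k x))\<^sup>2 \<partial>lborel)"
    by (rule nn_integral_suminf) measurable
  also have "\<dots> = (\<Sum>k. ennreal (4^k) * (\<integral>\<^sup>+x. (ennreal (d k x))\<^sup>2 \<partial>lborel))"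
    by (simp add: nn_integral_cmult)
  also have "\<dots> \<le> (\<Sum>k. ennreal ((1/4)^k))"
  proof (rule suminf_le)
    fix k
    have "ennreal (4^k) * (\<integral>\<^sup>+x. (ennreal (d k x))\<^sup>2 \<partial>lborel) \<le> ennreal (4^k) * ennreal ((1/16)^k)"
      by (intro mult_left_mono dn) auto
    also have "\<dots> = ennreal ((1/4)^k)"
      by (simp add: ennreal_mult[symmetric] power_mult_distrib[symmetric])
    finally show "ennreal (4^k) * (\<integral>\<^sup>+x. (ennreal (d k x))\<^sup>2 \<partial>lborel) \<le> ennreal ((1/4)^k)" .
  qed auto
  also have "\<dots> = ennreal (\<Sum>k. (1/4)^k)"
    by (intro suminf_ennreal2) (auto intro: summable_geometric)
  finally have fin: "(\<integral>\<^sup>+x. (\<Sum>k. ennreal (4^k) * (ennreal (d k x))\<^sup>2) \<partial>lborel) \<noteq> \<infinity>"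
    by (auto simp: top_unique)
  have "AE x in lborel. (\<Sum>k. ennreal (4^k) * (ennreal (d k x))\<^sup>2) \<noteq> \<infinity>"
    by (rule nn_integral_PInf_AE[OF _ fin]) measurable
  then have conv: "AE x in lborel. convergent (\<lambda>k. f (r k) x)"
  proof eventually_elim
    case (elim x)
    let ?S = "\<Sum>k. ennreal (4^k) * (ennreal (d k x))\<^sup>2"
    define c where "c = enn2real ?S"
    have S: "?S = ennreal c" using elim by (simp add: c_def ennreal_enn2real_if)
    have c0: "0 \<le> c" by (simp add: c_def)
    have le: "d k x \<le> sqrt c * (1/2)^k" for k
    proof -
      have "ennreal (4^k * (d k x)\<^sup>2) = (\<Sum>i\<in>{k}. ennreal (4^i) * (ennreal (d i x))\<^sup>2)"
        by (simp add: ennreal_mult ennreal_power d_def)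
      also have "\<dots> \<le> ?S" by (rule sum_le_suminf) auto
      finally have "4^k * (d k x)\<^sup>2 \<le> c" by (simp add: S ennreal_le_iff c0)
      then have "(2^k * d k x)\<^sup>2 \<le> c"
        by (simp add: power_mult_distrib power_mult[symmetric] mult.commute[of k] power_mult)
      then have "2^k * d k x \<le> sqrt c" by (rule real_le_rsqrt)
      then show ?thesis by (simp add: field_simps power_divide)
    qed
    have "summable (\<lambda>k. f (r (Suc k)) x - f (r k) x)"
    proof (rule summable_comparison_test')
      show "summable (\<lambda>k. sqrt c * (1/2)^k)" by (intro summable_mult summable_geometric) simp
      show "norm (f (r (Suc n)) x - f (r n) x) \<le> sqrt c * (1/2)^n" if "n \<ge> 0" for n
        using le[of n] by (simp add: d_def)
    qed
    then have "convergent (\<lambda>n. \<Sum>k<n. f (r (Suc k)) x - f (r k) x)"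
      by (simp add: summable_iff_convergent)
    then have "convergent (\<lambda>n. f (r n) x - f (r 0) x)"
      unfolding sum_lessThan_telescope[of "\<lambda>n. f (r n) x"] .
    then show ?case
      using convergent_diff_const_right_iff[of "\<lambda>n. f (r n) x" "f (r 0) x"] by simp
  qed
  define F where "F x = lim (\<lambda>k. f (r k) x)" for x
  have [measurable]: "F \<in> borel_measurable borel"
    unfolding F_def by (rule borel_measurable_lim_metric) measurable
  have limF: "AE x in lborel. (\<lambda>k. f (r k) x) \<longlonglongrightarrow> F x"
    using conv by eventually_elim (simp add: F_def convergent_LIMSEQ_iff)
  \<comment> \<open>Fatou in the second index of \<open>f n x - f (r i) x\<close>, with
    \<open>n\<close> fixed. The bound also shows that the difference lies in L2, whence so does
    \<open>F\<close>.\<close>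
  have est: "(\<lambda>x. f n x - F x) \<in> L2 \<and> L2_norm (\<lambda>x. f n x - F x) \<le> (1/4)^k" if n: "n \<ge> N k" for n k
  proof -
    have "(\<integral>\<^sup>+x. (ennreal (cmod (f n x - F x)))\<^sup>2 \<partial>lborel) =
        (\<integral>\<^sup>+x. liminf (\<lambda>i. (ennreal (cmod (f n x - f (r i) x)))\<^sup>2) \<partial>lborel)"
    proof (rule nn_integral_cong_AE)
      show "AE x in lborel. (ennreal (cmod (f n x - F x)))\<^sup>2 = liminf (\<lambda>i. (ennreal (cmod (f n x - f (r i) x)))\<^sup>2)"
        using limF
      proof eventually_elim
        case (elim x)
        have "(\<lambda>i. ennreal ((cmod (f n x - f (r i) x))\<^sup>2)) \<longlonglongrightarrow> ennreal ((cmod (f n x - F x))\<^sup>2)"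
          by (intro tendsto_intros tendsto_ennrealI elim)
        then show ?case
          by (intro lim_imp_Liminf[symmetric]) (auto simp: ennreal_power)
      qed
    qed
    also have "\<dots> \<le> liminf (\<lambda>i. \<integral>\<^sup>+x. (ennreal (cmod (f n x - f (r i) x)))\<^sup>2 \<partial>lborel)"
      by (rule nn_integral_liminf) measurable
    also have "\<dots> \<le> limsup (\<lambda>i. \<integral>\<^sup>+x. (ennreal (cmod (f n x - f (r i) x)))\<^sup>2 \<partial>lborel)"
      by (rule Liminf_le_Limsup) simp
    also have "\<dots> \<le> ennreal (((1/4)^k)\<^sup>2)"
    proof (rule Limsup_bounded)
      show "\<forall>\<^sub>F i in sequentially. (\<integral>\<^sup>+x. (ennreal (cmod (f n x - f (r i) x)))\<^sup>2 \<partial>lborel) \<le> ennreal (((1/4)^k)\<^sup>2)"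
        using eventually_ge_at_top[of k]
      proof eventually_elim
        case (elim i)
        have "N k \<le> r i" using rN[of k] rle[OF elim] by simp
        then have "L2_norm (\<lambda>x. f n x - f (r i) x) < (1/4)^k" using N n by blast
        then show ?case
          by (subst L2_norm_nn[OF L2_diff[OF f f]]) (intro ennreal_leI power_mono, auto)
      qed
    qed
    finally show ?thesis
      using L2_normI[of "\<lambda>x. f n x - F x" "(1/4)^k"] by auto
  qed
  have "(\<lambda>x. f (N 0) x - (f (N 0) x - F x)) \<in> L2"
    by (rule L2_diff[OF f]) (use est[of 0 "N 0"] in auto)
  then have FL: "F \<in> L2" by simp
  moreover have "(\<lambda>n. L2_norm (\<lambda>x. f n x - F x)) \<longlonglongrightarrow> 0"
  proof (rule LIMSEQ_I)
    fix e :: real assume "0 < e"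
    then obtain k where k: "(1/4)^k < e"
      using real_arch_pow_inv[of e "1/4"] by auto
    show "\<exists>no. \<forall>n\<ge>no. norm (L2_norm (\<lambda>x. f n x - F x) - 0) < e"
      using est[where k=k] k by (intro exI[of _ "N k"]) fastforce
  qed
  ultimately show ?thesis by blast
qed

text \<open>Test functions: bounded with bounded support, hence both integrable and square
  integrable. One number serves as bound and as radius, so that a multiple of the indicator of a
  ball is a majorant.\<close>

definition tame :: "('a::euclidean_space \<Rightarrow> complex) \<Rightarrow> bool" where
  "tame h \<longleftrightarrow> h \<in> borel_measurable borel \<and> (\<exists>R. \<forall>x. cmod (h x) \<le> R \<and> (norm x > R \<longrightarrow> h x = 0))"

lemma tame_measurable [measurable_dest]: "tame h \<Longrightarrow> h \<in> borel_measurable borel"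
  by (simp add: tame_def)

lemma integrable_indicator_cball: "integrable lborel (\<lambda>x::'a::euclidean_space. indicator (cball 0 R) x :: real)"
  using emeasure_bounded_finite[OF bounded_cball, of 0 R] by (simp add: integrable_indicator_iff)

lemma tame_bound: assumes "tame h" shows "\<exists>R\<ge>0. \<forall>x. cmod (h x) \<le> R * indicator (cball 0 R) x"
proof -
  obtain R where R: "\<And>x. cmod (h x) \<le> R \<and> (norm x > R \<longrightarrow> h x = 0)"
    using assms by (auto simp: tame_def)
  have "0 \<le> R" using R[of 0] norm_ge_zero[of "h 0"] by linarith
  with R show ?thesis
    by (intro exI[of _ R]) (auto simp: indicator_def not_le)
qed

lemma tame_integrable:
  fixes h :: "'a::euclidean_space \<Rightarrow> complex"
  assumes "tame h" shows "integrable lborel h"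
proof -
  obtain R where R: "0 \<le> R" "\<And>x. cmod (h x) \<le> R * indicator (cball 0 R) x"
    using tame_bound[OF assms] by blast
  show ?thesis
  proof (rule Bochner_Integration.integrable_bound)
    show "integrable lborel (\<lambda>x::'a. R * indicator (cball 0 R) x)"
      by (intro integrable_mult_right integrable_indicator_cball)
  qed (use R tame_measurable[OF assms] in auto)
qed

lemma tame_L2:
  fixes h :: "'a::euclidean_space \<Rightarrow> complex"
  assumes "tame h" shows "h \<in> L2"
proof (rule L2I)
  obtain R where R: "0 \<le> R" "\<And>x. cmod (h x) \<le> R * indicator (cball 0 R) x"
    using tame_bound[OF assms] by blast
  show "integrable lborel (\<lambda>x. (cmod (h x))\<^sup>2)"
  proof (rule Bochner_Integration.integrable_bound)
    show "integrable lborel (\<lambda>x::'a. R\<^sup>2 * indicator (cball 0 R) x)"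
      by (intro integrable_mult_right integrable_indicator_cball)
    show "AE x in lborel. norm ((cmod (h x))\<^sup>2) \<le> norm (R\<^sup>2 * indicator (cball 0 R) x)"
    proof (rule AE_I2)
      fix x
      show "norm ((cmod (h x))\<^sup>2) \<le> norm (R\<^sup>2 * indicator (cball 0 R) x)"
        using R(2)[of x] by (cases "x \<in> cball 0 R") (auto intro: power_mono)
    qed
  qed (use tame_measurable[OF assms] in auto)
qed (use tame_measurable[OF assms] in auto)

definition truncate :: "nat \<Rightarrow> ('a::euclidean_space \<Rightarrow> complex) \<Rightarrow> 'a \<Rightarrow> complex" where
  "truncate n f x = (if norm x \<le> real n \<and> cmod (f x) \<le> real n then f x else 0)"

lemma tame_truncate:
  assumes [measurable]: "f \<in> borel_measurable borel" shows "tame (truncate n f)"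
  unfolding tame_def
proof
  show "truncate n f \<in> borel_measurable borel" unfolding truncate_def by measurable
qed (auto simp: truncate_def intro!: exI[of _ "real n"])

lemma truncate_tendsto: "(\<lambda>n. truncate n f x) \<longlonglongrightarrow> f x"
proof (rule tendsto_eventually)
  obtain N where N: "real N \<ge> max (norm x) (cmod (f x))" using real_arch_simple by blast
  show "\<forall>\<^sub>F n in sequentially. truncate n f x = f x"
    using eventually_ge_at_top[of N] by eventually_elim (use N in \<open>auto simp: truncate_def\<close>)
qed

lemma truncate_L2_tendsto:
  assumes f: "f \<in> L2" shows "(\<lambda>n. L2_norm (\<lambda>x. truncate n f x - f x)) \<longlonglongrightarrow> 0"
  using f tame_truncate[OF L2_measurable[OF f]]
  by (intro L2_dominated_convergence[where g=f])
     (auto simp: truncate_tendsto tame_measurable L2_measurable, auto simp: truncate_def)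

text \<open>Membership in L2 is part of the conclusion. Each truncation F_n of \<open>F\<close> is
  an admissible test function, and <F, F_n> = <F_n, F_n> <= C |F_n| bounds its norm by
  \<open>C\<close>; Fatou passes to \<open>F\<close>.\<close>

lemma L2_dual_bound:
  assumes F [measurable]: "F \<in> borel_measurable borel" and C: "0 \<le> C"
    and bd: "\<And>h. tame h \<Longrightarrow> cmod (L2_inner F h) \<le> C * L2_norm h"
  shows "F \<in> L2" "L2_norm F \<le> C"
proof -
  let ?H = "\<lambda>n. truncate n F"
  note tH = tame_truncate[OF F]
  have H: "L2_norm (?H n) \<le> C" for n
  proof -
    have "L2_inner F (?H n) = L2_inner (?H n) (?H n)"
      unfolding L2_inner_def by (intro arg_cong[where f="integral\<^sup>L lborel"]) (auto simp: truncate_def)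
    then have "(L2_norm (?H n))\<^sup>2 \<le> C * L2_norm (?H n)"
      using bd[OF tH, of n] by (simp add: L2_inner_self norm_power)
    then show ?thesis
      using C by (cases "L2_norm (?H n) = 0") (auto simp: power2_eq_square mult_le_cancel_right)
  qed
  have "(\<integral>\<^sup>+x. (ennreal (cmod (F x)))\<^sup>2 \<partial>lborel) = (\<integral>\<^sup>+x. liminf (\<lambda>n. (ennreal (cmod (?H n x)))\<^sup>2) \<partial>lborel)"
  proof (rule nn_integral_cong)
    fix x
    have "(\<lambda>n. ennreal ((cmod (?H n x))\<^sup>2)) \<longlonglongrightarrow> ennreal ((cmod (F x))\<^sup>2)"
      by (intro tendsto_intros tendsto_ennrealI truncate_tendsto)
    then show "(ennreal (cmod (F x)))\<^sup>2 = liminf (\<lambda>n. (ennreal (cmod (?H n x)))\<^sup>2)"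
      by (intro lim_imp_Liminf[symmetric]) (auto simp: ennreal_power)
  qed
  also have "\<dots> \<le> liminf (\<lambda>n. \<integral>\<^sup>+x. (ennreal (cmod (?H n x)))\<^sup>2 \<partial>lborel)"
    by (rule nn_integral_liminf) (use tame_measurable[OF tH] in auto)
  also have "\<dots> \<le> limsup (\<lambda>n. \<integral>\<^sup>+x. (ennreal (cmod (?H n x)))\<^sup>2 \<partial>lborel)"
    by (rule Liminf_le_Limsup) simp
  also have "\<dots> \<le> ennreal (C\<^sup>2)"
    by (rule Limsup_bounded, rule always_eventually, rule allI,
        subst L2_norm_nn[OF tame_L2[OF tH]]) (use H in \<open>auto intro!: ennreal_leI power_mono\<close>)
  finally show "F \<in> L2" "L2_norm F \<le> C"
    using L2_normI[OF F C] by auto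
qed

text \<open>The difference satisfies \<open>L2_dual_bound\<close> with constant 0.\<close>

lemma ae_eq_weak:
  assumes F: "F \<in> L2" and G: "G \<in> L2" and eq: "\<And>h. tame h \<Longrightarrow> L2_inner F h = L2_inner G h"
  shows "ae_eq F G"
proof -
  note D = L2_diff[OF F G]
  have "L2_norm (\<lambda>x. F x - G x) \<le> 0"
    by (rule L2_dual_bound(2)) (use D eq in \<open>auto simp: L2_measurable L2_inner_diff_left[OF F G] tame_L2\<close>)
  then show ?thesis
    unfolding ae_eq_iff_L2_norm[OF F G] using L2_norm_nonneg[of "\<lambda>x. F x - G x"] by linarith
qed

lemma L2_inner_tendsto_left:
  assumes s: "\<And>n. s n \<in> L2" and f: "f \<in> L2" and h: "h \<in> L2"
    and lim: "(\<lambda>n. L2_norm (\<lambda>x. s n x - f x)) \<longlonglongrightarrow> 0"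
  shows "(\<lambda>n. L2_inner (s n) h) \<longlonglongrightarrow> L2_inner f h"
proof (rule Lim_null_comparison[THEN Lim_null[THEN iffD2]])
  show "\<forall>\<^sub>F n in sequentially. norm (L2_inner (s n) h - L2_inner f h) \<le> L2_norm (\<lambda>x. s n x - f x) * L2_norm h"
    using L2_inner_bound[OF L2_diff[OF s f] h] by (simp add: L2_inner_diff_left[OF s f h])
  show "(\<lambda>n. L2_norm (\<lambda>x. s n x - f x) * L2_norm h) \<longlonglongrightarrow> 0"
    using tendsto_mult_right[OF lim, of "L2_norm h"] by simp
qed

section \<open>Split coordinates and Gaussian integrals\<close>

lemma vfst_vjoin [simp]: "vfst (vjoin x y) = x"
  by (simp add: vfst_def vjoin_def vec_eq_iff)

lemma vsnd_vjoin [simp]: "vsnd (vjoin x y) = y"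
  by (simp add: vsnd_def vjoin_def vec_eq_iff)

lemma vjoin_nth [simp]: "vjoin x y $ Inl i = x $ i" "vjoin x y $ Inr i = y $ i"
  by (simp_all add: vjoin_def)

lemma vfst_nth: "vfst z $ i = z $ Inl i" and vsnd_nth: "vsnd z $ i = z $ Inr i"
  by (simp_all add: vfst_def vsnd_def)

lemma linear_vfst: "linear (vfst :: real^('m::finite + 'm) \<Rightarrow> real^'m)"
  by (rule linearI) (simp_all add: vfst_def vec_eq_iff)

lemma linear_vsnd: "linear (vsnd :: real^('m::finite + 'm) \<Rightarrow> real^'m)"
  by (rule linearI) (simp_all add: vsnd_def vec_eq_iff)

lemma linear_vjoin: "linear (\<lambda>p. vjoin (fst p) (snd p) :: real^('m::finite + 'm))"
  by (rule linearI) (auto simp: vjoin_def vec_eq_iff split: sum.split)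

lemmas vfst_linear_simps [simp] =
  linear_add[OF linear_vfst] linear_diff[OF linear_vfst] linear_cmul[OF linear_vfst] linear_0[OF linear_vfst]

lemmas vsnd_linear_simps [simp] =
  linear_add[OF linear_vsnd] linear_diff[OF linear_vsnd] linear_cmul[OF linear_vsnd] linear_0[OF linear_vsnd]

lemma vjoin_scaleR: "c *\<^sub>R vjoin a b = vjoin (c *\<^sub>R a) (c *\<^sub>R b)"
  by (auto simp: vjoin_def vec_eq_iff split: sum.split)

lemmas continuous_on_vfst [continuous_intros] = bounded_linear.continuous_on[OF linear_vfst[unfolded linear_conv_bounded_linear]]
lemmas continuous_on_vsnd [continuous_intros] = bounded_linear.continuous_on[OF linear_vsnd[unfolded linear_conv_bounded_linear]]
lemmas has_derivative_vfst [derivative_intros] = bounded_linear.has_derivative[OF linear_vfst[unfolded linear_conv_bounded_linear]]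
lemmas has_derivative_vsnd [derivative_intros] = bounded_linear.has_derivative[OF linear_vsnd[unfolded linear_conv_bounded_linear]]

lemma continuous_on_vjoin [continuous_intros]:
  "continuous_on S f \<Longrightarrow> continuous_on S g \<Longrightarrow> continuous_on S (\<lambda>x. vjoin (f x) (g x))"
  using bounded_linear.continuous_on[OF linear_vjoin[unfolded linear_conv_bounded_linear], of S "\<lambda>x. (f x, g x)"]
  by (simp add: continuous_on_Pair)

lemma has_derivative_vjoin [derivative_intros]:
  "(f has_derivative f') (at x within S) \<Longrightarrow> (g has_derivative g') (at x within S) \<Longrightarrow>
    ((\<lambda>x. vjoin (f x) (g x)) has_derivative (\<lambda>h. vjoin (f' h) (g' h))) (at x within S)"
  by (drule (1) has_derivative_Pair,
      drule bounded_linear.has_derivative[OF linear_vjoin[unfolded linear_conv_bounded_linear]]) simp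

lemma measurable_vfst [measurable (raw)]: "f \<in> borel_measurable M \<Longrightarrow> (\<lambda>x. vfst (f x)) \<in> borel_measurable M"
  by (rule borel_measurable_continuous_on[of vfst]) (auto intro: continuous_intros)

lemma measurable_vsnd [measurable (raw)]: "f \<in> borel_measurable M \<Longrightarrow> (\<lambda>x. vsnd (f x)) \<in> borel_measurable M"
  by (rule borel_measurable_continuous_on[of vsnd]) (auto intro: continuous_intros)

lemma measurable_vjoin [measurable (raw)]:
  assumes "f \<in> borel_measurable M" "g \<in> borel_measurable M"
  shows "(\<lambda>x. vjoin (f x) (g x)) \<in> borel_measurable M"
proof -
  have "(\<lambda>x. (\<lambda>p. vjoin (fst p) (snd p)) (f x, g x)) \<in> borel_measurable M"
    by (rule borel_measurable_continuous_on[OF _ borel_measurable_Pair[OF assms]])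
       (auto intro!: continuous_intros)
  then show ?thesis by simp
qed

lemma measurable_vjoin_pair [measurable]: "(\<lambda>p. vjoin (fst p) (snd p)) \<in> borel_measurable borel"
  by (intro borel_measurable_continuous_onI continuous_intros)

lemma sum_Plus_UNIV: "(\<Sum>i\<in>(UNIV :: ('m::finite + 'm) set). f i) = (\<Sum>j\<in>UNIV. f (Inl j)) + (\<Sum>j\<in>UNIV. f (Inr j))"
  unfolding UNIV_Plus_UNIV[symmetric] by (subst sum.Plus) simp_all

lemma prod_Plus_UNIV: "(\<Prod>i\<in>(UNIV :: ('m::finite + 'm) set). f i) = (\<Prod>j\<in>UNIV. f (Inl j)) * (\<Prod>j\<in>UNIV. f (Inr j))"
  unfolding UNIV_Plus_UNIV[symmetric] by (subst prod.Plus) simp_all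

lemma inner_vsplit: "z \<bullet> w = vfst z \<bullet> vfst w + vsnd z \<bullet> vsnd w"
  by (simp add: inner_vec_def sum_Plus_UNIV vfst_def vsnd_def)

lemma norm_vsplit: "(norm z)\<^sup>2 = (norm (vfst z))\<^sup>2 + (norm (vsnd z))\<^sup>2"
  by (simp add: power2_norm_eq_inner inner_vsplit)

lemma prod_Basis_vec: "(\<Prod>b\<in>(Basis :: (real^'m::finite) set). f b) = (\<Prod>i\<in>UNIV. f (axis i 1))"
proof -
  have B: "(Basis :: (real^'m) set) = range (\<lambda>i. axis i 1)"
    by (auto simp: Basis_vec_def)
  have I: "inj (\<lambda>i::'m. axis i (1::real))"
    by (auto simp: inj_on_def axis_eq_axis)
  show ?thesis
    unfolding B by (subst prod.reindex[OF I]) simp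
qed

lemma vjoin_vimage_box:
  "(\<lambda>p. vjoin (fst p) (snd p)) -` box l u = box (vfst l) (vfst u) \<times> box (vsnd l) (vsnd u)"
  by (auto simp: mem_box_cart vfst_nth vsnd_nth split_sum_all)

lemma emeasure_lborel_box_vec:
  fixes l u :: "real^'m::finite"
  assumes "\<And>i. l $ i \<le> u $ i"
  shows "emeasure lborel (box l u) = ennreal (\<Prod>i\<in>UNIV. (u - l) $ i)"
proof -
  have "l \<bullet> b \<le> u \<bullet> b" if "b \<in> Basis" for b
    using that assms by (auto simp: Basis_vec_def inner_axis)
  then show ?thesis
    by (simp add: emeasure_lborel_box prod_Basis_vec inner_axis)
qed

text \<open>A measure with the right values on boxes is Lebesgue measure, and the volume of a box in
  the split space factors into the products over the two halves of its coordinates.\<close>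

lemma distr_vjoin: "distr lborel borel (\<lambda>p. vjoin (fst p) (snd p)) = (lborel :: (real^('m::finite + 'm)) measure)"
proof (rule lborel_eqI[symmetric])
  fix l u :: "real^('m + 'm)"
  assume le: "\<And>b. b \<in> Basis \<Longrightarrow> l \<bullet> b \<le> u \<bullet> b"
  have le': "l $ i \<le> u $ i" for i
    using le[of "axis i 1"] by (simp add: inner_axis)
  have m: "(\<lambda>p. vjoin (fst p) (snd p)) \<in> measurable lborel (borel :: (real^('m + 'm)) measure)"
    by simp
  have "emeasure (distr lborel borel (\<lambda>p. vjoin (fst p) (snd p))) (box l u)
      = emeasure lborel (box (vfst l) (vfst u) \<times> box (vsnd l) (vsnd u))"
    by (subst emeasure_distr[OF m]) (simp_all add: vjoin_vimage_box)
  also have "\<dots> = emeasure lborel (box (vfst l) (vfst u)) * emeasure lborel (box (vsnd l) (vsnd u))"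
    unfolding lborel_prod[symmetric] by (rule lborel.emeasure_pair_measure_Times) simp_all
  also have "\<dots> = ennreal (\<Prod>i\<in>UNIV. (vfst u - vfst l) $ i) * ennreal (\<Prod>i\<in>UNIV. (vsnd u - vsnd l) $ i)"
    by (simp only: emeasure_lborel_box_vec vfst_nth vsnd_nth le')
  also have "\<dots> = (\<Prod>i\<in>UNIV. (u - l) $ i)"
    using le' by (subst ennreal_mult[symmetric]) (auto intro!: prod_nonneg simp: prod_Plus_UNIV vfst_def vsnd_def)
  also have "\<dots> = (\<Prod>b\<in>Basis. (u - l) \<bullet> b)"
    by (simp add: prod_Basis_vec inner_axis)
  finally show "emeasure (distr lborel borel (\<lambda>p. vjoin (fst p) (snd p))) (box l u) = (\<Prod>b\<in>Basis. (u - l) \<bullet> b)" .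
qed simp

lemma integral_vjoin:
  fixes F :: "real^('m::finite + 'm) \<Rightarrow> 'b::{banach, second_countable_topology}"
  assumes [measurable]: "F \<in> borel_measurable borel"
  shows "integral\<^sup>L lborel F = (LINT p|lborel. F (vjoin (fst p) (snd p)))"
  by (subst distr_vjoin[symmetric], subst integral_distr) simp_all

lemma integrable_vjoin:
  fixes F :: "real^('m::finite + 'm) \<Rightarrow> 'b::{banach, second_countable_topology}"
  assumes [measurable]: "F \<in> borel_measurable borel"
  shows "integrable lborel F \<longleftrightarrow> integrable lborel (\<lambda>p. F (vjoin (fst p) (snd p)))"
  by (subst distr_vjoin[symmetric], subst integrable_distr_eq) simp_all

lemma nn_integral_vjoin:
  fixes F :: "real^('m::finite + 'm) \<Rightarrow> ennreal"
  assumes [measurable]: "F \<in> borel_measurable borel"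
  shows "integral\<^sup>N lborel F = (\<integral>\<^sup>+p. F (vjoin (fst p) (snd p)) \<partial>lborel)"
  by (subst distr_vjoin[symmetric], subst nn_integral_distr) simp_all

section \<open>Integration over products and affine substitutions\<close>

lemma nn_integral_lborel_fst:
  fixes F :: "'a::euclidean_space \<times> 'b::euclidean_space \<Rightarrow> ennreal"
  assumes "F \<in> borel_measurable borel"
  shows "integral\<^sup>N lborel F = (\<integral>\<^sup>+x. \<integral>\<^sup>+y. F (x, y) \<partial>lborel \<partial>lborel)"
  using assms by (subst lborel_prod[symmetric], subst lborel.nn_integral_fst[symmetric]) (simp_all add: lborel_prod)

lemma integral_lborel_fst:
  fixes F :: "'a::euclidean_space \<times> 'b::euclidean_space \<Rightarrow> 'c::{banach, second_countable_topology}"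
  assumes "integrable lborel F"
  shows "integral\<^sup>L lborel F = (LINT x|lborel. LINT y|lborel. F (x, y))"
  using assms by (subst lborel_prod[symmetric], subst lborel_pair.integral_fst') (simp_all add: lborel_prod)

lemma integral_lborel_snd:
  fixes F :: "'a::euclidean_space \<times> 'b::euclidean_space \<Rightarrow> 'c::{banach, second_countable_topology}"
  assumes "integrable lborel F"
  shows "integral\<^sup>L lborel F = (LINT y|lborel. LINT x|lborel. F (x, y))"
  using assms lborel_pair.integral_snd[of "\<lambda>x y. F (x, y)"] by (simp add: lborel_prod)

lemma lborel_shift: "integrable lborel f \<Longrightarrow> integrable lborel (\<lambda>x. f (c + x))"
  for f :: "'a::euclidean_space \<Rightarrow> 'b::{banach, second_countable_topology}"
  using integrable_distr_eq[of "(+) c" lborel borel f] borel_measurable_integrable[of lborel f]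
  by (simp add: lborel_distr_plus)

lemma lborel_integral_shift: "(LINT x|lborel. f (c + x)) = integral\<^sup>L lborel f"
  if "f \<in> borel_measurable borel" for f :: "'a::euclidean_space \<Rightarrow> 'b::{banach, second_countable_topology}"
  by (subst (2) lborel_distr_plus[of c, symmetric], subst integral_distr) (use that in auto)

lemma lborel_nn_integral_shift: "(\<integral>\<^sup>+x. f (c + x) \<partial>lborel) = integral\<^sup>N lborel f"
  if "f \<in> borel_measurable borel" for f :: "'a::euclidean_space \<Rightarrow> ennreal"
  by (subst (2) lborel_distr_plus[of c, symmetric], subst nn_integral_distr) (use that in auto)

lemma lborel_distr_uminus_euclidean: "distr lborel borel uminus = (lborel :: 'a::euclidean_space measure)"
  using lborel_affine[of "-1" "0::'a"] by (simp add: density_1)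

lemma lborel_integral_reflect: "(LINT x|lborel. f (c - x)) = integral\<^sup>L lborel f"
  if [measurable]: "f \<in> borel_measurable borel" for f :: "'a::euclidean_space \<Rightarrow> 'b::{banach, second_countable_topology}"
proof -
  have "integral\<^sup>L lborel f = (LINT x|lborel. f (c + x))"
    by (simp add: lborel_integral_shift)
  also have "\<dots> = (LINT x|distr lborel borel uminus. f (c + x))"
    by (simp add: lborel_distr_uminus_euclidean)
  also have "\<dots> = (LINT x|lborel. f (c - x))"
    by (subst integral_distr) simp_all
  finally show ?thesis ..
qed

section \<open>Products over coordinates and Gaussian integrals\<close>

context
  fixes f :: "'a::euclidean_space \<Rightarrow> real \<Rightarrow> 'b::{real_normed_field, banach, second_countable_topology}"
  assumes int: "\<And>b. b \<in> Basis \<Longrightarrow> integrable lborel (f b)"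
begin

interpretation product_sigma_finite "\<lambda>_::'a. lborel :: real measure" ..

lemma integrable_prod_Basis: "integrable lborel (\<lambda>x. \<Prod>b\<in>Basis. f b (x \<bullet> b))"
  and integral_prod_Basis: "(LINT x|lborel. (\<Prod>b\<in>Basis. f b (x \<bullet> b))) = (\<Prod>b\<in>Basis. integral\<^sup>L lborel (f b))"
proof -
  let ?T = "\<lambda>g. \<Sum>b\<in>(Basis::'a set). g b *\<^sub>R b"
  have [measurable]: "b \<in> Basis \<Longrightarrow> f b \<in> borel_measurable borel" for b
    using borel_measurable_integrable[OF int, of b] by simp
  have eq: "(\<Prod>b\<in>Basis. f b (?T g \<bullet> b)) = (\<Prod>b\<in>Basis. f b (g b))" for g
    by (intro prod.cong) (auto simp: inner_sum_left_Basis)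
  show "integrable lborel (\<lambda>x. \<Prod>b\<in>Basis. f b (x \<bullet> b))"
    by (subst lborel_eq, subst integrable_distr_eq)
       (simp_all add: eq product_integrable_prod int)
  show "(LINT x|lborel. (\<Prod>b\<in>Basis. f b (x \<bullet> b))) = (\<Prod>b\<in>Basis. integral\<^sup>L lborel (f b))"
    by (subst lborel_eq, subst integral_distr)
       (simp_all add: eq product_integral_prod int)
qed

end

text \<open>Both claims are the characteristic function of the standard normal law after the
  substitution x = k t: \<open>k\<close> is chosen so that (k t)^2 / 2 = pi c t^2, and
  \<open>u\<close> so that u k t = 2 pi t s.\<close>

lemma gaussian_integral_real:
  fixes c s :: real
  assumes c: "0 < c"
  shows "integrable lborel (\<lambda>t. of_real (exp (- pi * c * t\<^sup>2)) * cis (2 * pi * (t * s)))"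
    and "(LINT t|lborel. of_real (exp (- pi * c * t\<^sup>2)) * cis (2 * pi * (t * s)))
      = of_real (1 / sqrt c * exp (- pi * s\<^sup>2 / c))"
proof -
  define k where "k = sqrt (2 * pi * c)"
  define u where "u = 2 * pi * s / k"
  have k: "0 < k" "k\<^sup>2 = 2 * pi * c" using c by (simp_all add: k_def)
  let ?G = "\<lambda>x. complex_of_real (std_normal_density x) * iexp (u * x)"
  have int: "integrable lborel ?G"
  proof (rule Bochner_Integration.integrable_bound)
    show "integrable lborel std_normal_density"
      using integrable_std_normal_moment[of 0] by simp
  qed (auto simp: norm_mult)
  have "(LINT x|lborel. ?G x) = char std_normal_distribution u"
    unfolding char_def by (subst integral_density) (auto simp: scaleR_conv_of_real mult.commute)
  also have "\<dots> = of_real (exp (- (u\<^sup>2) / 2))"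
    by (simp add: char_std_normal_distribution)
  finally have val: "(LINT x|lborel. ?G x) = of_real (exp (- (u\<^sup>2) / 2))" .
  have eq: "?G (k * t) = of_real (1 / sqrt (2 * pi)) * (of_real (exp (- pi * c * t\<^sup>2)) * cis (2 * pi * (t * s)))" for t
  proof -
    have "(k * t)\<^sup>2 / 2 = pi * c * t\<^sup>2" by (simp add: power_mult_distrib k)
    moreover have "u * (k * t) = 2 * pi * (t * s)" using k by (simp add: u_def)
    then have "iexp (u * (k * t)) = cis (2 * pi * (t * s))" by (simp only: cis_conv_exp)
    ultimately show ?thesis
      by (simp add: std_normal_density_def)
  qed
  have "integrable lborel (\<lambda>t. ?G (0 + k * t))"
    by (rule lborel_integrable_real_affine[OF int]) (use k in simp)
  then have "integrable lborel (\<lambda>t. of_real (sqrt (2 * pi)) * ?G (k * t))"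
    by simp
  then show "integrable lborel (\<lambda>t. of_real (exp (- pi * c * t\<^sup>2)) * cis (2 * pi * (t * s)))"
    unfolding eq by (simp add: mult.assoc[symmetric] del: of_real_mult of_real_divide flip: of_real_mult)
  have "(LINT x|lborel. ?G x) = \<bar>k\<bar> *\<^sub>R (LINT t|lborel. ?G (0 + k * t))"
    by (rule lborel_integral_real_affine) (use k in simp)
  also have "\<dots> = of_real (k / sqrt (2 * pi)) * (LINT t|lborel. of_real (exp (- pi * c * t\<^sup>2)) * cis (2 * pi * (t * s)))"
    using k by (simp only: eq add_0 integral_mult_right_zero) (simp add: scaleR_conv_of_real)
  also have "k / sqrt (2 * pi) = sqrt c"
    by (simp add: k_def real_sqrt_mult)
  finally have "of_real (sqrt c) * (LINT t|lborel. of_real (exp (- pi * c * t\<^sup>2)) * cis (2 * pi * (t * s)))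
      = complex_of_real (exp (- (u\<^sup>2) / 2))" using val by simp
  moreover have "u\<^sup>2 / 2 = pi * s\<^sup>2 / c"
    using c by (simp add: u_def power_divide k(2) power_mult_distrib) (simp add: field_simps power2_eq_square)
  ultimately show "(LINT t|lborel. of_real (exp (- pi * c * t\<^sup>2)) * cis (2 * pi * (t * s)))
      = of_real (1 / sqrt c * exp (- pi * s\<^sup>2 / c))"
    using c by (simp add: field_simps)
qed

lemma cis_sum: "finite S \<Longrightarrow> cis (\<Sum>b\<in>S. f b) = (\<Prod>b\<in>S. cis (f b))"
  by (induction S rule: finite_induct) (simp_all add: cis_mult[symmetric])

lemma gaussian_prod_Basis:
  fixes x \<xi> :: "'a::euclidean_space"
  shows "complex_of_real (exp (- pi * c * (norm x)\<^sup>2)) * cis (2 * pi * (x \<bullet> \<xi>)) =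
    (\<Prod>b\<in>Basis. of_real (exp (- pi * c * (x \<bullet> b)\<^sup>2)) * cis (2 * pi * ((x \<bullet> b) * (\<xi> \<bullet> b))))"
proof -
  have "- pi * c * (norm x)\<^sup>2 = (\<Sum>b\<in>Basis. - pi * c * (x \<bullet> b)\<^sup>2)"
    by (subst power2_norm_eq_inner, subst euclidean_inner) (simp add: sum_distrib_left power2_eq_square)
  moreover have "2 * pi * (x \<bullet> \<xi>) = (\<Sum>b\<in>Basis. 2 * pi * ((x \<bullet> b) * (\<xi> \<bullet> b)))"
    by (subst euclidean_inner) (simp add: sum_distrib_left)
  ultimately show ?thesis
    by (simp only: exp_sum[OF finite_Basis] cis_sum[OF finite_Basis] of_real_prod prod.distrib)
qed

lemma gaussian_integral:
  fixes \<xi> :: "'a::euclidean_space"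
  assumes c: "0 < c"
  shows integrable_gaussian_cis: "integrable lborel (\<lambda>x. of_real (exp (- pi * c * (norm x)\<^sup>2)) * cis (2 * pi * (x \<bullet> \<xi>)))"
    and integral_gaussian_cis: "(LINT x|lborel. of_real (exp (- pi * c * (norm x)\<^sup>2)) * cis (2 * pi * (x \<bullet> \<xi>)))
      = of_real ((1 / sqrt c)^DIM('a) * exp (- pi * (norm \<xi>)\<^sup>2 / c))"
proof -
  let ?f = "\<lambda>b t. of_real (exp (- pi * c * t\<^sup>2)) * cis (2 * pi * (t * (\<xi> \<bullet> b)))"
  note I = gaussian_integral_real[OF c]
  show "integrable lborel (\<lambda>x. of_real (exp (- pi * c * (norm x)\<^sup>2)) * cis (2 * pi * (x \<bullet> \<xi>)))"
    unfolding gaussian_prod_Basis by (rule integrable_prod_Basis[of ?f, OF I(1)])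
  have "(LINT x|lborel. of_real (exp (- pi * c * (norm x)\<^sup>2)) * cis (2 * pi * (x \<bullet> \<xi>)))
      = (\<Prod>b\<in>(Basis :: 'a set). of_real (1 / sqrt c * exp (- pi * (\<xi> \<bullet> b)\<^sup>2 / c)) :: complex)"
    unfolding gaussian_prod_Basis by (subst integral_prod_Basis[of ?f, OF I(1)]) (simp_all only: I(2))
  also have "\<dots> = of_real ((1 / sqrt c)^DIM('a) * exp (\<Sum>b\<in>Basis. - pi * (\<xi> \<bullet> b)\<^sup>2 / c))"
    by (simp only: of_real_prod[symmetric] prod.distrib exp_sum[OF finite_Basis] prod_constant)
  also have "(\<Sum>b\<in>Basis. - pi * (\<xi> \<bullet> b)\<^sup>2 / c) = - pi * (norm \<xi>)\<^sup>2 / c"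
    by (subst power2_norm_eq_inner, subst euclidean_inner)
       (simp add: sum_distrib_left sum_divide_distrib power2_eq_square)
  finally show "(LINT x|lborel. of_real (exp (- pi * c * (norm x)\<^sup>2)) * cis (2 * pi * (x \<bullet> \<xi>)))
      = of_real ((1 / sqrt c)^DIM('a) * exp (- pi * (norm \<xi>)\<^sup>2 / c))" .
qed

lemma integrable_gaussian: "0 < c \<Longrightarrow> integrable lborel (\<lambda>x::'a::euclidean_space. exp (- pi * c * (norm x)\<^sup>2))"
  using integrable_gaussian_cis[of c "0::'a", THEN integrable_norm] by simp

lemma integral_gaussian:
  "0 < c \<Longrightarrow> (LINT x::'a::euclidean_space|lborel. exp (- pi * c * (norm x)\<^sup>2)) = (1 / sqrt c)^DIM('a)"
  using integral_gaussian_cis[of c "0::'a"] integral_complex_of_real[of lborel "\<lambda>x::'a. exp (- pi * c * (norm x)\<^sup>2)"]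
  by (simp del: integral_complex_of_real of_real_power of_real_divide)

text \<open>The crude exponent reduces the claim to one dimension: 1 + |x|^2 dominates 1 + x_b^2 for
  every coordinate b, so the reciprocal power is dominated by a product of integrable functions of
  one coordinate each.\<close>

lemma integrable_japanese_power: "integrable lborel (\<lambda>x::'a::euclidean_space. 1 / (1 + (norm x)\<^sup>2)^DIM('a))"
proof (rule Bochner_Integration.integrable_bound)
  have "integrable lborel (\<lambda>t::real. 1 / (1 + t\<^sup>2))"
    using integrable_inverse_1_plus_square by (simp add: set_integrable_def inverse_eq_divide einterval_eq)
  then show "integrable lborel (\<lambda>x::'a. \<Prod>b\<in>Basis. 1 / (1 + (x \<bullet> b)\<^sup>2))"
    by (rule integrable_prod_Basis[of "\<lambda>b t. 1 / (1 + t\<^sup>2)"])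
  show "AE x in lborel. norm (1 / (1 + (norm x)\<^sup>2)^DIM('a)) \<le> norm (\<Prod>b\<in>(Basis::'a set). 1 / (1 + (x \<bullet> b)\<^sup>2))"
  proof (rule AE_I2)
    fix x :: 'a
    have "(1 / (1 + (norm x)\<^sup>2))^DIM('a) = (\<Prod>b\<in>(Basis::'a set). 1 / (1 + (norm x)\<^sup>2))"
      by simp
    also have "\<dots> \<le> (\<Prod>b\<in>(Basis::'a set). 1 / (1 + (x \<bullet> b)\<^sup>2))"
    proof (intro prod_mono conjI)
      fix b :: 'a assume b: "b \<in> Basis"
      have "(x \<bullet> b)\<^sup>2 \<le> (norm x)\<^sup>2"
        using Basis_le_norm[OF b, of x] by (metis abs_ge_zero power2_abs power_mono)
      then show "1 / (1 + (norm x)\<^sup>2) \<le> 1 / (1 + (x \<bullet> b)\<^sup>2)"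
        by (intro divide_left_mono mult_pos_pos add_pos_nonneg) auto
    qed simp
    finally show "norm (1 / (1 + (norm x)\<^sup>2)^DIM('a)) \<le> norm (\<Prod>b\<in>(Basis::'a set). 1 / (1 + (x \<bullet> b)\<^sup>2))"
      by (simp add: power_divide prod_nonneg)
  qed
qed simp

section \<open>Uniform families of symbols and Schwartz functions\<close>

text \<open>
  A symbol is the case \<open>K = {0}\<close>, a Schwartz function the case \<open>K = UNIV\<close>; the index set makes the
  bounds uniform along a family.
\<close>

definition unif_smooth :: "nat set \<Rightarrow> 'i set \<Rightarrow> ('i \<Rightarrow> real^'m::finite \<Rightarrow> complex) \<Rightarrow> bool" where
  "unif_smooth K I F \<longleftrightarrow> (\<forall>i\<in>I. smooth (F i)) \<and>
     (\<forall>\<alpha>. \<forall>k\<in>K. \<exists>C. \<forall>i\<in>I. \<forall>x. norm x ^ k * cmod (partial_derivs \<alpha> (F i) x) \<le> C)"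

lemma partial_derivs_Nil [simp]: "partial_derivs [] f = f"
  by (simp add: partial_derivs_def)

lemma partial_derivs_Cons: "partial_derivs (j # \<alpha>) f = partial_deriv j (partial_derivs \<alpha> f)"
  by (simp add: partial_derivs_def)

lemma partial_derivs_snoc: "partial_derivs \<alpha> (partial_deriv j f) = partial_derivs (\<alpha> @ [j]) f"
  by (simp add: partial_derivs_def)

lemma S000_iff: "a \<in> S000 \<longleftrightarrow> unif_smooth {0} (UNIV :: unit set) (\<lambda>_. a)"
  by (auto simp: S000_def unif_smooth_def bounded_iff)

lemma schwartz_iff: "f \<in> schwartz \<longleftrightarrow> unif_smooth UNIV (UNIV :: unit set) (\<lambda>_. f)"
  by (auto simp: schwartz_def unif_smooth_def)

text \<open>Higher derivatives are never computed. It is enough that the family lies in a set of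
  families closed under each \<open>partial_deriv j\<close>, all of whose members are differentiable
  and satisfy the weighted bounds; every iterated derivative then stays in that set. Closure is
  asked for indices in \<open>I\<close>, where the family is controlled.\<close>

lemma unif_smooth_coinduct:
  assumes "F \<in> X"
    and diff: "\<And>F i. F \<in> X \<Longrightarrow> i \<in> I \<Longrightarrow> F i differentiable_on UNIV"
    and bound: "\<And>F k. F \<in> X \<Longrightarrow> k \<in> K \<Longrightarrow> \<exists>C. \<forall>i\<in>I. \<forall>x. norm x ^ k * cmod (F i x) \<le> C"
    and deriv: "\<And>F j. F \<in> X \<Longrightarrow> \<exists>G\<in>X. \<forall>i\<in>I. partial_deriv j (F i) = G i"
  shows "unif_smooth K I F"
proof -
  have ex: "\<exists>G\<in>X. \<forall>i\<in>I. partial_derivs \<alpha> (F i) = G i" for \<alpha>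
  proof (induction \<alpha>)
    case Nil
    then show ?case using assms(1) by auto
  next
    case (Cons j \<alpha>)
    then obtain G where G: "G \<in> X" "\<forall>i\<in>I. partial_derivs \<alpha> (F i) = G i" by blast
    obtain H where "H \<in> X" "\<forall>i\<in>I. partial_deriv j (G i) = H i" using deriv[OF G(1)] by blast
    then show ?case using G(2) by (auto simp: partial_derivs_Cons)
  qed
  show ?thesis
    unfolding unif_smooth_def smooth_def
  proof (intro conjI ballI allI)
    fix i \<alpha> assume i: "i \<in> I"
    obtain G where "G \<in> X" "\<forall>i\<in>I. partial_derivs \<alpha> (F i) = G i" using ex by blast
    then show "partial_derivs \<alpha> (F i) differentiable_on UNIV" using diff i by metis
  next
    fix \<alpha> k assume k: "k \<in> K"
    obtain G where G: "G \<in> X" "\<forall>i\<in>I. partial_derivs \<alpha> (F i) = G i" using ex by blast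
    then show "\<exists>C. \<forall>i\<in>I. \<forall>x. norm x ^ k * cmod (partial_derivs \<alpha> (F i) x) \<le> C"
      using bound[OF G(1) k] by metis
  qed
qed

lemma unif_smooth_differentiable:
  "unif_smooth K I F \<Longrightarrow> i \<in> I \<Longrightarrow> F i differentiable (at x)"
  unfolding unif_smooth_def smooth_def
  by (metis UNIV_I differentiable_on_def partial_derivs_Nil)

lemma unif_smooth_bound:
  "unif_smooth K I F \<Longrightarrow> k \<in> K \<Longrightarrow> \<exists>C. \<forall>i\<in>I. \<forall>x. norm x ^ k * cmod (F i x) \<le> C"
  unfolding unif_smooth_def by (metis partial_derivs_Nil)

lemma unif_smooth_partial_deriv:
  "unif_smooth K I F \<Longrightarrow> unif_smooth K I (\<lambda>i. partial_deriv j (F i))"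
  unfolding unif_smooth_def smooth_def by (simp add: partial_derivs_snoc)

lemma unif_smooth_reindex:
  "unif_smooth K I F \<Longrightarrow> (\<And>j. j \<in> J \<Longrightarrow> h j \<in> I) \<Longrightarrow> unif_smooth K J (\<lambda>j. F (h j))"
  unfolding unif_smooth_def by (simp) metis

lemma unif_smooth_mono: "unif_smooth K I F \<Longrightarrow> L \<subseteq> K \<Longrightarrow> unif_smooth L I F"
  unfolding unif_smooth_def by blast

lemma unif_smooth_S000: "a \<in> S000 \<Longrightarrow> unif_smooth {0} I (\<lambda>_. a)"
  unfolding S000_iff by (erule unif_smooth_reindex) simp

lemma unif_smooth_schwartz: "f \<in> schwartz \<Longrightarrow> unif_smooth UNIV I (\<lambda>_. f)"
  unfolding schwartz_iff by (erule unif_smooth_reindex) simp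

lemma unif_smooth_continuous: "unif_smooth K I F \<Longrightarrow> i \<in> I \<Longrightarrow> continuous_on S (F i)"
  by (meson continuous_at_imp_continuous_on differentiable_imp_continuous_within unif_smooth_differentiable)

lemma unif_smooth_measurable: "unif_smooth K I F \<Longrightarrow> i \<in> I \<Longrightarrow> F i \<in> borel_measurable borel"
  by (intro borel_measurable_continuous_onI unif_smooth_continuous)

lemma S000_measurable [measurable_dest]: "a \<in> S000 \<Longrightarrow> a \<in> borel_measurable borel"
  unfolding S000_iff by (rule unif_smooth_measurable[where i="()"]) auto

lemma schwartz_measurable [measurable_dest]: "f \<in> schwartz \<Longrightarrow> f \<in> borel_measurable borel"
  unfolding schwartz_iff by (rule unif_smooth_measurable[where i="()"]) auto

lemma has_vector_derivative_line:
  assumes "(f has_derivative f') (at (x + t0 *\<^sub>R v))"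
  shows "((\<lambda>t. f (x + t *\<^sub>R v)) has_vector_derivative f' v) (at t0)"
proof -
  have 1: "((\<lambda>t. x + t *\<^sub>R v) has_derivative (\<lambda>t. t *\<^sub>R v)) (at t0)"
    by (auto intro!: derivative_eq_intros)
  show ?thesis
    using diff_chain_at[OF 1 assms] linear_cmul[OF has_derivative_linear[OF assms]]
    by (simp add: has_vector_derivative_def o_def)
qed

lemma partial_deriv_eq:
  assumes "(f has_derivative f') (at x)"
  shows "partial_deriv j f x = f' (axis j 1)"
  unfolding partial_deriv_def
  using has_vector_derivative_line[of f f' x 0 "axis j 1"] assms by (simp add: vector_derivative_at)

lemma partial_deriv_line:
  assumes "f differentiable (at (x + t0 *\<^sub>R axis j 1))"
  shows "((\<lambda>t. f (x + t *\<^sub>R axis j 1)) has_vector_derivative partial_deriv j f (x + t0 *\<^sub>R axis j 1)) (at t0)"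
proof -
  obtain f' where f': "(f has_derivative f') (at (x + t0 *\<^sub>R axis j 1))"
    using assms by (auto simp: differentiable_def)
  then show ?thesis
    using has_vector_derivative_line[OF f'] partial_deriv_eq[OF f'] by simp
qed

lemma partial_deriv_add:
  assumes "f differentiable (at x)" "g differentiable (at x)"
  shows "partial_deriv j (\<lambda>x. f x + g x) x = partial_deriv j f x + partial_deriv j g x"
proof -
  obtain f' g' where d: "(f has_derivative f') (at x)" "(g has_derivative g') (at x)"
    using assms by (auto simp: differentiable_def)
  show ?thesis
    unfolding partial_deriv_eq[OF d(1)] partial_deriv_eq[OF d(2)]
    by (subst partial_deriv_eq[OF has_derivative_add[OF d]]) simp
qed

lemma partial_deriv_mult:
  assumes "f differentiable (at x)" "g differentiable (at x)"
  shows "partial_deriv j (\<lambda>x. f x * g x) x = partial_deriv j f x * g x + f x * partial_deriv j g x"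
proof -
  obtain f' g' where d: "(f has_derivative f') (at x)" "(g has_derivative g') (at x)"
    using assms by (auto simp: differentiable_def)
  show ?thesis
    unfolding partial_deriv_eq[OF d(1)] partial_deriv_eq[OF d(2)]
    by (subst partial_deriv_eq[OF has_derivative_mult[OF d]]) simp
qed

lemma partial_deriv_cnj:
  assumes "f differentiable (at x)"
  shows "partial_deriv j (\<lambda>x. cnj (f x)) x = cnj (partial_deriv j f x)"
proof -
  obtain f' where d: "(f has_derivative f') (at x)"
    using assms by (auto simp: differentiable_def)
  show ?thesis
    unfolding partial_deriv_eq[OF d]
    by (subst partial_deriv_eq[OF has_derivative_cnj[OF d]]) simp
qed

lemma unif_smooth_add:
  assumes "unif_smooth K I F" "unif_smooth K I G"
  shows "unif_smooth K I (\<lambda>i x. F i x + G i x)"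
proof (rule unif_smooth_coinduct[where X="{\<lambda>i x. F i x + G i x | F G. unif_smooth K I F \<and> unif_smooth K I G}"])
  show "(\<lambda>i x. F i x + G i x) \<in> {\<lambda>i x. F i x + G i x | F G. unif_smooth K I F \<and> unif_smooth K I G}"
    using assms by blast
next
  fix H i assume "H \<in> {\<lambda>i x. F i x + G i x | F G. unif_smooth K I F \<and> unif_smooth K I G}" and i: "i \<in> I"
  then obtain F G where H: "H = (\<lambda>i x. F i x + G i x)" "unif_smooth K I F" "unif_smooth K I G" by blast
  show "H i differentiable_on UNIV"
    unfolding H(1) differentiable_on_def
    using unif_smooth_differentiable[OF H(2) i] unif_smooth_differentiable[OF H(3) i]
    by (auto intro!: differentiable_add)
next
  fix H k assume "H \<in> {\<lambda>i x. F i x + G i x | F G. unif_smooth K I F \<and> unif_smooth K I G}" and k: "k \<in> K"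
  then obtain F G where H: "H = (\<lambda>i x. F i x + G i x)" "unif_smooth K I F" "unif_smooth K I G" by blast
  obtain C D where C: "\<And>i x. i \<in> I \<Longrightarrow> norm x ^ k * cmod (F i x) \<le> C" and D: "\<And>i x. i \<in> I \<Longrightarrow> norm x ^ k * cmod (G i x) \<le> D"
    using unif_smooth_bound[OF H(2) k] unif_smooth_bound[OF H(3) k] by blast
  have "norm x ^ k * cmod (H i x) \<le> C + D" if "i \<in> I" for i x
  proof -
    have "norm x ^ k * cmod (H i x) \<le> norm x ^ k * (cmod (F i x) + cmod (G i x))"
      unfolding H(1) by (intro mult_left_mono norm_triangle_ineq) simp
    then show ?thesis using C[OF that, of x] D[OF that, of x] by (simp add: distrib_left)
  qed
  then show "\<exists>C. \<forall>i\<in>I. \<forall>x. norm x ^ k * cmod (H i x) \<le> C" by blast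
next
  fix H j assume "H \<in> {\<lambda>i x. F i x + G i x | F G. unif_smooth K I F \<and> unif_smooth K I G}"
  then obtain F G where H: "H = (\<lambda>i x. F i x + G i x)" "unif_smooth K I F" "unif_smooth K I G" by blast
  have "\<forall>i\<in>I. partial_deriv j (H i) = (\<lambda>x. partial_deriv j (F i) x + partial_deriv j (G i) x)"
    unfolding H(1) by (auto intro!: ext partial_deriv_add unif_smooth_differentiable[OF H(2)] unif_smooth_differentiable[OF H(3)])
  then show "\<exists>G\<in>{\<lambda>i x. F i x + G i x | F G. unif_smooth K I F \<and> unif_smooth K I G}. \<forall>i\<in>I. partial_deriv j (H i) = G i"
    using unif_smooth_partial_deriv[OF H(2)] unif_smooth_partial_deriv[OF H(3)]
    by (intro bexI[of _ "\<lambda>i x. partial_deriv j (F i) x + partial_deriv j (G i) x"] CollectI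
        exI[of _ "\<lambda>i. partial_deriv j (F i)"] exI[of _ "\<lambda>i. partial_deriv j (G i)"]) simp_all
qed

text \<open>The invariant set for products. The Leibniz rule leads from a product to a sum of two
  products, so finite sums of products are closed under differentiation while single products are
  not. The second factor carries the weights in \<open>K\<close>.\<close>

inductive_set product_sums :: "nat set \<Rightarrow> 'i set \<Rightarrow> ('i \<Rightarrow> real^'m::finite \<Rightarrow> complex) set" for K I where
  prod: "unif_smooth {0} I f \<Longrightarrow> unif_smooth K I g \<Longrightarrow> (\<lambda>i x. f i x * g i x) \<in> product_sums K I"
| add: "F \<in> product_sums K I \<Longrightarrow> G \<in> product_sums K I \<Longrightarrow> (\<lambda>i x. F i x + G i x) \<in> product_sums K I"

lemma unif_smooth_mult:
  assumes "unif_smooth {0} I f" "unif_smooth K I g"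
  shows "unif_smooth K I (\<lambda>i x. f i x * g i x)"
proof -
  have diff: "F i differentiable (at x)" if "F \<in> product_sums K I" "i \<in> I" for F i x
    using that
  proof (induction rule: product_sums.induct)
    case (prod f g)
    then show ?case
      by (intro differentiable_mult unif_smooth_differentiable[of "{0}" I f i] unif_smooth_differentiable[of K I g i])
  qed (auto intro: differentiable_add)
  show ?thesis
  proof (rule unif_smooth_coinduct[where X="product_sums K I"])
  show "(\<lambda>i x. f i x * g i x) \<in> product_sums K I"
    using assms by (rule product_sums.prod)
next
  fix F i assume "F \<in> product_sums K I" and i: "i \<in> I"
  then show "F i differentiable_on UNIV"
    by (auto simp: differentiable_on_def intro: diff)
next
  fix F k assume "F \<in> product_sums K I" and k: "k \<in> K"
  then show "\<exists>C. \<forall>i\<in>I. \<forall>x. norm x ^ k * cmod (F i x) \<le> C"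
  proof (induction rule: product_sums.induct)
    case (prod f g)
    obtain C where C: "\<And>i x. i \<in> I \<Longrightarrow> cmod (f i x) \<le> C"
      using unif_smooth_bound[OF prod(1), of 0] by auto
    obtain D where D: "\<And>i x. i \<in> I \<Longrightarrow> norm x ^ k * cmod (g i x) \<le> D"
      using unif_smooth_bound[OF prod(2) k] by blast
    have "norm x ^ k * cmod (f i x * g i x) \<le> C * D" if i: "i \<in> I" for i x
    proof -
      have "cmod (f i x) * (norm x ^ k * cmod (g i x)) \<le> C * D"
        by (intro mult_mono C[OF i] D[OF i] order_trans[OF norm_ge_zero C[OF i]]) simp
      then show ?thesis by (simp add: norm_mult mult_ac)
    qed
    then show ?case by blast
  next
    case (add F G)
    then obtain C D where C: "\<And>i x. i \<in> I \<Longrightarrow> norm x ^ k * cmod (F i x) \<le> C" and D: "\<And>i x. i \<in> I \<Longrightarrow> norm x ^ k * cmod (G i x) \<le> D"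
      by blast
    have "norm x ^ k * cmod (F i x + G i x) \<le> C + D" if "i \<in> I" for i x
    proof -
      have "norm x ^ k * cmod (F i x + G i x) \<le> norm x ^ k * (cmod (F i x) + cmod (G i x))"
        by (intro mult_left_mono norm_triangle_ineq) simp
      then show ?thesis using C[OF that, of x] D[OF that, of x] by (simp add: distrib_left)
    qed
    then show ?case by blast
  qed
next
  fix F j assume "F \<in> product_sums K I"
  then show "\<exists>G\<in>product_sums K I. \<forall>i\<in>I. partial_deriv j (F i) = G i"
  proof (induction rule: product_sums.induct)
    case (prod f g)
    have "\<forall>i\<in>I. partial_deriv j (\<lambda>x. f i x * g i x) = (\<lambda>x. partial_deriv j (f i) x * g i x + f i x * partial_deriv j (g i) x)"
      by (auto intro!: ext partial_deriv_mult unif_smooth_differentiable[OF prod(1)] unif_smooth_differentiable[OF prod(2)])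
    then show ?case
      using prod by (intro bexI[of _ "\<lambda>i x. partial_deriv j (f i) x * g i x + f i x * partial_deriv j (g i) x"])
        (auto intro!: product_sums.intros unif_smooth_partial_deriv)
  next
    case (add F G)
    then obtain F' G' where *: "F' \<in> product_sums K I" "\<forall>i\<in>I. partial_deriv j (F i) = F' i"
      "G' \<in> product_sums K I" "\<forall>i\<in>I. partial_deriv j (G i) = G' i" by blast
    have "\<forall>i\<in>I. partial_deriv j (\<lambda>x. F i x + G i x) = (\<lambda>x. F' i x + G' i x)"
      using * by (auto intro!: ext simp: partial_deriv_add diff[OF add(1)] diff[OF add(2)])
    then show ?case
      using * by (intro bexI[of _ "\<lambda>i x. F' i x + G' i x"]) (auto intro: product_sums.intros)
  qed
qed
qed

lemma unif_smooth_cnj: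
  assumes "unif_smooth K I F"
  shows "unif_smooth K I (\<lambda>i x. cnj (F i x))"
proof (rule unif_smooth_coinduct[where X="{\<lambda>i x. cnj (F i x) | F. unif_smooth K I F}"])
  fix H i assume "H \<in> {\<lambda>i x. cnj (F i x) | F. unif_smooth K I F}" "i \<in> I"
  then show "H i differentiable_on UNIV"
    by (auto simp: differentiable_on_def differentiable_cnj_iff intro: unif_smooth_differentiable)
next
  fix H j assume "H \<in> {\<lambda>i x. cnj (F i x) | F. unif_smooth K I F}"
  then obtain F where H: "H = (\<lambda>i x. cnj (F i x))" "unif_smooth K I F" by blast
  have "\<forall>i\<in>I. partial_deriv j (H i) = (\<lambda>x. cnj (partial_deriv j (F i) x))"
    unfolding H(1) by (auto intro!: ext partial_deriv_cnj unif_smooth_differentiable[OF H(2)])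
  then show "\<exists>G\<in>{\<lambda>i x. cnj (F i x) | F. unif_smooth K I F}. \<forall>i\<in>I. partial_deriv j (H i) = G i"
    using unif_smooth_partial_deriv[OF H(2)]
    by (intro bexI[of _ "\<lambda>i x. cnj (partial_deriv j (F i) x)"] CollectI exI[of _ "\<lambda>i. partial_deriv j (F i)"]) simp_all
next
  fix H k assume "H \<in> {\<lambda>i x. cnj (F i x) | F. unif_smooth K I F}" "k \<in> K"
  then show "\<exists>C. \<forall>i\<in>I. \<forall>x. norm x ^ k * cmod (H i x) \<le> C"
    using unif_smooth_bound by fastforce
qed (use assms in blast)

text \<open>\<open>M i\<close> sends the coordinate line in direction \<open>j\<close> to one in
  direction \<open>\<sigma> j\<close>, or to a point if \<open>c i j = 0\<close>. Hence a derivative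
  of the composition is one derivative of \<open>a\<close> times \<open>c i j\<close>, not a sum
  over coordinates. The bound 1 on \<open>c\<close> keeps the accumulated factors \<open>d\<close>
  of all orders bounded uniformly in \<open>i\<close>.\<close>

lemma unif_smooth_affine:
  fixes a :: "'i \<Rightarrow> real^'q::finite \<Rightarrow> complex" and M :: "'i \<Rightarrow> real^'p::finite \<Rightarrow> real^'q"
  assumes a: "unif_smooth {0} I a"
    and M: "\<And>i y. i \<in> I \<Longrightarrow> M i differentiable (at y)"
    and line: "\<And>i y j t. i \<in> I \<Longrightarrow> M i (y + t *\<^sub>R axis j 1) = M i y + (t * c i j) *\<^sub>R axis (\<sigma> j) 1"
    and c: "\<And>i j. i \<in> I \<Longrightarrow> \<bar>c i j\<bar> \<le> 1"
  shows "unif_smooth {0} I (\<lambda>i y. a i (M i y))"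
proof -
  let ?X = "{\<lambda>i y. of_real (d i) * b i (M i y) | d b. unif_smooth {0} I b \<and> (\<forall>i\<in>I. \<bar>d i\<bar> \<le> 1)}"
  show ?thesis
  proof (rule unif_smooth_coinduct[where X="?X"])
    show "(\<lambda>i y. a i (M i y)) \<in> ?X"
      using a by (intro CollectI exI[of _ "\<lambda>_. 1"] exI[of _ a]) simp
  next
    fix H i assume "H \<in> ?X" and i: "i \<in> I"
    then obtain d b where H: "H = (\<lambda>i y. of_real (d i) * b i (M i y))" "unif_smooth {0} I b" by blast
    have "(\<lambda>y. b i (M i y)) differentiable (at y)" for y
      using differentiable_chain_at[OF M[OF i] unif_smooth_differentiable[OF H(2) i]] by (simp add: o_def)
    then show "H i differentiable_on UNIV"
      unfolding H(1) differentiable_on_def by (auto intro!: differentiable_mult)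
  next
    fix H k assume "H \<in> ?X" and k: "k \<in> {0::nat}"
    then obtain d b where H: "H = (\<lambda>i y. of_real (d i) * b i (M i y))" "unif_smooth {0} I b" "\<forall>i\<in>I. \<bar>d i\<bar> \<le> 1" by blast
    obtain C where C: "\<And>i x. i \<in> I \<Longrightarrow> cmod (b i x) \<le> C"
      using unif_smooth_bound[OF H(2), of 0] by auto
    have "cmod (H i x) \<le> C" if i: "i \<in> I" for i x
      using mult_mono[of "\<bar>d i\<bar>" 1 "cmod (b i (M i x))" C] H(3) i C[OF i, of "M i x"]
      by (simp add: H(1) norm_mult)
    then show "\<exists>C. \<forall>i\<in>I. \<forall>x. norm x ^ k * cmod (H i x) \<le> C" using k by auto
  next
    fix H j assume "H \<in> ?X"
    then obtain d b where H: "H = (\<lambda>i y. of_real (d i) * b i (M i y))" "unif_smooth {0} I b" "\<forall>i\<in>I. \<bar>d i\<bar> \<le> 1" by blast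
    have "partial_deriv j (H i) y = of_real (d i * c i j) * partial_deriv (\<sigma> j) (b i) (M i y)" if i: "i \<in> I" for i y
    proof -
      have "((\<lambda>s. b i (M i y + s *\<^sub>R axis (\<sigma> j) 1)) has_vector_derivative partial_deriv (\<sigma> j) (b i) (M i y)) (at (0 * c i j))"
        using partial_deriv_line[where f="b i" and x="M i y" and ?t0.0=0 and j="\<sigma> j"] unif_smooth_differentiable[OF H(2) i] by simp
      moreover have "((\<lambda>t. t * c i j) has_vector_derivative c i j) (at 0)"
        by (auto intro!: derivative_eq_intros simp: has_vector_derivative_def)
      ultimately have "((\<lambda>s. b i (M i y + s *\<^sub>R axis (\<sigma> j) 1)) \<circ> (\<lambda>t. t * c i j) has_vector_derivative c i j *\<^sub>R partial_deriv (\<sigma> j) (b i) (M i y)) (at 0)"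
        by (intro vector_diff_chain_at) auto
      then have "((\<lambda>t. b i (M i (y + t *\<^sub>R axis j 1))) has_vector_derivative c i j *\<^sub>R partial_deriv (\<sigma> j) (b i) (M i y)) (at 0)"
        by (simp add: o_def line[OF i])
      from has_vector_derivative_mult_right[OF this, of "of_real (d i)"]
      have "partial_deriv j (H i) y = of_real (d i) * (c i j *\<^sub>R partial_deriv (\<sigma> j) (b i) (M i y))"
        unfolding H(1) by (subst partial_deriv_def, rule vector_derivative_at)
      then show ?thesis
        by (simp add: scaleR_conv_of_real)
    qed
    then have "\<forall>i\<in>I. partial_deriv j (H i) = (\<lambda>y. of_real (d i * c i j) * partial_deriv (\<sigma> j) (b i) (M i y))"
      by (auto intro!: ext)
    moreover have "\<bar>d i * c i j\<bar> \<le> 1" if "i \<in> I" for i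
      using H(3) c[OF that, of j] that mult_mono[of "\<bar>d i\<bar>" 1 "\<bar>c i j\<bar>" 1] by (auto simp: abs_mult)
    ultimately show "\<exists>G\<in>?X. \<forall>i\<in>I. partial_deriv j (H i) = G i"
      using unif_smooth_partial_deriv[OF H(2)]
      by (intro bexI[of _ "\<lambda>i y. of_real (d i * c i j) * partial_deriv (\<sigma> j) (b i) (M i y)"] CollectI
          exI[of _ "\<lambda>i. d i * c i j"] exI[of _ "\<lambda>i. partial_deriv (\<sigma> j) (b i)"]) auto
  qed
qed

section \<open>The algebra of symbols\<close>

lemma S000_add: "a \<in> S000 \<Longrightarrow> b \<in> S000 \<Longrightarrow> (\<lambda>x. a x + b x) \<in> S000"
  unfolding S000_iff by (rule unif_smooth_add)

lemma S000_mult: "a \<in> S000 \<Longrightarrow> b \<in> S000 \<Longrightarrow> (\<lambda>x. a x * b x) \<in> S000"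
  unfolding S000_iff by (rule unif_smooth_mult)

lemma S000_cnj: "a \<in> S000 \<Longrightarrow> (\<lambda>x. cnj (a x)) \<in> S000"
  unfolding S000_iff by (rule unif_smooth_cnj)

lemma S000_partial_deriv: "a \<in> S000 \<Longrightarrow> partial_deriv j a \<in> S000"
  unfolding S000_iff by (rule unif_smooth_partial_deriv)

lemma partial_deriv_const: "partial_deriv j (\<lambda>x. c) = (\<lambda>x. 0)"
  by (auto simp: partial_deriv_def)

lemma unif_smooth_const:
  fixes c :: "'i \<Rightarrow> complex"
  assumes "\<And>i. i \<in> I \<Longrightarrow> cmod (c i) \<le> C"
  shows "unif_smooth {0} I (\<lambda>i (x::real^'m::finite). c i)"
proof (rule unif_smooth_coinduct[where X="{\<lambda>i x. c i, \<lambda>i x. 0}"])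
  fix F :: "'i \<Rightarrow> real^'m \<Rightarrow> complex" and k
  assume "F \<in> {\<lambda>i x. c i, \<lambda>i x. 0}" "k \<in> {0::nat}"
  then show "\<exists>C. \<forall>i\<in>I. \<forall>x. norm x ^ k * cmod (F i x) \<le> C"
    using assms by auto
qed (auto simp: partial_deriv_const)

lemma S000_const: "(\<lambda>x. c) \<in> S000"
  unfolding S000_iff by (rule unif_smooth_const[where C="cmod c"]) simp

lemma unif_smooth_cmult: "unif_smooth K I F \<Longrightarrow> unif_smooth K I (\<lambda>i x. c * F i x)"
  by (rule unif_smooth_mult[OF unif_smooth_const[where C="cmod c"]]) simp_all

lemma S000_sum: "finite S \<Longrightarrow> (\<And>i. i \<in> S \<Longrightarrow> f i \<in> S000) \<Longrightarrow> (\<lambda>x. \<Sum>i\<in>S. f i x) \<in> S000"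
  by (induction S rule: finite_induct) (auto intro: S000_add S000_const)

lemma unif_smooth_sum:
  "finite S \<Longrightarrow> S \<noteq> {} \<Longrightarrow> (\<And>l. l \<in> S \<Longrightarrow> unif_smooth K I (F l)) \<Longrightarrow> unif_smooth K I (\<lambda>i x. \<Sum>l\<in>S. F l i x)"
  by (induction S rule: finite_ne_induct) (auto intro: unif_smooth_add)

section \<open>Fourier inversion and the Plancherel inequality\<close>

lemma integrable_lborel_pairI:
  fixes F :: "'a::euclidean_space \<times> 'b::euclidean_space \<Rightarrow> 'c::{banach, second_countable_topology}"
  assumes "F \<in> borel_measurable borel" "integrable lborel (\<lambda>x. LINT y|lborel. norm (F (x, y)))"
    "\<And>x. integrable lborel (\<lambda>y. F (x, y))"
  shows "integrable lborel F"
  using lborel_pair.Fubini_integrable[of F] assms by (simp add: lborel_prod)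

lemma integrable_pair_mult:
  fixes f :: "'a::euclidean_space \<Rightarrow> 'c::{real_normed_field, banach, second_countable_topology}"
    and g :: "'b::euclidean_space \<Rightarrow> 'c"
  assumes f: "integrable lborel f" and g: "integrable lborel g"
  shows "integrable lborel (\<lambda>p. f (fst p) * g (snd p))"
proof (rule integrable_lborel_pairI)
  have [measurable]: "f \<in> borel_measurable borel" "g \<in> borel_measurable borel"
    using borel_measurable_integrable[OF f] borel_measurable_integrable[OF g] by simp_all
  show "(\<lambda>p. f (fst p) * g (snd p)) \<in> borel_measurable borel"
    unfolding borel_prod[symmetric] by measurable
  show "integrable lborel (\<lambda>x. LINT y|lborel. norm (f (fst (x, y)) * g (snd (x, y))))"
    using f g by (simp add: norm_mult)
  show "integrable lborel (\<lambda>y. f (fst (x, y)) * g (snd (x, y)))" for x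
    using g by simp
qed

lemma integral_pair_mult:
  fixes f :: "'a::euclidean_space \<Rightarrow> 'c::{real_normed_field, banach, second_countable_topology}"
    and g :: "'b::euclidean_space \<Rightarrow> 'c"
  assumes f: "integrable lborel f" and g: "integrable lborel g"
  shows "(LINT p|lborel. f (fst p) * g (snd p)) = integral\<^sup>L lborel f * integral\<^sup>L lborel g"
  by (subst integral_lborel_fst[OF integrable_pair_mult[OF f g]]) simp

text \<open>No boundary terms at infinity are estimated. By translation invariance the integral
  equals its average over shifts t e_j with t in [0, 1]; doing the t-integral first gives the
  integral of H(e_j + y) - H(y), which vanishes for the same reason.\<close>

lemma integral_partial_deriv_eq_0:
  fixes H :: "real^'m::finite \<Rightarrow> complex"
  assumes diff: "\<And>x. H differentiable (at x)" and H: "integrable lborel H"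
    and D: "integrable lborel (partial_deriv j H)" and cont: "continuous_on UNIV (partial_deriv j H)"
  shows "integral\<^sup>L lborel (partial_deriv j H) = 0"
proof -
  let ?e = "axis j 1 :: real^'m" and ?D = "partial_deriv j H"
  have [measurable]: "?D \<in> borel_measurable borel" "H \<in> borel_measurable borel"
    using borel_measurable_integrable[OF D] borel_measurable_integrable[OF H] by simp_all
  define G where "G = (\<lambda>p :: real \<times> (real^'m). indicator {0..1} (fst p) *\<^sub>R ?D (fst p *\<^sub>R ?e + snd p))"
  have FTC: "(LINT t|lborel. G (t, y)) = H (?e + y) - H y" for y
  proof -
    have "(LINT t|lborel. indicator {0..1} t *\<^sub>R ?D (y + t *\<^sub>R ?e)) = H (y + 1 *\<^sub>R ?e) - H (y + 0 *\<^sub>R ?e)"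
    proof (rule integral_FTC_atLeastAtMost)
      show "((\<lambda>t. H (y + t *\<^sub>R ?e)) has_vector_derivative ?D (y + t *\<^sub>R ?e)) (at t within {0..1})" for t
        by (rule has_vector_derivative_at_within[OF partial_deriv_line[OF diff]])
      show "continuous_on {0..1} (\<lambda>t. ?D (y + t *\<^sub>R ?e))"
        by (intro continuous_on_compose2[OF cont] continuous_intros) auto
    qed simp
    then show ?thesis by (simp add: G_def add.commute)
  qed
  have G: "integrable lborel G"
  proof (rule integrable_lborel_pairI)
    show "G \<in> borel_measurable borel"
      unfolding G_def borel_prod[symmetric] by measurable
    show "integrable lborel (\<lambda>y. G (t, y))" for t
      unfolding G_def using lborel_shift[OF D, of "t *\<^sub>R ?e"] by simp
    have "(\<lambda>t. LINT y|lborel. norm (G (t, y))) = (\<lambda>t. indicator {0..1} t * (LINT y|lborel. norm (?D y)))"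
      unfolding G_def using lborel_integral_shift[of "\<lambda>y. norm (?D y)"] by auto
    then show "integrable lborel (\<lambda>t. LINT y|lborel. norm (G (t, y)))"
      by simp
  qed
  have "integral\<^sup>L lborel G = integral\<^sup>L lborel ?D"
    unfolding integral_lborel_fst[OF G] by (simp add: G_def lborel_integral_shift)
  then have "integral\<^sup>L lborel ?D = (LINT y|lborel. H (?e + y) - H y)"
    unfolding integral_lborel_snd[OF G] FTC by simp
  also have "\<dots> = 0"
    using H lborel_shift[OF H, of ?e] by (simp add: lborel_integral_shift)
  finally show ?thesis .
qed

lemma one_plus_square_power_le: "(1 + s\<^sup>2)^n \<le> 2^n * (1 + s^(2 * n))" for s :: real
proof (cases "s\<^sup>2 \<le> 1")
  case True
  then have "(1 + s\<^sup>2)^n \<le> 2^n" by (intro power_mono) auto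
  also have "\<dots> \<le> 2^n * (1 + s^(2 * n))" by (simp add: power_mult)
  finally show ?thesis .
next
  case False
  then have "(1 + s\<^sup>2)^n \<le> (2 * s\<^sup>2)^n" by (intro power_mono) auto
  also have "\<dots> = 2^n * s^(2*n)" by (simp add: power_mult_distrib power_mult)
  finally show ?thesis
    using zero_le_power[of "2::real" n] by (simp only: distrib_left mult_1_right) linarith
qed

lemma unif_smooth_decay:
  assumes F: "unif_smooth UNIV I F"
  shows "\<exists>C\<ge>0. \<forall>i\<in>I. \<forall>x. cmod (F i x) \<le> C * (1 / (1 + (norm x)\<^sup>2)^n)"
proof -
  obtain A B where A: "\<And>i x. i \<in> I \<Longrightarrow> norm x ^ 0 * cmod (F i x) \<le> A"
    and B: "\<And>i x. i \<in> I \<Longrightarrow> norm x ^ (2 * n) * cmod (F i x) \<le> B"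
    using unif_smooth_bound[OF F UNIV_I, of 0] unif_smooth_bound[OF F UNIV_I, of "2 * n"] by blast
  have "cmod (F i x) \<le> \<bar>2^n * (A + B)\<bar> * (1 / (1 + (norm x)\<^sup>2)^n)" if i: "i \<in> I" for i x
  proof -
    have "(1 + (norm x)\<^sup>2)^n * cmod (F i x) \<le> (2^n * (1 + norm x^(2*n))) * cmod (F i x)"
      by (intro mult_right_mono one_plus_square_power_le) simp
    also have "\<dots> = 2^n * (norm x ^ 0 * cmod (F i x) + norm x ^ (2 * n) * cmod (F i x))"
      by (simp add: algebra_simps)
    also have "\<dots> \<le> 2^n * (A + B)"
      by (intro mult_left_mono add_mono A B i) simp
    finally have "(1 + (norm x)\<^sup>2)^n * cmod (F i x) \<le> \<bar>2^n * (A + B)\<bar>" by linarith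
    moreover have "0 < (1 + (norm x)\<^sup>2)^n" by (intro zero_less_power add_pos_nonneg) auto
    ultimately show ?thesis by (simp add: field_simps)
  qed
  then show ?thesis by (intro exI[of _ "\<bar>2^n * (A + B)\<bar>"]) auto
qed

lemma unif_smooth_integrable:
  fixes F :: "'i \<Rightarrow> real^'m::finite \<Rightarrow> complex"
  assumes F: "unif_smooth UNIV I F" and i: "i \<in> I"
  shows "integrable lborel (F i)"
proof -
  obtain C where C: "C \<ge> 0" "\<And>i x. i \<in> I \<Longrightarrow> cmod (F i x) \<le> C * (1 / (1 + (norm x)\<^sup>2)^DIM(real^'m))"
    using unif_smooth_decay[OF F] by blast
  show ?thesis
  proof (rule Bochner_Integration.integrable_bound)
    show "integrable lborel (\<lambda>x::real^'m. C * (1 / (1 + (norm x)\<^sup>2)^DIM(real^'m)))"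
      by (intro integrable_mult_right integrable_japanese_power)
    show "F i \<in> borel_measurable lborel"
      using unif_smooth_measurable[OF F i] by simp
    show "AE x in lborel. norm (F i x) \<le> norm (C * (1 / (1 + (norm x)\<^sup>2)^DIM(real^'m)))"
      unfolding real_norm_def by (intro AE_I2 order_trans[OF C(2)[OF i] abs_ge_self])
  qed
qed

lemma unif_smooth_L1_bound:
  fixes F :: "'i \<Rightarrow> real^'m::finite \<Rightarrow> complex"
  assumes F: "unif_smooth UNIV I F"
  shows "\<exists>C. \<forall>i\<in>I. (LINT x|lborel. cmod (F i x)) \<le> C"
proof -
  obtain C where C: "C \<ge> 0" "\<And>i x. i \<in> I \<Longrightarrow> cmod (F i x) \<le> C * (1 / (1 + (norm x)\<^sup>2)^DIM(real^'m))"
    using unif_smooth_decay[OF F] by blast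
  have "(LINT x|lborel. cmod (F i x)) \<le> (LINT x::real^'m|lborel. C * (1 / (1 + (norm x)\<^sup>2)^DIM(real^'m)))" if "i \<in> I" for i
    by (intro integral_mono integrable_norm unif_smooth_integrable[OF F that] integrable_mult_right integrable_japanese_power C(2) that)
  then show ?thesis by blast
qed

section \<open>The Fourier transform and its decay\<close>

definition ft :: "('a::euclidean_space \<Rightarrow> complex) \<Rightarrow> 'a \<Rightarrow> complex" where
  "ft F \<xi> = (LINT y|lborel. F y * cis (- (2 * pi * (y \<bullet> \<xi>))))"

lemma measurable_cis [measurable (raw)]: "f \<in> borel_measurable M \<Longrightarrow> (\<lambda>x. cis (f x)) \<in> borel_measurable M"
  by (rule borel_measurable_continuous_on[of cis]) (auto intro: continuous_intros)

lemma integrable_mult_cis: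
  "integrable M F \<Longrightarrow> f \<in> borel_measurable M \<Longrightarrow> integrable M (\<lambda>y. F y * cis (f y))"
  by (rule Bochner_Integration.integrable_bound[where f=F]) (auto simp: norm_mult)

lemma ft_add: "integrable lborel F \<Longrightarrow> integrable lborel G \<Longrightarrow> ft (\<lambda>x. F x + G x) \<xi> = ft F \<xi> + ft G \<xi>"
  unfolding ft_def by (simp add: distrib_right integrable_mult_cis)

lemma ft_cmult: "ft (\<lambda>x. c * F x) \<xi> = c * ft F \<xi>"
  unfolding ft_def by (simp add: mult.assoc)

lemma ft_sum:
  "finite S \<Longrightarrow> (\<And>l. l \<in> S \<Longrightarrow> integrable lborel (F l)) \<Longrightarrow> ft (\<lambda>x. \<Sum>l\<in>S. F l x) \<xi> = (\<Sum>l\<in>S. ft (F l) \<xi>)"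
  unfolding ft_def by (simp add: sum_distrib_right integrable_mult_cis)

lemma ft_bound: "cmod (ft F \<xi>) \<le> (LINT x|lborel. cmod (F x))"
proof -
  have "cmod (ft F \<xi>) \<le> (LINT x|lborel. cmod (F x * cis (- (2 * pi * (x \<bullet> \<xi>)))))"
    unfolding ft_def by (rule integral_norm_bound)
  then show ?thesis by (simp add: norm_mult)
qed

lemma borel_measurable_ft [measurable]:
  assumes [measurable]: "F \<in> borel_measurable borel"
  shows "ft F \<in> borel_measurable borel"
proof -
  have "(\<lambda>\<xi>. LINT y|lborel. F y * cis (- (2 * pi * (y \<bullet> \<xi>)))) \<in> borel_measurable borel"
    by (rule lborel.borel_measurable_lebesgue_integral) measurable
  then show ?thesis unfolding ft_def[abs_def] .
qed

lemma has_derivative_cis_inner: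
  fixes x \<xi> :: "'a::euclidean_space"
  shows "((\<lambda>y. cis (- (2 * pi * (y \<bullet> \<xi>)))) has_derivative
    (\<lambda>h. - (2 * pi * \<i> * of_real (h \<bullet> \<xi>)) * cis (- (2 * pi * (x \<bullet> \<xi>))))) (at x)"
proof -
  let ?g = "\<lambda>y. \<i> * complex_of_real (- (2 * pi * (y \<bullet> \<xi>)))"
  have "linear ?g"
    by (rule linearI) (simp_all add: inner_add_left algebra_simps scaleR_conv_of_real)
  then have "(?g has_derivative ?g) (at x)"
    unfolding linear_conv_bounded_linear by (rule bounded_linear_imp_has_derivative)
  moreover have "(exp has_derivative (\<lambda>h. exp (?g x) * h)) (at (?g x))"
    using DERIV_exp[of "?g x"] by (simp only: has_field_derivative_def)
  ultimately have "((\<lambda>y. exp (?g y)) has_derivative (\<lambda>h. exp (?g x) * ?g h)) (at x)"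
    by (rule has_derivative_compose)
  then show ?thesis
    unfolding cis_conv_exp by (rule has_derivative_eq_rhs) (auto simp: mult_ac)
qed

lemma ft_partial_deriv:
  fixes F :: "'i \<Rightarrow> real^'m::finite \<Rightarrow> complex"
  assumes F: "unif_smooth UNIV I F" and i: "i \<in> I"
  shows "ft (partial_deriv j (F i)) \<xi> = 2 * pi * \<i> * of_real (\<xi> $ j) * ft (F i) \<xi>"
proof -
  let ?c = "\<lambda>y. cis (- (2 * pi * (y \<bullet> \<xi>)))"
  let ?H = "\<lambda>y. F i y * ?c y"
  note dF = unif_smooth_partial_deriv[OF F]
  have dc: "?c differentiable (at x)" for x
    using has_derivative_cis_inner by (rule differentiableI)
  have pd: "partial_deriv j ?H = (\<lambda>x. partial_deriv j (F i) x * ?c x + (- (2 * pi * \<i> * of_real (\<xi> $ j))) * (F i x * ?c x))"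
  proof
    fix x
    have "partial_deriv j ?c x = - (2 * pi * \<i> * of_real (\<xi> $ j)) * ?c x"
      by (subst partial_deriv_eq[OF has_derivative_cis_inner]) (simp add: inner_axis')
    then show "partial_deriv j ?H x = partial_deriv j (F i) x * ?c x + (- (2 * pi * \<i> * of_real (\<xi> $ j))) * (F i x * ?c x)"
      by (subst partial_deriv_mult[OF unif_smooth_differentiable[OF F i] dc]) simp
  qed
  have cc: "continuous_on UNIV ?c"
    by (intro continuous_intros)
  have I1: "integrable lborel (\<lambda>x. partial_deriv j (F i) x * ?c x)" "integrable lborel ?H"
    using unif_smooth_integrable[OF dF i] unif_smooth_integrable[OF F i] by (auto intro!: integrable_mult_cis)
  have "integral\<^sup>L lborel (partial_deriv j ?H) = 0"
  proof (rule integral_partial_deriv_eq_0)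
    show "?H differentiable (at x)" for x
      by (intro differentiable_mult unif_smooth_differentiable[OF F i] dc)
    show "integrable lborel ?H" by fact
    show "integrable lborel (partial_deriv j ?H)"
      unfolding pd by (intro Bochner_Integration.integrable_add integrable_mult_right I1)
    show "continuous_on UNIV (partial_deriv j ?H)"
      unfolding pd by (intro continuous_intros cc unif_smooth_continuous[OF F i] unif_smooth_continuous[OF dF i])
  qed
  then have "ft (partial_deriv j (F i)) \<xi> + (- (2 * pi * \<i> * of_real (\<xi> $ j))) * ft (F i) \<xi> = 0"
    unfolding pd ft_def
    by (subst (asm) Bochner_Integration.integral_add[OF I1(1) integrable_mult_right[OF I1(2)]])
       (simp only: integral_mult_right_zero)
  then show ?thesis by (simp add: add_eq_0_iff)
qed

lemma norm_square_vec: "(norm \<xi>)\<^sup>2 = (\<Sum>j\<in>UNIV. (\<xi> $ j)\<^sup>2)" for \<xi> :: "real^'m::finite"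
  unfolding power2_norm_eq_inner inner_vec_def by (simp add: power2_eq_square)

text \<open>Subtracting from F its Laplacian divided by 4 pi^2 multiplies the transform by 1 +
  |\<xi>|^2 and stays within uniform Schwartz families, so one factor is gained per induction
  step.\<close>

lemma unif_smooth_ft_decay:
  fixes F :: "'i \<Rightarrow> real^'m::finite \<Rightarrow> complex"
  assumes "unif_smooth UNIV I F"
  shows "\<exists>C. \<forall>i\<in>I. \<forall>\<xi>. (1 + (norm \<xi>)\<^sup>2)^N * cmod (ft (F i) \<xi>) \<le> C"
  using assms
proof (induction N arbitrary: F)
  case 0
  then show ?case
    using unif_smooth_L1_bound[OF 0] ft_bound order_trans by (metis mult_1 power_0)
next
  case (Suc N)
  note F = Suc.prems
  note dF = unif_smooth_partial_deriv[OF F]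
  note ddF = unif_smooth_partial_deriv[OF dF]
  define c :: complex where "c = - (4 * (of_real pi)\<^sup>2)"
  define k where "k = 1 / c"
  have kc: "k * c = 1" by (simp add: k_def c_def)
  define G where "G = (\<lambda>i x. F i x + k * (\<Sum>j\<in>UNIV. partial_deriv j (partial_deriv j (F i)) x))"
  have G: "unif_smooth UNIV I G"
    unfolding G_def by (intro unif_smooth_add unif_smooth_cmult unif_smooth_sum F ddF) auto
  have ftG: "ft (G i) \<xi> = of_real (1 + (norm \<xi>)\<^sup>2) * ft (F i) \<xi>" if i: "i \<in> I" for i \<xi>
  proof -
    have int: "integrable lborel (F i)" "\<And>j. integrable lborel (partial_deriv j (partial_deriv j (F i)))"
      using unif_smooth_integrable[OF F i] unif_smooth_integrable[OF ddF i] by auto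
    have "ft (G i) \<xi> = ft (F i) \<xi> + k * (\<Sum>j\<in>UNIV. ft (partial_deriv j (partial_deriv j (F i))) \<xi>)"
      unfolding G_def using int by (subst ft_add) (auto simp: ft_cmult ft_sum)
    also have "\<dots> = ft (F i) \<xi> + k * (\<Sum>j\<in>UNIV. c * (of_real ((\<xi> $ j)\<^sup>2) * ft (F i) \<xi>))"
      by (simp add: ft_partial_deriv[OF dF i] ft_partial_deriv[OF F i] power2_eq_square mult_ac c_def)
    also have "\<dots> = ft (F i) \<xi> + (\<Sum>j\<in>UNIV. of_real ((\<xi> $ j)\<^sup>2) * ft (F i) \<xi>)"
      by (simp only: sum_distrib_left mult.assoc[symmetric] kc mult_1_left)
    also have "\<dots> = of_real (1 + (norm \<xi>)\<^sup>2) * ft (F i) \<xi>"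
      by (simp add: norm_square_vec sum_distrib_right distrib_right)
    finally show ?thesis .
  qed
  obtain C where C: "\<And>i \<xi>. i \<in> I \<Longrightarrow> (1 + (norm \<xi>)\<^sup>2)^N * cmod (ft (G i) \<xi>) \<le> C"
    using Suc.IH[OF G] by blast
  have "(1 + (norm \<xi>)\<^sup>2)^Suc N * cmod (ft (F i) \<xi>) \<le> C" if i: "i \<in> I" for i \<xi>
  proof -
    have "cmod (ft (G i) \<xi>) = (1 + (norm \<xi>)\<^sup>2) * cmod (ft (F i) \<xi>)"
      unfolding ftG[OF i] norm_mult norm_of_real by simp
    then show ?thesis using C[OF i, of \<xi>] by (simp add: mult_ac)
  qed
  then show ?case by blast
qed

lemma unif_smooth_ft_bound:
  fixes F :: "'i \<Rightarrow> real^'m::finite \<Rightarrow> complex"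
  assumes "unif_smooth UNIV I F"
  shows "\<exists>C\<ge>0. \<forall>i\<in>I. \<forall>\<xi>. cmod (ft (F i) \<xi>) \<le> C * (1 / (1 + (norm \<xi>)\<^sup>2)^N)"
proof -
  obtain C where C: "\<And>i \<xi>. i \<in> I \<Longrightarrow> (1 + (norm \<xi>)\<^sup>2)^N * cmod (ft (F i) \<xi>) \<le> C"
    using unif_smooth_ft_decay[OF assms] by blast
  have "cmod (ft (F i) \<xi>) \<le> \<bar>C\<bar> * (1 / (1 + (norm \<xi>)\<^sup>2)^N)" if i: "i \<in> I" for i \<xi>
  proof -
    have "(1 + (norm \<xi>)\<^sup>2)^N * cmod (ft (F i) \<xi>) \<le> \<bar>C\<bar>" using C[OF i, of \<xi>] by linarith
    moreover have "0 < (1 + (norm \<xi>)\<^sup>2)^N" by (intro zero_less_power add_pos_nonneg) auto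
    ultimately show ?thesis by (simp add: field_simps)
  qed
  then show ?thesis by (intro exI[of _ "\<bar>C\<bar>"]) auto
qed

lemma lborel_integral_scale:
  fixes f :: "'a::euclidean_space \<Rightarrow> 'b::{banach, second_countable_topology}"
  assumes [measurable]: "f \<in> borel_measurable borel" and c: "c \<noteq> 0"
  shows "integral\<^sup>L lborel f = \<bar>c\<bar>^DIM('a) *\<^sub>R (LINT x|lborel. f (c *\<^sub>R x))"
  by (subst lborel_affine[OF c, of 0], subst integral_density) (auto simp: integral_distr)

text \<open>The inversion integral is regularised by exp(-pi e_n |\<xi>|^2). Integrability of
  \<open>ft F\<close> removes this factor on one side. On the other side Fubini turns the
  regularised integral into the convolution of \<open>F\<close> with a Gaussian of width sqrt(e_n),
  an approximate identity; continuity and boundedness of \<open>F\<close> give its limit.\<close>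

lemma fourier_inversion:
  fixes F :: "'a::euclidean_space \<Rightarrow> complex"
  assumes cont: "continuous_on UNIV F" and bd: "\<And>x. cmod (F x) \<le> B"
    and F: "integrable lborel F" and ftF: "integrable lborel (ft F)"
  shows "(LINT \<xi>|lborel. ft F \<xi> * cis (2 * pi * (\<xi> \<bullet> x))) = F x"
proof -
  have [measurable]: "F \<in> borel_measurable borel"
    using borel_measurable_integrable[OF F] by simp
  define e where "e n = 1 / real (Suc n)" for n
  have e: "0 < e n" for n by (simp add: e_def)
  define g where "g n \<xi> = exp (- pi * e n * (norm \<xi>)\<^sup>2)" for n and \<xi> :: 'a
  have [measurable]: "g n \<in> borel_measurable borel" for n unfolding g_def by measurable
  have e0: "e \<longlonglongrightarrow> 0" unfolding e_def using LIMSEQ_inverse_real_of_nat by (simp add: inverse_eq_divide)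
  have g1: "(\<lambda>n. g n \<xi>) \<longlonglongrightarrow> 1" for \<xi>
  proof -
    have "(\<lambda>n. g n \<xi>) \<longlonglongrightarrow> exp (- pi * 0 * (norm \<xi>)\<^sup>2)"
      unfolding g_def by (intro tendsto_intros e0)
    then show ?thesis by simp
  qed
  have gle: "0 \<le> g n \<xi>" "g n \<xi> \<le> 1" for n \<xi>
    using e[of n] by (simp_all add: g_def)
  have gint: "integrable lborel (g n)" for n
    unfolding g_def by (rule integrable_gaussian[OF e])
  define A where "A n = (LINT \<xi>|lborel. (ft F \<xi> * cis (2 * pi * (\<xi> \<bullet> x))) * of_real (g n \<xi>))" for n
  have lim1: "A \<longlonglongrightarrow> (LINT \<xi>|lborel. ft F \<xi> * cis (2 * pi * (\<xi> \<bullet> x)))"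
    unfolding A_def
  proof (rule integral_dominated_convergence[where w="\<lambda>\<xi>. cmod (ft F \<xi>)"])
    show "AE \<xi> in lborel. (\<lambda>n. (ft F \<xi> * cis (2 * pi * (\<xi> \<bullet> x))) * of_real (g n \<xi>)) \<longlonglongrightarrow> ft F \<xi> * cis (2 * pi * (\<xi> \<bullet> x))"
    proof (rule AE_I2)
      fix \<xi>
      have "(\<lambda>n. (ft F \<xi> * cis (2 * pi * (\<xi> \<bullet> x))) * of_real (g n \<xi>)) \<longlonglongrightarrow> (ft F \<xi> * cis (2 * pi * (\<xi> \<bullet> x))) * of_real 1"
        by (intro tendsto_intros g1)
      then show "(\<lambda>n. (ft F \<xi> * cis (2 * pi * (\<xi> \<bullet> x))) * of_real (g n \<xi>)) \<longlonglongrightarrow> ft F \<xi> * cis (2 * pi * (\<xi> \<bullet> x))" by simp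
    qed
    show "AE \<xi> in lborel. norm ((ft F \<xi> * cis (2 * pi * (\<xi> \<bullet> x))) * of_real (g n \<xi>)) \<le> cmod (ft F \<xi>)" for n
      using gle by (intro AE_I2) (simp add: norm_mult mult_left_le)
  qed (use ftF in auto)
  have A_eq: "A n = (LINT u|lborel. F (x - sqrt (e n) *\<^sub>R u) * of_real (exp (- pi * (norm u)\<^sup>2)))" for n
  proof -
    define P where "P = (\<lambda>p :: 'a \<times> 'a. (of_real (g n (fst p)) * F (snd p)) * cis (2 * pi * (fst p \<bullet> (x - snd p))))"
    have intP: "integrable lborel P"
      unfolding P_def
      by (intro integrable_mult_cis integrable_pair_mult[of "\<lambda>\<xi>. of_real (g n \<xi>)" F] F integrable_of_real gint)
         (simp add: borel_prod[symmetric] del: measurable_lborel1, measurable)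
    have "A n = (LINT \<xi>|lborel. LINT y|lborel. P (\<xi>, y))"
      unfolding A_def
    proof (rule Bochner_Integration.integral_cong[OF refl])
      fix \<xi>
      have "(ft F \<xi> * cis (2 * pi * (\<xi> \<bullet> x))) * of_real (g n \<xi>)
          = (LINT y|lborel. (F y * cis (- (2 * pi * (y \<bullet> \<xi>)))) * (cis (2 * pi * (\<xi> \<bullet> x)) * of_real (g n \<xi>)))"
        unfolding ft_def integral_mult_left_zero by (simp only: mult.assoc)
      also have "\<dots> = (LINT y|lborel. P (\<xi>, y))"
      proof (rule Bochner_Integration.integral_cong[OF refl])
        fix y
        have "cis (- (2 * pi * (y \<bullet> \<xi>))) * cis (2 * pi * (\<xi> \<bullet> x)) = cis (2 * pi * (\<xi> \<bullet> (x - y)))"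
          by (simp add: cis_mult inner_diff_right inner_commute algebra_simps)
        then show "(F y * cis (- (2 * pi * (y \<bullet> \<xi>)))) * (cis (2 * pi * (\<xi> \<bullet> x)) * of_real (g n \<xi>)) = P (\<xi>, y)"
          by (simp add: P_def mult_ac)
      qed
      finally show "(ft F \<xi> * cis (2 * pi * (\<xi> \<bullet> x))) * of_real (g n \<xi>) = (LINT y|lborel. P (\<xi>, y))" .
    qed
    also have "\<dots> = (LINT y|lborel. LINT \<xi>|lborel. P (\<xi>, y))"
      by (simp only: integral_lborel_fst[OF intP, symmetric] integral_lborel_snd[OF intP, symmetric])
    also have "\<dots> = (LINT y|lborel. F y * of_real ((1 / sqrt (e n))^DIM('a) * exp (- pi * (norm (x - y))\<^sup>2 / e n)))"
    proof (rule Bochner_Integration.integral_cong[OF refl])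
      fix y
      have "(LINT \<xi>|lborel. P (\<xi>, y)) = (LINT \<xi>|lborel. F y * (of_real (g n \<xi>) * cis (2 * pi * (\<xi> \<bullet> (x - y)))))"
        by (simp add: P_def mult_ac)
      also have "\<dots> = F y * of_real ((1 / sqrt (e n))^DIM('a) * exp (- pi * (norm (x - y))\<^sup>2 / e n))"
        unfolding integral_mult_right_zero g_def integral_gaussian_cis[OF e] ..
      finally show "(LINT \<xi>|lborel. P (\<xi>, y)) = F y * of_real ((1 / sqrt (e n))^DIM('a) * exp (- pi * (norm (x - y))\<^sup>2 / e n))" .
    qed
    \<comment> \<open>Reflecting and rescaling moves \<open>n\<close> from the kernel into the
      argument of \<open>F\<close>, so the Gaussian weight is fixed and dominated convergence
      applies.\<close>
    also have "\<dots> = (LINT y|lborel. F (x - y) * of_real ((1 / sqrt (e n))^DIM('a) * exp (- pi * (norm y)\<^sup>2 / e n)))"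
      by (subst lborel_integral_reflect[of _ x, symmetric]) simp_all
    also have "\<dots> = \<bar>sqrt (e n)\<bar>^DIM('a) *\<^sub>R (LINT u|lborel. F (x - sqrt (e n) *\<^sub>R u) *
        of_real ((1 / sqrt (e n))^DIM('a) * exp (- pi * (norm (sqrt (e n) *\<^sub>R u))\<^sup>2 / e n)))"
      by (rule lborel_integral_scale) (use e[of n] in \<open>auto\<close>)
    also have "\<dots> = (LINT u|lborel. F (x - sqrt (e n) *\<^sub>R u) * of_real (exp (- pi * (norm u)\<^sup>2)))"
      unfolding integral_scaleR_right[symmetric]
    proof (rule Bochner_Integration.integral_cong[OF refl])
      fix u :: 'a
      have "\<bar>sqrt (e n)\<bar>^DIM('a) * (1 / sqrt (e n))^DIM('a) = 1"
        using e[of n] by (simp add: power_mult_distrib[symmetric])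
      moreover have "- pi * (norm (sqrt (e n) *\<^sub>R u))\<^sup>2 / e n = - pi * (norm u)\<^sup>2"
        using e[of n] by (simp add: power_mult_distrib)
      moreover have "a *\<^sub>R (f * of_real (b * E)) = f * of_real ((a * b) * E)" for a b E :: real and f :: complex
        by (simp add: scaleR_conv_of_real mult_ac)
      ultimately show "\<bar>sqrt (e n)\<bar>^DIM('a) *\<^sub>R (F (x - sqrt (e n) *\<^sub>R u) *
          of_real ((1 / sqrt (e n))^DIM('a) * exp (- pi * (norm (sqrt (e n) *\<^sub>R u))\<^sup>2 / e n)))
          = F (x - sqrt (e n) *\<^sub>R u) * of_real (exp (- pi * (norm u)\<^sup>2))"
        by (simp only: mult_1_left)
    qed
    finally show ?thesis .
  qed
  have G1: "integrable lborel (\<lambda>u::'a. exp (- pi * (norm u)\<^sup>2))" "(LINT u::'a|lborel. exp (- pi * (norm u)\<^sup>2)) = 1"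
    using integrable_gaussian[of 1, where 'a='a] integral_gaussian[of 1, where 'a='a] by simp_all
  have "(\<lambda>n. LINT u|lborel. F (x - sqrt (e n) *\<^sub>R u) * of_real (exp (- pi * (norm u)\<^sup>2)))
      \<longlonglongrightarrow> (LINT u::'a|lborel. F x * of_real (exp (- pi * (norm u)\<^sup>2)))"
  proof (rule integral_dominated_convergence[where w="\<lambda>u::'a. B * exp (- pi * (norm u)\<^sup>2)"])
    show "AE u in lborel. (\<lambda>n. F (x - sqrt (e n) *\<^sub>R u) * of_real (exp (- pi * (norm u)\<^sup>2))) \<longlonglongrightarrow> F x * of_real (exp (- pi * (norm u)\<^sup>2))"
    proof (rule AE_I2)
      fix u :: 'a
      have "(\<lambda>n. x - sqrt (e n) *\<^sub>R u) \<longlonglongrightarrow> x - sqrt 0 *\<^sub>R u"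
        by (intro tendsto_intros e0)
      then have "(\<lambda>n. F (x - sqrt (e n) *\<^sub>R u)) \<longlonglongrightarrow> F x"
        using continuous_on_tendsto_compose[OF cont, of _ x] by simp
      then show "(\<lambda>n. F (x - sqrt (e n) *\<^sub>R u) * of_real (exp (- pi * (norm u)\<^sup>2))) \<longlonglongrightarrow> F x * of_real (exp (- pi * (norm u)\<^sup>2))"
        by (intro tendsto_intros)
    qed
    show "AE u in lborel. norm (F (x - sqrt (e n) *\<^sub>R u) * of_real (exp (- pi * (norm u)\<^sup>2))) \<le> B * exp (- pi * (norm u)\<^sup>2)" for n
      by (intro AE_I2) (simp add: norm_mult bd)
  qed (use G1 in auto)
  then have "A \<longlonglongrightarrow> F x"
    unfolding A_eq[symmetric] integral_mult_right_zero integral_complex_of_real G1(2) by simp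
  with lim1 show ?thesis by (rule LIMSEQ_unique)
qed

text \<open>Integrating against exp(-pi e_n |\<xi>|^2) and expanding the square gives a double
  integral of F(y) times the conjugate of F(y') against a Gaussian kernel of total mass one in
  either variable. The inequality ab <= (a^2 + b^2) / 2 bounds it by the right-hand side, and Fatou
  removes the regularisation. The integrals are extended ones, so the right-hand side may be
  infinite.\<close>

lemma plancherel_le:
  fixes F :: "'a::euclidean_space \<Rightarrow> complex"
  assumes F: "integrable lborel F"
  shows "(\<integral>\<^sup>+\<xi>. (ennreal (cmod (ft F \<xi>)))\<^sup>2 \<partial>lborel) \<le> (\<integral>\<^sup>+y. (ennreal (cmod (F y)))\<^sup>2 \<partial>lborel)"
proof -
  have [measurable]: "F \<in> borel_measurable borel"
    using borel_measurable_integrable[OF F] by simp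
  define e where "e n = 1 / real (Suc n)" for n
  have e: "0 < e n" for n by (simp add: e_def)
  define g where "g n \<xi> = exp (- pi * e n * (norm \<xi>)\<^sup>2)" for n and \<xi> :: 'a
  have [measurable]: "g n \<in> borel_measurable borel" for n unfolding g_def by measurable
  have e0: "e \<longlonglongrightarrow> 0" unfolding e_def using LIMSEQ_inverse_real_of_nat by (simp add: inverse_eq_divide)
  have g1: "(\<lambda>n. g n \<xi>) \<longlonglongrightarrow> 1" for \<xi>
  proof -
    have "(\<lambda>n. g n \<xi>) \<longlonglongrightarrow> exp (- pi * 0 * (norm \<xi>)\<^sup>2)"
      unfolding g_def by (intro tendsto_intros e0)
    then show ?thesis by simp
  qed
  have gint: "integrable lborel (g n)" for n
    unfolding g_def by (rule integrable_gaussian[OF e])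
  have g0: "0 \<le> g n \<xi>" for n \<xi> by (simp add: g_def)
  define K where "K n y = (1 / sqrt (e n))^DIM('a) * exp (- pi * (norm y)\<^sup>2 / e n)" for n and y :: 'a
  have K0: "0 \<le> K n y" for n y using e[of n] by (simp add: K_def)
  have [measurable]: "K n \<in> borel_measurable borel" for n unfolding K_def by measurable
  have Kint: "(\<integral>\<^sup>+y. ennreal (K n y) \<partial>lborel) = 1" for n
  proof -
    have eq: "K n = (\<lambda>y. (1 / sqrt (e n))^DIM('a) * exp (- pi * (1 / e n) * (norm y)\<^sup>2))"
      by (simp add: K_def fun_eq_iff)
    have "integrable lborel (K n)"
      unfolding eq using e[of n] by (intro integrable_mult_right integrable_gaussian) simp
    moreover have "integral\<^sup>L lborel (K n) = 1"
      unfolding eq integral_mult_right_zero using e[of n]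
      by (subst integral_gaussian) (simp_all add: real_sqrt_divide power_mult_distrib[symmetric])
    ultimately show ?thesis
      by (subst nn_integral_eq_integral) (auto simp: K0)
  qed
  let ?N = "\<integral>\<^sup>+y. (ennreal (cmod (F y)))\<^sup>2 \<partial>lborel"
  have main: "(\<integral>\<^sup>+\<xi>. (ennreal (cmod (ft F \<xi>)))\<^sup>2 * ennreal (g n \<xi>) \<partial>lborel) \<le> ?N" for n
  proof -
    define G where "G = (\<lambda>p :: 'a \<times> 'a. F (fst p) * cnj (F (snd p)))"
    have G: "integrable lborel G"
      unfolding G_def using integrable_pair_mult[OF F, of "\<lambda>y. cnj (F y)"] F by simp
    have [measurable]: "G \<in> borel_measurable borel"
      using borel_measurable_integrable[OF G] by simp
    define P where "P = (\<lambda>q :: 'a \<times> ('a \<times> 'a). (of_real (g n (fst q)) * G (snd q)) * cis (2 * pi * (fst q \<bullet> (snd (snd q) - fst (snd q)))))"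
    have intP: "integrable lborel P"
      unfolding P_def
      by (intro integrable_mult_cis integrable_pair_mult[of "\<lambda>\<xi>. of_real (g n \<xi>)" G] G integrable_of_real gint)
         (simp add: borel_prod[symmetric] del: measurable_lborel1, measurable)
    have ft2: "of_real ((cmod (ft F \<xi>))\<^sup>2 * g n \<xi>) = (LINT p|lborel. P (\<xi>, p))" for \<xi>
    proof -
      have I: "integrable lborel (\<lambda>y. F y * cis (- (2 * pi * (y \<bullet> \<xi>))))"
        by (intro integrable_mult_cis F) simp
      have "complex_of_real ((cmod (ft F \<xi>))\<^sup>2) = ft F \<xi> * cnj (ft F \<xi>)"
        by (rule complex_norm_square)
      also have "\<dots> = (LINT p|lborel. (F (fst p) * cis (- (2 * pi * (fst p \<bullet> \<xi>)))) * cnj (F (snd p) * cis (- (2 * pi * (snd p \<bullet> \<xi>)))))"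
        using integral_pair_mult[OF I, of "\<lambda>y. cnj (F y * cis (- (2 * pi * (y \<bullet> \<xi>))))"] I
        by (simp only: ft_def integrable_cnj Bochner_Integration.integral_cnj)
      also have "\<dots> = (LINT p|lborel. G p * cis (2 * pi * (\<xi> \<bullet> (snd p - fst p))))"
      proof (rule Bochner_Integration.integral_cong[OF refl])
        fix p :: "'a \<times> 'a"
        have "cis (- (2 * pi * (fst p \<bullet> \<xi>))) * cnj (cis (- (2 * pi * (snd p \<bullet> \<xi>)))) = cis (2 * pi * (\<xi> \<bullet> (snd p - fst p)))"
          by (simp add: cis_cnj cis_mult inner_diff_right inner_commute algebra_simps)
        then show "(F (fst p) * cis (- (2 * pi * (fst p \<bullet> \<xi>)))) * cnj (F (snd p) * cis (- (2 * pi * (snd p \<bullet> \<xi>))))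
            = G p * cis (2 * pi * (\<xi> \<bullet> (snd p - fst p)))"
          by (simp add: G_def mult_ac)
      qed
      finally have "complex_of_real ((cmod (ft F \<xi>))\<^sup>2) = \<dots>" .
      then have "of_real ((cmod (ft F \<xi>))\<^sup>2 * g n \<xi>) = of_real (g n \<xi>) * (LINT p|lborel. G p * cis (2 * pi * (\<xi> \<bullet> (snd p - fst p))))"
        by (simp only: of_real_mult mult.commute)
      then show ?thesis
        by (simp only: P_def fst_conv snd_conv mult.assoc integral_mult_right_zero)
    qed
    have i2: "integrable lborel (\<lambda>\<xi>. (cmod (ft F \<xi>))\<^sup>2 * g n \<xi>)"
    proof (rule Bochner_Integration.integrable_bound)
      show "integrable lborel (\<lambda>\<xi>. ((LINT x|lborel. cmod (F x)))\<^sup>2 * g n \<xi>)"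
        by (intro integrable_mult_right gint)
      show "AE \<xi> in lborel. norm ((cmod (ft F \<xi>))\<^sup>2 * g n \<xi>) \<le> norm (((LINT x|lborel. cmod (F x)))\<^sup>2 * g n \<xi>)"
      proof (rule AE_I2)
        fix \<xi>
        have "(cmod (ft F \<xi>))\<^sup>2 * g n \<xi> \<le> ((LINT x|lborel. cmod (F x)))\<^sup>2 * g n \<xi>"
          by (intro mult_right_mono power_mono ft_bound g0) simp
        then show "norm ((cmod (ft F \<xi>))\<^sup>2 * g n \<xi>) \<le> norm (((LINT x|lborel. cmod (F x)))\<^sup>2 * g n \<xi>)"
          using g0[of n \<xi>] by (simp add: abs_mult)
      qed
    qed simp
    have "of_real (LINT \<xi>|lborel. (cmod (ft F \<xi>))\<^sup>2 * g n \<xi>) = (LINT \<xi>|lborel. LINT p|lborel. P (\<xi>, p))"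
      unfolding ft2[symmetric] integral_complex_of_real ..
    also have "\<dots> = (LINT p|lborel. LINT \<xi>|lborel. P (\<xi>, p))"
      by (simp only: integral_lborel_fst[OF intP, symmetric] integral_lborel_snd[OF intP, symmetric])
    also have "\<dots> = (LINT p|lborel. G p * of_real (K n (snd p - fst p)))"
    proof (rule Bochner_Integration.integral_cong[OF refl])
      fix p :: "'a \<times> 'a"
      have "(LINT \<xi>|lborel. P (\<xi>, p)) = (LINT \<xi>|lborel. G p * (of_real (g n \<xi>) * cis (2 * pi * (\<xi> \<bullet> (snd p - fst p)))))"
        by (simp add: P_def mult_ac)
      also have "\<dots> = G p * of_real (K n (snd p - fst p))"
        unfolding integral_mult_right_zero g_def integral_gaussian_cis[OF e] K_def ..
      finally show "(LINT \<xi>|lborel. P (\<xi>, p)) = G p * of_real (K n (snd p - fst p))" .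
    qed
    finally have eq: "of_real (LINT \<xi>|lborel. (cmod (ft F \<xi>))\<^sup>2 * g n \<xi>) = (LINT p|lborel. G p * of_real (K n (snd p - fst p)))" .
    \<comment> \<open>\<open>h\<close> is the one half in ab <= (a^2 + b^2) / 2; the two halves
      recombine to 1 in \<open>ennreal\<close> at the end.\<close>
    define h :: real where "h = 1/2"
    have h: "0 \<le> h" by (simp add: h_def)
    have sq: "ennreal h * ((ennreal u)\<^sup>2 * ennreal k) + ennreal h * ((ennreal v)\<^sup>2 * ennreal k) = ennreal ((h * u\<^sup>2 + h * v\<^sup>2) * k)"
      if "0 \<le> u" "0 \<le> v" "0 \<le> k" for u v k
      using that h by (simp add: ennreal_power ennreal_mult[symmetric] ennreal_plus[symmetric] algebra_simps del: ennreal_plus)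
    have "(\<integral>\<^sup>+\<xi>. (ennreal (cmod (ft F \<xi>)))\<^sup>2 * ennreal (g n \<xi>) \<partial>lborel) = ennreal (LINT \<xi>|lborel. (cmod (ft F \<xi>))\<^sup>2 * g n \<xi>)"
      by (subst nn_integral_eq_integral[symmetric, OF i2]) (auto simp: g0 ennreal_mult ennreal_power)
    also have "\<dots> \<le> ennreal (cmod (of_real (LINT \<xi>|lborel. (cmod (ft F \<xi>))\<^sup>2 * g n \<xi>)))"
      by (intro ennreal_leI) simp
    also have "\<dots> = ennreal (cmod (LINT p|lborel. G p * of_real (K n (snd p - fst p))))"
      unfolding eq ..
    also have "\<dots> \<le> (\<integral>\<^sup>+p. ennreal (cmod (G p * of_real (K n (snd p - fst p)))) \<partial>lborel)"
      \<comment> \<open>If the integrand were not integrable, its integral would be 0 by convention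
        and the bound trivial.\<close>
      by (cases "integrable lborel (\<lambda>p. G p * of_real (K n (snd p - fst p)))")
        (simp_all add: integral_norm_bound_ennreal not_integrable_integral_eq)
    also have "\<dots> = (\<integral>\<^sup>+y. \<integral>\<^sup>+y'. ennreal (cmod (F y) * cmod (F y') * K n (y' - y)) \<partial>lborel \<partial>lborel)"
      by (subst nn_integral_lborel_fst) (auto simp: G_def norm_mult K0 borel_prod[symmetric] simp del: measurable_lborel1)
    also have "\<dots> \<le> (\<integral>\<^sup>+y. \<integral>\<^sup>+y'. ennreal h * ((ennreal (cmod (F y)))\<^sup>2 * ennreal (K n (y' - y)))
        + ennreal h * ((ennreal (cmod (F y')))\<^sup>2 * ennreal (K n (y' - y))) \<partial>lborel \<partial>lborel)"
    proof (intro nn_integral_mono)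
      fix y y'
      have "cmod (F y) * cmod (F y') * K n (y' - y) \<le> (h * (cmod (F y))\<^sup>2 + h * (cmod (F y'))\<^sup>2) * K n (y' - y)"
        using sum_squares_bound[of "cmod (F y)" "cmod (F y')"] by (intro mult_right_mono K0) (simp add: h_def)
      then show "ennreal (cmod (F y) * cmod (F y') * K n (y' - y)) \<le> ennreal h * ((ennreal (cmod (F y)))\<^sup>2 * ennreal (K n (y' - y)))
        + ennreal h * ((ennreal (cmod (F y')))\<^sup>2 * ennreal (K n (y' - y)))"
        by (simp only: sq[OF norm_ge_zero norm_ge_zero K0] ennreal_leI)
    qed
    also have "\<dots> = (\<integral>\<^sup>+y. \<integral>\<^sup>+y'. ennreal h * ((ennreal (cmod (F y)))\<^sup>2 * ennreal (K n (y' - y))) \<partial>lborel \<partial>lborel)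
        + (\<integral>\<^sup>+y. \<integral>\<^sup>+y'. ennreal h * ((ennreal (cmod (F y')))\<^sup>2 * ennreal (K n (y' - y))) \<partial>lborel \<partial>lborel)"
      by (subst nn_integral_add[symmetric]) (auto intro!: nn_integral_cong nn_integral_add)
    also have "(\<integral>\<^sup>+y. \<integral>\<^sup>+y'. ennreal h * ((ennreal (cmod (F y')))\<^sup>2 * ennreal (K n (y' - y))) \<partial>lborel \<partial>lborel)
        = (\<integral>\<^sup>+y'. \<integral>\<^sup>+y. ennreal h * ((ennreal (cmod (F y')))\<^sup>2 * ennreal (K n (y' - y))) \<partial>lborel \<partial>lborel)"
      by (rule lborel_pair.Fubini') measurable
    also have "\<dots> = (\<integral>\<^sup>+y'. ennreal h * (ennreal (cmod (F y')))\<^sup>2 \<partial>lborel)"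
    proof (rule nn_integral_cong)
      fix y' :: 'a
      have "(\<integral>\<^sup>+y. ennreal (K n (y' - y)) \<partial>lborel) = (\<integral>\<^sup>+y. ennreal (K n (- y' + y)) \<partial>lborel)"
        by (simp add: K_def norm_minus_commute)
      also have "\<dots> = 1" using lborel_nn_integral_shift[of "\<lambda>y. ennreal (K n y)" "- y'"] Kint[of n] by simp
      finally show "(\<integral>\<^sup>+y. ennreal h * ((ennreal (cmod (F y')))\<^sup>2 * ennreal (K n (y' - y))) \<partial>lborel) = ennreal h * (ennreal (cmod (F y')))\<^sup>2"
        by (simp add: nn_integral_cmult)
    qed
    also have "(\<integral>\<^sup>+y. \<integral>\<^sup>+y'. ennreal h * ((ennreal (cmod (F y)))\<^sup>2 * ennreal (K n (y' - y))) \<partial>lborel \<partial>lborel)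
      = (\<integral>\<^sup>+y. ennreal h * (ennreal (cmod (F y)))\<^sup>2 \<partial>lborel)"
    proof (rule nn_integral_cong)
      fix y :: 'a
      have "(\<integral>\<^sup>+y'. ennreal (K n (y' - y)) \<partial>lborel) = 1"
        using lborel_nn_integral_shift[of "\<lambda>y. ennreal (K n y)" "- y"] Kint[of n] by simp
      then show "(\<integral>\<^sup>+y'. ennreal h * ((ennreal (cmod (F y)))\<^sup>2 * ennreal (K n (y' - y))) \<partial>lborel) = ennreal h * (ennreal (cmod (F y)))\<^sup>2"
        by (simp add: nn_integral_cmult)
    qed
    also have "(\<integral>\<^sup>+y. ennreal h * (ennreal (cmod (F y)))\<^sup>2 \<partial>lborel) + (\<integral>\<^sup>+y. ennreal h * (ennreal (cmod (F y)))\<^sup>2 \<partial>lborel)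
        = (ennreal h + ennreal h) * ?N"
      by (simp add: nn_integral_cmult distrib_right)
    also have "ennreal h + ennreal h = 1" by (subst ennreal_plus[symmetric]) (auto simp: h_def)
    finally show ?thesis by simp
  qed
  have "(\<integral>\<^sup>+\<xi>. (ennreal (cmod (ft F \<xi>)))\<^sup>2 \<partial>lborel) = (\<integral>\<^sup>+\<xi>. liminf (\<lambda>n. (ennreal (cmod (ft F \<xi>)))\<^sup>2 * ennreal (g n \<xi>)) \<partial>lborel)"
  proof (rule nn_integral_cong)
    fix \<xi>
    have "(\<lambda>n. ennreal ((cmod (ft F \<xi>))\<^sup>2 * g n \<xi>)) \<longlonglongrightarrow> ennreal ((cmod (ft F \<xi>))\<^sup>2 * 1)"
      by (intro tendsto_ennrealI tendsto_intros g1)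
    then show "(ennreal (cmod (ft F \<xi>)))\<^sup>2 = liminf (\<lambda>n. (ennreal (cmod (ft F \<xi>)))\<^sup>2 * ennreal (g n \<xi>))"
      by (intro lim_imp_Liminf[symmetric]) (auto simp: ennreal_power ennreal_mult g0)
  qed
  also have "\<dots> \<le> liminf (\<lambda>n. \<integral>\<^sup>+\<xi>. (ennreal (cmod (ft F \<xi>)))\<^sup>2 * ennreal (g n \<xi>) \<partial>lborel)"
    by (rule nn_integral_liminf) measurable
  also have "\<dots> \<le> limsup (\<lambda>n. \<integral>\<^sup>+\<xi>. (ennreal (cmod (ft F \<xi>)))\<^sup>2 * ennreal (g n \<xi>) \<partial>lborel)"
    by (rule Liminf_le_Limsup) simp
  also have "\<dots> \<le> ?N"
    by (rule Limsup_bounded) (simp add: main)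
  finally show ?thesis .
qed

section \<open>The Gaussian short-time Fourier transform\<close>

lemma power_le_exp: "0 \<le> t \<Longrightarrow> t^n \<le> real n^n * exp t" for t :: real
proof (cases "n = 0")
  case False
  assume t: "0 \<le> t"
  have "(t / real n)^n \<le> (1 + t / real n)^n"
    using t by (intro power_mono) auto
  also have "\<dots> \<le> exp t"
    using t False by (intro exp_ge_one_plus_x_over_n_power_n) auto
  finally have "t^n / real n^n \<le> exp t" by (simp add: power_divide)
  then show ?thesis using False by (simp add: field_simps)
qed simp

lemma real_polynomial_function_growth:
  assumes "real_polynomial_function Q"
  shows "\<exists>C\<ge>0. \<exists>d. \<forall>x. \<bar>Q x\<bar> \<le> C * (1 + (norm x)\<^sup>2)^d"
  using assms
proof (induction rule: real_polynomial_function.induct)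
  case (linear f)
  then obtain K where K: "K > 0" "\<And>x. norm (f x) \<le> norm x * K"
    using bounded_linear.pos_bounded by blast
  have "\<bar>f x\<bar> \<le> K * (1 + (norm x)\<^sup>2)^1" for x
  proof -
    have "norm x \<le> 1 + (norm x)\<^sup>2"
      using sum_squares_bound[of "norm x" 1] norm_ge_zero[of x] by (simp only: power2_eq_square mult_1_right mult_1_left)
    then have "norm x * K \<le> (1 + (norm x)\<^sup>2) * K" using K(1) by (intro mult_right_mono) auto
    then show ?thesis using K(2)[of x] by (simp add: mult.commute)
  qed
  then show ?case using K(1) by (intro exI[of _ K] conjI exI[of _ 1]) auto
next
  case (const c)
  show ?case by (intro exI[of _ "\<bar>c\<bar>"] conjI exI[of _ 0]) auto
next
  case (add f g)
  then obtain C d D e where C: "C \<ge> 0" "\<And>x. \<bar>f x\<bar> \<le> C * (1 + (norm x)\<^sup>2)^d"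
    and D: "D \<ge> 0" "\<And>x. \<bar>g x\<bar> \<le> D * (1 + (norm x)\<^sup>2)^e" by blast
  have "\<bar>f x + g x\<bar> \<le> (C + D) * (1 + (norm x)\<^sup>2)^(d + e)" for x
  proof -
    have "C * (1 + (norm x)\<^sup>2)^d \<le> C * (1 + (norm x)\<^sup>2)^(d + e)" "D * (1 + (norm x)\<^sup>2)^e \<le> D * (1 + (norm x)\<^sup>2)^(d + e)"
      by (intro mult_left_mono power_increasing C D; simp)+
    then show ?thesis using C(2)[of x] D(2)[of x] abs_triangle_ineq[of "f x" "g x"] unfolding distrib_right by linarith
  qed
  then show ?case using C(1) D(1) by (intro exI[of _ "C + D"] conjI exI[of _ "d + e"]) auto
next
  case (mult f g)
  then obtain C d D e where C: "C \<ge> 0" "\<And>x. \<bar>f x\<bar> \<le> C * (1 + (norm x)\<^sup>2)^d"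
    and D: "D \<ge> 0" "\<And>x. \<bar>g x\<bar> \<le> D * (1 + (norm x)\<^sup>2)^e" by blast
  have "\<bar>f x * g x\<bar> \<le> (C * D) * (1 + (norm x)\<^sup>2)^(d + e)" for x
  proof -
    have "\<bar>f x\<bar> * \<bar>g x\<bar> \<le> (C * (1 + (norm x)\<^sup>2)^d) * (D * (1 + (norm x)\<^sup>2)^e)"
      by (intro mult_mono C(2) D(2) mult_nonneg_nonneg C(1)) auto
    then show ?thesis by (simp add: abs_mult power_add mult_ac)
  qed
  then show ?case using C(1) D(1) by (intro exI[of _ "C * D"] conjI exI[of _ "d + e"]) auto
qed

lemma real_polynomial_function_partial:
  fixes e :: "'a::real_normed_vector"
  assumes "real_polynomial_function Q"
  shows "\<exists>Q'. real_polynomial_function Q' \<and> (\<forall>x. ((\<lambda>t. Q (x + t *\<^sub>R e)) has_real_derivative Q' x) (at 0))"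
  using assms
proof (induction rule: real_polynomial_function.induct)
  case (linear f)
  interpret bounded_linear f by fact
  have "((\<lambda>t. f (x + t *\<^sub>R e)) has_real_derivative f e) (at 0)" for x
    unfolding add scaleR by (auto intro!: derivative_eq_intros)
  then show ?case by (intro exI[of _ "\<lambda>_. f e"]) (auto intro: real_polynomial_function.intros)
next
  case (const c)
  show ?case by (intro exI[of _ "\<lambda>_. 0"]) (auto intro: real_polynomial_function.intros)
next
  case (add f g)
  then obtain f' g' where "real_polynomial_function f'" "\<And>x. ((\<lambda>t. f (x + t *\<^sub>R e)) has_real_derivative f' x) (at 0)"
    "real_polynomial_function g'" "\<And>x. ((\<lambda>t. g (x + t *\<^sub>R e)) has_real_derivative g' x) (at 0)" by blast
  then show ?case
    by (intro exI[of _ "\<lambda>x. f' x + g' x"]) (auto intro: real_polynomial_function.intros(3) DERIV_add)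
next
  case (mult f g)
  then obtain f' g' where *: "real_polynomial_function f'" "\<And>x. ((\<lambda>t. f (x + t *\<^sub>R e)) has_real_derivative f' x) (at 0)"
    "real_polynomial_function g'" "\<And>x. ((\<lambda>t. g (x + t *\<^sub>R e)) has_real_derivative g' x) (at 0)" by blast
  have "((\<lambda>t. f (x + t *\<^sub>R e) * g (x + t *\<^sub>R e)) has_real_derivative f' x * g x + g' x * f x) (at 0)" for x
    using DERIV_mult[OF *(2)[of x] *(4)[of x]] by simp
  then show ?case using mult *
    by (intro exI[of _ "\<lambda>x. f' x * g x + g' x * f x"]) (auto intro: real_polynomial_function.intros(3) real_polynomial_function.intros(4))
qed

text \<open>Products Q exp(-P) with P fixed and Q an arbitrary polynomial are closed under
  derivatives, which replace Q by Q' - Q P'. The quadratic lower bound on P beats every polynomial.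
  The exponent is general because, besides Gaussians, the density proof uses exponents of high even
  degree.\<close>

lemma schwartz_polynomial_exp:
  fixes P Q :: "real^'m::finite \<Rightarrow> real"
  assumes Q: "real_polynomial_function Q" and P: "real_polynomial_function P"
    and a: "0 < a" and lower: "\<And>x. a * (norm x)\<^sup>2 - b \<le> P x"
  shows "(\<lambda>x. of_real (Q x * exp (- P x))) \<in> schwartz"
  unfolding schwartz_iff
proof (rule unif_smooth_coinduct[where X="{\<lambda>_ x. of_real (Q x * exp (- P x)) | Q. real_polynomial_function Q}"])
  show "(\<lambda>_ x. of_real (Q x * exp (- P x))) \<in> {\<lambda>_ x. complex_of_real (Q x * exp (- P x)) | Q. real_polynomial_function Q}"
    using Q by blast
next
  fix F :: "unit \<Rightarrow> real^'m \<Rightarrow> complex" and i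
  assume "F \<in> {\<lambda>_ x. of_real (Q x * exp (- P x)) | Q. real_polynomial_function Q}"
  then obtain Q where F: "F = (\<lambda>_ x. of_real (Q x * exp (- P x)))" and Q: "real_polynomial_function Q" by blast
  show "F i differentiable_on UNIV"
    unfolding differentiable_on_def
  proof
    fix x
    obtain Q' P' where Q': "(Q has_derivative Q') (at x)" and P': "(P has_derivative P') (at x)"
      using differentiable_at_real_polynomial_function[OF Q] differentiable_at_real_polynomial_function[OF P]
      by (metis differentiable_def)
    have E: "((\<lambda>x. exp (- P x)) has_derivative (\<lambda>h. exp (- P x) * (- P' h))) (at x)"
      by (rule has_derivative_compose[OF has_derivative_minus[OF P'], of exp "\<lambda>h. exp (- P x) * h"])
         (use DERIV_exp[of "- P x"] in \<open>simp add: has_field_derivative_def\<close>)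
    from has_derivative_of_real[OF has_derivative_mult[OF Q' E]] show "F i differentiable (at x within UNIV)"
      unfolding F by (auto simp: differentiable_def simp del: of_real_mult)
  qed
next
  fix F :: "unit \<Rightarrow> real^'m \<Rightarrow> complex" and k :: nat
  assume "F \<in> {\<lambda>_ x. of_real (Q x * exp (- P x)) | Q. real_polynomial_function Q}"
  then obtain Q where F: "F = (\<lambda>_ x. of_real (Q x * exp (- P x)))" and Q: "real_polynomial_function Q" by blast
  obtain C d where C: "C \<ge> 0" "\<And>x. \<bar>Q x\<bar> \<le> C * (1 + (norm x)\<^sup>2)^d"
    using real_polynomial_function_growth[OF Q] by blast
  let ?n = "k + d"
  have "norm x ^ k * cmod (F i x) \<le> C * (real ?n^?n / a^?n * exp (a + b))" for i x
  proof -
    let ?s = "1 + (norm x)\<^sup>2"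
    have "norm x \<le> ?s"
      using sum_squares_bound[of "norm x" 1] norm_ge_zero[of x] by (simp only: power2_eq_square mult_1_right mult_1_left)
    then have "norm x ^ k \<le> ?s ^ k" by (intro power_mono) auto
    then have "norm x ^ k * (\<bar>Q x\<bar> * exp (- P x)) \<le> ?s ^ k * ((C * ?s^d) * exp (- P x))"
      by (intro mult_mono mult_nonneg_nonneg C) auto
    also have "\<dots> = C * (?s^?n * exp (- P x))" by (simp add: power_add mult_ac)
    also have "\<dots> \<le> C * (real ?n^?n / a^?n * exp (a + b))"
    proof (intro mult_left_mono C)
      have "(a * ?s)^?n \<le> real ?n^?n * exp (a * ?s)"
        using a by (intro power_le_exp) auto
      then have "?s^?n * a^?n \<le> real ?n^?n * exp (a * ?s)"
        unfolding power_mult_distrib by (simp only: mult.commute)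
      then have "?s^?n \<le> (real ?n^?n * exp (a * ?s)) / a^?n"
        using a by (simp only: pos_le_divide_eq zero_less_power)
      then have "?s^?n \<le> real ?n^?n / a^?n * exp (a * ?s)"
        by simp
      then have "?s^?n * exp (- P x) \<le> (real ?n^?n / a^?n * exp (a * ?s)) * exp (- P x)"
        by (intro mult_right_mono) auto
      also have "\<dots> = real ?n^?n / a^?n * exp (a * ?s - P x)"
        by (simp add: exp_diff exp_minus field_simps)
      also have "\<dots> \<le> real ?n^?n / a^?n * exp (a + b)"
        using lower[of x] a by (intro mult_left_mono) (auto simp: algebra_simps)
      finally show "?s^?n * exp (- P x) \<le> real ?n^?n / a^?n * exp (a + b)" .
    qed
    finally show ?thesis by (simp add: F norm_mult abs_mult)
  qed
  then show "\<exists>C. \<forall>i\<in>UNIV. \<forall>x. norm x ^ k * cmod (F i x) \<le> C" by blast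
next
  fix F :: "unit \<Rightarrow> real^'m \<Rightarrow> complex" and j
  assume "F \<in> {\<lambda>_ x. of_real (Q x * exp (- P x)) | Q. real_polynomial_function Q}"
  then obtain Q where F: "F = (\<lambda>_ x. of_real (Q x * exp (- P x)))" and Q: "real_polynomial_function Q" by blast
  obtain Q' P' where Q': "real_polynomial_function Q'" "\<And>x. ((\<lambda>t. Q (x + t *\<^sub>R axis j 1)) has_real_derivative Q' x) (at 0)"
    and P': "real_polynomial_function P'" "\<And>x. ((\<lambda>t. P (x + t *\<^sub>R axis j 1)) has_real_derivative P' x) (at 0)"
    using real_polynomial_function_partial[OF Q] real_polynomial_function_partial[OF P] by meson
  have "partial_deriv j (F i) = (\<lambda>x. of_real ((Q' x - Q x * P' x) * exp (- P x)))" for i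
  proof
    fix x
    have "((\<lambda>t. Q (x + t *\<^sub>R axis j 1) * exp (- P (x + t *\<^sub>R axis j 1))) has_real_derivative
        (Q' x - Q x * P' x) * exp (- P x)) (at 0)"
      by (rule derivative_eq_intros Q' P' refl | simp add: algebra_simps)+
    then have "((\<lambda>t. complex_of_real (Q (x + t *\<^sub>R axis j 1) * exp (- P (x + t *\<^sub>R axis j 1)))) has_vector_derivative
        of_real ((Q' x - Q x * P' x) * exp (- P x))) (at 0)"
      by (intro has_vector_derivative_of_real) (simp add: has_real_derivative_iff_has_vector_derivative)
    then show "partial_deriv j (F i) x = of_real ((Q' x - Q x * P' x) * exp (- P x))"
      unfolding partial_deriv_def F by (rule vector_derivative_at)
  qed
  moreover have "real_polynomial_function (\<lambda>x. Q' x - Q x * P' x)"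
    by (intro real_polynomial_function_diff real_polynomial_function.intros(4) Q Q' P')
  ultimately show "\<exists>G\<in>{\<lambda>_ x. of_real (Q x * exp (- P x)) | Q. real_polynomial_function Q}. \<forall>i\<in>UNIV. partial_deriv j (F i) = G i"
    by (intro bexI[of _ "\<lambda>_ x. of_real ((Q' x - Q x * P' x) * exp (- P x))"] CollectI
        exI[of _ "\<lambda>x. Q' x - Q x * P' x"] conjI refl ballI)
qed

lemma real_polynomial_function_nth: "real_polynomial_function (\<lambda>x::real^'m::finite. x $ j)"
  by (intro real_polynomial_function.intros(1) bounded_linear_vec_nth)

lemma schwartz_gaussian:
  assumes c: "0 < c"
  shows "(\<lambda>x::real^'m::finite. of_real (exp (- c * (norm x)\<^sup>2))) \<in> schwartz"
proof -
  have "real_polynomial_function (\<lambda>x::real^'m. c * (norm x)\<^sup>2)"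
    unfolding norm_square_vec
    by (intro real_polynomial_function.intros(4) real_polynomial_function.intros(2) real_polynomial_function_sum
        real_polynomial_function_power real_polynomial_function_nth) simp
  from schwartz_polynomial_exp[OF real_polynomial_function.intros(2)[of 1] this c, of 0]
  show ?thesis by simp
qed

definition gauss :: "real^'m::finite \<Rightarrow> real" where
  "gauss x = exp (- pi * (norm x)\<^sup>2)"

text \<open>Besides being the square of \<open>gauss\<close>, on phase space this is, up to a
  constant, the Wigner distribution of \<open>gauss\<close>; that makes it the matching window for
  symbols when functions are analysed with \<open>gauss\<close>.\<close>

definition gauss2 :: "real^'m::finite \<Rightarrow> real" where
  "gauss2 x = exp (- (2 * pi) * (norm x)\<^sup>2)"

lemma gauss_measurable [measurable]: "gauss \<in> borel_measurable borel"
  unfolding gauss_def by measurable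

lemma gauss2_measurable [measurable]: "gauss2 \<in> borel_measurable borel"
  unfolding gauss2_def by measurable

lemma gauss_bounds: "0 < gauss x" "gauss x \<le> 1"
  by (simp_all add: gauss_def)

lemma gauss2_bounds: "0 < gauss2 x" "gauss2 x \<le> 1"
  by (simp_all add: gauss2_def)

lemma gauss_square: "(gauss x)\<^sup>2 = gauss2 x"
  by (simp add: gauss_def gauss2_def exp_of_nat_mult[symmetric] power2_eq_square exp_add[symmetric])

lemma gauss2_minus: "gauss2 (x - y) = gauss2 (y - x)"
  by (simp add: gauss2_def norm_minus_commute)

lemma schwartz_gauss2: "(\<lambda>x::real^'m::finite. of_real (gauss2 x)) \<in> schwartz"
  unfolding gauss2_def by (rule schwartz_gaussian) simp

lemma integrable_gauss2: "integrable lborel (gauss2 :: real^'m::finite \<Rightarrow> real)"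
  using integrable_gaussian[of 2, where 'a="real^'m"] by (simp add: gauss2_def[abs_def] mult_ac)

lemma gauss_L2: "(\<lambda>x::real^'m::finite. of_real (gauss x)) \<in> L2"
  by (rule L2I) (simp_all add: gauss_square integrable_gauss2)

lemma L2_shift:
  assumes f: "f \<in> L2"
  shows "(\<lambda>x. f (c + x)) \<in> L2" "L2_norm (\<lambda>x. f (c + x)) = L2_norm f"
proof -
  note [measurable] = L2_measurable[OF f]
  show "(\<lambda>x. f (c + x)) \<in> L2"
    using lborel_shift[OF L2_square_integrable[OF f]] by (intro L2I) auto
  show "L2_norm (\<lambda>x. f (c + x)) = L2_norm f"
    unfolding L2_norm_def using lborel_integral_shift[of "\<lambda>x. (cmod (f x))\<^sup>2" c] by simp
qed

section \<open>The transform of square integrable functions\<close>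

definition stft :: "(real^'m::finite \<Rightarrow> complex) \<Rightarrow> real^('m + 'm) \<Rightarrow> complex" where
  "stft P z = ft (\<lambda>y. P y * of_real (gauss (y - vfst z))) (vsnd z)"

lemma L2_gauss_integrable: "P \<in> L2 \<Longrightarrow> integrable lborel (\<lambda>y. P y * of_real (gauss (y - p)))"
  using L2_mult_integrable[OF _ L2_shift(1)[OF gauss_L2, of "- p"]] by simp

lemma stft_integrable:
  "P \<in> L2 \<Longrightarrow> integrable lborel (\<lambda>y. P y * of_real (gauss (y - p)) * cis (- (2 * pi * (y \<bullet> q))))"
  by (intro integrable_mult_cis L2_gauss_integrable) auto

lemma stft_measurable [measurable]:
  assumes [measurable]: "P \<in> borel_measurable borel"
  shows "stft P \<in> borel_measurable borel"
proof -
  have "(\<lambda>z. LINT y|lborel. P y * of_real (gauss (y - vfst z)) * cis (- (2 * pi * (y \<bullet> vsnd z)))) \<in> borel_measurable borel"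
    by (rule lborel.borel_measurable_lebesgue_integral) measurable
  then show ?thesis unfolding stft_def[abs_def] ft_def .
qed

lemma stft_add: "P \<in> L2 \<Longrightarrow> Q \<in> L2 \<Longrightarrow> stft (\<lambda>y. P y + Q y) z = stft P z + stft Q z"
  unfolding stft_def ft_def using stft_integrable[of P "vfst z" "vsnd z"] stft_integrable[of Q "vfst z" "vsnd z"]
  by (simp add: distrib_right)

lemma stft_cmult: "stft (\<lambda>y. c * P y) z = c * stft P z"
  unfolding stft_def by (simp add: ft_cmult mult.assoc)

lemma stft_cong_AE:
  assumes "P \<in> L2" "Q \<in> L2" "ae_eq P Q"
  shows "stft P = stft Q"
proof
  fix z
  note [measurable] = assms(1,2)[THEN L2_measurable]
  show "stft P z = stft Q z"
    unfolding stft_def ft_def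
  proof (rule integral_cong_AE)
    show "AE y in lborel. P y * of_real (gauss (y - vfst z)) * cis (- (2 * pi * (y \<bullet> vsnd z))) =
        Q y * of_real (gauss (y - vfst z)) * cis (- (2 * pi * (y \<bullet> vsnd z)))"
      using assms(3) unfolding ae_eq_def by eventually_elim simp
  qed simp_all
qed

text \<open>The L2 norm of the window \<open>gauss\<close>, by \<open>gauss_square\<close>. It
  depends on the dimension alone, so its argument is a type.\<close>

definition gconst :: "'m::finite itself \<Rightarrow> real" where
  "gconst _ = sqrt (LINT x::real^'m|lborel. gauss2 x)"

lemma gconst_nonneg [simp]: "0 \<le> gconst t"
  unfolding gconst_def by (simp add: Bochner_Integration.integral_nonneg less_imp_le[OF gauss2_bounds(1)])

lemma gconst_nn: "(\<integral>\<^sup>+x. ennreal (gauss2 (x::real^'m::finite)) \<partial>lborel) = ennreal ((gconst TYPE('m))\<^sup>2)"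
  unfolding gconst_def
  by (subst nn_integral_eq_integral[OF integrable_gauss2])
     (simp_all add: Bochner_Integration.integral_nonneg less_imp_le[OF gauss2_bounds(1)])

text \<open>For a fixed window centre p, \<open>plancherel_le\<close> in the frequency variable
  leaves the integral of |P(y)|^2 \<open>gauss2 (y - p)\<close>; integrating over p afterwards
  yields the square of \<open>gconst\<close>.\<close>

lemma stft_L2:
  fixes P :: "real^'m::finite \<Rightarrow> complex"
  assumes P: "P \<in> L2"
  shows "stft P \<in> L2" "L2_norm (stft P) \<le> gconst TYPE('m) * L2_norm P"
proof -
  note [measurable] = L2_measurable[OF P]
  have "(\<integral>\<^sup>+z. (ennreal (cmod (stft P z)))\<^sup>2 \<partial>lborel) = (\<integral>\<^sup>+p. \<integral>\<^sup>+q. (ennreal (cmod (stft P (vjoin p q))))\<^sup>2 \<partial>lborel \<partial>lborel)"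
    by (subst nn_integral_vjoin, simp, subst nn_integral_lborel_fst) simp_all
  also have "\<dots> \<le> (\<integral>\<^sup>+p. \<integral>\<^sup>+y. (ennreal (cmod (P y)))\<^sup>2 * ennreal (gauss2 (y - p)) \<partial>lborel \<partial>lborel)"
  proof (rule nn_integral_mono)
    fix p :: "real^'m"
    have "(\<integral>\<^sup>+q. (ennreal (cmod (stft P (vjoin p q))))\<^sup>2 \<partial>lborel) \<le> (\<integral>\<^sup>+y. (ennreal (cmod (P y * of_real (gauss (y - p)))))\<^sup>2 \<partial>lborel)"
      using plancherel_le[OF L2_gauss_integrable[OF P]] by (simp add: stft_def)
    also have "\<dots> = (\<integral>\<^sup>+y. (ennreal (cmod (P y)))\<^sup>2 * ennreal (gauss2 (y - p)) \<partial>lborel)"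
      using gauss_bounds(1)[THEN less_imp_le]
      by (simp add: norm_mult ennreal_power ennreal_mult[symmetric] power_mult_distrib gauss_square gauss2_bounds(1)[THEN less_imp_le])
    finally show "(\<integral>\<^sup>+q. (ennreal (cmod (stft P (vjoin p q))))\<^sup>2 \<partial>lborel) \<le> \<dots>" .
  qed
  also have "\<dots> = (\<integral>\<^sup>+y. \<integral>\<^sup>+p. (ennreal (cmod (P y)))\<^sup>2 * ennreal (gauss2 (y - p)) \<partial>lborel \<partial>lborel)"
    by (rule lborel_pair.Fubini') measurable
  also have "\<dots> = (\<integral>\<^sup>+y. (ennreal (cmod (P y)))\<^sup>2 * ennreal ((gconst TYPE('m))\<^sup>2) \<partial>lborel)"
  proof (rule nn_integral_cong)
    fix y :: "real^'m"
    have "(\<integral>\<^sup>+p. ennreal (gauss2 (y - p)) \<partial>lborel) = ennreal ((gconst TYPE('m))\<^sup>2)"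
      using lborel_nn_integral_shift[of "\<lambda>y. ennreal (gauss2 y)" "- y"] gconst_nn
      by (simp add: gauss2_minus[of y])
    then show "(\<integral>\<^sup>+p. (ennreal (cmod (P y)))\<^sup>2 * ennreal (gauss2 (y - p)) \<partial>lborel) = (ennreal (cmod (P y)))\<^sup>2 * ennreal ((gconst TYPE('m))\<^sup>2)"
      by (simp add: nn_integral_cmult)
  qed
  also have "\<dots> = ennreal ((gconst TYPE('m) * L2_norm P)\<^sup>2)"
    by (subst nn_integral_multc) (simp_all add: L2_norm_nn[OF P] ennreal_mult[symmetric] power_mult_distrib mult.commute)
  finally have le: "(\<integral>\<^sup>+z. (ennreal (cmod (stft P z)))\<^sup>2 \<partial>lborel) \<le> ennreal ((gconst TYPE('m) * L2_norm P)\<^sup>2)" .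
  show "stft P \<in> L2" "L2_norm (stft P) \<le> gconst TYPE('m) * L2_norm P"
    by (rule L2_normI[OF _ _ le], simp_all)+
qed

text \<open>The substitution of \<open>vfst z + y\<close> for y moves translation and modulation
  into the window centre and the frequency. The phase left over depends on \<open>w\<close> only
  through the inner product of \<open>vfst z\<close> and \<open>vsnd w\<close>; the rest of it
  cancels in \<open>weyl_kernel\<close>.\<close>

lemma stft_rho:
  fixes P :: "real^'m::finite \<Rightarrow> complex"
  assumes [measurable]: "P \<in> borel_measurable borel"
  shows "stft (rho z \<tau> P) w = cis (2 * pi * \<tau> - pi * (vfst z \<bullet> vsnd z) + 2 * pi * (vfst z \<bullet> (vsnd z - vsnd w))) * stft P (w - z)"
proof -
  let ?F = "\<lambda>y. rho z \<tau> P y * of_real (gauss (y - vfst w)) * cis (- (2 * pi * (y \<bullet> vsnd w)))"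
  have [measurable]: "rho z \<tau> P \<in> borel_measurable borel"
    unfolding rho_def by measurable
  have "stft (rho z \<tau> P) w = (LINT y|lborel. ?F y)"
    by (simp add: stft_def ft_def)
  also have "\<dots> = (LINT y|lborel. ?F (vfst z + y))"
    by (rule lborel_integral_shift[symmetric]) simp
  also have "\<dots> = (LINT y|lborel. cis (2 * pi * \<tau> - pi * (vfst z \<bullet> vsnd z) + 2 * pi * (vfst z \<bullet> (vsnd z - vsnd w))) *
      (P y * of_real (gauss (y - vfst (w - z))) * cis (- (2 * pi * (y \<bullet> vsnd (w - z))))))"
  proof (rule Bochner_Integration.integral_cong[OF refl])
    fix y
    have eq: "cis (2 * pi * \<tau>) * cis (- pi * (vfst z \<bullet> vsnd z)) * cis (2 * pi * (vsnd z \<bullet> (vfst z + y))) * cis (- (2 * pi * ((vfst z + y) \<bullet> vsnd w)))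
        = cis (2 * pi * \<tau> - pi * (vfst z \<bullet> vsnd z) + 2 * pi * (vfst z \<bullet> (vsnd z - vsnd w))) * cis (- (2 * pi * (y \<bullet> vsnd (w - z))))"
      by (simp add: cis_mult inner_simps inner_commute algebra_simps)
    have g: "vfst z + y - vfst w = y - vfst (w - z)" by simp
    have "?F (vfst z + y) = (cis (2 * pi * \<tau>) * cis (- pi * (vfst z \<bullet> vsnd z)) * cis (2 * pi * (vsnd z \<bullet> (vfst z + y))) *
        cis (- (2 * pi * ((vfst z + y) \<bullet> vsnd w)))) * (P y * of_real (gauss (vfst z + y - vfst w)))"
      unfolding rho_def by (simp only: add_diff_cancel_left' mult_ac)
    then show "?F (vfst z + y) = cis (2 * pi * \<tau> - pi * (vfst z \<bullet> vsnd z) + 2 * pi * (vfst z \<bullet> (vsnd z - vsnd w))) *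
      (P y * of_real (gauss (y - vfst (w - z))) * cis (- (2 * pi * (y \<bullet> vsnd (w - z)))))"
      unfolding eq g by (simp only: mult_ac)
  qed
  also have "\<dots> = cis (2 * pi * \<tau> - pi * (vfst z \<bullet> vsnd z) + 2 * pi * (vfst z \<bullet> (vsnd z - vsnd w))) * stft P (w - z)"
    by (simp only: integral_mult_right_zero stft_def ft_def)
  finally show ?thesis .
qed

section \<open>The transform of a symbol, and the Weyl form\<close>

definition symbol_stft :: "(real^'k::finite \<Rightarrow> complex) \<Rightarrow> real^'k \<Rightarrow> real^'k \<Rightarrow> complex" where
  "symbol_stft a W \<Omega> = ft (\<lambda>Z. a Z * of_real (gauss2 (Z - W))) \<Omega>"

text \<open>Recentring the window at the origin leaves \<open>W\<close> only in a phase and in a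
  translate of \<open>a\<close>. As translates of a symbol have common bounds, the decay in the
  frequency is uniform in \<open>W\<close>.\<close>

lemma symbol_stft_shift:
  assumes [measurable]: "a \<in> borel_measurable borel"
  shows "symbol_stft a W \<Omega> = cis (- (2 * pi * (W \<bullet> \<Omega>))) * ft (\<lambda>U. a (W + U) * of_real (gauss2 U)) \<Omega>"
proof -
  have "symbol_stft a W \<Omega> = (LINT U|lborel. a (W + U) * of_real (gauss2 ((W + U) - W)) * cis (- (2 * pi * ((W + U) \<bullet> \<Omega>))))"
    unfolding symbol_stft_def ft_def by (rule lborel_integral_shift[symmetric]) simp
  also have "\<dots> = (LINT U|lborel. cis (- (2 * pi * (W \<bullet> \<Omega>))) * (a (W + U) * of_real (gauss2 U) * cis (- (2 * pi * (U \<bullet> \<Omega>)))))"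
  proof (rule Bochner_Integration.integral_cong[OF refl])
    fix U
    have "cis (- (2 * pi * ((W + U) \<bullet> \<Omega>))) = cis (- (2 * pi * (W \<bullet> \<Omega>))) * cis (- (2 * pi * (U \<bullet> \<Omega>)))"
      by (simp add: cis_mult inner_add_left algebra_simps)
    then show "a (W + U) * of_real (gauss2 ((W + U) - W)) * cis (- (2 * pi * ((W + U) \<bullet> \<Omega>))) =
        cis (- (2 * pi * (W \<bullet> \<Omega>))) * (a (W + U) * of_real (gauss2 U) * cis (- (2 * pi * (U \<bullet> \<Omega>))))"
      by (simp only: add_diff_cancel_left' mult_ac)
  qed
  finally show ?thesis
    by (simp only: integral_mult_right_zero ft_def)
qed

lemma unif_smooth_translate_gauss2:
  assumes "unif_smooth {0} I a"
  shows "unif_smooth UNIV (I \<times> UNIV) (\<lambda>p U. a (fst p) (snd p + U) * of_real (gauss2 U))"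
proof (rule unif_smooth_mult)
  show "unif_smooth {0} (I \<times> UNIV) (\<lambda>p U. a (fst p) (snd p + U))"
    by (rule unif_smooth_affine[where c="\<lambda>_ _. 1" and \<sigma>=id])
       (use unif_smooth_reindex[OF assms, of "I \<times> UNIV" fst] in \<open>auto simp: add.assoc\<close>)
qed (intro unif_smooth_schwartz schwartz_gauss2)

lemma symbol_stft_bound:
  assumes a: "unif_smooth {0} I a"
  shows "\<exists>C\<ge>0. \<forall>i\<in>I. \<forall>W \<Omega>. cmod (symbol_stft (a i) W \<Omega>) \<le> C * (1 / (1 + (norm \<Omega>)\<^sup>2)^N)"
proof -
  obtain C where C: "C \<ge> 0" "\<forall>p\<in>I \<times> UNIV. \<forall>\<xi>. cmod (ft (\<lambda>U. a (fst p) (snd p + U) * of_real (gauss2 U)) \<xi>) \<le> C * (1 / (1 + (norm \<xi>)\<^sup>2)^N)"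
    using unif_smooth_ft_bound[OF unif_smooth_translate_gauss2[OF a]] by blast
  have "cmod (symbol_stft (a i) W \<Omega>) \<le> C * (1 / (1 + (norm \<Omega>)\<^sup>2)^N)" if "i \<in> I" for i W \<Omega>
    using bspec[OF C(2), of "(i, W)"] that
    by (simp add: symbol_stft_shift[OF unif_smooth_measurable[OF a that]] norm_mult)
  then show ?thesis using C(1) by blast
qed

lemma symbol_stft_measurable [measurable]:
  assumes [measurable]: "a \<in> borel_measurable borel" "f \<in> borel_measurable M" "g \<in> borel_measurable M"
  shows "(\<lambda>x. symbol_stft a (f x) (g x)) \<in> borel_measurable M"
proof -
  have "(\<lambda>p. LINT Z|lborel. a Z * of_real (gauss2 (Z - fst p)) * cis (- (2 * pi * (Z \<bullet> snd p)))) \<in> borel_measurable (borel \<Otimes>\<^sub>M borel)"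
    by (rule lborel.borel_measurable_lebesgue_integral) measurable
  then have "(\<lambda>p. symbol_stft a (fst p) (snd p)) \<in> borel_measurable (borel \<Otimes>\<^sub>M borel)"
    by (simp add: symbol_stft_def ft_def)
  from measurable_compose[OF _ this, of "\<lambda>x. (f x, g x)" M] show ?thesis by simp
qed

lemma S000_gauss2_integrable:
  assumes "a \<in> S000"
  shows "integrable lborel (\<lambda>Z. a Z * of_real (gauss2 (Z - W)))"
proof -
  note [measurable] = S000_measurable[OF assms]
  obtain C where C: "\<And>x. cmod (a x) \<le> C"
    using unif_smooth_bound[OF assms[unfolded S000_iff], of 0] by auto
  have C0: "0 \<le> C" using order_trans[OF norm_ge_zero C] by blast
  show ?thesis
  proof (rule Bochner_Integration.integrable_bound)
    show "integrable lborel (\<lambda>Z. C * gauss2 (Z - W))"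
      using lborel_shift[OF integrable_gauss2, of "- W"] by simp
    show "AE Z in lborel. norm (a Z * of_real (gauss2 (Z - W))) \<le> norm (C * gauss2 (Z - W))"
      using gauss2_bounds(1)[THEN less_imp_le] C0
      by (intro AE_I2) (simp add: norm_mult abs_mult mult_right_mono C)
  qed simp
qed

lemma symbol_stft_add:
  "a \<in> S000 \<Longrightarrow> b \<in> S000 \<Longrightarrow> symbol_stft (\<lambda>x. a x + b x) W \<Omega> = symbol_stft a W \<Omega> + symbol_stft b W \<Omega>"
  unfolding symbol_stft_def distrib_right by (intro ft_add S000_gauss2_integrable)

lemma symbol_stft_cmult: "symbol_stft (\<lambda>x. c * a x) W \<Omega> = c * symbol_stft a W \<Omega>"
  unfolding symbol_stft_def by (simp add: ft_cmult mult.assoc)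

text \<open>Half of \<open>symplectic_J\<close> applied to \<open>\<Omega>\<close>: the points
  \<open>W + half_J \<Omega>\<close> and \<open>W - half_J \<Omega>\<close> have midpoint
  \<open>W\<close> and differ by the symplectic rotation of \<open>\<Omega>\<close>.\<close>

definition half_J :: "real^('m::finite + 'm) \<Rightarrow> real^('m + 'm)" where
  "half_J \<Omega> = vjoin ((1/2) *\<^sub>R vsnd \<Omega>) (- (1/2) *\<^sub>R vfst \<Omega>)"

lemma half_J_measurable [measurable]: "half_J \<in> borel_measurable borel"
  unfolding half_J_def by measurable

text \<open>
  The symbol \<open>Z \<mapsto> gauss2 (Z - W) * cis (2 * pi * (\<Omega> \<bullet> Z))\<close> quantizes to a multiple of the rank-one operator
  given by the Gaussians centred at the phase-space points \<open>W \<plusminus> half_J \<Omega>\<close>. Expanding \<open>a\<close> by inversion of its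
  short-time Fourier transform therefore leads to the kernel below.
\<close>

definition weyl_kernel :: "(real^('m::finite + 'm) \<Rightarrow> complex) \<Rightarrow> (real^'m \<Rightarrow> complex) \<Rightarrow> (real^'m \<Rightarrow> complex) \<Rightarrow>
    (real^('m + 'm)) \<times> (real^('m + 'm)) \<Rightarrow> complex" where
  "weyl_kernel a P H = (\<lambda>(\<Omega>, W). symbol_stft a W \<Omega> *
     (cis (2 * pi * (vsnd \<Omega> \<bullet> vsnd W)) * (stft P (W + half_J \<Omega>) * cnj (stft H (W - half_J \<Omega>)))))"

text \<open>Two constants normalise the form: the power of 1 / sqrt 2 is the Gaussian integral over
  \<xi> that produces the rank-one operators, and the integral of the square of
  \<open>gauss2\<close> comes from recovering the symbol by integrating over the window
  centre.\<close>

definition weyl_form :: "(real^('m::finite + 'm) \<Rightarrow> complex) \<Rightarrow> (real^'m \<Rightarrow> complex) \<Rightarrow> (real^'m \<Rightarrow> complex) \<Rightarrow> complex" where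
  "weyl_form a P H = of_real ((1 / sqrt 2)^CARD('m) / (LINT Z::real^('m + 'm)|lborel. (gauss2 Z)\<^sup>2)) *
     integral\<^sup>L lborel (weyl_kernel a P H)"

section \<open>Boundedness and covariance of the Weyl form\<close>

text \<open>A majorant, up to a constant, of every kernel whose symbol ranges over a uniformly
  bounded family. The exponent is the dimension of phase space, which suffices for integrability in
  \<open>\<Omega>\<close>.\<close>

definition weyl_weight :: "(real^'m::finite \<Rightarrow> complex) \<Rightarrow> (real^'m \<Rightarrow> complex) \<Rightarrow> (real^('m + 'm)) \<times> (real^('m + 'm)) \<Rightarrow> real" where
  "weyl_weight P H = (\<lambda>(\<Omega>, W). 1 / (1 + (norm \<Omega>)\<^sup>2)^DIM(real^('m + 'm)) *
     (cmod (stft P (W + half_J \<Omega>)) * cmod (stft H (W - half_J \<Omega>))))"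

lemma weyl_kernel_measurable:
  assumes [measurable]: "a \<in> borel_measurable borel" "P \<in> borel_measurable borel" "H \<in> borel_measurable borel"
  shows "weyl_kernel a P H \<in> borel_measurable borel"
  unfolding weyl_kernel_def borel_prod[symmetric] by measurable

text \<open>For each \<open>\<Omega>\<close> the W-integral is bounded by Cauchy-Schwarz. The shifts
  by \<open>half_J \<Omega>\<close> do not change the norms, so this bound is independent of
  \<open>\<Omega>\<close> and the explicit weight carries the outer integral.\<close>

lemma weyl_weight_integrable:
  fixes P H :: "real^'m::finite \<Rightarrow> complex"
  assumes P: "P \<in> L2" and H: "H \<in> L2"
  shows "integrable lborel (weyl_weight P H)"
    and "integral\<^sup>L lborel (weyl_weight P H) \<le>
      (LINT \<Omega>::real^('m + 'm)|lborel. 1 / (1 + (norm \<Omega>)\<^sup>2)^DIM(real^('m + 'm))) * (gconst TYPE('m) * L2_norm P * (gconst TYPE('m) * L2_norm H))"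
proof -
  note [measurable] = L2_measurable[OF P] L2_measurable[OF H]
  let ?w = "\<lambda>\<Omega>::real^('m + 'm). 1 / (1 + (norm \<Omega>)\<^sup>2)^DIM(real^('m + 'm))"
  let ?N = "gconst TYPE('m) * L2_norm P * (gconst TYPE('m) * L2_norm H)"
  have w0: "0 \<le> ?w \<Omega>" for \<Omega> by simp
  have iw: "integrable lborel ?w" by (rule integrable_japanese_power)
  have sP: "(\<lambda>W. stft P (W + half_J \<Omega>)) \<in> L2" "L2_norm (\<lambda>W. stft P (W + half_J \<Omega>)) \<le> gconst TYPE('m) * L2_norm P" for \<Omega>
    using L2_shift[OF stft_L2(1)[OF P], of "half_J \<Omega>"] stft_L2(2)[OF P] by (simp_all add: add.commute)
  have sH: "(\<lambda>W. stft H (W - half_J \<Omega>)) \<in> L2" "L2_norm (\<lambda>W. stft H (W - half_J \<Omega>)) \<le> gconst TYPE('m) * L2_norm H" for \<Omega>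
    using L2_shift[OF stft_L2(1)[OF H], of "- half_J \<Omega>"] stft_L2(2)[OF H] by simp_all
  have inner: "integrable lborel (\<lambda>W. cmod (stft P (W + half_J \<Omega>)) * cmod (stft H (W - half_J \<Omega>)))" for \<Omega>
    using integrable_norm[OF L2_mult_integrable[OF sP(1) sH(1)]] by (simp add: norm_mult)
  have le: "(LINT W|lborel. cmod (stft P (W + half_J \<Omega>)) * cmod (stft H (W - half_J \<Omega>))) \<le> ?N" for \<Omega>
    using L2_Cauchy_Schwarz[OF sP(1) sH(1)]
    by (rule order_trans) (intro mult_mono sP sH; simp)
  have [measurable]: "weyl_weight P H \<in> borel_measurable borel"
    unfolding weyl_weight_def borel_prod[symmetric] by measurable
  show int: "integrable lborel (weyl_weight P H)"
  proof (rule integrable_lborel_pairI)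
    show "integrable lborel (\<lambda>W. weyl_weight P H (\<Omega>, W))" for \<Omega>
      unfolding weyl_weight_def by (simp only: prod.case) (intro integrable_mult_right inner)
    show "integrable lborel (\<lambda>\<Omega>. LINT W|lborel. norm (weyl_weight P H (\<Omega>, W)))"
    proof (rule Bochner_Integration.integrable_bound)
      show "integrable lborel (\<lambda>\<Omega>. ?w \<Omega> * ?N)"
        using iw by (rule integrable_mult_left)
      have eq: "(LINT W|lborel. norm (weyl_weight P H (\<Omega>, W))) = ?w \<Omega> * (LINT W|lborel. cmod (stft P (W + half_J \<Omega>)) * cmod (stft H (W - half_J \<Omega>)))" for \<Omega>
        unfolding weyl_weight_def prod.case by (simp add: abs_mult)
      show "AE \<Omega> in lborel. norm (LINT W|lborel. norm (weyl_weight P H (\<Omega>, W))) \<le> norm (?w \<Omega> * ?N)"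
      proof (rule AE_I2)
        fix \<Omega>
        have "0 \<le> (LINT W|lborel. cmod (stft P (W + half_J \<Omega>)) * cmod (stft H (W - half_J \<Omega>)))"
          by (intro Bochner_Integration.integral_nonneg) simp
        then have "norm (LINT W|lborel. norm (weyl_weight P H (\<Omega>, W))) = ?w \<Omega> * (LINT W|lborel. cmod (stft P (W + half_J \<Omega>)) * cmod (stft H (W - half_J \<Omega>)))"
          unfolding eq unfolding real_norm_def by (intro abs_of_nonneg mult_nonneg_nonneg w0)
        also have "\<dots> \<le> ?w \<Omega> * ?N"
          by (intro mult_left_mono le w0)
        finally show "norm (LINT W|lborel. norm (weyl_weight P H (\<Omega>, W))) \<le> norm (?w \<Omega> * ?N)"
          unfolding real_norm_def by (rule order_trans[OF _ abs_ge_self])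
      qed
      have "(\<lambda>\<Omega>. LINT W|lborel. norm (weyl_weight P H (\<Omega>, W))) \<in> borel_measurable borel"
        by (rule lborel.borel_measurable_lebesgue_integral) (simp add: weyl_weight_def)
      then show "(\<lambda>\<Omega>. LINT W|lborel. norm (weyl_weight P H (\<Omega>, W))) \<in> borel_measurable lborel" by simp
    qed
  qed simp
  have "integral\<^sup>L lborel (weyl_weight P H) = (LINT \<Omega>|lborel. ?w \<Omega> * (LINT W|lborel. cmod (stft P (W + half_J \<Omega>)) * cmod (stft H (W - half_J \<Omega>))))"
    unfolding integral_lborel_fst[OF int] by (simp only: weyl_weight_def prod.case integral_mult_right_zero)
  also have "\<dots> \<le> (LINT \<Omega>|lborel. ?w \<Omega> * ?N)"
  proof (rule integral_mono')
    show "integrable lborel (\<lambda>\<Omega>. ?w \<Omega> * ?N)"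
      using iw by (rule integrable_mult_left)
  qed (intro mult_left_mono le w0 mult_nonneg_nonneg gconst_nonneg L2_norm_nonneg)+
  finally show "integral\<^sup>L lborel (weyl_weight P H) \<le> (LINT \<Omega>|lborel. ?w \<Omega>) * ?N"
    by (simp only: integral_mult_left_zero)
qed

lemma weyl_kernel_bound:
  fixes a :: "'i \<Rightarrow> real^('m::finite + 'm) \<Rightarrow> complex"
  assumes "unif_smooth {0} I a"
  shows "\<exists>C\<ge>0. \<forall>i\<in>I. \<forall>P H p. cmod (weyl_kernel (a i) P H p) \<le> C * weyl_weight P H p"
proof -
  obtain C where C: "C \<ge> 0" "\<And>i W \<Omega>. i \<in> I \<Longrightarrow> cmod (symbol_stft (a i) W \<Omega>) \<le> C * (1 / (1 + (norm \<Omega>)\<^sup>2)^DIM(real^('m + 'm)))"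
    using symbol_stft_bound[OF assms] by blast
  have "cmod (weyl_kernel (a i) P H (\<Omega>, W)) \<le> C * weyl_weight P H (\<Omega>, W)" if "i \<in> I" for i P H \<Omega> W
  proof -
    have "cmod (weyl_kernel (a i) P H (\<Omega>, W)) = cmod (symbol_stft (a i) W \<Omega>) * (cmod (stft P (W + half_J \<Omega>)) * cmod (stft H (W - half_J \<Omega>)))"
      by (simp add: weyl_kernel_def norm_mult)
    also have "\<dots> \<le> (C * (1 / (1 + (norm \<Omega>)\<^sup>2)^DIM(real^('m + 'm)))) * (cmod (stft P (W + half_J \<Omega>)) * cmod (stft H (W - half_J \<Omega>)))"
      by (intro mult_right_mono C(2) that) simp
    finally show ?thesis by (simp only: weyl_weight_def prod.case mult.assoc)
  qed
  then show ?thesis using C(1) by (intro exI[of _ C]) auto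
qed

lemma weyl_kernel_integrable:
  fixes a :: "real^('m::finite + 'm) \<Rightarrow> complex"
  assumes a: "a \<in> S000" and P: "P \<in> L2" and H: "H \<in> L2"
  shows "integrable lborel (weyl_kernel a P H)"
proof -
  obtain C where C: "C \<ge> 0" "\<And>P H p. cmod (weyl_kernel a P H p) \<le> C * weyl_weight P H p"
    using weyl_kernel_bound[OF unif_smooth_S000[OF a, of "UNIV :: unit set"]] by auto
  show ?thesis
  proof (rule Bochner_Integration.integrable_bound)
    show "integrable lborel (\<lambda>p. C * weyl_weight P H p)"
      by (intro integrable_mult_right weyl_weight_integrable P H)
    show "weyl_kernel a P H \<in> borel_measurable lborel"
      using weyl_kernel_measurable[OF S000_measurable[OF a] L2_measurable[OF P] L2_measurable[OF H]] by simp
    show "AE p in lborel. norm (weyl_kernel a P H p) \<le> norm (C * weyl_weight P H p)"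
      unfolding real_norm_def by (intro AE_I2 order_trans[OF C(2) abs_ge_self])
  qed
qed

lemma weyl_form_bound:
  fixes a :: "real^('m::finite + 'm) \<Rightarrow> complex"
  assumes a: "a \<in> S000"
  shows "\<exists>C\<ge>0. \<forall>P\<in>L2. \<forall>H\<in>L2. cmod (weyl_form a P H) \<le> C * (L2_norm P * L2_norm H)"
proof -
  obtain C where C: "C \<ge> 0" "\<And>P H p. cmod (weyl_kernel a P H p) \<le> C * weyl_weight P H p"
    using weyl_kernel_bound[OF unif_smooth_S000[OF a, of "UNIV :: unit set"]] by auto
  let ?k = "(1 / sqrt 2)^CARD('m) / (LINT Z::real^('m + 'm)|lborel. (gauss2 Z)\<^sup>2)"
  let ?I = "LINT \<Omega>::real^('m + 'm)|lborel. 1 / (1 + (norm \<Omega>)\<^sup>2)^DIM(real^('m + 'm))"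
  let ?g = "gconst TYPE('m)"
  have "cmod (weyl_form a P H) \<le> (\<bar>?k\<bar> * (C * (?I * ?g * ?g))) * (L2_norm P * L2_norm H)" if P: "P \<in> L2" and H: "H \<in> L2" for P H
  proof -
    have "cmod (integral\<^sup>L lborel (weyl_kernel a P H)) \<le> (LINT p|lborel. cmod (weyl_kernel a P H p))"
      by (rule integral_norm_bound)
    also have "\<dots> \<le> (LINT p|lborel. C * weyl_weight P H p)"
      by (intro integral_mono integrable_norm weyl_kernel_integrable a P H integrable_mult_right weyl_weight_integrable C(2))
    also have "\<dots> \<le> C * (?I * (?g * L2_norm P * (?g * L2_norm H)))"
      unfolding integral_mult_right_zero by (intro mult_left_mono weyl_weight_integrable P H C(1))
    finally have "\<bar>?k\<bar> * cmod (integral\<^sup>L lborel (weyl_kernel a P H)) \<le> \<bar>?k\<bar> * (C * (?I * (?g * L2_norm P * (?g * L2_norm H))))"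
      by (intro mult_left_mono) simp_all
    then show ?thesis
      unfolding weyl_form_def norm_mult norm_of_real by (simp only: mult_ac)
  qed
  moreover have "0 \<le> \<bar>?k\<bar> * (C * (?I * ?g * ?g))"
    by (intro mult_nonneg_nonneg C(1) Bochner_Integration.integral_nonneg gconst_nonneg) auto
  ultimately show ?thesis by blast
qed

lemma weyl_form_add_left:
  assumes "a \<in> S000" "P \<in> L2" "Q \<in> L2" "H \<in> L2"
  shows "weyl_form a (\<lambda>x. P x + Q x) H = weyl_form a P H + weyl_form a Q H"
proof -
  have "weyl_kernel a (\<lambda>x. P x + Q x) H = (\<lambda>p. weyl_kernel a P H p + weyl_kernel a Q H p)"
    by (auto simp: fun_eq_iff weyl_kernel_def stft_add assms algebra_simps)
  then show ?thesis
    unfolding weyl_form_def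
    by (simp only: Bochner_Integration.integral_add weyl_kernel_integrable assms distrib_left)
qed

lemma weyl_form_add_right:
  assumes "a \<in> S000" "P \<in> L2" "H \<in> L2" "K \<in> L2"
  shows "weyl_form a P (\<lambda>x. H x + K x) = weyl_form a P H + weyl_form a P K"
proof -
  have "weyl_kernel a P (\<lambda>x. H x + K x) = (\<lambda>p. weyl_kernel a P H p + weyl_kernel a P K p)"
    by (auto simp: fun_eq_iff weyl_kernel_def stft_add assms algebra_simps)
  then show ?thesis
    unfolding weyl_form_def
    by (simp only: Bochner_Integration.integral_add weyl_kernel_integrable assms distrib_left)
qed

lemma weyl_form_cmult_left: "weyl_form a (\<lambda>x. c * P x) H = c * weyl_form a P H"
proof -
  have "weyl_kernel a (\<lambda>x. c * P x) H = (\<lambda>p. c * weyl_kernel a P H p)"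
    by (auto simp: fun_eq_iff weyl_kernel_def stft_cmult)
  then show ?thesis
    unfolding weyl_form_def by (simp only: integral_mult_right_zero mult_ac)
qed

lemma weyl_form_cmult_right: "weyl_form a P (\<lambda>x. c * H x) = cnj c * weyl_form a P H"
proof -
  have "weyl_kernel a P (\<lambda>x. c * H x) = (\<lambda>p. cnj c * weyl_kernel a P H p)"
    by (auto simp: fun_eq_iff weyl_kernel_def stft_cmult)
  then show ?thesis
    unfolding weyl_form_def by (simp only: integral_mult_right_zero mult_ac)
qed

lemma weyl_form_diff_left:
  assumes "a \<in> S000" "P \<in> L2" "Q \<in> L2" "H \<in> L2"
  shows "weyl_form a (\<lambda>x. P x - Q x) H = weyl_form a P H - weyl_form a Q H"
  using weyl_form_add_left[OF assms(1,2) L2_cmult[OF assms(3), of "-1"] assms(4)] weyl_form_cmult_left[of a "-1" Q H]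
  by simp

lemma weyl_form_diff_right:
  assumes "a \<in> S000" "P \<in> L2" "H \<in> L2" "K \<in> L2"
  shows "weyl_form a P (\<lambda>x. H x - K x) = weyl_form a P H - weyl_form a P K"
  using weyl_form_add_right[OF assms(1,2,3) L2_cmult[OF assms(4), of "-1"]] weyl_form_cmult_right[of a P "-1" K]
  by simp

lemma weyl_form_cong_AE:
  assumes "P \<in> L2" "P' \<in> L2" "H \<in> L2" "H' \<in> L2" "ae_eq P P'" "ae_eq H H'"
  shows "weyl_form a P H = weyl_form a P' H'"
  using stft_cong_AE[OF assms(1,2,5)] stft_cong_AE[OF assms(3,4,6)]
  by (simp add: weyl_form_def weyl_kernel_def)

lemma weyl_form_symbol_add:
  assumes "a \<in> S000" "b \<in> S000" "P \<in> L2" "H \<in> L2"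
  shows "weyl_form (\<lambda>x. a x + b x) P H = weyl_form a P H + weyl_form b P H"
proof -
  have "weyl_kernel (\<lambda>x. a x + b x) P H = (\<lambda>p. weyl_kernel a P H p + weyl_kernel b P H p)"
    by (auto simp: fun_eq_iff weyl_kernel_def symbol_stft_add assms algebra_simps)
  then show ?thesis
    unfolding weyl_form_def
    by (simp only: Bochner_Integration.integral_add weyl_kernel_integrable assms distrib_left)
qed

lemma weyl_form_symbol_cmult: "weyl_form (\<lambda>x. c * a x) P H = c * weyl_form a P H"
proof -
  have "weyl_kernel (\<lambda>x. c * a x) P H = (\<lambda>p. c * weyl_kernel a P H p)"
    by (auto simp: fun_eq_iff weyl_kernel_def symbol_stft_cmult)
  then show ?thesis
    unfolding weyl_form_def by (simp only: integral_mult_right_zero mult_ac)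
qed

section \<open>Covariance and differentiation along phase-space translations\<close>

lemma symbol_stft_translate:
  assumes [measurable]: "a \<in> borel_measurable borel"
  shows "symbol_stft (\<lambda>Z. a (Z + z)) (W - z) \<Omega> = cis (2 * pi * (z \<bullet> \<Omega>)) * symbol_stft a W \<Omega>"
proof -
  let ?F = "\<lambda>Z. a (Z + z) * of_real (gauss2 (Z - (W - z))) * cis (- (2 * pi * (Z \<bullet> \<Omega>)))"
  have "symbol_stft (\<lambda>Z. a (Z + z)) (W - z) \<Omega> = (LINT Z|lborel. ?F Z)"
    by (simp add: symbol_stft_def ft_def)
  also have "\<dots> = (LINT Z|lborel. ?F (- z + Z))"
    by (rule lborel_integral_shift[symmetric]) simp
  also have "\<dots> = (LINT Z|lborel. cis (2 * pi * (z \<bullet> \<Omega>)) * (a Z * of_real (gauss2 (Z - W)) * cis (- (2 * pi * (Z \<bullet> \<Omega>)))))"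
  proof (rule Bochner_Integration.integral_cong[OF refl])
    fix Z
    have "cis (- (2 * pi * ((- z + Z) \<bullet> \<Omega>))) = cis (2 * pi * (z \<bullet> \<Omega>)) * cis (- (2 * pi * (Z \<bullet> \<Omega>)))"
      by (simp add: cis_mult inner_simps algebra_simps)
    then show "?F (- z + Z) = cis (2 * pi * (z \<bullet> \<Omega>)) * (a Z * of_real (gauss2 (Z - W)) * cis (- (2 * pi * (Z \<bullet> \<Omega>))))"
      by (simp add: mult_ac)
  qed
  also have "\<dots> = cis (2 * pi * (z \<bullet> \<Omega>)) * symbol_stft a W \<Omega>"
    by (simp only: integral_mult_right_zero symbol_stft_def ft_def)
  finally show ?thesis .
qed

text \<open>The scalar phases of \<open>rho z \<tau>\<close> cancel because \<open>H\<close> enters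
  conjugated. What is left combines with the phase of the kernel at W into the phase of the kernel
  at W - z times \<open>cis (2 * pi * (z \<bullet> \<Omega>))\<close>, and the latter is absorbed by
  \<open>symbol_stft_translate\<close>.\<close>

lemma weyl_kernel_rho:
  fixes P H :: "real^'m::finite \<Rightarrow> complex"
  assumes "a \<in> borel_measurable borel" "P \<in> borel_measurable borel" "H \<in> borel_measurable borel"
  shows "weyl_kernel a (rho z \<tau> P) (rho z \<tau> H) (\<Omega>, W) = weyl_kernel (\<lambda>Z. a (Z + z)) P H (\<Omega>, W - z)"
proof -
  let ?c = "2 * pi * \<tau> - pi * (vfst z \<bullet> vsnd z)"
  let ?A = "symbol_stft a W \<Omega>" and ?B = "stft P (W - z + half_J \<Omega>)" and ?C = "cnj (stft H (W - z - half_J \<Omega>))"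
  have h: "vsnd (W + half_J \<Omega>) = vsnd W - (1/2) *\<^sub>R vfst \<Omega>" "vsnd (W - half_J \<Omega>) = vsnd W + (1/2) *\<^sub>R vfst \<Omega>"
    by (simp_all add: half_J_def)
  have p: "W + half_J \<Omega> - z = W - z + half_J \<Omega>" "W - half_J \<Omega> - z = W - z - half_J \<Omega>"
    by (simp_all add: algebra_simps)
  have "weyl_kernel a (rho z \<tau> P) (rho z \<tau> H) (\<Omega>, W) = ?A * (cis (2 * pi * (vsnd \<Omega> \<bullet> vsnd W)) *
      ((cis (?c + 2 * pi * (vfst z \<bullet> (vsnd z - vsnd (W + half_J \<Omega>)))) * ?B) *
       (cis (- (?c + 2 * pi * (vfst z \<bullet> (vsnd z - vsnd (W - half_J \<Omega>))))) * ?C)))"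
    by (simp only: weyl_kernel_def prod.case stft_rho[OF assms(2)] stft_rho[OF assms(3)] p complex_cnj_mult cis_cnj)
  also have "\<dots> = ?A * ((cis (2 * pi * (vsnd \<Omega> \<bullet> vsnd W)) *
      cis (?c + 2 * pi * (vfst z \<bullet> (vsnd z - vsnd (W + half_J \<Omega>)))) *
      cis (- (?c + 2 * pi * (vfst z \<bullet> (vsnd z - vsnd (W - half_J \<Omega>)))))) * (?B * ?C))"
    by (simp only: mult_ac)
  also have "cis (2 * pi * (vsnd \<Omega> \<bullet> vsnd W)) *
      cis (?c + 2 * pi * (vfst z \<bullet> (vsnd z - vsnd (W + half_J \<Omega>)))) *
      cis (- (?c + 2 * pi * (vfst z \<bullet> (vsnd z - vsnd (W - half_J \<Omega>)))))
      = cis (2 * pi * (z \<bullet> \<Omega>)) * cis (2 * pi * (vsnd \<Omega> \<bullet> vsnd (W - z)))"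
    unfolding h cis_mult by (rule arg_cong[where f=cis])
      (simp add: inner_vsplit[of z \<Omega>] inner_vsplit[of \<Omega> z] inner_simps inner_commute algebra_simps)
  also have "?A * (cis (2 * pi * (z \<bullet> \<Omega>)) * cis (2 * pi * (vsnd \<Omega> \<bullet> vsnd (W - z))) * (?B * ?C))
      = (cis (2 * pi * (z \<bullet> \<Omega>)) * ?A) * (cis (2 * pi * (vsnd \<Omega> \<bullet> vsnd (W - z))) * (?B * ?C))"
    by (simp only: mult_ac)
  also have "\<dots> = weyl_kernel (\<lambda>Z. a (Z + z)) P H (\<Omega>, W - z)"
    by (simp only: weyl_kernel_def prod.case symbol_stft_translate[OF assms(1)])
  finally show ?thesis .
qed

lemma weyl_form_rho:
  fixes P H :: "real^'m::finite \<Rightarrow> complex"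
  assumes [measurable]: "a \<in> borel_measurable borel" "P \<in> borel_measurable borel" "H \<in> borel_measurable borel"
  shows "weyl_form a (rho z \<tau> P) (rho z \<tau> H) = weyl_form (\<lambda>Z. a (Z + z)) P H"
proof -
  have [measurable]: "weyl_kernel (\<lambda>Z. a (Z + z)) P H \<in> borel_measurable borel"
    by (rule weyl_kernel_measurable) measurable
  have "weyl_kernel a (rho z \<tau> P) (rho z \<tau> H) = (\<lambda>p. weyl_kernel (\<lambda>Z. a (Z + z)) P H ((0, - z) + p))"
    by (auto simp: fun_eq_iff weyl_kernel_rho assms)
  then show ?thesis
    unfolding weyl_form_def by (simp only: lborel_integral_shift[OF \<open>weyl_kernel (\<lambda>Z. a (Z + z)) P H \<in> borel_measurable borel\<close>])
qed

text \<open>Uniform symbol bounds make pointwise convergence of the symbols sufficient: they give a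
  majorant first for the integral defining \<open>symbol_stft\<close> and then, through
  \<open>weyl_weight\<close>, for the integral of the kernel.\<close>

lemma weyl_form_continuous:
  fixes A :: "nat \<Rightarrow> real^('m::finite + 'm) \<Rightarrow> complex"
  assumes A: "unif_smooth {0} UNIV A" and a: "a \<in> S000" and lim: "\<And>Z. (\<lambda>n. A n Z) \<longlonglongrightarrow> a Z"
    and P: "P \<in> L2" and H: "H \<in> L2"
  shows "(\<lambda>n. weyl_form (A n) P H) \<longlonglongrightarrow> weyl_form a P H"
proof -
  note mA = unif_smooth_measurable[OF A UNIV_I]
  note [measurable] = mA S000_measurable[OF a] L2_measurable[OF P] L2_measurable[OF H]
  obtain B where B: "\<And>n Z. cmod (A n Z) \<le> B"
    using unif_smooth_bound[OF A, of 0] by auto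
  have B0: "0 \<le> B" using order_trans[OF norm_ge_zero B] by blast
  have sym: "(\<lambda>n. symbol_stft (A n) W \<Omega>) \<longlonglongrightarrow> symbol_stft a W \<Omega>" for W \<Omega>
    unfolding symbol_stft_def ft_def
  proof (rule integral_dominated_convergence[where w="\<lambda>Z. B * gauss2 (Z - W)"])
    show "integrable lborel (\<lambda>Z. B * gauss2 (Z - W))"
      using lborel_shift[OF integrable_gauss2, of "- W"] by simp
    show "AE Z in lborel. (\<lambda>n. A n Z * of_real (gauss2 (Z - W)) * cis (- (2 * pi * (Z \<bullet> \<Omega>)))) \<longlonglongrightarrow>
        a Z * of_real (gauss2 (Z - W)) * cis (- (2 * pi * (Z \<bullet> \<Omega>)))"
      by (intro AE_I2 tendsto_intros lim)
    show "AE Z in lborel. norm (A n Z * of_real (gauss2 (Z - W)) * cis (- (2 * pi * (Z \<bullet> \<Omega>)))) \<le> B * gauss2 (Z - W)" for n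
      by (intro AE_I2) (simp add: norm_mult abs_of_pos[OF gauss2_bounds(1)] mult_right_mono[OF B less_imp_le[OF gauss2_bounds(1)]])
  qed measurable
  obtain C where C: "C \<ge> 0" "\<And>n P H p. cmod (weyl_kernel (A n) P H p) \<le> C * weyl_weight P H p"
    using weyl_kernel_bound[OF A] by auto
  have "(\<lambda>n. integral\<^sup>L lborel (weyl_kernel (A n) P H)) \<longlonglongrightarrow> integral\<^sup>L lborel (weyl_kernel a P H)"
  proof (rule integral_dominated_convergence[where w="\<lambda>p. C * weyl_weight P H p"])
    show "integrable lborel (\<lambda>p. C * weyl_weight P H p)"
      by (intro integrable_mult_right weyl_weight_integrable P H)
    show "weyl_kernel a P H \<in> borel_measurable lborel" "weyl_kernel (A n) P H \<in> borel_measurable lborel" for n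
      using weyl_kernel_measurable[of a P H] weyl_kernel_measurable[of "A n" P H] by simp_all
    show "AE p in lborel. (\<lambda>n. weyl_kernel (A n) P H p) \<longlonglongrightarrow> weyl_kernel a P H p"
      unfolding weyl_kernel_def by (intro AE_I2) (auto split: prod.split intro!: tendsto_mult_right sym)
    show "AE p in lborel. norm (weyl_kernel (A n) P H p) \<le> C * weyl_weight P H p" for n
      by (intro AE_I2 C(2))
  qed
  then show ?thesis
    unfolding weyl_form_def by (intro tendsto_intros)
qed

text \<open>Written through partial derivatives so that membership in \<open>S000\<close> is
  immediate; \<open>dir_deriv_line\<close> identifies it with the derivative along a line.\<close>

definition dir_deriv :: "real^'k::finite \<Rightarrow> (real^'k \<Rightarrow> complex) \<Rightarrow> real^'k \<Rightarrow> complex" where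
  "dir_deriv z a Z = (\<Sum>k\<in>UNIV. of_real (z $ k) * partial_deriv k a Z)"

lemma S000_dir_deriv: "a \<in> S000 \<Longrightarrow> dir_deriv z a \<in> S000"
  unfolding dir_deriv_def[abs_def] by (intro S000_sum S000_mult S000_const S000_partial_deriv) simp

lemma dir_deriv_line:
  assumes "a \<in> S000"
  shows "((\<lambda>t. a (Z + t *\<^sub>R z)) has_vector_derivative dir_deriv z a (Z + t0 *\<^sub>R z)) (at t0)"
proof -
  obtain f' where f': "(a has_derivative f') (at (Z + t0 *\<^sub>R z))"
    using unif_smooth_differentiable[OF assms[unfolded S000_iff]] by (auto simp: differentiable_def)
  interpret f': bounded_linear f' using f' by (rule has_derivative_bounded_linear)
  have z: "z = (\<Sum>k\<in>UNIV. (z $ k) *\<^sub>R axis k 1)"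
    by (simp add: vec_eq_iff axis_def if_distrib cong: if_cong)
  have "f' z = (\<Sum>k\<in>UNIV. (z $ k) *\<^sub>R f' (axis k 1))"
    by (subst z) (simp add: f'.sum f'.scaleR)
  also have "\<dots> = dir_deriv z a (Z + t0 *\<^sub>R z)"
    unfolding dir_deriv_def partial_deriv_eq[OF f'] by (simp add: scaleR_conv_of_real)
  finally show ?thesis
    using has_vector_derivative_line[OF f'] by simp
qed

lemma S000_increment_bound:
  assumes "a \<in> S000" and B: "\<And>Z. cmod (dir_deriv z a Z) \<le> B"
  shows "cmod (a (Z + t *\<^sub>R z) - a Z) \<le> B * \<bar>t\<bar>"
proof -
  have "norm (a (Z + t *\<^sub>R z) - a (Z + 0 *\<^sub>R z)) \<le> B * norm (t - 0)"
  proof (rule differentiable_bound[of UNIV "\<lambda>t. a (Z + t *\<^sub>R z)" "\<lambda>s h. h *\<^sub>R dir_deriv z a (Z + s *\<^sub>R z)"])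
    fix s
    show "((\<lambda>t. a (Z + t *\<^sub>R z)) has_derivative (\<lambda>h. h *\<^sub>R dir_deriv z a (Z + s *\<^sub>R z))) (at s within UNIV)"
      using dir_deriv_line[OF assms(1), of Z z s] by (simp add: has_vector_derivative_def)
    show "onorm (\<lambda>h. h *\<^sub>R dir_deriv z a (Z + s *\<^sub>R z)) \<le> B"
    proof (rule onorm_bound)
      show "0 \<le> B" using order_trans[OF norm_ge_zero B] by blast
      show "norm (h *\<^sub>R dir_deriv z a (Z + s *\<^sub>R z)) \<le> B * norm h" for h
        using mult_left_mono[OF B[of "Z + s *\<^sub>R z"] abs_ge_zero[of h]] by (simp add: mult.commute)
    qed
  qed auto
  then show ?thesis by simp
qed

text \<open>Differentiation commutes with difference quotients, so the quotients of all symbols in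
  \<open>S000\<close> form an invariant set, and the mean value bound
  \<open>S000_increment_bound\<close> does not depend on the step \<open>t n\<close>.\<close>

lemma unif_smooth_difference_quotient:
  assumes a: "a \<in> S000"
  shows "unif_smooth {0} I (\<lambda>n Z. of_real (1 / t n) * (a (Z + t n *\<^sub>R z) - a Z))"
proof (rule unif_smooth_coinduct[where X="{\<lambda>n Z. of_real (1 / t n) * (b (Z + t n *\<^sub>R z) - b Z) | b. b \<in> S000}"])
  fix F j assume "F \<in> {\<lambda>n Z. of_real (1 / t n) * (b (Z + t n *\<^sub>R z) - b Z) | b. b \<in> S000}"
  then obtain b where F: "F = (\<lambda>n Z. of_real (1 / t n) * (b (Z + t n *\<^sub>R z) - b Z))" and b: "b \<in> S000" by blast
  have "partial_deriv j (F n) Z = of_real (1 / t n) * (partial_deriv j b (Z + t n *\<^sub>R z) - partial_deriv j b Z)" for n Z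
  proof -
    have d: "((\<lambda>s. b (W + s *\<^sub>R axis j 1)) has_vector_derivative partial_deriv j b W) (at 0)" for W
      using partial_deriv_line[of b W 0 j] unif_smooth_differentiable[OF b[unfolded S000_iff] UNIV_I] by simp
    have "((\<lambda>s. of_real (1 / t n) * (b ((Z + t n *\<^sub>R z) + s *\<^sub>R axis j 1) - b (Z + s *\<^sub>R axis j 1))) has_vector_derivative
        of_real (1 / t n) * (partial_deriv j b (Z + t n *\<^sub>R z) - partial_deriv j b Z)) (at 0)"
      by (intro has_vector_derivative_mult_right has_vector_derivative_diff d)
    then show ?thesis
      unfolding F by (subst partial_deriv_def, intro vector_derivative_at) (simp add: add_ac)
  qed
  then show "\<exists>G\<in>{\<lambda>n Z. of_real (1 / t n) * (b (Z + t n *\<^sub>R z) - b Z) | b. b \<in> S000}. \<forall>n\<in>I. partial_deriv j (F n) = G n"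
    using S000_partial_deriv[OF b]
    by (intro bexI[of _ "\<lambda>n Z. of_real (1 / t n) * (partial_deriv j b (Z + t n *\<^sub>R z) - partial_deriv j b Z)"]) auto
next
  fix F n assume "F \<in> {\<lambda>n Z. of_real (1 / t n) * (b (Z + t n *\<^sub>R z) - b Z) | b. b \<in> S000}"
  then obtain b where F: "F = (\<lambda>n Z. of_real (1 / t n) * (b (Z + t n *\<^sub>R z) - b Z))" and b: "b \<in> S000" by blast
  have "(\<lambda>Z. b (Z + v)) differentiable (at Z)" for v Z
    using differentiable_chain_at[of "\<lambda>Z. Z + v" Z b] unif_smooth_differentiable[OF b[unfolded S000_iff] UNIV_I]
    by (simp add: o_def)
  from this this[of 0] show "F n differentiable_on UNIV"
    unfolding F differentiable_on_def
    by (intro ballI differentiable_mult differentiable_diff differentiable_const) simp_all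
next
  fix F and k :: nat assume "F \<in> {\<lambda>n Z. of_real (1 / t n) * (b (Z + t n *\<^sub>R z) - b Z) | b. b \<in> S000}" and k: "k \<in> {0}"
  then obtain b where F: "F = (\<lambda>n Z. of_real (1 / t n) * (b (Z + t n *\<^sub>R z) - b Z))" and b: "b \<in> S000" by blast
  obtain B where B: "\<And>Z. cmod (dir_deriv z b Z) \<le> B"
    using unif_smooth_bound[OF S000_dir_deriv[OF b, unfolded S000_iff], of 0] by auto
  have B0: "0 \<le> B" using order_trans[OF norm_ge_zero B] by blast
  have "cmod (F n Z) \<le> B" for n Z
  \<comment> \<open>For a vanishing step, 1 / 0 = 0 makes the quotient zero.\<close>
  proof (cases "t n = 0")
    case False
    have "cmod (F n Z) = cmod (b (Z + t n *\<^sub>R z) - b Z) / \<bar>t n\<bar>"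
      by (simp add: F norm_mult norm_divide)
    also have "\<dots> \<le> B * \<bar>t n\<bar> / \<bar>t n\<bar>"
      by (intro divide_right_mono S000_increment_bound b B) simp
    finally show ?thesis using False by simp
  qed (simp add: F B0)
  then show "\<exists>C. \<forall>i\<in>I. \<forall>x. norm x ^ k * cmod (F i x) \<le> C" using k by auto
qed (use a in blast)

lemma S000_translate:
  assumes "a \<in> S000" shows "(\<lambda>Z. a (Z + z)) \<in> S000"
  unfolding S000_iff
  by (rule unif_smooth_affine[OF assms[unfolded S000_iff], where M="\<lambda>_ Z. Z + z" and c="\<lambda>_ _. 1" and \<sigma>=id]) auto

lemma rho_L2:
  assumes "g \<in> L2" shows "rho z \<tau> g \<in> L2"
proof -
  note [measurable] = L2_measurable[OF assms]
  have "(\<lambda>y. (cis (2 * pi * \<tau>) * cis (- pi * (vfst z \<bullet> vsnd z)) * cis (2 * pi * (vsnd z \<bullet> y))) * g (- vfst z + y)) \<in> L2"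
    by (rule L2_mult_bounded[OF L2_shift(1)[OF assms], of _ 1]) (auto simp: norm_mult)
  then show ?thesis by (simp add: rho_def[abs_def])
qed

text \<open>By \<open>weyl_form_rho\<close> each term of the sequence is the form with a difference
  quotient of \<open>a\<close> as its symbol; these quotients are uniformly bounded symbols and
  converge pointwise, so \<open>weyl_form_continuous\<close> applies.\<close>

lemma weyl_form_rho_derivative:
  fixes a :: "real^('m::finite + 'm) \<Rightarrow> complex"
  assumes a: "a \<in> S000" and P: "P \<in> L2" and H: "H \<in> L2" and t: "\<And>n. t n \<noteq> 0" "t \<longlonglongrightarrow> 0"
  shows "(\<lambda>n. of_real (1 / t n) * (weyl_form a (rho (t n *\<^sub>R z) 0 P) (rho (t n *\<^sub>R z) 0 H) - weyl_form a P H))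
     \<longlonglongrightarrow> weyl_form (dir_deriv z a) P H"
proof -
  have "weyl_form (\<lambda>Z. of_real (1 / t n) * (a (Z + t n *\<^sub>R z) + (-1) * a Z)) P H =
      of_real (1 / t n) * (weyl_form a (rho (t n *\<^sub>R z) 0 P) (rho (t n *\<^sub>R z) 0 H) - weyl_form a P H)" for n
    unfolding weyl_form_symbol_cmult
    by (subst weyl_form_symbol_add[OF S000_translate[OF a] S000_mult[OF S000_const a] P H])
       (simp only: weyl_form_symbol_cmult weyl_form_rho[OF S000_measurable[OF a] L2_measurable[OF P] L2_measurable[OF H]], simp)
  moreover have "(\<lambda>n. weyl_form (\<lambda>Z. of_real (1 / t n) * (a (Z + t n *\<^sub>R z) - a Z)) P H) \<longlonglongrightarrow> weyl_form (dir_deriv z a) P H"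
  proof (rule weyl_form_continuous[OF unif_smooth_difference_quotient[OF a] S000_dir_deriv[OF a] _ P H])
    fix Z
    let ?D = "dir_deriv z a Z"
    have "((\<lambda>s. norm ((a (Z + s *\<^sub>R z) - a (Z + 0 *\<^sub>R z)) - (s - 0) *\<^sub>R ?D) / norm (s - 0)) \<longlongrightarrow> 0) (at 0)"
      using dir_deriv_line[OF a, of Z z 0] unfolding has_vector_derivative_def has_derivative_iff_norm by simp
    moreover have "filterlim t (at 0) sequentially"
      by (rule filterlim_atI[OF t(2)]) (simp add: t(1))
    ultimately have "(\<lambda>n. norm ((a (Z + t n *\<^sub>R z) - a (Z + 0 *\<^sub>R z)) - (t n - 0) *\<^sub>R ?D) / norm (t n - 0)) \<longlonglongrightarrow> 0"
      by (rule filterlim_compose)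
    moreover have "norm ((a (Z + t n *\<^sub>R z) - a (Z + 0 *\<^sub>R z)) - (t n - 0) *\<^sub>R ?D) / norm (t n - 0) =
        norm (of_real (1 / t n) * (a (Z + t n *\<^sub>R z) - a Z) - ?D)" for n
    proof -
      have "of_real (1 / t n) * (a (Z + t n *\<^sub>R z) - a Z) - ?D = of_real (1 / t n) * ((a (Z + t n *\<^sub>R z) - a Z) - t n *\<^sub>R ?D)"
        using t(1)[of n] by (simp add: scaleR_conv_of_real field_simps)
      then show ?thesis
        by (simp add: norm_mult norm_divide)
    qed
    ultimately show "(\<lambda>n. of_real (1 / t n) * (a (Z + t n *\<^sub>R z) - a Z)) \<longlonglongrightarrow> dir_deriv z a Z"
      by (simp only: tendsto_norm_zero_iff Lim_null[of _ ?D])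
  qed
  ultimately show ?thesis by simp
qed

section \<open>The Weyl operator on Schwartz functions\<close>

text \<open>The order of integration matters: the y-integral is, up to a phase, the Fourier
  transform at \<xi> of a Schwartz function and decays rapidly, whereas the double integral may fail
  to converge absolutely.\<close>

definition weyl_fun :: "(real^('m::finite + 'm) \<Rightarrow> complex) \<Rightarrow> (real^'m \<Rightarrow> complex) \<Rightarrow> real^'m \<Rightarrow> complex" where
  "weyl_fun a f x = (LINT \<xi>|lborel. LINT y|lborel. weyl_integrand a f x (vjoin y \<xi>))"

lemma weyl_integrand_vjoin:
  "weyl_integrand a f x (vjoin y \<xi>) = cis (2 * pi * ((x - y) \<bullet> \<xi>)) * a (vjoin ((1/2) *\<^sub>R (x + y)) \<xi>) * f y"
  by (simp add: weyl_integrand_def)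

lemma S000_bounded: "a \<in> S000 \<Longrightarrow> \<exists>B\<ge>0. \<forall>Z. cmod (a Z) \<le> B"
  using unif_smooth_bound[of "{0}" "UNIV :: unit set" "\<lambda>_. a" 0] unfolding S000_iff
  by (auto intro: order_trans[OF norm_ge_zero])

lemma schwartz_integrable: "f \<in> schwartz \<Longrightarrow> integrable lborel f"
  unfolding schwartz_iff by (erule unif_smooth_integrable) simp

lemma schwartz_S000: "f \<in> schwartz \<Longrightarrow> f \<in> S000"
  unfolding schwartz_iff S000_iff by (erule unif_smooth_mono) simp

lemma schwartz_L2: 
  assumes "f \<in> schwartz" shows "f \<in> L2"
proof (rule L2I)
  have "(\<lambda>x. f x * cnj (f x)) \<in> schwartz"
    unfolding schwartz_iff
    by (intro unif_smooth_mult unif_smooth_cnj) (use assms schwartz_S000 in \<open>auto simp: schwartz_iff S000_iff\<close>)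
  moreover have "(cmod (f x))\<^sup>2 = Re (f x * cnj (f x))" for x
    unfolding complex_norm_square[symmetric] by (rule Re_complex_of_real[symmetric])
  ultimately show "integrable lborel (\<lambda>x. (cmod (f x))\<^sup>2)"
    by (simp only: integrable_Re schwartz_integrable)
qed (use schwartz_measurable[OF assms] in simp)

lemma nn_integral_scale:
  fixes f :: "'a::euclidean_space \<Rightarrow> ennreal"
  assumes [measurable]: "f \<in> borel_measurable borel" and c: "c \<noteq> 0"
  shows "integral\<^sup>N lborel f = ennreal (\<bar>c\<bar>^DIM('a)) * (\<integral>\<^sup>+x. f (c *\<^sub>R x) \<partial>lborel)"
  by (subst lborel_affine[OF c, of 0], subst nn_integral_density) (auto simp: nn_integral_distr nn_integral_cmult)

lemma lborel_integrable_scale: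
  fixes f :: "'a::euclidean_space \<Rightarrow> 'b::{banach, second_countable_topology}"
  assumes f: "integrable lborel f" and c: "c \<noteq> 0"
  shows "integrable lborel (\<lambda>x. f (c *\<^sub>R x))"
proof -
  have [measurable]: "f \<in> borel_measurable borel" using borel_measurable_integrable[OF f] by simp
  have "ennreal (\<bar>c\<bar>^DIM('a)) * (\<integral>\<^sup>+x. ennreal (norm (f (c *\<^sub>R x))) \<partial>lborel) < \<infinity>"
    using f nn_integral_scale[of "\<lambda>x. ennreal (norm (f x))", OF _ c] by (simp add: integrable_iff_bounded)
  then have "(\<integral>\<^sup>+x. ennreal (norm (f (c *\<^sub>R x))) \<partial>lborel) < \<infinity>"
    using c by (auto simp: ennreal_mult_less_top ennreal_mult_eq_top_iff less_top)
  then show ?thesis by (simp add: integrable_iff_bounded)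
qed

lemma differentiable_vjoin:
  "f differentiable (at x) \<Longrightarrow> g differentiable (at x) \<Longrightarrow> (\<lambda>y. vjoin (f y) (g y)) differentiable (at x)"
  unfolding differentiable_def by (blast intro: has_derivative_vjoin)

lemma unif_smooth_weyl_symbol:
  fixes a :: "real^('m::finite + 'm) \<Rightarrow> complex"
  assumes "a \<in> S000"
  shows "unif_smooth {0} I (\<lambda>i y. a (vjoin ((1/2) *\<^sub>R (x i + y)) (\<xi> i)))"
proof (rule unif_smooth_affine[OF unif_smooth_S000[OF assms], where c="\<lambda>_ _. 1/2" and \<sigma>=Inl])
  show "(\<lambda>y. vjoin ((1/2) *\<^sub>R (x i + y)) (\<xi> i)) differentiable (at y)" for i y
    by (intro differentiable_vjoin) simp_all
  show "vjoin ((1/2) *\<^sub>R (x i + (y + t *\<^sub>R axis j 1))) (\<xi> i) = vjoin ((1/2) *\<^sub>R (x i + y)) (\<xi> i) + (t * (1/2)) *\<^sub>R axis (Inl j) 1" for i y j t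
    by (auto simp: vec_eq_iff vjoin_def axis_def algebra_simps split: sum.split)
qed auto

section \<open>Removal of cutoffs in the iterated Weyl integral\<close>

context
  fixes a :: "real^('m::finite + 'm) \<Rightarrow> complex" and f :: "real^'m \<Rightarrow> complex"
    and c :: "nat \<Rightarrow> real^'m \<Rightarrow> real^'m \<Rightarrow> real^'m \<Rightarrow> complex" and X :: "(real^'m) set"
  assumes a: "a \<in> S000" and f: "f \<in> schwartz"
    and c: "unif_smooth {0} (UNIV \<times> X \<times> UNIV) (\<lambda>(n, x, \<xi>) y. c n x \<xi> y)"
    and c1: "\<And>x \<xi> y. x \<in> X \<Longrightarrow> (\<lambda>n. c n x \<xi> y) \<longlonglongrightarrow> 1"
    and cm: "\<And>n x. x \<in> X \<Longrightarrow> (\<lambda>(\<xi>, y). c n x \<xi> y) \<in> borel_measurable borel"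
begin

text \<open>The y-integral is a phase times the Fourier transform of Schwartz functions of y with
  bounds uniform in n, x and \<xi>. The cutoff \<open>c\<close> stands for the dilated Schwartz
  functions of the oscillatory integral, for the Gaussian \<open>cutoff\<close> left by damping, and
  for the constant 1.\<close>

lemma weyl_cutoff_bound:
  "\<exists>C\<ge>0. \<forall>n. \<forall>x\<in>X. \<forall>\<xi>. cmod (LINT y|lborel. c n x \<xi> y * weyl_integrand a f x (vjoin y \<xi>)) \<le> C * (1 / (1 + (norm \<xi>)\<^sup>2)^N)"
proof -
  let ?F = "\<lambda>(n, x, \<xi>) y. (c n x \<xi> y * a (vjoin ((1/2) *\<^sub>R (x + y)) \<xi>)) * f y"
  have "unif_smooth UNIV (UNIV \<times> X \<times> UNIV) ?F"
    using unif_smooth_mult[OF unif_smooth_mult[OF c unif_smooth_weyl_symbol[OF a, of _ "fst \<circ> snd" "snd \<circ> snd"]]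
      unif_smooth_schwartz[OF f]]
    by (simp add: case_prod_beta')
  from unif_smooth_ft_bound[OF this] obtain C where C: "C \<ge> 0"
    "\<And>n x \<xi> \<eta>. x \<in> X \<Longrightarrow> cmod (ft (?F (n, x, \<xi>)) \<eta>) \<le> C * (1 / (1 + (norm \<eta>)\<^sup>2)^N)"
    by fastforce
  have "(LINT y|lborel. c n x \<xi> y * weyl_integrand a f x (vjoin y \<xi>)) = cis (2 * pi * (x \<bullet> \<xi>)) * ft (?F (n, x, \<xi>)) \<xi>" for n x \<xi>
    unfolding ft_def integral_mult_right_zero[symmetric]
  proof (rule Bochner_Integration.integral_cong[OF refl])
    fix y
    have "cis (2 * pi * ((x - y) \<bullet> \<xi>)) = cis (2 * pi * (x \<bullet> \<xi>)) * cis (- (2 * pi * (y \<bullet> \<xi>)))"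
      by (simp add: cis_mult inner_simps algebra_simps)
    then show "c n x \<xi> y * weyl_integrand a f x (vjoin y \<xi>) = cis (2 * pi * (x \<bullet> \<xi>)) * (?F (n, x, \<xi>) y * cis (- (2 * pi * (y \<bullet> \<xi>))))"
      by (simp add: weyl_integrand_vjoin mult_ac)
  qed
  then show ?thesis using C by (intro exI[of _ C]) (auto simp: norm_mult)
qed

lemma weyl_integrand_measurable [measurable]:
  "(\<lambda>(\<xi>, y). weyl_integrand a f x (vjoin y \<xi>)) \<in> borel_measurable (borel \<Otimes>\<^sub>M borel)"
  unfolding weyl_integrand_vjoin using S000_measurable[OF a] schwartz_measurable[OF f] by measurable

lemma weyl_cutoff_inner_tendsto:
  assumes x: "x \<in> X"
  shows "(\<lambda>n. LINT y|lborel. c n x \<xi> y * weyl_integrand a f x (vjoin y \<xi>)) \<longlonglongrightarrow> (LINT y|lborel. weyl_integrand a f x (vjoin y \<xi>))"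
proof -
  obtain B where B: "B \<ge> 0" "\<And>Z. cmod (a Z) \<le> B" using S000_bounded[OF a] by blast
  obtain D where D: "\<And>n y. cmod (c n x \<xi> y) \<le> D"
    using unif_smooth_bound[OF c, of 0] x by fastforce
  have D0: "0 \<le> D" using order_trans[OF norm_ge_zero D] by blast
  have [measurable]: "c n x \<xi> \<in> borel_measurable borel" for n
    using unif_smooth_measurable[OF c, of "(n, x, \<xi>)"] x by simp
  have m: "(\<lambda>y. weyl_integrand a f x (vjoin y \<xi>)) \<in> borel_measurable borel"
    unfolding weyl_integrand_vjoin using S000_measurable[OF a] schwartz_measurable[OF f] by measurable
  show ?thesis
  proof (rule integral_dominated_convergence[where w="\<lambda>y. D * B * cmod (f y)"])
    show "AE y in lborel. (\<lambda>n. c n x \<xi> y * weyl_integrand a f x (vjoin y \<xi>)) \<longlonglongrightarrow> weyl_integrand a f x (vjoin y \<xi>)"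
    proof (rule AE_I2)
      fix y
      show "(\<lambda>n. c n x \<xi> y * weyl_integrand a f x (vjoin y \<xi>)) \<longlonglongrightarrow> weyl_integrand a f x (vjoin y \<xi>)"
        using tendsto_mult_right[OF c1[OF x, of \<xi> y], of "weyl_integrand a f x (vjoin y \<xi>)"] by simp
    qed
    show "integrable lborel (\<lambda>y. D * B * cmod (f y))"
      using schwartz_integrable[OF f] by simp
    show "AE y in lborel. norm (c n x \<xi> y * weyl_integrand a f x (vjoin y \<xi>)) \<le> D * B * cmod (f y)" for n
    proof (rule AE_I2)
      fix y
      have "cmod (c n x \<xi> y) * (cmod (a (vjoin ((1/2) *\<^sub>R (x + y)) \<xi>)) * cmod (f y)) \<le> D * (B * cmod (f y))"
        by (intro mult_mono D B mult_nonneg_nonneg D0) auto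
      then show "norm (c n x \<xi> y * weyl_integrand a f x (vjoin y \<xi>)) \<le> D * B * cmod (f y)"
        by (simp add: weyl_integrand_vjoin norm_mult mult_ac)
    qed
  qed (use m in measurable)
qed

lemma weyl_cutoff_tendsto:
  assumes x: "x \<in> X"
  shows "(\<lambda>n. LINT \<xi>|lborel. LINT y|lborel. c n x \<xi> y * weyl_integrand a f x (vjoin y \<xi>)) \<longlonglongrightarrow> weyl_fun a f x"
proof -
  obtain C where C: "C \<ge> 0" "\<And>n x \<xi>. x \<in> X \<Longrightarrow> cmod (LINT y|lborel. c n x \<xi> y * weyl_integrand a f x (vjoin y \<xi>)) \<le> C * (1 / (1 + (norm \<xi>)\<^sup>2)^DIM(real^'m))"
    using weyl_cutoff_bound by blast
  note [measurable] = cm[OF x, unfolded borel_prod[symmetric]]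
  show ?thesis
    unfolding weyl_fun_def
  proof (rule integral_dominated_convergence[where w="\<lambda>\<xi>. C * (1 / (1 + (norm \<xi>)\<^sup>2)^DIM(real^'m))"])
    show "integrable lborel (\<lambda>\<xi>::real^'m. C * (1 / (1 + (norm \<xi>)\<^sup>2)^DIM(real^'m)))"
      by (intro integrable_mult_right integrable_japanese_power)
    have "(\<lambda>\<xi>. LINT y|lborel. weyl_integrand a f x (vjoin y \<xi>)) \<in> borel_measurable borel"
      by (rule lborel.borel_measurable_lebesgue_integral) measurable
    then show "(\<lambda>\<xi>. LINT y|lborel. weyl_integrand a f x (vjoin y \<xi>)) \<in> borel_measurable lborel" by simp
    have "(\<lambda>\<xi>. LINT y|lborel. c n x \<xi> y * weyl_integrand a f x (vjoin y \<xi>)) \<in> borel_measurable borel" for n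
      by (rule lborel.borel_measurable_lebesgue_integral) measurable
    then show "(\<lambda>\<xi>. LINT y|lborel. c n x \<xi> y * weyl_integrand a f x (vjoin y \<xi>)) \<in> borel_measurable lborel" for n by simp
  qed (intro AE_I2 weyl_cutoff_inner_tendsto C(2) x)+
qed

lemma weyl_cutoff_uniform_bound:
  "\<exists>C. \<forall>n. \<forall>x\<in>X. cmod (LINT \<xi>|lborel. LINT y|lborel. c n x \<xi> y * weyl_integrand a f x (vjoin y \<xi>)) \<le> C"
proof -
  obtain C where C: "C \<ge> 0" "\<And>n x \<xi>. x \<in> X \<Longrightarrow> cmod (LINT y|lborel. c n x \<xi> y * weyl_integrand a f x (vjoin y \<xi>)) \<le> C * (1 / (1 + (norm \<xi>)\<^sup>2)^DIM(real^'m))"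
    using weyl_cutoff_bound by blast
  have "cmod (LINT \<xi>|lborel. LINT y|lborel. c n x \<xi> y * weyl_integrand a f x (vjoin y \<xi>)) \<le>
      (LINT \<xi>::real^'m|lborel. C * (1 / (1 + (norm \<xi>)\<^sup>2)^DIM(real^'m)))" if x: "x \<in> X" for n x
  proof (rule order_trans[OF integral_norm_bound], rule integral_mono')
    show "integrable lborel (\<lambda>\<xi>::real^'m. C * (1 / (1 + (norm \<xi>)\<^sup>2)^DIM(real^'m)))"
      by (intro integrable_mult_right integrable_japanese_power)
    show "0 \<le> C * (1 / (1 + (norm \<xi>)\<^sup>2)^DIM(real^'m))" for \<xi> :: "real^'m"
      using C(1) by simp
  qed (intro C(2) x)
  then show ?thesis by blast
qed

end

text \<open>Each regularised integral converges absolutely and so equals an iterated one, from which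
  the cutoff is removed by \<open>weyl_cutoff_tendsto\<close>. The limit at 0 from the right is
  tested along sequences.\<close>

lemma weyl_has_oscillatory_integral:
  fixes a :: "real^('m::finite + 'm) \<Rightarrow> complex"
  assumes a: "a \<in> S000" and f: "f \<in> schwartz"
  shows "has_oscillatory_integral (weyl_integrand a f x) (weyl_fun a f x)"
  unfolding has_oscillatory_integral_def
proof (intro ballI impI conjI allI)
  fix \<phi> :: "real^('m + 'm) \<Rightarrow> complex" and \<epsilon> :: real
  assume \<phi>: "\<phi> \<in> schwartz" "\<phi> 0 = 1"
  note [measurable] = S000_measurable[OF a] schwartz_measurable[OF f] schwartz_measurable[OF \<phi>(1)]
  have mw [measurable]: "weyl_integrand a f x \<in> borel_measurable borel"
    unfolding weyl_integrand_def Let_def by measurable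
  obtain B where B: "B \<ge> 0" "\<And>Z. cmod (a Z) \<le> B" using S000_bounded[OF a] by blast
  obtain D where D: "D \<ge> 0" "\<And>y. cmod (f y) \<le> D" using S000_bounded[OF schwartz_S000[OF f]] by blast
  have int: "integrable lborel (\<lambda>Z. \<phi> (e *\<^sub>R Z) * weyl_integrand a f x Z)" if e: "e > 0" for e
  proof (rule Bochner_Integration.integrable_bound)
    show "integrable lborel (\<lambda>Z. (B * D) * cmod (\<phi> (e *\<^sub>R Z)))"
      using lborel_integrable_scale[OF schwartz_integrable[OF \<phi>(1)], of e] e by simp
    show "AE Z in lborel. norm (\<phi> (e *\<^sub>R Z) * weyl_integrand a f x Z) \<le> norm ((B * D) * cmod (\<phi> (e *\<^sub>R Z)))"
    proof (rule AE_I2)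
      fix Z
      have "cmod (weyl_integrand a f x Z) \<le> B * D"
        unfolding weyl_integrand_def Let_def by (simp add: norm_mult) (intro mult_mono B D; simp)
      from mult_right_mono[OF this, of "cmod (\<phi> (e *\<^sub>R Z))"]
      show "norm (\<phi> (e *\<^sub>R Z) * weyl_integrand a f x Z) \<le> norm ((B * D) * cmod (\<phi> (e *\<^sub>R Z)))"
        using B D by (simp add: norm_mult abs_mult mult_ac)
    qed
  qed measurable
  show "integrable lborel (\<lambda>Z. \<phi> (\<epsilon> *\<^sub>R Z) * weyl_integrand a f x Z)" if "\<epsilon> > 0"
    by (rule int[OF that])
  show "((\<lambda>\<epsilon>. LINT Z|lborel. \<phi> (\<epsilon> *\<^sub>R Z) * weyl_integrand a f x Z) \<longlongrightarrow> weyl_fun a f x) (at_right 0)"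
    unfolding tendsto_at_iff_sequentially
  proof (intro allI impI)
    fix e :: "nat \<Rightarrow> real" assume e: "\<forall>n. e n \<in> {0<..} - {0}" "e \<longlonglongrightarrow> 0"
    \<comment> \<open>Dilations by at most 1 meet the slope condition of
      \<open>unif_smooth_affine\<close>; eventually \<open>d n = e n\<close>.\<close>
    define d where "d n = min (e n) 1" for n
    have d: "0 < d n" "d n \<le> 1" for n using e(1) by (auto simp: d_def)
    have ed: "\<forall>\<^sub>F n in sequentially. d n = e n"
      using order_tendstoD(2)[OF e(2), of 1] by (auto simp: d_def elim: eventually_mono)
    have d0: "d \<longlonglongrightarrow> 0" using e(2) tendsto_cong[OF ed] by simp
    have M: "(\<lambda>y. r *\<^sub>R vjoin y \<xi>) differentiable (at y)" for r \<xi> and y :: "real^'m"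
      unfolding vjoin_scaleR by (intro differentiable_vjoin) simp_all
    have us: "unif_smooth {0} (UNIV \<times> {x} \<times> UNIV) (\<lambda>(n, x, \<xi>) y. \<phi> (d n *\<^sub>R vjoin y \<xi>))"
    proof -
      have "unif_smooth {0} (UNIV \<times> {x} \<times> UNIV) (\<lambda>i y. \<phi> (d (fst i) *\<^sub>R vjoin y (snd (snd i))))"
        by (rule unif_smooth_affine[OF unif_smooth_S000[OF schwartz_S000[OF \<phi>(1)]], where c="\<lambda>i _. d (fst i)" and \<sigma>=Inl])
           (use d M in \<open>auto simp: vec_eq_iff vjoin_def axis_def algebra_simps less_imp_le split: sum.split\<close>)
      then show ?thesis by (simp add: case_prod_beta')
    qed
    have "(\<lambda>n. LINT \<xi>|lborel. LINT y|lborel. \<phi> (d n *\<^sub>R vjoin y \<xi>) * weyl_integrand a f x (vjoin y \<xi>)) \<longlonglongrightarrow> weyl_fun a f x"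
    proof (rule weyl_cutoff_tendsto[OF a f us])
      fix \<xi> y :: "real^'m"
      have "(\<lambda>n. d n *\<^sub>R vjoin y \<xi>) \<longlonglongrightarrow> 0 *\<^sub>R vjoin y \<xi>" by (intro tendsto_intros d0)
      then show "(\<lambda>n. \<phi> (d n *\<^sub>R vjoin y \<xi>)) \<longlonglongrightarrow> 1"
        using continuous_on_tendsto_compose[OF unif_smooth_continuous[OF \<phi>(1)[unfolded schwartz_iff], of "()" UNIV], of "\<lambda>n. d n *\<^sub>R vjoin y \<xi>" 0] \<phi>(2) by simp
    next
      show "(\<lambda>(\<xi>, y). \<phi> (d n *\<^sub>R vjoin y \<xi>)) \<in> borel_measurable borel" for n
        unfolding borel_prod[symmetric] by measurable
    qed auto
    moreover have "(LINT Z|lborel. \<phi> (d n *\<^sub>R Z) * weyl_integrand a f x Z) =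
        (LINT \<xi>|lborel. LINT y|lborel. \<phi> (d n *\<^sub>R vjoin y \<xi>) * weyl_integrand a f x (vjoin y \<xi>))" for n
    proof -
      have m: "(\<lambda>Z. \<phi> (d n *\<^sub>R Z) * weyl_integrand a f x Z) \<in> borel_measurable borel" by measurable
      show ?thesis
        using int[OF d(1)[of n]] unfolding integrable_vjoin[OF m] integral_vjoin[OF m]
        by (subst integral_lborel_snd) simp_all
    qed
    ultimately have "(\<lambda>n. LINT Z|lborel. \<phi> (d n *\<^sub>R Z) * weyl_integrand a f x Z) \<longlonglongrightarrow> weyl_fun a f x" by simp
    then show "((\<lambda>\<epsilon>. LINT Z|lborel. \<phi> (\<epsilon> *\<^sub>R Z) * weyl_integrand a f x Z) \<circ> e) \<longlonglongrightarrow> weyl_fun a f x"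
      by (rule Lim_transform_eventually) (use ed in \<open>auto elim: eventually_mono\<close>)
  qed
qed

lemma weyl_fun_measurable [measurable]:
  assumes [measurable]: "a \<in> borel_measurable borel" "f \<in> borel_measurable borel"
  shows "weyl_fun a f \<in> borel_measurable borel"
proof -
  have "(\<lambda>p. LINT y|lborel. weyl_integrand a f (fst p) (vjoin y (snd p))) \<in> borel_measurable (borel \<Otimes>\<^sub>M borel)"
    unfolding weyl_integrand_vjoin by (rule lborel.borel_measurable_lebesgue_integral) measurable
  then have [measurable]: "(\<lambda>(x, \<xi>). LINT y|lborel. weyl_integrand a f x (vjoin y \<xi>)) \<in> borel_measurable (borel \<Otimes>\<^sub>M borel)"
    by (simp add: case_prod_beta')
  show ?thesis
    unfolding weyl_fun_def[abs_def] by (rule lborel.borel_measurable_lebesgue_integral) measurable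
qed

section \<open>The Weyl form represents the Weyl operator\<close>

lemma gauss2_cis_integral:
  fixes v w :: "real^'m::finite"
  shows "integrable lborel (\<lambda>\<xi>. of_real (gauss2 (\<xi> - w)) * cis (2 * pi * (\<xi> \<bullet> v)))"
    and "(LINT \<xi>|lborel. of_real (gauss2 (\<xi> - w)) * cis (2 * pi * (\<xi> \<bullet> v)))
      = cis (2 * pi * (w \<bullet> v)) * of_real ((1 / sqrt 2)^CARD('m) * exp (- pi * (norm v)\<^sup>2 / 2))"
proof -
  let ?F = "\<lambda>\<xi>. of_real (gauss2 (\<xi> - w)) * cis (2 * pi * (\<xi> \<bullet> v))"
  let ?G = "\<lambda>\<xi>. complex_of_real (gauss2 \<xi>) * cis (2 * pi * (\<xi> \<bullet> v))"
  have G: "integrable lborel ?G" "integral\<^sup>L lborel ?G = of_real ((1 / sqrt 2)^CARD('m) * exp (- pi * (norm v)\<^sup>2 / 2))"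
    using integrable_gaussian_cis[of 2 v] integral_gaussian_cis[of 2 v] by (simp_all add: gauss2_def mult_ac)
  have eq: "?F (w + \<xi>) = cis (2 * pi * (w \<bullet> v)) * ?G \<xi>" for \<xi>
  proof -
    have "cis (2 * pi * ((w + \<xi>) \<bullet> v)) = cis (2 * pi * (w \<bullet> v)) * cis (2 * pi * (\<xi> \<bullet> v))"
      by (simp add: cis_mult inner_simps algebra_simps)
    then show ?thesis by (simp only: add_diff_cancel_left' mult_ac)
  qed
  have eq': "?F \<xi> = cis (2 * pi * (w \<bullet> v)) * ?G (- w + \<xi>)" for \<xi>
    using eq[of "- w + \<xi>"] by simp
  show "integrable lborel ?F"
    unfolding eq' by (intro integrable_mult_right lborel_shift[OF G(1)])
  have m: "?G \<in> borel_measurable borel" by measurable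
  have "integral\<^sup>L lborel ?F = cis (2 * pi * (w \<bullet> v)) * integral\<^sup>L lborel ?G"
    unfolding eq' integral_mult_right_zero by (simp only: lborel_integral_shift[OF m])
  then show "integral\<^sup>L lborel ?F = cis (2 * pi * (w \<bullet> v)) * of_real ((1 / sqrt 2)^CARD('m) * exp (- pi * (norm v)\<^sup>2 / 2))"
    unfolding G(2) .
qed

text \<open>The parallelogram law |p - q|^2 + |p + q|^2 = 2 |p|^2 + 2 |q|^2. A Gaussian in the
  difference of x and y times one in their midpoint separates into a function of x and a function of
  y, which is why the quantized Gaussian symbol has rank one.\<close>

lemma gauss_split:
  fixes x y :: "real^'m::finite"
  shows "exp (- pi * (norm (x - y + b))\<^sup>2 / 2) * gauss2 ((1/2) *\<^sub>R (x + y) - w)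
    = gauss (y - (w + (1/2) *\<^sub>R b)) * gauss (x - (w - (1/2) *\<^sub>R b))"
proof -
  define p where "p = x - (w - (1/2) *\<^sub>R b)"
  define q where "q = y - (w + (1/2) *\<^sub>R b)"
  have 1: "x - y + b = p - q" by (simp add: p_def q_def algebra_simps scaleR_add_left[symmetric])
  have "(1/2) *\<^sub>R (x + y) - w = (1/2) *\<^sub>R (p + q)"
  proof -
    have "w = (1/2) *\<^sub>R w + (1/2) *\<^sub>R w" by (simp add: scaleR_add_left[symmetric])
    then show ?thesis by (simp add: p_def q_def algebra_simps)
  qed
  then have 2: "(norm ((1/2) *\<^sub>R (x + y) - w))\<^sup>2 = (norm (p + q))\<^sup>2 / 4" by (simp add: power_divide)
  have "(norm (p - q))\<^sup>2 + (norm (p + q))\<^sup>2 = 2 * (norm p)\<^sup>2 + 2 * (norm q)\<^sup>2"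
    by (simp add: power2_norm_eq_inner inner_simps inner_commute)
  then have 3: "(norm (p - q))\<^sup>2 / 2 + (norm (p + q))\<^sup>2 / 2 = (norm p)\<^sup>2 + (norm q)\<^sup>2" by simp
  have "- pi * (norm (p - q))\<^sup>2 / 2 + - (2 * pi) * ((norm (p + q))\<^sup>2 / 4)
      = - pi * ((norm (p - q))\<^sup>2 / 2 + (norm (p + q))\<^sup>2 / 2)"
    by (simp add: algebra_simps)
  also have "\<dots> = - pi * (norm q)\<^sup>2 + - pi * (norm p)\<^sup>2"
    unfolding 3 by (simp add: algebra_simps)
  finally show ?thesis
    unfolding gauss_def gauss2_def exp_add[symmetric] 1 2 p_def[symmetric] q_def[symmetric] by simp
qed

lemma gauss2_vsplit: "gauss2 Z = gauss2 (vfst Z) * gauss2 (vsnd Z)"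
  by (simp add: gauss2_def norm_vsplit exp_add[symmetric] algebra_simps)

lemma gauss2_vjoin: "gauss2 (vjoin u v - W) = gauss2 (u - vfst W) * gauss2 (v - vsnd W)"
  by (simp add: gauss2_vsplit)

text \<open>
  \<open>cutoff n Z\<close> is the normalised integral of \<open>damp n W * (gauss2 (Z - W))\<^sup>2\<close> over \<open>W\<close>; with
  \<open>\<epsilon> = 1 / Suc n\<close> completing the square gives the rate \<open>4\<epsilon> / (4 + \<epsilon>)\<close>.
\<close>

definition damp :: "nat \<Rightarrow> real^'k::finite \<Rightarrow> real" where
  "damp n W = exp (- pi * (1 / real (Suc n)) * (norm W)\<^sup>2)"

definition damp_rate :: "nat \<Rightarrow> real" where
  "damp_rate n = (4 * (1 / real (Suc n))) / (4 + 1 / real (Suc n))"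

definition cutoff :: "nat \<Rightarrow> real^'k::finite \<Rightarrow> real" where
  "cutoff n Z = (2 / sqrt (4 + 1 / real (Suc n)))^CARD('k) * exp (- pi * damp_rate n * (norm Z)\<^sup>2)"

lemma damp_bounds: "0 < damp n W" "damp n W \<le> 1"
  by (simp_all add: damp_def)

lemma damp_measurable [measurable]: "damp n \<in> borel_measurable borel"
  unfolding damp_def by measurable

lemma damp_integrable: "integrable lborel (damp n :: real^'k::finite \<Rightarrow> real)"
  unfolding damp_def by (rule integrable_gaussian) simp

text \<open>The upper bound keeps the slopes sqrt(\<open>damp_rate n\<close>) / 2 in
  \<open>unif_smooth_cutoff\<close> below 1.\<close>

lemma damp_rate_bounds: "0 < damp_rate n" "damp_rate n \<le> 1"
proof -
  define d where "d = 1 / real (Suc n)"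
  have "0 < d" "d \<le> 1" by (simp_all add: d_def)
  then show "0 < damp_rate n" "damp_rate n \<le> 1"
    unfolding damp_rate_def d_def[symmetric] by (simp_all add: divide_le_eq)
qed

lemma damp_rate_tendsto: "damp_rate \<longlonglongrightarrow> 0"
proof -
  have "(\<lambda>n. (4 * (1 / real (Suc n))) / (4 + 1 / real (Suc n))) \<longlonglongrightarrow> (4 * 0) / (4 + 0)"
    using LIMSEQ_inverse_real_of_nat by (intro tendsto_intros) (simp_all add: inverse_eq_divide)
  then show ?thesis by (simp add: damp_rate_def[abs_def])
qed

lemma integral_gauss2_square: "(LINT Z::real^'k::finite|lborel. (gauss2 Z)\<^sup>2) = (1 / 2)^CARD('k)"
proof -
  have "(gauss2 Z)\<^sup>2 = exp (- pi * 4 * (norm Z)\<^sup>2)" for Z :: "real^'k"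
    by (simp add: gauss2_def power2_eq_square exp_add[symmetric])
  then show ?thesis
    using integral_gaussian[of 4, where 'a="real^'k"] by simp
qed

lemma damp_integral:
  fixes Z :: "real^'k::finite"
  shows "(LINT W|lborel. damp n W * (gauss2 (Z - W))\<^sup>2) = (1/2)^CARD('k) * cutoff n Z"
proof -
  define d where "d = 1 / real (Suc n)"
  have d: "0 < d" by (simp add: d_def)
  \<comment> \<open>\<open>u\<close> is the minimiser in W of d |W|^2 + 4 |Z - W|^2, the exponent up
    to the factor -pi.\<close>
  define u where "u = (4 / (4 + d)) *\<^sub>R Z"
  have eq: "damp n W * (gauss2 (Z - W))\<^sup>2 = exp (- pi * damp_rate n * (norm Z)\<^sup>2) * exp (- pi * (4 + d) * (norm (- u + W))\<^sup>2)" for W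
  proof -
    have "d * (norm W)\<^sup>2 + 4 * (norm (Z - W))\<^sup>2 = damp_rate n * (norm Z)\<^sup>2 + (4 + d) * (norm (- u + W))\<^sup>2"
    proof -
      have "(4 + d) * (norm (- u + W))\<^sup>2 = (4 + d) * ((4 / (4 + d))\<^sup>2 * (Z \<bullet> Z) - 2 * (4 / (4 + d)) * (Z \<bullet> W) + W \<bullet> W)"
        unfolding power2_norm_eq_inner u_def
        by (simp add: inner_simps inner_commute power2_eq_square algebra_simps)
      also have "\<dots> = 16 / (4 + d) * (Z \<bullet> Z) - 8 * (Z \<bullet> W) + (4 + d) * (W \<bullet> W)"
      proof -
        have "e * ((4 / e)\<^sup>2 * p - 2 * (4 / e) * q + s) = 16 / e * p - 8 * q + e * s" if "e \<noteq> 0" for e p q s :: real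
          using that by (simp add: field_simps power2_eq_square)
        then show ?thesis using d by simp
      qed
      finally have 1: "(4 + d) * (norm (- u + W))\<^sup>2 = \<dots>" .
      have "damp_rate n = 4 - 16 / (4 + d)"
        using d unfolding damp_rate_def d_def[symmetric] by (simp add: field_simps)
      then have 2: "damp_rate n * (norm Z)\<^sup>2 = 4 * (norm Z)\<^sup>2 - 16 / (4 + d) * (norm Z)\<^sup>2"
        by (simp add: left_diff_distrib)
      show ?thesis
        unfolding 1 2 unfolding power2_norm_eq_inner by (simp add: inner_simps inner_commute algebra_simps)
    qed
    moreover have "damp n W * (gauss2 (Z - W))\<^sup>2 = exp (- pi * (d * (norm W)\<^sup>2 + 4 * (norm (Z - W))\<^sup>2))"
      by (simp add: damp_def gauss2_def d_def power2_eq_square exp_add[symmetric] algebra_simps)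
    ultimately show ?thesis
      by (simp add: exp_add[symmetric] algebra_simps)
  qed
  have m: "(\<lambda>W::real^'k. exp (- pi * (4 + d) * (norm W)\<^sup>2)) \<in> borel_measurable borel" by measurable
  have "(LINT W|lborel. damp n W * (gauss2 (Z - W))\<^sup>2) = exp (- pi * damp_rate n * (norm Z)\<^sup>2) * (1 / sqrt (4 + d))^CARD('k)"
    unfolding eq integral_mult_right_zero lborel_integral_shift[OF m, of "- u"]
    using integral_gaussian[of "4 + d", where 'a="real^'k"] d by simp
  also have "\<dots> = (1/2)^CARD('k) * cutoff n Z"
    unfolding cutoff_def d_def[symmetric] by (simp add: power_divide)
  finally show ?thesis .
qed

lemma cutoff_bounds: "0 < cutoff n Z" "cutoff n Z \<le> exp (- pi * damp_rate n * (norm Z)\<^sup>2)"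
proof -
  define s where "s = sqrt (4 + 1 / real (Suc n))"
  have "sqrt (2^2) \<le> s" unfolding s_def by (intro real_sqrt_le_mono) simp
  then have s: "2 \<le> s" by simp
  then have "(2 / s)^k \<le> 1" for k by (intro power_le_one) auto
  then show "0 < cutoff n Z" "cutoff n Z \<le> exp (- pi * damp_rate n * (norm Z)\<^sup>2)"
    using s unfolding cutoff_def s_def[symmetric] by (auto simp: mult_left_le_one_le)
qed

lemma cutoff_le_1: "cutoff n Z \<le> 1"
  by (rule order_trans[OF cutoff_bounds(2)])
     (simp add: mult_nonneg_nonneg less_imp_le[OF damp_rate_bounds(1)])

lemma cutoff_measurable [measurable]: "cutoff n \<in> borel_measurable borel"
  unfolding cutoff_def by measurable

lemma cutoff_tendsto: "(\<lambda>n. cutoff n Z) \<longlonglongrightarrow> 1"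
proof -
  have "(\<lambda>n. (2 / sqrt (4 + 1 / real (Suc n)))^CARD('k) * exp (- pi * damp_rate n * (norm Z)\<^sup>2))
      \<longlonglongrightarrow> (2 / sqrt (4 + 0))^CARD('k) * exp (- pi * 0 * (norm Z)\<^sup>2)" for Z :: "real^'k"
    using LIMSEQ_inverse_real_of_nat by (intro tendsto_intros damp_rate_tendsto) (simp_all add: inverse_eq_divide)
  then show ?thesis by (simp add: cutoff_def)
qed

text \<open>Each cutoff is a constant times a dilate of one fixed Gaussian with dilation factor
  sqrt(\<open>damp_rate n\<close>), and the midpoint contributes a further slope 1/2.\<close>

lemma unif_smooth_cutoff:
  "unif_smooth {0} (UNIV \<times> X \<times> UNIV) (\<lambda>(n, x, \<xi>) y. complex_of_real (cutoff n (vjoin ((1/2) *\<^sub>R (x + y)) \<xi>)))"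
  for X :: "(real^'m::finite) set"
proof -
  let ?\<phi> = "\<lambda>Z::real^('m + 'm). complex_of_real (exp (- pi * (norm Z)\<^sup>2))"
  have \<phi>: "?\<phi> \<in> S000" by (intro schwartz_S000 schwartz_gaussian) simp
  let ?r = "\<lambda>n. (2 / sqrt (4 + 1 / real (Suc n)))^CARD('m + 'm)"
  let ?M = "\<lambda>i y. sqrt (damp_rate (fst i)) *\<^sub>R vjoin ((1/2) *\<^sub>R (fst (snd i) + y)) (snd (snd i))"
  have "unif_smooth {0} (UNIV \<times> X \<times> UNIV) (\<lambda>i y. ?\<phi> (?M i y))"
  proof (rule unif_smooth_affine[OF unif_smooth_S000[OF \<phi>], where c="\<lambda>i _. sqrt (damp_rate (fst i)) / 2" and \<sigma>=Inl])
    show "?M i differentiable (at y)" for i y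
      unfolding vjoin_scaleR by (intro differentiable_vjoin) simp_all
    show "?M i (y + t *\<^sub>R axis j 1) = ?M i y + (t * (sqrt (damp_rate (fst i)) / 2)) *\<^sub>R axis (Inl j) 1" for i y j t
      by (auto simp: vec_eq_iff vjoin_def axis_def algebra_simps split: sum.split)
    have "sqrt (damp_rate n) \<le> 1" "0 \<le> sqrt (damp_rate n)" for n
      using damp_rate_bounds[of n] by simp_all
    then show "\<bar>sqrt (damp_rate (fst i)) / 2\<bar> \<le> 1" for i :: "nat \<times> (real^'m) \<times> (real^'m)"
      by (simp add: order_trans[of _ 1])
  qed
  moreover have "unif_smooth {0} (UNIV \<times> X \<times> UNIV) (\<lambda>(i :: nat \<times> (real^'m) \<times> (real^'m)) (y::real^'m). complex_of_real (?r (fst i)))"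
  proof (rule unif_smooth_const[where C=1])
    fix i :: "nat \<times> (real^'m) \<times> (real^'m)"
    \<comment> \<open>The constant in front is the value of the cutoff at the origin.\<close>
    have "0 < cutoff (fst i) (0 :: real^('m + 'm))" "cutoff (fst i) (0 :: real^('m + 'm)) \<le> 1"
      by (rule cutoff_bounds cutoff_le_1)+
    then show "cmod (complex_of_real (?r (fst i))) \<le> 1"
      unfolding norm_of_real by (simp add: cutoff_def)
  qed
  ultimately have "unif_smooth {0} (UNIV \<times> X \<times> UNIV) (\<lambda>i y. complex_of_real (?r (fst i)) * ?\<phi> (?M i y))"
    by (rule unif_smooth_mult[rotated])
  moreover have "complex_of_real (?r n) * ?\<phi> (sqrt (damp_rate n) *\<^sub>R Z) = complex_of_real (cutoff n Z)" for n Z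
    using damp_rate_bounds(1)[of n] by (simp add: cutoff_def power_mult_distrib less_imp_le mult.assoc)
  ultimately show ?thesis by (simp add: case_prod_beta')
qed

section \<open>Expansion of a symbol in modulated Gaussians, and the resulting pairing\<close>

lemma symbol_stft_decay:
  assumes "a \<in> S000"
  shows "\<exists>C\<ge>0. \<forall>W \<Omega>. cmod (symbol_stft a W \<Omega>) \<le> C * (1 / (1 + (norm \<Omega>)\<^sup>2)^N)"
  using symbol_stft_bound[OF unif_smooth_S000[OF assms, of "UNIV :: unit set"], of N] by blast

lemma symbol_stft_integrable:
  fixes a :: "real^'k::finite \<Rightarrow> complex"
  assumes a: "a \<in> S000"
  shows "integrable lborel (symbol_stft a W)"
proof -
  obtain C where C: "C \<ge> 0" "\<And>W \<Omega>. cmod (symbol_stft a W \<Omega>) \<le> C * (1 / (1 + (norm \<Omega>)\<^sup>2)^DIM(real^'k))"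
    using symbol_stft_decay[OF a] by blast
  note [measurable] = S000_measurable[OF a]
  show ?thesis
  proof (rule Bochner_Integration.integrable_bound)
    show "integrable lborel (\<lambda>\<Omega>::real^'k. C * (1 / (1 + (norm \<Omega>)\<^sup>2)^DIM(real^'k)))"
      by (intro integrable_mult_right integrable_japanese_power)
    show "AE \<Omega> in lborel. norm (symbol_stft a W \<Omega>) \<le> norm (C * (1 / (1 + (norm \<Omega>)\<^sup>2)^DIM(real^'k)))"
      unfolding real_norm_def by (intro AE_I2 order_trans[OF C(2) abs_ge_self])
  qed measurable
qed

lemma symbol_stft_inversion:
  fixes a :: "real^'k::finite \<Rightarrow> complex"
  assumes a: "a \<in> S000"
  shows "(LINT \<Omega>|lborel. symbol_stft a W \<Omega> * cis (2 * pi * (\<Omega> \<bullet> Z))) = a Z * of_real (gauss2 (Z - W))"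
proof -
  obtain B where B: "B \<ge> 0" "\<And>Z. cmod (a Z) \<le> B" using S000_bounded[OF a] by blast
  show ?thesis
    unfolding symbol_stft_def
  proof (rule fourier_inversion[where B=B])
    show "continuous_on UNIV (\<lambda>Z. a Z * of_real (gauss2 (Z - W)))"
      unfolding gauss2_def
      by (intro continuous_intros unif_smooth_continuous[OF a[unfolded S000_iff]]) simp
    show "cmod (a x * of_real (gauss2 (x - W))) \<le> B" for x
      using mult_mono[OF B(2)[of x] gauss2_bounds(2)[of "x - W"] B(1)] gauss2_bounds(1)[of "x - W"]
      by (simp add: norm_mult)
    show "integrable lborel (\<lambda>Z. a Z * of_real (gauss2 (Z - W)))"
      by (rule S000_gauss2_integrable[OF a])
    show "integrable lborel (ft (\<lambda>Z. a Z * of_real (gauss2 (Z - W))))"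
      using symbol_stft_integrable[OF a, of W] by (simp only: symbol_stft_def[abs_def])
  qed
qed

text \<open>The integrand of <Op(g) f, H> for the single symbol \<open>gauss2 (Z - W)\<close> times
  \<open>cis (2 * pi * (\<Omega> \<bullet> Z))\<close>, with the variables in the order x, \<xi>, y.
  Expanding \<open>a\<close> in such symbols leaves one of these factors for each pair of
  \<open>\<Omega>\<close> and \<open>W\<close>.\<close>

definition pairing_factor :: "(real^'m::finite \<Rightarrow> complex) \<Rightarrow> (real^'m \<Rightarrow> complex) \<Rightarrow>
    real^('m + 'm) \<Rightarrow> real^('m + 'm) \<Rightarrow> (real^'m) \<times> (real^'m) \<times> (real^'m) \<Rightarrow> complex" where
  "pairing_factor f H \<Omega> W = (\<lambda>(x, \<xi>, y). cnj (H x) * (f y * (cis (2 * pi * ((x - y) \<bullet> \<xi>)) *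
     (of_real (gauss2 (vjoin ((1/2) *\<^sub>R (x + y)) \<xi> - W)) * cis (2 * pi * (\<Omega> \<bullet> vjoin ((1/2) *\<^sub>R (x + y)) \<xi>))))))"

lemma pairing_factor_bound:
  "cmod (pairing_factor f H \<Omega> W (x, \<xi>, y)) \<le> cmod (H x) * (gauss2 (\<xi> - vsnd W) * cmod (f y))"
proof -
  have "cmod (pairing_factor f H \<Omega> W (x, \<xi>, y)) = cmod (H x) * (gauss2 ((1/2) *\<^sub>R (x + y) - vfst W) * (gauss2 (\<xi> - vsnd W) * cmod (f y)))"
    unfolding pairing_factor_def gauss2_vjoin
    by (simp add: norm_mult abs_of_pos[OF gauss2_bounds(1)] mult_ac)
  also have "\<dots> \<le> cmod (H x) * (1 * (gauss2 (\<xi> - vsnd W) * cmod (f y)))"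
    by (intro mult_left_mono mult_right_mono gauss2_bounds(2) mult_nonneg_nonneg less_imp_le[OF gauss2_bounds(1)]) simp_all
  finally show ?thesis by simp
qed

lemma half_phase:
  fixes x y :: "real^'m::finite"
  shows "cis (2 * pi * (vsnd W \<bullet> (x - y + vsnd \<Omega>))) * cis (2 * pi * (vfst \<Omega> \<bullet> ((1/2) *\<^sub>R (x + y)))) =
    cis (2 * pi * (vsnd \<Omega> \<bullet> vsnd W)) * (cis (- (2 * pi * (y \<bullet> (vsnd W - (1/2) *\<^sub>R vfst \<Omega>)))) *
      cis (2 * pi * (x \<bullet> (vsnd W + (1/2) *\<^sub>R vfst \<Omega>))))"
  unfolding cis_mult by (rule arg_cong[where f=cis]) (simp add: inner_simps inner_commute algebra_simps)

text \<open>The \<xi>-integral yields a Gaussian in \<open>x - y + vsnd \<Omega>\<close>. Together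
  with the Gaussian in the midpoint, \<open>gauss_split\<close> separates the variables, and
  \<open>half_phase\<close> does the same for the phases. The result is a product of the integrands
  of two transforms, at \<open>W + half_J \<Omega>\<close> and
  \<open>W - half_J \<Omega>\<close>.\<close>

lemma pairing_factor_xi_integral:
  fixes f H :: "real^'m::finite \<Rightarrow> complex"
  shows "(LINT \<xi>|lborel. pairing_factor f H \<Omega> W (x, \<xi>, y)) =
    of_real ((1 / sqrt 2)^CARD('m)) * cis (2 * pi * (vsnd \<Omega> \<bullet> vsnd W)) *
     ((f y * of_real (gauss (y - vfst (W + half_J \<Omega>))) * cis (- (2 * pi * (y \<bullet> vsnd (W + half_J \<Omega>))))) *
      cnj (H x * of_real (gauss (x - vfst (W - half_J \<Omega>))) * cis (- (2 * pi * (x \<bullet> vsnd (W - half_J \<Omega>))))))"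
proof -
  let ?u = "(1/2) *\<^sub>R (x + y)"
  let ?v = "x - y + vsnd \<Omega>"
  have "pairing_factor f H \<Omega> W (x, \<xi>, y) = (cnj (H x) * f y * of_real (gauss2 (?u - vfst W)) * cis (2 * pi * (vfst \<Omega> \<bullet> ?u))) *
      (of_real (gauss2 (\<xi> - vsnd W)) * cis (2 * pi * (\<xi> \<bullet> ?v)))" for \<xi>
  proof -
    have "cis (2 * pi * ((x - y) \<bullet> \<xi>)) * cis (2 * pi * (\<Omega> \<bullet> vjoin ?u \<xi>)) = cis (2 * pi * (vfst \<Omega> \<bullet> ?u)) * cis (2 * pi * (\<xi> \<bullet> ?v))"
      unfolding cis_mult by (rule arg_cong[where f=cis]) (simp add: inner_vsplit[of \<Omega>] inner_simps inner_commute algebra_simps)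
    moreover have "pairing_factor f H \<Omega> W (x, \<xi>, y) = (cnj (H x) * f y * of_real (gauss2 (?u - vfst W)) * of_real (gauss2 (\<xi> - vsnd W))) *
       (cis (2 * pi * ((x - y) \<bullet> \<xi>)) * cis (2 * pi * (\<Omega> \<bullet> vjoin ?u \<xi>)))"
      by (simp only: pairing_factor_def prod.case gauss2_vjoin of_real_mult mult_ac)
    ultimately show ?thesis by (simp only: mult_ac)
  qed
  then have "(LINT \<xi>|lborel. pairing_factor f H \<Omega> W (x, \<xi>, y)) =
      (cnj (H x) * f y * of_real (gauss2 (?u - vfst W)) * cis (2 * pi * (vfst \<Omega> \<bullet> ?u))) *
      (cis (2 * pi * (vsnd W \<bullet> ?v)) * of_real ((1 / sqrt 2)^CARD('m) * exp (- pi * (norm ?v)\<^sup>2 / 2)))"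
    by (simp only: integral_mult_right_zero gauss2_cis_integral(2))
  also have "\<dots> = (cnj (H x) * f y) * of_real ((1 / sqrt 2)^CARD('m)) * of_real (exp (- pi * (norm ?v)\<^sup>2 / 2) * gauss2 (?u - vfst W)) *
      (cis (2 * pi * (vsnd W \<bullet> ?v)) * cis (2 * pi * (vfst \<Omega> \<bullet> ?u)))"
    by (simp only: of_real_mult mult_ac)
  also have "\<dots> = (cnj (H x) * f y) * of_real ((1 / sqrt 2)^CARD('m)) *
      of_real (gauss (y - (vfst W + (1/2) *\<^sub>R vsnd \<Omega>)) * gauss (x - (vfst W - (1/2) *\<^sub>R vsnd \<Omega>))) *
      (cis (2 * pi * (vsnd \<Omega> \<bullet> vsnd W)) * (cis (- (2 * pi * (y \<bullet> (vsnd W - (1/2) *\<^sub>R vfst \<Omega>)))) *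
      cis (2 * pi * (x \<bullet> (vsnd W + (1/2) *\<^sub>R vfst \<Omega>)))))"
    unfolding gauss_split half_phase ..
  also have "\<dots> = of_real ((1 / sqrt 2)^CARD('m)) * cis (2 * pi * (vsnd \<Omega> \<bullet> vsnd W)) *
     ((f y * of_real (gauss (y - vfst (W + half_J \<Omega>))) * cis (- (2 * pi * (y \<bullet> vsnd (W + half_J \<Omega>))))) *
      cnj (H x * of_real (gauss (x - vfst (W - half_J \<Omega>))) * cis (- (2 * pi * (x \<bullet> vsnd (W - half_J \<Omega>))))))"
    by (simp add: half_J_def cis_cnj mult_ac)
  finally show ?thesis .
qed

context
  fixes f H :: "real^'m::finite \<Rightarrow> complex"
  assumes f: "f \<in> L2" "integrable lborel f" and H: "H \<in> L2" "integrable lborel H"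
begin

lemma pairing_dominant:
  fixes w :: "real^'m"
  shows "integrable lborel (\<lambda>r. gauss2 (fst r - w) * cmod (f (snd r)))"
    and "integrable lborel (\<lambda>q. cmod (H (fst q)) * (gauss2 (fst (snd q) - w) * cmod (f (snd (snd q)))))"
    and "(LINT q|lborel. cmod (H (fst q)) * (gauss2 (fst (snd q) - w) * cmod (f (snd (snd q))))) =
      (LINT x|lborel. cmod (H x)) * (integral\<^sup>L lborel (gauss2 :: real^'m \<Rightarrow> real) * (LINT y|lborel. cmod (f y)))"
proof -
  have g: "integrable lborel (\<lambda>\<xi>::real^'m. gauss2 (\<xi> - w))"
    using lborel_shift[OF integrable_gauss2, of "- w"] by simp
  have gi: "(LINT \<xi>|lborel. gauss2 (\<xi> - w)) = integral\<^sup>L lborel (gauss2 :: real^'m \<Rightarrow> real)"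
    using lborel_integral_shift[OF gauss2_measurable, of "- w"] by simp
  note h = integrable_norm[OF H(2)] and k = integrable_norm[OF f(2)]
  show 1: "integrable lborel (\<lambda>r. gauss2 (fst r - w) * cmod (f (snd r)))"
    by (rule integrable_pair_mult[OF g k])
  show "integrable lborel (\<lambda>q. cmod (H (fst q)) * (gauss2 (fst (snd q) - w) * cmod (f (snd (snd q)))))"
    by (rule integrable_pair_mult[OF h 1])
  show "(LINT q|lborel. cmod (H (fst q)) * (gauss2 (fst (snd q) - w) * cmod (f (snd (snd q))))) =
      (LINT x|lborel. cmod (H x)) * (integral\<^sup>L lborel (gauss2 :: real^'m \<Rightarrow> real) * (LINT y|lborel. cmod (f y)))"
    using integral_pair_mult[OF h 1] integral_pair_mult[OF g k] gi by simp
qed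

lemma pairing_factor_integrable: "integrable lborel (pairing_factor f H \<Omega> W)"
proof (rule Bochner_Integration.integrable_bound[OF pairing_dominant(2)[of "vsnd W"]])
  note [measurable] = L2_measurable[OF f(1)] L2_measurable[OF H(1)]
  have "pairing_factor f H \<Omega> W \<in> borel_measurable borel"
    unfolding pairing_factor_def borel_prod[symmetric] by measurable
  then show "pairing_factor f H \<Omega> W \<in> borel_measurable lborel" by simp
  show "AE q in lborel. norm (pairing_factor f H \<Omega> W q) \<le> norm (cmod (H (fst q)) * (gauss2 (fst (snd q) - vsnd W) * cmod (f (snd (snd q)))))"
    unfolding real_norm_def by (intro AE_I2 order_trans[OF _ abs_ge_self]) (metis pairing_factor_bound prod.collapse)
qed

lemma pairing_factor_inner_integrable: "integrable lborel (\<lambda>r. pairing_factor f H \<Omega> W (x, r))"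
proof (rule Bochner_Integration.integrable_bound[OF integrable_mult_right[OF pairing_dominant(1)[of "vsnd W"], of "cmod (H x)"]])
  note [measurable] = L2_measurable[OF f(1)] L2_measurable[OF H(1)]
  have "(\<lambda>r. pairing_factor f H \<Omega> W (x, r)) \<in> borel_measurable borel"
    unfolding pairing_factor_def prod.case borel_prod[symmetric] by measurable
  then show "(\<lambda>r. pairing_factor f H \<Omega> W (x, r)) \<in> borel_measurable lborel" by simp
  show "AE r in lborel. norm (pairing_factor f H \<Omega> W (x, r)) \<le> norm (cmod (H x) * (gauss2 (fst r - vsnd W) * cmod (f (snd r))))"
    unfolding real_norm_def by (intro AE_I2 order_trans[OF _ abs_ge_self]) (metis pairing_factor_bound prod.collapse)
qed

lemma pairing_factor_integral:
  "integral\<^sup>L lborel (pairing_factor f H \<Omega> W) = of_real ((1 / sqrt 2)^CARD('m)) *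
    (cis (2 * pi * (vsnd \<Omega> \<bullet> vsnd W)) * (stft f (W + half_J \<Omega>) * cnj (stft H (W - half_J \<Omega>))))"
proof -
  let ?k = "of_real ((1 / sqrt 2)^CARD('m)) * cis (2 * pi * (vsnd \<Omega> \<bullet> vsnd W))"
  let ?A = "\<lambda>y. f y * of_real (gauss (y - vfst (W + half_J \<Omega>))) * cis (- (2 * pi * (y \<bullet> vsnd (W + half_J \<Omega>))))"
  let ?B = "\<lambda>x. H x * of_real (gauss (x - vfst (W - half_J \<Omega>))) * cis (- (2 * pi * (x \<bullet> vsnd (W - half_J \<Omega>))))"
  have "integral\<^sup>L lborel (pairing_factor f H \<Omega> W) = (LINT x|lborel. LINT r|lborel. pairing_factor f H \<Omega> W (x, r))"
    by (rule integral_lborel_fst[OF pairing_factor_integrable])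
  also have "\<dots> = (LINT x|lborel. LINT y|lborel. LINT \<xi>|lborel. pairing_factor f H \<Omega> W (x, \<xi>, y))"
    by (simp only: integral_lborel_snd[OF pairing_factor_inner_integrable])
  also have "\<dots> = (LINT x|lborel. LINT y|lborel. ?k * (?A y * cnj (?B x)))"
    unfolding pairing_factor_xi_integral ..
  also have "\<dots> = ?k * (integral\<^sup>L lborel ?A * (LINT x|lborel. cnj (?B x)))"
    by (simp only: integral_mult_right_zero integral_mult_left_zero)
  also have "\<dots> = ?k * (stft f (W + half_J \<Omega>) * cnj (stft H (W - half_J \<Omega>)))"
    by (simp only: stft_def ft_def Bochner_Integration.integral_cnj)
  finally show ?thesis by (simp only: mult.assoc)
qed

end

text \<open>Integrating over \<Omega> first inverts the transform of the symbol and returns a(Z)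
  with one factor \<open>gauss2\<close>. The second factor makes it a square, whose damped integral
  over W is \<open>damp_integral\<close>.\<close>

lemma damped_symbol_integral:
  fixes a :: "real^'k::finite \<Rightarrow> complex"
  assumes a: "a \<in> S000"
  shows "(LINT p|lborel. of_real (damp n (snd p) * gauss2 (Z - snd p)) * (symbol_stft a (snd p) (fst p) * cis (2 * pi * (fst p \<bullet> Z))))
    = of_real ((1/2)^CARD('k)) * (of_real (cutoff n Z) * a Z)"
proof -
  let ?F = "\<lambda>p. of_real (damp n (snd p) * gauss2 (Z - snd p)) * (symbol_stft a (snd p) (fst p) * cis (2 * pi * (fst p \<bullet> Z)))"
  obtain C where C: "C \<ge> 0" "\<And>W \<Omega>. cmod (symbol_stft a W \<Omega>) \<le> C * (1 / (1 + (norm \<Omega>)\<^sup>2)^DIM(real^'k))"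
    using symbol_stft_decay[OF a] by blast
  note [measurable] = S000_measurable[OF a]
  have int: "integrable lborel ?F"
  proof (rule Bochner_Integration.integrable_bound)
    show "integrable lborel (\<lambda>p::(real^'k) \<times> (real^'k). (C * (1 / (1 + (norm (fst p))\<^sup>2)^DIM(real^'k))) * damp n (snd p))"
      by (rule integrable_pair_mult[OF integrable_mult_right[OF integrable_japanese_power] damp_integrable])
    have "?F \<in> borel_measurable borel"
      unfolding borel_prod[symmetric] by measurable
    then show "?F \<in> borel_measurable lborel" by simp
    show "AE p in lborel. norm (?F p) \<le> norm ((C * (1 / (1 + (norm (fst p))\<^sup>2)^DIM(real^'k))) * damp n (snd p))"
    proof (rule AE_I2)
      fix p :: "(real^'k) \<times> (real^'k)"
      have "norm (?F p) = cmod (symbol_stft a (snd p) (fst p)) * (damp n (snd p) * gauss2 (Z - snd p))"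
        unfolding norm_mult norm_of_real by (simp add: abs_mult abs_of_pos[OF damp_bounds(1)] abs_of_pos[OF gauss2_bounds(1)] mult_ac)
      also have "\<dots> \<le> (C * (1 / (1 + (norm (fst p))\<^sup>2)^DIM(real^'k))) * (damp n (snd p) * 1)"
        by (intro mult_mono C(2) gauss2_bounds(2) order_refl mult_nonneg_nonneg C(1) less_imp_le[OF damp_bounds(1)] less_imp_le[OF gauss2_bounds(1)]) simp_all
      finally show "norm (?F p) \<le> norm ((C * (1 / (1 + (norm (fst p))\<^sup>2)^DIM(real^'k))) * damp n (snd p))"
        unfolding real_norm_def mult_1_right by (rule order_trans[OF _ abs_ge_self])
    qed
  qed
  have "integral\<^sup>L lborel ?F = (LINT W|lborel. of_real (damp n W * gauss2 (Z - W)) * (LINT \<Omega>|lborel. symbol_stft a W \<Omega> * cis (2 * pi * (\<Omega> \<bullet> Z))))"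
    unfolding integral_lborel_snd[OF int] by (simp only: fst_conv snd_conv integral_mult_right_zero)
  also have "\<dots> = (LINT W|lborel. a Z * of_real (damp n W * (gauss2 (Z - W))\<^sup>2))"
    unfolding symbol_stft_inversion[OF a]
    by (rule Bochner_Integration.integral_cong[OF refl]) (simp add: power2_eq_square gauss2_minus[of Z] mult_ac)
  also have "\<dots> = a Z * of_real ((1/2)^CARD('k) * cutoff n Z)"
    by (simp only: integral_mult_right_zero integral_complex_of_real damp_integral)
  finally show ?thesis by (simp only: of_real_mult mult_ac)
qed

text \<open>One absolutely convergent integral \<open>S\<close>, over (\<Omega>, W) and over (x,
  \<xi>, y), is evaluated in both orders. Integrating (x, \<xi>, y) first gives the damped kernel;
  integrating (\<Omega>, W) first gives the Weyl integral with a cutoff. It is the damping that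
  makes the majorant \<open>D\<close> integrable in W.\<close>

lemma weyl_pairing_cutoff:
  fixes f H :: "real^'m::finite \<Rightarrow> complex"
  assumes a: "a \<in> S000" and f: "f \<in> L2" "integrable lborel f" and H: "H \<in> L2" "integrable lborel H"
  shows "of_real ((1 / sqrt 2)^CARD('m)) * (LINT p|lborel. of_real (damp n (snd p)) * weyl_kernel a f H p) =
    of_real ((1/2)^CARD('m + 'm)) * (LINT x|lborel. cnj (H x) *
      (LINT \<xi>|lborel. LINT y|lborel. of_real (cutoff n (vjoin ((1/2) *\<^sub>R (x + y)) \<xi>)) * weyl_integrand a f x (vjoin y \<xi>)))"
proof -
  note [measurable] = S000_measurable[OF a] L2_measurable[OF f(1)] L2_measurable[OF H(1)]
  obtain C where C: "C \<ge> 0" "\<And>W \<Omega>. cmod (symbol_stft a W \<Omega>) \<le> C * (1 / (1 + (norm \<Omega>)\<^sup>2)^DIM(real^('m + 'm)))"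
    using symbol_stft_decay[OF a] by blast
  let ?w = "\<lambda>\<Omega>::real^('m + 'm). 1 / (1 + (norm \<Omega>)\<^sup>2)^DIM(real^('m + 'm))"
  define S where "S = (\<lambda>z. (of_real (damp n (snd (fst z))) * symbol_stft a (snd (fst z)) (fst (fst z))) *
    pairing_factor f H (fst (fst z)) (snd (fst z)) (snd z))"
  define D where "D = (\<lambda>z :: ((real^('m + 'm)) \<times> (real^('m + 'm))) \<times> (real^'m) \<times> (real^'m) \<times> (real^'m).
    ((C * ?w (fst (fst z))) * damp n (snd (fst z))) *
    (cmod (H (fst (snd z))) * (gauss2 (fst (snd (snd z)) - vsnd (snd (fst z))) * cmod (f (snd (snd (snd z)))))))"
  have D: "integrable lborel D"
  proof (rule integrable_lborel_pairI)
    show "D \<in> borel_measurable borel"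
      unfolding D_def borel_prod[symmetric] by measurable
    show "integrable lborel (\<lambda>q. D (p, q))" for p
      unfolding D_def fst_conv snd_conv by (intro integrable_mult_right pairing_dominant f H)
    have "(LINT q|lborel. norm (D (p, q))) = ((C * ?w (fst p)) * damp n (snd p)) *
      ((LINT x|lborel. cmod (H x)) * (integral\<^sup>L lborel (gauss2 :: real^'m \<Rightarrow> real) * (LINT y|lborel. cmod (f y))))" for p
    proof -
      have "norm (D (p, q)) = D (p, q)" for q
        unfolding D_def real_norm_def
        by (intro abs_of_nonneg mult_nonneg_nonneg C(1) less_imp_le[OF damp_bounds(1)] less_imp_le[OF gauss2_bounds(1)]) simp_all
      then show ?thesis
        by (simp only: D_def fst_conv snd_conv integral_mult_right_zero pairing_dominant(3)[OF f H])
    qed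
    then show "integrable lborel (\<lambda>p. LINT q|lborel. norm (D (p, q)))"
      by (simp only:) (intro integrable_mult_left integrable_pair_mult[OF integrable_mult_right[OF integrable_japanese_power] damp_integrable])
  qed
  have S: "integrable lborel S"
  proof (rule Bochner_Integration.integrable_bound[OF D])
    have "S \<in> borel_measurable borel"
      unfolding S_def pairing_factor_def borel_prod[symmetric] by measurable
    then show "S \<in> borel_measurable lborel" by simp
    show "AE z in lborel. norm (S z) \<le> norm (D z)"
    proof (rule AE_I2)
      fix z :: "((real^('m + 'm)) \<times> (real^('m + 'm))) \<times> (real^'m) \<times> (real^'m) \<times> (real^'m)"
      obtain \<Omega> W x \<xi> y where z: "z = ((\<Omega>, W), (x, \<xi>, y))" by (metis surj_pair)
      have "norm (S z) = (cmod (symbol_stft a W \<Omega>) * damp n W) * cmod (pairing_factor f H \<Omega> W (x, \<xi>, y))"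
        unfolding S_def z fst_conv snd_conv norm_mult norm_of_real by (simp add: abs_of_pos[OF damp_bounds(1)] mult_ac)
      also have "\<dots> \<le> ((C * ?w \<Omega>) * damp n W) * (cmod (H x) * (gauss2 (\<xi> - vsnd W) * cmod (f y)))"
        by (intro mult_mono C(2) pairing_factor_bound order_refl mult_nonneg_nonneg C(1) less_imp_le[OF damp_bounds(1)]) simp_all
      finally show "norm (S z) \<le> norm (D z)"
        unfolding D_def z fst_conv snd_conv real_norm_def by (rule order_trans[OF _ abs_ge_self])
    qed
  qed
  define R where "R = (\<lambda>(x, \<xi>, y). cnj (H x) * (of_real (cutoff n (vjoin ((1/2) *\<^sub>R (x + y)) \<xi>)) * weyl_integrand a f x (vjoin y \<xi>)))"
  have inner: "(LINT q|lborel. S (p, q)) = of_real ((1 / sqrt 2)^CARD('m)) * (of_real (damp n (snd p)) * weyl_kernel a f H p)" for p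
    by (simp only: S_def fst_conv snd_conv integral_mult_right_zero pairing_factor_integral[OF f H] weyl_kernel_def case_prod_beta' mult_ac)
  have "of_real ((1 / sqrt 2)^CARD('m)) * (LINT p|lborel. of_real (damp n (snd p)) * weyl_kernel a f H p) = (LINT p|lborel. LINT q|lborel. S (p, q))"
    by (simp only: inner integral_mult_right_zero)
  also have "\<dots> = (LINT q|lborel. LINT p|lborel. S (p, q))"
    by (simp only: integral_lborel_fst[OF S, symmetric] integral_lborel_snd[OF S, symmetric])
  also have "\<dots> = (LINT q|lborel. of_real ((1/2)^CARD('m + 'm)) * R q)"
  proof (rule Bochner_Integration.integral_cong[OF refl])
    fix q :: "(real^'m) \<times> (real^'m) \<times> (real^'m)"
    obtain x \<xi> y where q: "q = (x, \<xi>, y)" by (metis surj_pair)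
    let ?Z = "vjoin ((1/2) *\<^sub>R (x + y)) \<xi>"
    let ?c = "cnj (H x) * (f y * cis (2 * pi * ((x - y) \<bullet> \<xi>)))"
    have "S (p, q) = ?c * (of_real (damp n (snd p) * gauss2 (?Z - snd p)) * (symbol_stft a (snd p) (fst p) * cis (2 * pi * (fst p \<bullet> ?Z))))" for p
      by (simp only: S_def q pairing_factor_def fst_conv snd_conv prod.case of_real_mult mult_ac)
    then have "(LINT p|lborel. S (p, q)) = ?c * (of_real ((1/2)^CARD('m + 'm)) * (of_real (cutoff n ?Z) * a ?Z))"
      by (simp only: integral_mult_right_zero damped_symbol_integral[OF a])
    then show "(LINT p|lborel. S (p, q)) = of_real ((1/2)^CARD('m + 'm)) * R q"
      by (simp only: R_def q prod.case weyl_integrand_vjoin mult_ac)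
  qed
  also have "\<dots> = of_real ((1/2)^CARD('m + 'm)) * integral\<^sup>L lborel R"
    by (rule integral_mult_right_zero)
  also have "integral\<^sup>L lborel R = (LINT x|lborel. cnj (H x) *
      (LINT \<xi>|lborel. LINT y|lborel. of_real (cutoff n (vjoin ((1/2) *\<^sub>R (x + y)) \<xi>)) * weyl_integrand a f x (vjoin y \<xi>)))"
  proof -
    obtain B where B: "B \<ge> 0" "\<And>Z. cmod (a Z) \<le> B" using S000_bounded[OF a] by blast
    let ?e = "\<lambda>\<xi>::real^'m. exp (- pi * damp_rate n * (norm \<xi>)\<^sup>2)"
    \<comment> \<open>Only the decay of the cutoff in \<xi> is kept, since \<open>H\<close> and
      \<open>f\<close> are integrable in x and y.\<close>
    have dom: "integrable lborel (\<lambda>r. (B * ?e (fst r)) * cmod (f (snd r)))"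
      by (rule integrable_pair_mult[OF integrable_mult_right[OF integrable_gaussian[OF damp_rate_bounds(1)]] integrable_norm[OF f(2)]])
    have bd: "cmod (R (x, \<xi>, y)) \<le> cmod (H x) * ((B * ?e \<xi>) * cmod (f y))" for x \<xi> y
    proof -
      let ?Z = "vjoin ((1/2) *\<^sub>R (x + y)) \<xi>"
      have "cutoff n ?Z \<le> exp (- pi * damp_rate n * (norm ?Z)\<^sup>2)" by (rule cutoff_bounds)
      also have "\<dots> \<le> ?e \<xi>"
        unfolding norm_vsplit[of ?Z] using damp_rate_bounds(1)[of n] by (simp add: mult_left_mono)
      finally have "(cmod (a ?Z) * cutoff n ?Z) * cmod (f y) \<le> (B * ?e \<xi>) * cmod (f y)"
        by (intro mult_right_mono mult_mono B less_imp_le[OF cutoff_bounds(1)]) simp_all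
      from mult_left_mono[OF this, of "cmod (H x)"] show ?thesis
        by (simp add: R_def weyl_integrand_vjoin norm_mult abs_of_pos[OF cutoff_bounds(1)] mult_ac)
    qed
    have mR: "R \<in> borel_measurable borel"
      unfolding R_def weyl_integrand_vjoin borel_prod[symmetric] by measurable
    have R: "integrable lborel R"
    proof (rule Bochner_Integration.integrable_bound[OF integrable_pair_mult[OF integrable_norm[OF H(2)] dom]])
      show "AE q in lborel. norm (R q) \<le> norm (norm (H (fst q)) * (B * ?e (fst (snd q)) * cmod (f (snd (snd q)))))"
        unfolding real_norm_def by (intro AE_I2 order_trans[OF _ abs_ge_self]) (metis bd prod.collapse)
    qed (use mR in simp)
    have Rx: "integrable lborel (\<lambda>r. R (x, r))" for x
    proof (rule Bochner_Integration.integrable_bound[OF integrable_mult_right[OF dom, of "cmod (H x)"]])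
      show "AE r in lborel. norm (R (x, r)) \<le> norm (cmod (H x) * (B * ?e (fst r) * cmod (f (snd r))))"
        unfolding real_norm_def by (intro AE_I2 order_trans[OF _ abs_ge_self]) (metis bd prod.collapse)
      have "(\<lambda>r. R (x, r)) \<in> borel_measurable borel"
        unfolding R_def prod.case weyl_integrand_vjoin borel_prod[symmetric] by measurable
      then show "(\<lambda>r. R (x, r)) \<in> borel_measurable lborel" by simp
    qed
    show ?thesis
      unfolding integral_lborel_fst[OF R] integral_lborel_fst[OF Rx]
      by (simp only: R_def prod.case integral_mult_right_zero)
  qed
  finally show ?thesis .
qed

text \<open>Both sides of \<open>weyl_pairing_cutoff\<close> converge as the damping is removed: the
  kernel is absolutely integrable, and the Weyl integrals with cutoff are bounded uniformly for x in
  the ball that carries \<open>H\<close>.\<close>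

lemma weyl_fun_pairing:
  fixes f H :: "real^'m::finite \<Rightarrow> complex"
  assumes a: "a \<in> S000" and f: "f \<in> schwartz" and H: "tame H"
  shows "L2_inner (weyl_fun a f) H = weyl_form a f H"
proof -
  note [measurable] = S000_measurable[OF a] schwartz_measurable[OF f] tame_measurable[OF H]
  note fL = schwartz_L2[OF f] schwartz_integrable[OF f] and HL = tame_L2[OF H] tame_integrable[OF H]
  let ?k = "complex_of_real ((1 / sqrt 2)^CARD('m))" and ?c = "complex_of_real ((1/2)^CARD('m + 'm))"
  define I where "I n x = (LINT \<xi>|lborel. LINT y|lborel. of_real (cutoff n (vjoin ((1/2) *\<^sub>R (x + y)) \<xi>)) * weyl_integrand a f x (vjoin y \<xi>))" for n x
  obtain R where R: "R \<ge> 0" "\<And>x. cmod (H x) \<le> R * indicator (cball 0 R) x" using tame_bound[OF H] by blast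
  let ?X = "cball 0 R :: (real^'m) set"
  have out: "H x = 0" if "x \<notin> ?X" for x using R(2)[of x] that by simp
  have cm: "(\<lambda>(\<xi>, y). complex_of_real (cutoff n (vjoin ((1/2) *\<^sub>R (x + y)) \<xi>))) \<in> borel_measurable borel" for n and x :: "real^'m"
    unfolding borel_prod[symmetric] by measurable
  have c1: "(\<lambda>n. complex_of_real (cutoff n (vjoin ((1/2) *\<^sub>R (x + y)) \<xi>))) \<longlonglongrightarrow> 1" for x y \<xi> :: "real^'m"
    using tendsto_of_real[OF cutoff_tendsto, where 'a=complex] by simp
  note cut = a f unif_smooth_cutoff[of ?X] c1 cm
  have lim: "(\<lambda>n. I n x) \<longlonglongrightarrow> weyl_fun a f x" if "x \<in> ?X" for x
    unfolding I_def using weyl_cutoff_tendsto[OF cut that] by simp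
  obtain C where C: "\<And>n x. x \<in> ?X \<Longrightarrow> cmod (I n x) \<le> C"
    unfolding I_def using weyl_cutoff_uniform_bound[OF cut] by blast
  have mI: "I n \<in> borel_measurable borel" for n
  proof -
    have "(\<lambda>p. LINT y|lborel. of_real (cutoff n (vjoin ((1/2) *\<^sub>R (fst p + y)) (snd p))) * weyl_integrand a f (fst p) (vjoin y (snd p))) \<in> borel_measurable (borel \<Otimes>\<^sub>M borel)"
      unfolding weyl_integrand_vjoin by (rule lborel.borel_measurable_lebesgue_integral) measurable
    then have [measurable]: "(\<lambda>(x, \<xi>). LINT y|lborel. of_real (cutoff n (vjoin ((1/2) *\<^sub>R (x + y)) \<xi>)) * weyl_integrand a f x (vjoin y \<xi>)) \<in> borel_measurable (borel \<Otimes>\<^sub>M borel)"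
      by (simp add: case_prod_beta')
    show ?thesis
      unfolding I_def[abs_def] by (rule lborel.borel_measurable_lebesgue_integral) measurable
  qed
  note [measurable] = mI
  have lim1: "(\<lambda>n. LINT x|lborel. cnj (H x) * I n x) \<longlonglongrightarrow> (LINT x|lborel. cnj (H x) * weyl_fun a f x)"
  proof (rule integral_dominated_convergence[where w="\<lambda>x. cmod (H x) * C"])
    show "AE x in lborel. (\<lambda>n. cnj (H x) * I n x) \<longlonglongrightarrow> cnj (H x) * weyl_fun a f x"
    proof (rule AE_I2)
      fix x show "(\<lambda>n. cnj (H x) * I n x) \<longlonglongrightarrow> cnj (H x) * weyl_fun a f x"
        using lim[of x] out[of x] by (cases "x \<in> ?X") (auto intro: tendsto_intros)
    qed
    show "AE x in lborel. norm (cnj (H x) * I n x) \<le> cmod (H x) * C" for n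
    proof (rule AE_I2)
      fix x show "norm (cnj (H x) * I n x) \<le> cmod (H x) * C"
        using C[of x n] out[of x] by (cases "x \<in> ?X") (auto simp: norm_mult intro: mult_left_mono)
    qed
    show "integrable lborel (\<lambda>x. cmod (H x) * C)"
      using integrable_norm[OF HL(2)] by simp
  qed measurable
  have wk: "integrable lborel (weyl_kernel a f H)"
    by (rule weyl_kernel_integrable[OF a fL(1) HL(1)])
  have damp1: "(\<lambda>n. damp n W) \<longlonglongrightarrow> 1" for W :: "real^('m + 'm)"
  proof -
    have "(\<lambda>n. exp (- pi * (1 / real (Suc n)) * (norm W)\<^sup>2)) \<longlonglongrightarrow> exp (- pi * 0 * (norm W)\<^sup>2)"
      using LIMSEQ_inverse_real_of_nat by (intro tendsto_intros) (simp add: inverse_eq_divide)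
    then show ?thesis by (simp add: damp_def)
  qed
  have lim2: "(\<lambda>n. LINT p|lborel. of_real (damp n (snd p)) * weyl_kernel a f H p) \<longlonglongrightarrow> integral\<^sup>L lborel (weyl_kernel a f H)"
  proof (rule integral_dominated_convergence[where w="\<lambda>p. cmod (weyl_kernel a f H p)"])
    show "integrable lborel (\<lambda>p. cmod (weyl_kernel a f H p))" by (rule integrable_norm[OF wk])
    show "weyl_kernel a f H \<in> borel_measurable lborel" using wk by (rule borel_measurable_integrable)
    then have mk: "weyl_kernel a f H \<in> borel_measurable (borel \<Otimes>\<^sub>M borel)" by (simp add: borel_prod)
    have "(\<lambda>p. complex_of_real (damp n (snd p)) * weyl_kernel a f H p) \<in> borel_measurable (borel \<Otimes>\<^sub>M borel)" for n
      using mk by measurable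
    then show "(\<lambda>p. complex_of_real (damp n (snd p)) * weyl_kernel a f H p) \<in> borel_measurable lborel" for n
      by (simp add: borel_prod)
    show "AE p in lborel. (\<lambda>n. of_real (damp n (snd p)) * weyl_kernel a f H p) \<longlonglongrightarrow> weyl_kernel a f H p"
    proof (rule AE_I2)
      fix p :: "(real^('m + 'm)) \<times> (real^('m + 'm))"
      have "(\<lambda>n. of_real (damp n (snd p)) * weyl_kernel a f H p) \<longlonglongrightarrow> of_real 1 * weyl_kernel a f H p"
        by (intro tendsto_intros damp1)
      then show "(\<lambda>n. of_real (damp n (snd p)) * weyl_kernel a f H p) \<longlonglongrightarrow> weyl_kernel a f H p" by simp
    qed
    show "AE p in lborel. norm (of_real (damp n (snd p)) * weyl_kernel a f H p) \<le> cmod (weyl_kernel a f H p)" for n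
      by (intro AE_I2) (simp add: norm_mult abs_of_pos[OF damp_bounds(1)] mult_left_le_one_le less_imp_le[OF damp_bounds(1)] damp_bounds(2))
  qed
  have "(\<lambda>n. ?k * (LINT p|lborel. of_real (damp n (snd p)) * weyl_kernel a f H p)) \<longlonglongrightarrow> ?k * integral\<^sup>L lborel (weyl_kernel a f H)"
    by (intro tendsto_mult_left lim2)
  moreover have "(\<lambda>n. ?k * (LINT p|lborel. of_real (damp n (snd p)) * weyl_kernel a f H p)) \<longlonglongrightarrow> ?c * (LINT x|lborel. cnj (H x) * weyl_fun a f x)"
    unfolding weyl_pairing_cutoff[OF a fL HL] I_def[symmetric] by (intro tendsto_mult_left lim1)
  ultimately have "?k * integral\<^sup>L lborel (weyl_kernel a f H) = ?c * (LINT x|lborel. cnj (H x) * weyl_fun a f x)"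
    by (rule LIMSEQ_unique)
  then have "?k * integral\<^sup>L lborel (weyl_kernel a f H) = ?c * L2_inner (weyl_fun a f) H"
    unfolding L2_inner_def by (simp only: mult.commute)
  moreover have "?c \<noteq> 0" by simp
  \<comment> \<open>The normalising integral in \<open>weyl_form\<close> is \<open>?c\<close> by
    \<open>integral_gauss2_square\<close>.\<close>
  moreover have "weyl_form a f H = (?k / ?c) * integral\<^sup>L lborel (weyl_kernel a f H)"
    unfolding weyl_form_def integral_gauss2_square of_real_divide[of "(1 / sqrt 2)^CARD('m)"] ..
  moreover have "y = (k / c) * z" if "k * z = c * y" "c \<noteq> 0" for k c y z :: complex
    using that by (simp add: field_simps)
  ultimately show ?thesis by simp
qed

section \<open>Density of Schwartz functions in \<open>L\<^sup>2\<close>\<close>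

definition approximable :: "(real^'m::finite \<Rightarrow> complex) \<Rightarrow> bool" where
  "approximable f \<longleftrightarrow> f \<in> L2 \<and> (\<forall>e>0. \<exists>g\<in>schwartz. L2_norm (\<lambda>x. f x - g x) < e)"

lemma schwartz_add: "f \<in> schwartz \<Longrightarrow> g \<in> schwartz \<Longrightarrow> (\<lambda>x. f x + g x) \<in> schwartz"
  unfolding schwartz_iff by (rule unif_smooth_add)

lemma schwartz_cmult: "f \<in> schwartz \<Longrightarrow> (\<lambda>x. c * f x) \<in> schwartz"
  unfolding schwartz_iff by (rule unif_smooth_cmult)

lemma approximable_schwartz: "f \<in> schwartz \<Longrightarrow> approximable f"
  unfolding approximable_def using schwartz_L2 by (auto intro!: bexI[of _ f] simp: L2_norm_def)

lemma approximable_zero: "approximable (\<lambda>x::real^'m::finite. 0)"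
  using approximable_schwartz[OF schwartz_cmult[OF schwartz_gauss2, of 0]] by simp

lemma approximable_limit:
  assumes "\<And>n. approximable (s n)" "f \<in> L2" "(\<lambda>n. L2_norm (\<lambda>x. s n x - f x)) \<longlonglongrightarrow> 0"
  shows "approximable f"
  unfolding approximable_def
proof (intro conjI allI impI)
  fix e :: real assume e: "0 < e"
  obtain n where n: "L2_norm (\<lambda>x. s n x - f x) < e / 2"
    using order_tendstoD(2)[OF assms(3), of "e / 2"] e by (auto simp: eventually_sequentially)
  obtain g where g: "g \<in> schwartz" "L2_norm (\<lambda>x. s n x - g x) < e / 2"
    using assms(1)[of n] e unfolding approximable_def by (meson half_gt_zero)
  have sn: "s n \<in> L2" using assms(1) by (simp add: approximable_def)
  have "L2_norm (\<lambda>x. f x - g x) \<le> L2_norm (\<lambda>x. f x - s n x) + L2_norm (\<lambda>x. s n x - g x)"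
    by (rule L2_norm_triangle_diff[OF assms(2) sn schwartz_L2[OF g(1)]])
  then have "L2_norm (\<lambda>x. f x - g x) < e"
    using n g(2) L2_norm_minus_commute[of f "s n"] by linarith
  then show "\<exists>g\<in>schwartz. L2_norm (\<lambda>x. f x - g x) < e" using g(1) by blast
qed fact

lemma approximable_sequence:
  assumes "approximable f"
  obtains s where "\<And>n. s n \<in> schwartz" "(\<lambda>n. L2_norm (\<lambda>x. s n x - f x)) \<longlonglongrightarrow> 0"
proof -
  have "\<exists>g. g \<in> schwartz \<and> L2_norm (\<lambda>x. f x - g x) < 1 / real (Suc n)" for n
    using assms unfolding approximable_def by (metis divide_pos_pos of_nat_0_less_iff zero_less_Suc zero_less_one)
  then obtain s where s: "\<And>n. s n \<in> schwartz" "\<And>n. L2_norm (\<lambda>x. f x - s n x) < 1 / real (Suc n)" by metis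
  have "(\<lambda>n. L2_norm (\<lambda>x. s n x - f x)) \<longlonglongrightarrow> 0"
  proof (rule Lim_null_comparison)
    show "\<forall>\<^sub>F n in sequentially. norm (L2_norm (\<lambda>x. s n x - f x)) \<le> 1 / real (Suc n)"
    proof (rule always_eventually, rule allI)
      fix n
      show "norm (L2_norm (\<lambda>x. s n x - f x)) \<le> 1 / real (Suc n)"
        unfolding L2_norm_minus_commute[of "s n" f] real_norm_def abs_of_nonneg[OF L2_norm_nonneg]
        by (rule less_imp_le[OF s(2)])
    qed
    show "(\<lambda>n. 1 / real (Suc n)) \<longlonglongrightarrow> 0"
      using LIMSEQ_inverse_real_of_nat by (simp add: inverse_eq_divide)
  qed
  with s(1) that show ?thesis by blast
qed

lemma approximable_add:
  assumes f: "approximable f" and g: "approximable g"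
  shows "approximable (\<lambda>x. f x + g x)"
proof -
  obtain s where s: "\<And>n. s n \<in> schwartz" "(\<lambda>n. L2_norm (\<lambda>x. s n x - f x)) \<longlonglongrightarrow> 0"
    using approximable_sequence[OF f] by blast
  obtain t where t: "\<And>n. t n \<in> schwartz" "(\<lambda>n. L2_norm (\<lambda>x. t n x - g x)) \<longlonglongrightarrow> 0"
    using approximable_sequence[OF g] by blast
  have fg: "f \<in> L2" "g \<in> L2" using f g by (simp_all add: approximable_def)
  show ?thesis
  proof (rule approximable_limit)
    show "approximable (\<lambda>x. s n x + t n x)" for n by (intro approximable_schwartz schwartz_add s t)
    show "(\<lambda>x. f x + g x) \<in> L2" by (intro L2_add fg)
    show "(\<lambda>n. L2_norm (\<lambda>x. s n x + t n x - (f x + g x))) \<longlonglongrightarrow> 0"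
    proof (rule Lim_null_comparison)
      have "L2_norm (\<lambda>x. s n x + t n x - (f x + g x)) \<le> L2_norm (\<lambda>x. s n x - f x) + L2_norm (\<lambda>x. t n x - g x)" for n
        using L2_norm_triangle[OF L2_diff[OF schwartz_L2[OF s(1)] fg(1)] L2_diff[OF schwartz_L2[OF t(1)] fg(2)]]
        by (simp add: algebra_simps)
      then show "\<forall>\<^sub>F n in sequentially. norm (L2_norm (\<lambda>x. s n x + t n x - (f x + g x))) \<le> L2_norm (\<lambda>x. s n x - f x) + L2_norm (\<lambda>x. t n x - g x)"
        by simp
      show "(\<lambda>n. L2_norm (\<lambda>x. s n x - f x) + L2_norm (\<lambda>x. t n x - g x)) \<longlonglongrightarrow> 0"
        using tendsto_add[OF s(2) t(2)] by simp
    qed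
  qed
qed

lemma approximable_cmult:
  assumes f: "approximable f"
  shows "approximable (\<lambda>x. c * f x)"
proof -
  obtain s where s: "\<And>n. s n \<in> schwartz" "(\<lambda>n. L2_norm (\<lambda>x. s n x - f x)) \<longlonglongrightarrow> 0"
    using approximable_sequence[OF f] by blast
  show ?thesis
  proof (rule approximable_limit)
    show "approximable (\<lambda>x. c * s n x)" for n by (intro approximable_schwartz schwartz_cmult s)
    show "(\<lambda>x. c * f x) \<in> L2" using f by (simp add: approximable_def L2_cmult)
    have "L2_norm (\<lambda>x. c * s n x - c * f x) = cmod c * L2_norm (\<lambda>x. s n x - f x)" for n
      unfolding right_diff_distrib[symmetric] by (rule L2_norm_cmult)
    then show "(\<lambda>n. L2_norm (\<lambda>x. c * s n x - c * f x)) \<longlonglongrightarrow> 0"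
      using tendsto_mult_left[OF s(2), of "cmod c"] by simp
  qed
qed

lemma approximable_sum:
  "finite S \<Longrightarrow> (\<And>i. i \<in> S \<Longrightarrow> approximable (f i)) \<Longrightarrow> approximable (\<lambda>x. \<Sum>i\<in>S. f i x)"
  by (induction S rule: finite_induct) (auto intro: approximable_add approximable_zero)

lemma L2_indicator:
  assumes "A \<in> sets borel" "bounded A"
  shows "(\<lambda>x. indicator A x :: complex) \<in> L2"
proof -
  obtain R where R: "\<And>x. x \<in> A \<Longrightarrow> norm x \<le> R" using assms(2) by (auto simp: bounded_iff)
  have "tame (\<lambda>x. indicator A x :: complex)"
    unfolding tame_def
  proof
    show "(\<lambda>x. indicator A x :: complex) \<in> borel_measurable borel" using assms(1) by simp
    show "\<exists>R. \<forall>x. cmod (indicator A x) \<le> R \<and> (norm x > R \<longrightarrow> (indicator A x :: complex) = 0)"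
    proof (intro exI[of _ "max 1 R"] allI)
      fix x
      show "cmod (indicator A x) \<le> max 1 R \<and> (norm x > max 1 R \<longrightarrow> (indicator A x :: complex) = 0)"
        using R[of x] by (cases "x \<in> A") auto
    qed
  qed
  then show ?thesis by (rule tame_L2)
qed

text \<open>In coordinates t_j that map the box to the open cube |t_j| < 1, the Schwartz function
  with exponent - sum_j t_j^(2n+2) tends to 1 inside and to 0 outside the closed box. The first
  function of the sequence dominates all others up to the factor \<open>exp m\<close>.\<close>

lemma approximable_box:
  fixes l u :: "real^'m::finite"
  shows "approximable (\<lambda>x. indicator (box l u) x)"
proof (cases "\<forall>j. l $ j < u $ j")
  case False
  then have "box l u = {}" by (auto simp: interval_eq_empty_cart not_less)
  then show ?thesis using approximable_zero by simp
next
  case True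
  define c where "c j = (l $ j + u $ j) / 2" for j
  define r where "r j = (u $ j - l $ j) / 2" for j
  have r: "0 < r j" for j using True by (simp add: r_def)
  define t where "t j x = (x $ j - c j) / r j" for j and x :: "real^'m"
  have t_box: "x \<in> box l u \<longleftrightarrow> (\<forall>j. \<bar>t j x\<bar> < 1)" for x
  proof -
    have "\<bar>t j x\<bar> < 1 \<longleftrightarrow> l $ j < x $ j \<and> x $ j < u $ j" for j
      using r[of j] unfolding t_def abs_divide abs_of_pos[OF r] pos_divide_less_eq[OF r] abs_less_iff
      by (auto simp: c_def r_def field_simps)
    then show ?thesis by (auto simp: mem_box_cart)
  qed
  have t_cbox: "x \<in> cbox l u \<longleftrightarrow> (\<forall>j. \<bar>t j x\<bar> \<le> 1)" for x
  proof -
    have "\<bar>t j x\<bar> \<le> 1 \<longleftrightarrow> l $ j \<le> x $ j \<and> x $ j \<le> u $ j" for j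
      using r[of j] unfolding t_def abs_divide abs_of_pos[OF r] pos_divide_le_eq[OF r] abs_le_iff
      by (auto simp: c_def r_def field_simps)
    then show ?thesis by (auto simp: mem_box_cart)
  qed
  define P where "P n x = (\<Sum>j\<in>UNIV. (t j x)^(2 * Suc n))" for n x
  have Ppoly: "real_polynomial_function (P n)" for n
    unfolding P_def t_def
    by (intro real_polynomial_function_sum real_polynomial_function_power real_polynomial_function_divide
        real_polynomial_function_diff real_polynomial_function_nth real_polynomial_function.intros(2)) simp
  define m where "m = real CARD('m)"
  \<comment> \<open>Comparison of every exponent with the quadratic one. It gives both the lower
    bound asked of a Schwartz exponent and the domination by \<open>g 0\<close>.\<close>
  have t_pow: "(t j x)\<^sup>2 - 1 \<le> (t j x)^(2 * Suc n)" for j x n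
  proof (cases "(t j x)\<^sup>2 \<le> 1")
    case True
    moreover have "0 \<le> (t j x)^(2 * Suc n)" by (rule zero_le_even_power) simp
    ultimately show ?thesis by linarith
  next
    case False
    then have "((t j x)\<^sup>2)^1 \<le> ((t j x)\<^sup>2)^(Suc n)" by (intro power_increasing) auto
    then show ?thesis unfolding power_mult power_one_right by linarith
  qed
  have P1: "P 0 x - m \<le> P n x" for n x
  proof -
    have "(\<Sum>j\<in>UNIV. (t j x)\<^sup>2 - 1) \<le> P n x" unfolding P_def by (intro sum_mono t_pow)
    then show ?thesis by (simp add: P_def sum_subtractf m_def numeral_2_eq_2)
  qed
  define R where "R = (\<Sum>j\<in>UNIV. r j)"
  have rR: "r j \<le> R" for j unfolding R_def by (rule member_le_sum) (auto intro: less_imp_le r)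
  have R: "0 < R" using r rR by (metis less_le_trans)
  define b where "b = (\<Sum>j\<in>UNIV. (c j)\<^sup>2 / (r j)\<^sup>2)"
  \<comment> \<open>From (x_j - c_j)^2 >= x_j^2 / 2 - c_j^2 and r_j <= R; hence the coefficient 1 /
    (2 R^2).\<close>
  have P0: "1 / (2 * R\<^sup>2) * (norm x)\<^sup>2 - b \<le> P 0 x" for x
  proof -
    have "1 / (2 * R\<^sup>2) * (x $ j)\<^sup>2 - (c j)\<^sup>2 / (r j)\<^sup>2 \<le> (t j x)^(2 * Suc 0)" for j
    proof -
      have "(x $ j)\<^sup>2 / (2 * R\<^sup>2) \<le> (x $ j)\<^sup>2 / (2 * (r j)\<^sup>2)"
        using r[of j] rR[of j] R by (intro divide_left_mono mult_left_mono power_mono mult_pos_pos) auto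
      moreover have "(x $ j)\<^sup>2 / 2 - (c j)\<^sup>2 \<le> (x $ j - c j)\<^sup>2"
        using sum_power2_ge_zero[of "x $ j - 2 * c j" 0] by (simp add: power2_eq_square algebra_simps)
      then have "((x $ j)\<^sup>2 / 2 - (c j)\<^sup>2) / (r j)\<^sup>2 \<le> (x $ j - c j)\<^sup>2 / (r j)\<^sup>2"
        by (intro divide_right_mono) auto
      then have "(x $ j)\<^sup>2 / (2 * (r j)\<^sup>2) - (c j)\<^sup>2 / (r j)\<^sup>2 \<le> (x $ j - c j)\<^sup>2 / (r j)\<^sup>2"
        by (simp add: diff_divide_distrib)
      moreover have "(t j x)^(2 * Suc 0) = (x $ j - c j)\<^sup>2 / (r j)\<^sup>2"
        by (simp add: t_def power_divide)
      ultimately show ?thesis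
        by simp
    qed
    then have "(\<Sum>j\<in>UNIV. 1 / (2 * R\<^sup>2) * (x $ j)\<^sup>2 - (c j)\<^sup>2 / (r j)\<^sup>2) \<le> P 0 x"
      unfolding P_def by (intro sum_mono)
    then show ?thesis
      by (simp add: sum_subtractf sum_distrib_left[symmetric] norm_square_vec b_def sum_divide_distrib[symmetric])
  qed
  have Plow: "1 / (2 * R\<^sup>2) * (norm x)\<^sup>2 - (b + m) \<le> P n x" for n x
    using P0[of x] P1[of x n] by linarith
  define g where "g n x = complex_of_real (exp (- P n x))" for n x
  have gS: "g n \<in> schwartz" for n
    using schwartz_polynomial_exp[OF real_polynomial_function.intros(2)[of 1] Ppoly _ Plow] R
    by (simp add: g_def[abs_def])
  show ?thesis
  proof (rule approximable_limit[of g])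
    show "approximable (g n)" for n by (rule approximable_schwartz[OF gS])
    show "(\<lambda>x. indicator (box l u) x :: complex) \<in> L2" by (rule L2_indicator) auto
    show "(\<lambda>n. L2_norm (\<lambda>x. g n x - indicator (box l u) x)) \<longlonglongrightarrow> 0"
    proof (rule L2_dominated_convergence[where g="\<lambda>x. of_real (exp m) * g 0 x"])
      show "(\<lambda>x. of_real (exp m) * g 0 x) \<in> L2" by (intro L2_cmult schwartz_L2 gS)
      show "g n \<in> borel_measurable borel" for n by (rule schwartz_measurable[OF gS])
      \<comment> \<open>On the boundary of the box the limit is neither 0 nor 1, but the boundary
        has measure zero.\<close>
      have "emeasure lborel (cbox l u - box l u) = emeasure lborel (cbox l u) - emeasure lborel (box l u)"
        by (rule emeasure_Diff) (auto simp: box_subset_cbox emeasure_lborel_box_eq)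
      also have "\<dots> = 0" by (simp add: emeasure_lborel_box_eq emeasure_lborel_cbox_eq)
      finally have "AE x in lborel. x \<notin> cbox l u - box l u"
        by (intro AE_not_in) (simp add: null_sets_def)
      then show "AE x in lborel. (\<lambda>n. g n x) \<longlonglongrightarrow> indicator (box l u) x"
      proof eventually_elim
        case (elim x)
        show ?case
        proof (cases "x \<in> box l u")
          case True
          have "(\<lambda>n. (t j x)^(2 * Suc n)) \<longlonglongrightarrow> 0" for j
          proof -
            have "\<bar>(t j x)\<^sup>2\<bar> < 1" using True t_box abs_square_less_1[of "t j x"] by auto
            then have "(\<lambda>n. ((t j x)\<^sup>2)^n) \<longlonglongrightarrow> 0" by (intro LIMSEQ_power_zero) simp
            then have "(\<lambda>n. ((t j x)\<^sup>2)^Suc n) \<longlonglongrightarrow> 0" by (rule LIMSEQ_Suc)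
            then show ?thesis by (simp only: power_mult)
          qed
          then have "(\<lambda>n. P n x) \<longlonglongrightarrow> (\<Sum>j\<in>(UNIV::'m set). 0)"
            unfolding P_def by (intro tendsto_sum)
          then have "(\<lambda>n. complex_of_real (exp (- P n x))) \<longlonglongrightarrow> of_real (exp (- 0))"
            by (intro tendsto_intros) simp
          then show ?thesis using True by (simp add: g_def)
        next
          case False
          with elim obtain j where j: "1 < \<bar>t j x\<bar>" using t_cbox by (auto simp: not_le)
          then have j2: "1 < (t j x)\<^sup>2" using one_less_power[of "\<bar>t j x\<bar>" 2] by simp
          have "norm (g n x) \<le> inverse (((t j x)\<^sup>2) ^ n)" for n
          proof -
            have "((t j x)\<^sup>2)^n \<le> ((t j x)\<^sup>2)^Suc n" using j2 by (intro power_increasing) auto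
            also have "\<dots> = (t j x)^(2 * Suc n)" by (simp only: power_mult)
            also have "\<dots> \<le> P n x" unfolding P_def by (rule member_le_sum[OF _ zero_le_even_power]) simp_all
            also have "\<dots> \<le> exp (P n x)" using exp_ge_add_one_self[of "P n x"] by linarith
            finally have "((t j x)\<^sup>2)^n \<le> exp (P n x)" .
            moreover have "0 < ((t j x)\<^sup>2)^n" by (rule zero_less_power) (use j2 in linarith)
            ultimately show ?thesis unfolding g_def norm_of_real by (simp add: exp_minus le_imp_inverse_le)
          qed
          moreover have "(\<lambda>n. inverse (((t j x)\<^sup>2) ^ n)) \<longlonglongrightarrow> 0" by (rule LIMSEQ_inverse_realpow_zero[OF j2])
          ultimately have "(\<lambda>n. g n x) \<longlonglongrightarrow> 0"
            by (intro Lim_null_comparison[of "\<lambda>n. g n x"]) (auto intro: always_eventually)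
          then show ?thesis using False by simp
        qed
      qed
      show "cmod (g n x - indicator (box l u) x) \<le> cmod (of_real (exp m) * g 0 x)" for n x
      proof -
        have 1: "exp (- P n x) \<le> exp m * exp (- P 0 x)"
          unfolding exp_add[symmetric] using P1[of x n] by simp
        have 2: "indicator (box l u) x \<le> exp m * exp (- P 0 x)"
        proof (cases "x \<in> box l u")
          case True
          have "(t j x)^(2 * Suc 0) \<le> 1" for j
          proof -
            have "\<bar>t j x\<bar> \<le> 1" using True t_box by (blast intro: less_imp_le)
            then have "(t j x)\<^sup>2 \<le> 1" by (simp only: abs_square_le_1)
            then show ?thesis by simp
          qed
          then have "P 0 x \<le> (\<Sum>j\<in>(UNIV::'m set). 1)"
            unfolding P_def by (intro sum_mono)
          then show ?thesis unfolding exp_add[symmetric] by (simp add: m_def True)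
        qed simp
        have "\<bar>exp (- P n x) - indicator (box l u) x\<bar> \<le> exp m * exp (- P 0 x)"
          using 1 2 exp_gt_zero[of "- P n x"] indicator_pos_le[of "box l u" x, where 'a=real] by linarith
        moreover have "g n x - indicator (box l u) x = of_real (exp (- P n x) - indicator (box l u) x)"
          by (simp add: g_def indicator_def)
        ultimately show ?thesis
          by (simp only: norm_of_real norm_mult g_def abs_exp_cancel)
      qed
    qed simp
  qed
qed

text \<open>Induction over the Borel sets generated by the intersection-stable family of boxes. The
  fixed box \<open>box l u\<close> keeps every set bounded, so that complements give functions in
  L2.\<close>

lemma approximable_indicator:
  fixes A :: "(real^'m::finite) set"
  assumes A: "A \<in> sets borel"
  shows "approximable (\<lambda>x. indicator (A \<inter> box l u) x)"
proof -
  let ?E = "range (\<lambda>(a, b). box a b :: (real^'m) set)"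
  have "Int_stable ?E" by (auto simp: Int_stable_def box_Int_box)
  moreover have "?E \<subseteq> Pow UNIV" by simp
  moreover have "A \<in> sigma_sets UNIV ?E" using A by (simp add: borel_eq_box)
  ultimately show ?thesis
  proof (induction rule: sigma_sets_induct_disjoint)
    case (basic A)
    then obtain a b where "A = box a b" by auto
    then show ?case by (simp add: box_Int_box approximable_box)
  next
    case empty
    then show ?case by (simp add: approximable_zero)
  next
    case (compl A)
    have "(\<lambda>x. indicator ((UNIV - A) \<inter> box l u) x :: complex) = (\<lambda>x. indicator (box l u) x + (-1) * indicator (A \<inter> box l u) x)"
      by (auto simp: indicator_def)
    then show ?case using approximable_add[OF approximable_box approximable_cmult[OF compl(2), of "-1"]] by simp
  next
    case (union A)
    have mA: "A i \<in> sets borel" for i using union(2) by (auto simp: borel_eq_box)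
    let ?s = "\<lambda>n x. \<Sum>i<n. indicator (A i \<inter> box l u) x :: complex"
    have s: "?s n x = indicator ((\<Union>i<n. A i) \<inter> box l u) x" for n x
    proof -
      have "disjoint_family_on A {..<n}" using union(1) by (rule disjoint_family_on_mono[rotated]) simp
      then have "(\<Sum>i<n. indicator (A i) x :: complex) = indicator (\<Union>i<n. A i) x"
        by (subst indicator_UN_disjoint) auto
      then show ?thesis by (simp add: indicator_inter_arith sum_distrib_right[symmetric])
    qed
    show ?case
    proof (rule approximable_limit[of ?s])
      show "approximable (?s n)" for n by (intro approximable_sum union) simp
      show "(\<lambda>x. indicator ((\<Union>i. A i) \<inter> box l u) x :: complex) \<in> L2"
        using mA by (intro L2_indicator) (auto intro: bounded_subset[OF bounded_box])
      show "(\<lambda>n. L2_norm (\<lambda>x. ?s n x - indicator ((\<Union>i. A i) \<inter> box l u) x)) \<longlonglongrightarrow> 0"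
        unfolding s
      proof (rule L2_dominated_convergence[where g="\<lambda>x. indicator (box l u) x"])
        show "(\<lambda>x. indicator (box l u) x :: complex) \<in> L2" by (rule L2_indicator) auto
        show "AE x in lborel. (\<lambda>n. indicator ((\<Union>i<n. A i) \<inter> box l u) x :: complex) \<longlonglongrightarrow> indicator ((\<Union>i. A i) \<inter> box l u) x"
        proof (rule AE_I2, rule tendsto_eventually)
          fix x
          show "\<forall>\<^sub>F n in sequentially. (indicator ((\<Union>i<n. A i) \<inter> box l u) x :: complex) = indicator ((\<Union>i. A i) \<inter> box l u) x"
          proof (cases "x \<in> (\<Union>i. A i)")
            case True
            then obtain i where "x \<in> A i" by blast
            show ?thesis
            proof (rule eventually_mono[OF eventually_gt_at_top[of i]])
              fix n assume "i < n"
              then have "x \<in> (\<Union>i<n. A i)" using \<open>x \<in> A i\<close> by blast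
              then show "(indicator ((\<Union>i<n. A i) \<inter> box l u) x :: complex) = indicator ((\<Union>i. A i) \<inter> box l u) x"
                using True by (simp only: indicator_inter_arith indicator_simps)
            qed
          qed (auto simp: indicator_def)
        qed
        show "cmod (indicator ((\<Union>i<n. A i) \<inter> box l u) x - indicator ((\<Union>i. A i) \<inter> box l u) x) \<le> cmod (indicator (box l u) x)" for n x
          by (auto simp: indicator_def)
      qed (use mA in auto)
    qed
  qed
qed

text \<open>Truncations reduce to bounded functions with bounded support, dominated simple functions
  reduce these to level sets, and the level sets are handled by
  \<open>approximable_indicator\<close>.\<close>

lemma approximable_L2:
  fixes f :: "real^'m::finite \<Rightarrow> complex"
  assumes f: "f \<in> L2"
  shows "approximable f"
proof (rule approximable_limit[OF _ f truncate_L2_tendsto[OF f]])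
  fix n
  let ?h = "truncate n f"
  have h: "tame ?h" by (rule tame_truncate[OF L2_measurable[OF f]])
  obtain R where R: "R \<ge> 0" "\<And>x. cmod (?h x) \<le> R * indicator (cball 0 R) x" using tame_bound[OF h] by blast
  obtain l u :: "real^'m" where lu: "cball 0 R \<subseteq> box l u" using bounded_subset_box_symmetric[OF bounded_cball] by blast
  obtain F where F: "\<And>i. simple_function lborel (F i)" "\<And>x. (\<lambda>i. F i x) \<longlonglongrightarrow> ?h x" "\<And>i x. dist (F i x) 0 \<le> 2 * dist (?h x) 0"
    using borel_measurable_implies_sequence_metric[of ?h lborel 0] tame_measurable[OF h] by auto
  have Fm: "F i \<in> borel_measurable borel" for i
    using borel_measurable_simple_function[OF F(1)] by simp
  show "approximable ?h"
  proof (rule approximable_limit[of F])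
    show "approximable (F i)" for i
    proof -
      let ?Y = "F i ` UNIV"
      have fin: "finite ?Y" using simple_functionD(1)[OF F(1)] by simp
      have eq: "F i x = (\<Sum>y\<in>?Y. y * indicator (F i -` {y} \<inter> box l u) x)" for x
      proof (cases "x \<in> box l u")
        case True
        have "(\<Sum>y\<in>?Y. y * indicator (F i -` {y} \<inter> box l u) x) = (\<Sum>y\<in>?Y. if y = F i x then y else 0)"
          using True by (intro sum.cong) (auto simp: indicator_def)
        then show ?thesis using fin by simp
      next
        case False
        \<comment> \<open>Outside the box the truncation vanishes, and the distance bound forces the
          simple function to vanish as well, so its level sets may be cut by the box.\<close>
        then have "x \<notin> cball 0 R" using lu by blast
        then have "?h x = 0" using R(2)[of x] by simp
        then have "F i x = 0" using F(3)[of i x] by simp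
        then show ?thesis using False by simp
      qed
      have "approximable (\<lambda>x. \<Sum>y\<in>?Y. y * indicator (F i -` {y} \<inter> box l u) x)"
        using measurable_sets[OF Fm, of "{_}"] by (intro approximable_sum fin approximable_cmult approximable_indicator) simp
      then show ?thesis unfolding eq[symmetric] .
    qed
    show "?h \<in> L2" by (rule tame_L2[OF h])
    show "(\<lambda>i. L2_norm (\<lambda>x. F i x - ?h x)) \<longlonglongrightarrow> 0"
    proof (rule L2_dominated_convergence[where g="\<lambda>x. 3 * ?h x"])
      show "(\<lambda>x. 3 * ?h x) \<in> L2" by (rule L2_cmult[OF tame_L2[OF h]])
      show "cmod (F i x - ?h x) \<le> cmod (3 * ?h x)" for i x
        using norm_triangle_ineq4[of "F i x" "?h x"] F(3)[of i x] by (simp add: norm_mult)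
    qed (use Fm F(2) tame_measurable[OF h] in auto)
  qed
qed

lemma schwartz_dense:
  fixes f :: "real^'m::finite \<Rightarrow> complex"
  assumes "f \<in> L2"
  obtains s where "\<And>n. s n \<in> schwartz" "(\<lambda>n. L2_norm (\<lambda>x. s n x - f x)) \<longlonglongrightarrow> 0"
  using approximable_sequence[OF approximable_L2[OF assms]] by blast

section \<open>The Weyl operator on \<open>L\<^sup>2\<close>\<close>

lemma L2_inner_cnj_commute: "L2_inner f g = cnj (L2_inner g f)"
proof -
  have "L2_inner f g = (LINT x|lborel. cnj (g x * cnj (f x)))"
    by (simp add: L2_inner_def mult.commute)
  also have "\<dots> = cnj (L2_inner g f)"
    unfolding L2_inner_def by (rule Bochner_Integration.integral_cnj)
  finally show ?thesis .
qed

lemma L2_inner_tendsto_right: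
  assumes s: "\<And>n. s n \<in> L2" and f: "f \<in> L2" and h: "h \<in> L2" and lim: "(\<lambda>n. L2_norm (\<lambda>x. s n x - f x)) \<longlonglongrightarrow> 0"
  shows "(\<lambda>n. L2_inner h (s n)) \<longlonglongrightarrow> L2_inner h f"
proof -
  have "(\<lambda>n. cnj (L2_inner (s n) h)) \<longlonglongrightarrow> cnj (L2_inner f h)"
    by (rule tendsto_cnj[OF L2_inner_tendsto_left[OF s f h lim]])
  then show ?thesis
    by (simp only: L2_inner_cnj_commute[symmetric])
qed

lemma weyl_form_tendsto_left:
  assumes a: "a \<in> S000" and s: "\<And>n. s n \<in> L2" and f: "f \<in> L2" and h: "h \<in> L2"
    and lim: "(\<lambda>n. L2_norm (\<lambda>x. s n x - f x)) \<longlonglongrightarrow> 0"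
  shows "(\<lambda>n. weyl_form a (s n) h) \<longlonglongrightarrow> weyl_form a f h"
proof -
  obtain C where C: "\<And>P H. P \<in> L2 \<Longrightarrow> H \<in> L2 \<Longrightarrow> cmod (weyl_form a P H) \<le> C * (L2_norm P * L2_norm H)"
    using weyl_form_bound[OF a] by blast
  show ?thesis
  proof (rule Lim_null_comparison[THEN Lim_null[THEN iffD2]])
    show "\<forall>\<^sub>F n in sequentially. norm (weyl_form a (s n) h - weyl_form a f h) \<le> C * (L2_norm (\<lambda>x. s n x - f x) * L2_norm h)"
      using C[OF L2_diff[OF s f] h] by (simp add: weyl_form_diff_left[OF a s f h])
    show "(\<lambda>n. C * (L2_norm (\<lambda>x. s n x - f x) * L2_norm h)) \<longlonglongrightarrow> 0"
      using tendsto_mult_left[OF tendsto_mult_right[OF lim, of "L2_norm h"], of C] by simp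
  qed
qed

lemma weyl_form_tendsto_right:
  assumes a: "a \<in> S000" and s: "\<And>n. s n \<in> L2" and f: "f \<in> L2" and h: "h \<in> L2"
    and lim: "(\<lambda>n. L2_norm (\<lambda>x. s n x - f x)) \<longlonglongrightarrow> 0"
  shows "(\<lambda>n. weyl_form a h (s n)) \<longlonglongrightarrow> weyl_form a h f"
proof -
  obtain C where C: "\<And>P H. P \<in> L2 \<Longrightarrow> H \<in> L2 \<Longrightarrow> cmod (weyl_form a P H) \<le> C * (L2_norm P * L2_norm H)"
    using weyl_form_bound[OF a] by blast
  show ?thesis
  proof (rule Lim_null_comparison[THEN Lim_null[THEN iffD2]])
    show "\<forall>\<^sub>F n in sequentially. norm (weyl_form a h (s n) - weyl_form a h f) \<le> C * (L2_norm h * L2_norm (\<lambda>x. s n x - f x))"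
      using C[OF h L2_diff[OF s f]] by (simp add: weyl_form_diff_right[OF a h s f])
    show "(\<lambda>n. C * (L2_norm h * L2_norm (\<lambda>x. s n x - f x))) \<longlonglongrightarrow> 0"
      using tendsto_mult_left[OF tendsto_mult_left[OF lim, of "L2_norm h"], of C] by simp
  qed
qed

lemma weyl_fun_L2:
  assumes a: "a \<in> S000" and f: "f \<in> schwartz"
  shows "weyl_fun a f \<in> L2"
proof -
  obtain C where C: "C \<ge> 0" "\<And>P H. P \<in> L2 \<Longrightarrow> H \<in> L2 \<Longrightarrow> cmod (weyl_form a P H) \<le> C * (L2_norm P * L2_norm H)"
    using weyl_form_bound[OF a] by blast
  show ?thesis
  proof (rule L2_dual_bound(1)[where C="C * L2_norm f"])
    show "weyl_fun a f \<in> borel_measurable borel"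
      using S000_measurable[OF a] schwartz_measurable[OF f] by measurable
    show "cmod (L2_inner (weyl_fun a f) h) \<le> C * L2_norm f * L2_norm h" if "tame h" for h
      using C(2)[OF schwartz_L2[OF f] tame_L2[OF that]] by (simp add: weyl_fun_pairing[OF a f that] mult.assoc)
  qed (use C(1) in simp)
qed

lemma weyl_fun_inner:
  assumes a: "a \<in> S000" and f: "f \<in> schwartz" and h: "h \<in> L2"
  shows "L2_inner (weyl_fun a f) h = weyl_form a f h"
proof (rule LIMSEQ_unique)
  note t = tame_truncate[OF L2_measurable[OF h]]
  show "(\<lambda>n. L2_inner (weyl_fun a f) (truncate n h)) \<longlonglongrightarrow> L2_inner (weyl_fun a f) h"
    by (intro L2_inner_tendsto_right tame_L2 t h weyl_fun_L2 a f truncate_L2_tendsto)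
  show "(\<lambda>n. L2_inner (weyl_fun a f) (truncate n h)) \<longlonglongrightarrow> weyl_form a f h"
    unfolding weyl_fun_pairing[OF a f t]
    by (intro weyl_form_tendsto_right tame_L2 t h schwartz_L2 a f truncate_L2_tendsto)
qed

text \<open>The representing function is constructed as a limit. For Schwartz functions approaching
  \<open>f\<close> their images under \<open>weyl_fun\<close> are Cauchy, by the bound on the form
  and \<open>L2_dual_bound\<close>, and the form is continuous in its first argument.\<close>

lemma weyl_form_represented:
  fixes a :: "real^('m::finite + 'm) \<Rightarrow> complex"
  assumes a: "a \<in> S000" and f: "f \<in> L2"
  shows "\<exists>F\<in>L2. \<forall>h\<in>L2. L2_inner F h = weyl_form a f h"
proof -
  obtain C where C: "C \<ge> 0" "\<And>P H. P \<in> L2 \<Longrightarrow> H \<in> L2 \<Longrightarrow> cmod (weyl_form a P H) \<le> C * (L2_norm P * L2_norm H)"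
    using weyl_form_bound[OF a] by blast
  obtain s where s: "\<And>n. s n \<in> schwartz" "(\<lambda>n. L2_norm (\<lambda>x. s n x - f x)) \<longlonglongrightarrow> 0"
    using schwartz_dense[OF f] by blast
  note sL = schwartz_L2[OF s(1)] and wL = weyl_fun_L2[OF a s(1)]
  have diff: "L2_norm (\<lambda>x. weyl_fun a (s m) x - weyl_fun a (s n) x) \<le> C * L2_norm (\<lambda>x. s m x - s n x)" for m n
  proof (rule L2_dual_bound(2))
    show "(\<lambda>x. weyl_fun a (s m) x - weyl_fun a (s n) x) \<in> borel_measurable borel"
      by (rule L2_measurable[OF L2_diff[OF wL wL]])
    show "cmod (L2_inner (\<lambda>x. weyl_fun a (s m) x - weyl_fun a (s n) x) h) \<le> C * L2_norm (\<lambda>x. s m x - s n x) * L2_norm h" if h: "tame h" for h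
      using C(2)[OF L2_diff[OF sL sL] tame_L2[OF h]]
      by (simp add: L2_inner_diff_left[OF wL wL tame_L2[OF h]] weyl_fun_inner[OF a s(1) tame_L2[OF h]]
          weyl_form_diff_left[OF a sL sL tame_L2[OF h]] mult.assoc)
  qed (use C(1) in simp)
  have "\<exists>F\<in>L2. (\<lambda>n. L2_norm (\<lambda>x. weyl_fun a (s n) x - F x)) \<longlonglongrightarrow> 0"
  proof (rule L2_complete[OF wL])
    fix e :: real assume e: "0 < e"
    \<comment> \<open>\<open>C + 1\<close> avoids dividing by a vanishing \<open>C\<close>; two
      approximants differ in norm by at most 2 d.\<close>
    define d where "d = e / (2 * (C + 1))"
    have d: "0 < d" using e C(1) by (simp add: d_def)
    obtain N where N: "\<And>n. n \<ge> N \<Longrightarrow> L2_norm (\<lambda>x. s n x - f x) < d"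
      using order_tendstoD(2)[OF s(2) d] by (auto simp: eventually_sequentially)
    have "L2_norm (\<lambda>x. weyl_fun a (s m) x - weyl_fun a (s n) x) < e" if "m \<ge> N" "n \<ge> N" for m n
    proof -
      have "L2_norm (\<lambda>x. s m x - s n x) \<le> L2_norm (\<lambda>x. s m x - f x) + L2_norm (\<lambda>x. f x - s n x)"
        by (rule L2_norm_triangle_diff[OF sL f sL])
      also have "\<dots> \<le> 2 * d"
        using N[OF that(1)] N[OF that(2)] L2_norm_minus_commute[of f "s n"] by linarith
      finally have "C * L2_norm (\<lambda>x. s m x - s n x) \<le> C * (2 * d)" by (intro mult_left_mono C(1))
      also have "\<dots> < (C + 1) * (2 * d)" using d by simp
      also have "\<dots> = e" unfolding d_def using C(1) by (simp add: field_simps)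
      finally show ?thesis using diff[of m n] by linarith
    qed
    then show "\<exists>N. \<forall>m\<ge>N. \<forall>n\<ge>N. L2_norm (\<lambda>x. weyl_fun a (s m) x - weyl_fun a (s n) x) < e" by blast
  qed
  then obtain F where F: "F \<in> L2" "(\<lambda>n. L2_norm (\<lambda>x. weyl_fun a (s n) x - F x)) \<longlonglongrightarrow> 0" by blast
  have "L2_inner F h = weyl_form a f h" if h: "h \<in> L2" for h
  proof (rule LIMSEQ_unique)
    show "(\<lambda>n. L2_inner (weyl_fun a (s n)) h) \<longlonglongrightarrow> L2_inner F h"
      by (rule L2_inner_tendsto_left[OF wL F(1) h F(2)])
    show "(\<lambda>n. L2_inner (weyl_fun a (s n)) h) \<longlonglongrightarrow> weyl_form a f h"
      unfolding weyl_fun_inner[OF a s(1) h] by (rule weyl_form_tendsto_left[OF a sL f h s(2)])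
  qed
  with F(1) show ?thesis by blast
qed

text \<open>The operator is chosen from \<open>weyl_form_represented\<close> one function at a time.
  Linearity, the bound and the agreement with \<open>weyl_fun\<close> then all follow by testing
  against functions that satisfy \<open>tame\<close>.\<close>

lemma weyl_op_exists:
  fixes a :: "real^('m::finite + 'm) \<Rightarrow> complex"
  assumes a: "a \<in> S000"
  shows "\<exists>T. L2_bounded_linear T \<and> (\<forall>f\<in>schwartz. AE x in lborel. has_oscillatory_integral (weyl_integrand a f x) (T f x))"
proof -
  obtain T where T: "\<And>f. f \<in> L2 \<Longrightarrow> T f \<in> L2" "\<And>f h. f \<in> L2 \<Longrightarrow> h \<in> L2 \<Longrightarrow> L2_inner (T f) h = weyl_form a f h"
    using weyl_form_represented[OF a] by metis
  obtain C where C: "C \<ge> 0" "\<And>P H. P \<in> L2 \<Longrightarrow> H \<in> L2 \<Longrightarrow> cmod (weyl_form a P H) \<le> C * (L2_norm P * L2_norm H)"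
    using weyl_form_bound[OF a] by blast
  have "L2_linear T"
    unfolding L2_linear_def
  proof (intro conjI ballI allI)
    fix f g :: "real^'m \<Rightarrow> complex" assume f: "f \<in> L2" and g: "g \<in> L2"
    show "ae_eq (T (\<lambda>x. f x + g x)) (\<lambda>x. T f x + T g x)"
      by (rule ae_eq_weak[OF T(1)[OF L2_add[OF f g]] L2_add[OF T(1)[OF f] T(1)[OF g]]])
         (simp add: tame_L2 T L2_add f g L2_inner_add_left weyl_form_add_left[OF a])
  next
    fix c and f :: "real^'m \<Rightarrow> complex" assume f: "f \<in> L2"
    show "ae_eq (T (\<lambda>x. c * f x)) (\<lambda>x. c * T f x)"
      by (rule ae_eq_weak[OF T(1)[OF L2_cmult[OF f]] L2_cmult[OF T(1)[OF f]]])
         (simp add: tame_L2 T L2_cmult f L2_inner_cmult_left weyl_form_cmult_left)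
  qed (rule T(1))
  moreover have "L2_norm (T f) \<le> C * L2_norm f" if f: "f \<in> L2" for f
  proof (rule L2_dual_bound(2)[OF L2_measurable[OF T(1)[OF f]]])
    show "cmod (L2_inner (T f) h) \<le> C * L2_norm f * L2_norm h" if "tame h" for h
      using C(2)[OF f tame_L2[OF that]] by (simp add: T(2)[OF f tame_L2[OF that]] mult.assoc)
  qed (use C(1) in simp)
  ultimately have "L2_bounded_linear T"
    unfolding L2_bounded_linear_def by blast
  moreover have "AE x in lborel. has_oscillatory_integral (weyl_integrand a f x) (T f x)" if f: "f \<in> schwartz" for f
  proof -
    have "ae_eq (T f) (weyl_fun a f)"
      by (rule ae_eq_weak[OF T(1)[OF schwartz_L2[OF f]] weyl_fun_L2[OF a f]])
         (simp add: T(2)[OF schwartz_L2[OF f] tame_L2] weyl_fun_pairing[OF a f])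
    then show ?thesis
      unfolding ae_eq_def by eventually_elim (simp add: weyl_has_oscillatory_integral[OF a f])
  qed
  ultimately show ?thesis by blast
qed

text \<open>A single cutoff equal to 1 at the origin, here a Gaussian, already determines the
  value.\<close>

lemma has_oscillatory_integral_unique:
  fixes F :: "real^'k::finite \<Rightarrow> complex"
  assumes "has_oscillatory_integral F I" "has_oscillatory_integral F J"
  shows "I = J"
proof -
  let ?\<phi> = "\<lambda>Z::real^'k. complex_of_real (gauss2 Z)"
  have "?\<phi> 0 = 1" by (simp add: gauss2_def)
  then have "((\<lambda>\<epsilon>. LINT Z|lborel. ?\<phi> (\<epsilon> *\<^sub>R Z) * F Z) \<longlongrightarrow> K) (at_right 0)" if "has_oscillatory_integral F K" for K
    using that[unfolded has_oscillatory_integral_def, THEN bspec[OF _ schwartz_gauss2]] by (simp only: simp_thms)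
  from this[OF assms(1)] this[OF assms(2)] show ?thesis
    by (rule tendsto_unique[rotated]) simp
qed

context
  fixes a :: "real^('m::finite + 'm) \<Rightarrow> complex"
  assumes a: "a \<in> S000"
begin

lemma weyl_op_properties:
  shows weyl_op_bounded_linear: "L2_bounded_linear (weyl_op a)"
    and weyl_op_oscillatory: "f \<in> schwartz \<Longrightarrow> AE x in lborel. has_oscillatory_integral (weyl_integrand a f x) (weyl_op a f x)"
  using someI_ex[OF weyl_op_exists[OF a]] unfolding weyl_op_def by blast+

lemma weyl_op_L2: "f \<in> L2 \<Longrightarrow> weyl_op a f \<in> L2"
  using weyl_op_bounded_linear unfolding L2_bounded_linear_def L2_linear_def by blast

lemma weyl_op_schwartz:
  assumes "f \<in> schwartz" shows "ae_eq (weyl_op a f) (weyl_fun a f)"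
  using weyl_op_oscillatory[OF assms] unfolding ae_eq_def
  by eventually_elim (rule has_oscillatory_integral_unique[OF _ weyl_has_oscillatory_integral[OF a assms]])

text \<open>\<open>L2_linear\<close> speaks of sums, up to null sets; the difference is reached by
  writing f = (f - g) + g.\<close>

lemma weyl_op_diff_bound:
  "\<exists>C. \<forall>f\<in>L2. \<forall>g\<in>L2. L2_norm (\<lambda>x. weyl_op a f x - weyl_op a g x) \<le> C * L2_norm (\<lambda>x. f x - g x)"
proof -
  obtain C where C: "\<And>f. f \<in> L2 \<Longrightarrow> L2_norm (weyl_op a f) \<le> C * L2_norm f"
    using weyl_op_bounded_linear unfolding L2_bounded_linear_def by blast
  have lin: "f \<in> L2 \<Longrightarrow> g \<in> L2 \<Longrightarrow> ae_eq (weyl_op a (\<lambda>x. f x + g x)) (\<lambda>x. weyl_op a f x + weyl_op a g x)" for f g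
    using weyl_op_bounded_linear unfolding L2_bounded_linear_def L2_linear_def by blast
  have "L2_norm (\<lambda>x. weyl_op a f x - weyl_op a g x) \<le> C * L2_norm (\<lambda>x. f x - g x)" if f: "f \<in> L2" and g: "g \<in> L2" for f g
  proof -
    let ?d = "\<lambda>x. f x - g x"
    have d: "?d \<in> L2" by (rule L2_diff[OF f g])
    have "ae_eq (weyl_op a f) (\<lambda>x. weyl_op a ?d x + weyl_op a g x)"
      using lin[OF d g] by simp
    then have "ae_eq (\<lambda>x. weyl_op a f x - weyl_op a g x) (weyl_op a ?d)"
      unfolding ae_eq_def by eventually_elim simp
    then have "L2_norm (\<lambda>x. weyl_op a f x - weyl_op a g x) = L2_norm (weyl_op a ?d)"
      by (intro L2_norm_cong_AE L2_diff weyl_op_L2 f g d)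
    then show ?thesis using C[OF d] by simp
  qed
  then show ?thesis by blast
qed

end

section \<open>Tensor products\<close>

lemma integrable_vsplit_mult:
  fixes u v :: "real^'m::finite \<Rightarrow> 'c::{real_normed_field, banach, second_countable_topology}"
  assumes u: "integrable lborel u" and v: "integrable lborel v"
  shows "integrable lborel (\<lambda>z. u (vfst z) * v (vsnd z))"
    and integral_vsplit_mult: "(LINT z|lborel. u (vfst z) * v (vsnd z)) = integral\<^sup>L lborel u * integral\<^sup>L lborel v"
proof -
  have [measurable]: "u \<in> borel_measurable borel" "v \<in> borel_measurable borel"
    using borel_measurable_integrable[OF u] borel_measurable_integrable[OF v] by simp_all
  have m: "(\<lambda>z. u (vfst z) * v (vsnd z)) \<in> borel_measurable borel" by measurable
  show "integrable lborel (\<lambda>z. u (vfst z) * v (vsnd z))"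
    unfolding integrable_vjoin[OF m] using integrable_pair_mult[OF u v] by simp
  show "(LINT z|lborel. u (vfst z) * v (vsnd z)) = integral\<^sup>L lborel u * integral\<^sup>L lborel v"
    unfolding integral_vjoin[OF m] using integral_pair_mult[OF u v] by simp
qed

lemma tensor_L2:
  fixes u v :: "real^'n::finite \<Rightarrow> complex"
  assumes u: "u \<in> L2" and v: "v \<in> L2"
  shows "tensor u v \<in> L2" "L2_norm (tensor u v) = L2_norm u * L2_norm v"
proof -
  note [measurable] = L2_measurable[OF u] L2_measurable[OF v]
  have eq: "(cmod (tensor u v z))\<^sup>2 = (cmod (u (vfst z)))\<^sup>2 * (cmod (v (vsnd z)))\<^sup>2" for z
    by (simp add: tensor_def norm_mult power_mult_distrib)
  show "tensor u v \<in> L2"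
  proof (rule L2I)
    show "tensor u v \<in> borel_measurable borel" unfolding tensor_def by measurable
    show "integrable lborel (\<lambda>z. (cmod (tensor u v z))\<^sup>2)"
      unfolding eq by (rule integrable_vsplit_mult[OF L2_square_integrable[OF u] L2_square_integrable[OF v]])
  qed
  show "L2_norm (tensor u v) = L2_norm u * L2_norm v"
    unfolding L2_norm_def eq integral_vsplit_mult[OF L2_square_integrable[OF u] L2_square_integrable[OF v]]
    by (rule real_sqrt_mult)
qed

lemma tensor_tendsto:
  fixes f g :: "real^'n::finite \<Rightarrow> complex"
  assumes s: "\<And>n. s n \<in> L2" and t: "\<And>n. t n \<in> L2" and f: "f \<in> L2" and g: "g \<in> L2"
    and lim: "(\<lambda>n. L2_norm (\<lambda>x. s n x - f x)) \<longlonglongrightarrow> 0" "(\<lambda>n. L2_norm (\<lambda>x. t n x - g x)) \<longlonglongrightarrow> 0"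
  shows "(\<lambda>n. L2_norm (\<lambda>z. tensor (s n) (t n) z - tensor f g z)) \<longlonglongrightarrow> 0"
proof (rule Lim_null_comparison)
  let ?a = "\<lambda>n. L2_norm (\<lambda>x. s n x - f x)" and ?b = "\<lambda>n. L2_norm (\<lambda>x. t n x - g x)"
  have "L2_norm (\<lambda>z. tensor (s n) (t n) z - tensor f g z) \<le> ?a n * (L2_norm g + ?b n) + L2_norm f * ?b n" for n
  proof -
    have "(\<lambda>z. tensor (s n) (t n) z - tensor f g z) = (\<lambda>z. tensor (\<lambda>x. s n x - f x) (t n) z + tensor f (\<lambda>x. t n x - g x) z)"
      by (simp add: tensor_def fun_eq_iff algebra_simps)
    then have "L2_norm (\<lambda>z. tensor (s n) (t n) z - tensor f g z) \<le> L2_norm (tensor (\<lambda>x. s n x - f x) (t n)) + L2_norm (tensor f (\<lambda>x. t n x - g x))"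
      using L2_norm_triangle[OF tensor_L2(1)[OF L2_diff[OF s f] t] tensor_L2(1)[OF f L2_diff[OF t g]]] by simp
    also have "\<dots> = ?a n * L2_norm (t n) + L2_norm f * ?b n"
      by (simp add: tensor_L2 L2_diff s t f g)
    also have "\<dots> \<le> ?a n * (L2_norm g + ?b n) + L2_norm f * ?b n"
      by (intro add_right_mono mult_left_mono L2_norm_le_diff t g) simp
    finally show ?thesis .
  qed
  then show "\<forall>\<^sub>F n in sequentially. norm (L2_norm (\<lambda>z. tensor (s n) (t n) z - tensor f g z)) \<le> ?a n * (L2_norm g + ?b n) + L2_norm f * ?b n"
    by simp
  have "(\<lambda>n. ?a n * (L2_norm g + ?b n) + L2_norm f * ?b n) \<longlonglongrightarrow> 0 * (L2_norm g + 0) + L2_norm f * 0"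
    by (intro tendsto_intros lim)
  then show "(\<lambda>n. ?a n * (L2_norm g + ?b n) + L2_norm f * ?b n) \<longlonglongrightarrow> 0" by simp
qed

lemma vfst_axis: "vfst (axis (Inl j) c) = axis j c" "vfst (axis (Inr j) c) = 0"
  and vsnd_axis: "vsnd (axis (Inl j) c) = 0" "vsnd (axis (Inr j) c) = axis j c"
  by (simp_all add: vfst_def vsnd_def axis_def vec_eq_iff)

lemma norm_le_vsplit: "norm z \<le> norm (vfst z) + norm (vsnd z)"
  by (rule power2_le_imp_le) (simp_all add: norm_vsplit power2_sum)

lemma sum_power_le: "0 \<le> u \<Longrightarrow> 0 \<le> v \<Longrightarrow> (u + v)^k \<le> 2^k * (u^k + v^k)" for u v :: real
proof -
  assume u: "0 \<le> u" and v: "0 \<le> v"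
  have "(u + v)^k \<le> (2 * max u v)^k" using u v by (intro power_mono) auto
  also have "\<dots> = 2^k * (max u v)^k" by (rule power_mult_distrib)
  also have "\<dots> \<le> 2^k * (u^k + v^k)" using u v by (intro mult_left_mono) (auto simp: max_def)
  finally show ?thesis .
qed

lemma differentiable_vfst: "f differentiable (at x) \<Longrightarrow> (\<lambda>y. vfst (f y)) differentiable (at x)"
  and differentiable_vsnd: "f differentiable (at x) \<Longrightarrow> (\<lambda>y. vsnd (f y)) differentiable (at x)"
  unfolding differentiable_def by (blast intro: has_derivative_vfst has_derivative_vsnd)+

lemma tensor_schwartz:
  fixes f g :: "real^'n::finite \<Rightarrow> complex"
  assumes "f \<in> schwartz" "g \<in> schwartz"
  shows "tensor f g \<in> schwartz"
  unfolding schwartz_iff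
proof (rule unif_smooth_coinduct[where X="{\<lambda>_. tensor f g | f g. f \<in> schwartz \<and> g \<in> schwartz}"])
  show "(\<lambda>_. tensor f g) \<in> {\<lambda>_. tensor f g | f g. f \<in> schwartz \<and> g \<in> schwartz}" using assms by blast
next
  fix F :: "unit \<Rightarrow> real^('n + 'n) \<Rightarrow> complex" and i
  assume "F \<in> {\<lambda>_. tensor f g | f g. f \<in> schwartz \<and> g \<in> schwartz}"
  then obtain f g where F: "F = (\<lambda>_. tensor f g)" and fg: "f \<in> schwartz" "g \<in> schwartz" by blast
  note d = unif_smooth_differentiable[OF fg(1)[unfolded schwartz_iff] UNIV_I] unif_smooth_differentiable[OF fg(2)[unfolded schwartz_iff] UNIV_I]
  have v: "vfst differentiable (at z)" "vsnd differentiable (at z)" for z :: "real^('n + 'n)"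
    by (intro differentiable_vfst differentiable_vsnd differentiable_ident)+
  have "(\<lambda>z. f (vfst z)) differentiable (at z)" "(\<lambda>z. g (vsnd z)) differentiable (at z)" for z
    using differentiable_chain_at[OF v(1) d(1), of z] differentiable_chain_at[OF v(2) d(2), of z] by (simp_all add: o_def)
  then show "F i differentiable_on UNIV"
    unfolding F tensor_def[abs_def] differentiable_on_def by (intro ballI differentiable_mult) simp_all
next
  fix F :: "unit \<Rightarrow> real^('n + 'n) \<Rightarrow> complex" and k :: nat
  assume "F \<in> {\<lambda>_. tensor f g | f g. f \<in> schwartz \<and> g \<in> schwartz}"
  then obtain f g where F: "F = (\<lambda>_. tensor f g)" and fg: "f \<in> schwartz" "g \<in> schwartz" by blast
  obtain A A' B B' where b: "\<And>x. norm x ^ k * cmod (f x) \<le> A" "\<And>x. norm x ^ 0 * cmod (f x) \<le> A'"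
    "\<And>x. norm x ^ k * cmod (g x) \<le> B" "\<And>x. norm x ^ 0 * cmod (g x) \<le> B'"
    using unif_smooth_bound[OF fg(1)[unfolded schwartz_iff] UNIV_I, of k] unif_smooth_bound[OF fg(1)[unfolded schwartz_iff] UNIV_I, of 0]
      unif_smooth_bound[OF fg(2)[unfolded schwartz_iff] UNIV_I, of k] unif_smooth_bound[OF fg(2)[unfolded schwartz_iff] UNIV_I, of 0] by blast
  have "norm z ^ k * cmod (F i z) \<le> 2^k * (A * B' + A' * B)" for i z
  proof -
    let ?u = "vfst z" and ?v = "vsnd z"
    have "norm z ^ k \<le> (norm ?u + norm ?v)^k" by (intro power_mono norm_le_vsplit) simp
    also have "\<dots> \<le> 2^k * (norm ?u^k + norm ?v^k)" by (rule sum_power_le) simp_all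
    finally have "norm z ^ k * cmod (F i z) \<le> (2^k * (norm ?u^k + norm ?v^k)) * (cmod (f ?u) * cmod (g ?v))"
      unfolding F tensor_def norm_mult by (intro mult_right_mono) simp_all
    also have "\<dots> = 2^k * ((norm ?u^k * cmod (f ?u)) * (norm ?v^0 * cmod (g ?v)) + (norm ?u^0 * cmod (f ?u)) * (norm ?v^k * cmod (g ?v)))"
      by (simp add: algebra_simps)
    also have "\<dots> \<le> 2^k * (A * B' + A' * B)"
      by (intro mult_left_mono add_mono mult_mono b order_trans[OF _ b(1)] order_trans[OF _ b(2)]) simp_all
    finally show ?thesis .
  qed
  then show "\<exists>C. \<forall>i\<in>UNIV. \<forall>x. norm x ^ k * cmod (F i x) \<le> C" by blast
next
  fix F :: "unit \<Rightarrow> real^('n + 'n) \<Rightarrow> complex" and j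
  assume "F \<in> {\<lambda>_. tensor f g | f g. f \<in> schwartz \<and> g \<in> schwartz}"
  then obtain f g where F: "F = (\<lambda>_. tensor f g)" and fg: "f \<in> schwartz" "g \<in> schwartz" by blast
  have pd: "partial_deriv j f \<in> schwartz" if "f \<in> schwartz" for j and f :: "real^'n \<Rightarrow> complex"
    using that unfolding schwartz_iff by (rule unif_smooth_partial_deriv)
  have line: "((\<lambda>t. f (x + t *\<^sub>R axis j 1)) has_vector_derivative partial_deriv j f x) (at 0)" if "f \<in> schwartz" for j and f :: "real^'n \<Rightarrow> complex" and x
    using partial_deriv_line[of f x 0 j] unif_smooth_differentiable[OF that[unfolded schwartz_iff] UNIV_I] by simp
  show "\<exists>G\<in>{\<lambda>_. tensor f g | f g. f \<in> schwartz \<and> g \<in> schwartz}. \<forall>i\<in>UNIV. partial_deriv j (F i) = G i"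
  proof (cases j)
    case (Inl j')
    have "partial_deriv j (tensor f g) z = tensor (partial_deriv j' f) g z" for z
    proof -
      have "((\<lambda>t. tensor f g (z + t *\<^sub>R axis j 1)) has_vector_derivative tensor (partial_deriv j' f) g z) (at 0)"
        unfolding Inl tensor_def by (simp add: vfst_axis vsnd_axis has_vector_derivative_mult_left line fg)
      then show ?thesis
        unfolding partial_deriv_def[of j] by (rule vector_derivative_at)
    qed
    then show ?thesis using pd[OF fg(1)] fg(2) F by (intro bexI[of _ "\<lambda>_. tensor (partial_deriv j' f) g"]) auto
  next
    case (Inr j')
    have "partial_deriv j (tensor f g) z = tensor f (partial_deriv j' g) z" for z
    proof -
      have "((\<lambda>t. tensor f g (z + t *\<^sub>R axis j 1)) has_vector_derivative tensor f (partial_deriv j' g) z) (at 0)"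
        unfolding Inr tensor_def by (simp add: vfst_axis vsnd_axis has_vector_derivative_mult_right line fg)
      then show ?thesis
        unfolding partial_deriv_def[of j] by (rule vector_derivative_at)
    qed
    then show ?thesis using pd[OF fg(2)] fg(1) F by (intro bexI[of _ "\<lambda>_. tensor f (partial_deriv j' g)"]) auto
  qed
qed

text \<open>
  The sign in the last slot comes from complex conjugation, which sends \<open>Op(a)\<close> to the Weyl operator with symbol
  \<open>(x, \<xi>) \<mapsto> cnj (a (x, - \<xi>))\<close>.
\<close>

definition tensor_symbol :: "(real^('n::finite + 'n) \<Rightarrow> complex) \<Rightarrow> real^(('n + 'n) + ('n + 'n)) \<Rightarrow> complex" where
  "tensor_symbol a Z = a (vjoin (vfst (vfst Z)) (vfst (vsnd Z))) * cnj (a (vjoin (vsnd (vfst Z)) (- vsnd (vsnd Z))))"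

lemma tensor_symbol_S000:
  fixes a :: "real^('n::finite + 'n) \<Rightarrow> complex"
  assumes a: "a \<in> S000"
  shows "tensor_symbol a \<in> S000"
proof -
  have M1: "(\<lambda>Z. vjoin (vfst (vfst Z)) (vfst (vsnd Z))) differentiable (at Z)"
    and M2: "(\<lambda>Z. vjoin (vsnd (vfst Z)) (- vsnd (vsnd Z))) differentiable (at Z)" for Z :: "real^(('n + 'n) + ('n + 'n))"
    by (intro differentiable_vjoin differentiable_vfst differentiable_vsnd differentiable_minus differentiable_ident)+
  have 1: "(\<lambda>Z. a (vjoin (vfst (vfst Z)) (vfst (vsnd Z)))) \<in> S000"
    unfolding S000_iff
    \<comment> \<open>The slope is 0 in the coordinates that the projection forgets;
      \<open>\<sigma>\<close> takes a dummy value there.\<close>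
    by (rule unif_smooth_affine[OF a[unfolded S000_iff], where M="\<lambda>_ Z. vjoin (vfst (vfst Z)) (vfst (vsnd Z))"
          and c="\<lambda>_ i. case i of Inl (Inl _) \<Rightarrow> 1 | Inr (Inl _) \<Rightarrow> 1 | _ \<Rightarrow> 0"
          and \<sigma>="\<lambda>i. case i of Inl (Inl j) \<Rightarrow> Inl j | Inl (Inr j) \<Rightarrow> Inl j | Inr (Inl j) \<Rightarrow> Inr j | Inr (Inr j) \<Rightarrow> Inr j"])
       (rule M1, auto simp: vec_eq_iff vjoin_def vfst_def vsnd_def axis_def split: sum.split)
  have 2: "(\<lambda>Z. a (vjoin (vsnd (vfst Z)) (- vsnd (vsnd Z)))) \<in> S000"
    unfolding S000_iff
    \<comment> \<open>The slope -1 belongs to the reflected frequency.\<close>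
    by (rule unif_smooth_affine[OF a[unfolded S000_iff], where M="\<lambda>_ Z. vjoin (vsnd (vfst Z)) (- vsnd (vsnd Z))"
          and c="\<lambda>_ i. case i of Inl (Inr _) \<Rightarrow> 1 | Inr (Inr _) \<Rightarrow> - 1 | _ \<Rightarrow> 0"
          and \<sigma>="\<lambda>i. case i of Inl (Inl j) \<Rightarrow> Inl j | Inl (Inr j) \<Rightarrow> Inl j | Inr (Inl j) \<Rightarrow> Inr j | Inr (Inr j) \<Rightarrow> Inr j"])
       (rule M2, auto simp: vec_eq_iff vjoin_def vfst_def vsnd_def axis_def split: sum.split)
  show ?thesis
    unfolding tensor_symbol_def[abs_def] by (intro S000_mult S000_cnj 1 2)
qed

lemma weyl_inner_integrable:
  fixes a :: "real^('n::finite + 'n) \<Rightarrow> complex"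
  assumes a: "a \<in> S000" and f: "f \<in> schwartz"
  shows "integrable lborel (\<lambda>y. weyl_integrand a f x (vjoin y \<xi>))"
    and "integrable lborel (\<lambda>\<xi>. LINT y|lborel. weyl_integrand a f x (vjoin y \<xi>))"
proof -
  note [measurable] = S000_measurable[OF a] schwartz_measurable[OF f]
  obtain B where B: "B \<ge> 0" "\<And>Z. cmod (a Z) \<le> B" using S000_bounded[OF a] by blast
  show "integrable lborel (\<lambda>y. weyl_integrand a f x (vjoin y \<xi>))"
  proof (rule Bochner_Integration.integrable_bound)
    show "integrable lborel (\<lambda>y. B * cmod (f y))" using schwartz_integrable[OF f] by simp
    show "(\<lambda>y. weyl_integrand a f x (vjoin y \<xi>)) \<in> borel_measurable lborel"
      unfolding weyl_integrand_vjoin by measurable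
    show "AE y in lborel. norm (weyl_integrand a f x (vjoin y \<xi>)) \<le> norm (B * cmod (f y))"
      using B by (intro AE_I2) (simp add: weyl_integrand_vjoin norm_mult abs_mult mult_right_mono)
  qed
  \<comment> \<open>The constant cutoff 1 makes \<open>weyl_cutoff_bound\<close> a bound for the
    integral without cutoff.\<close>
  have us: "unif_smooth {0} (UNIV \<times> {x} \<times> UNIV) (\<lambda>(n::nat, x, \<xi>) y. 1)"
    using unif_smooth_const[where c="\<lambda>_. 1" and C=1 and I="(UNIV :: nat set) \<times> {x} \<times> UNIV"] by (simp add: case_prod_beta')
  obtain C where C: "C \<ge> 0" "\<And>\<xi>. cmod (LINT y|lborel. 1 * weyl_integrand a f x (vjoin y \<xi>)) \<le> C * (1 / (1 + (norm \<xi>)\<^sup>2)^DIM(real^'n))"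
    using weyl_cutoff_bound[OF a f us, of "DIM(real^'n)"] by auto
  show "integrable lborel (\<lambda>\<xi>. LINT y|lborel. weyl_integrand a f x (vjoin y \<xi>))"
  proof (rule Bochner_Integration.integrable_bound)
    show "integrable lborel (\<lambda>\<xi>::real^'n. C * (1 / (1 + (norm \<xi>)\<^sup>2)^DIM(real^'n)))"
      by (intro integrable_mult_right integrable_japanese_power)
    have "(\<lambda>\<xi>. LINT y|lborel. weyl_integrand a f x (vjoin y \<xi>)) \<in> borel_measurable borel"
      unfolding weyl_integrand_vjoin by (rule lborel.borel_measurable_lebesgue_integral) measurable
    then show "(\<lambda>\<xi>. LINT y|lborel. weyl_integrand a f x (vjoin y \<xi>)) \<in> borel_measurable lborel" by simp
    show "AE \<xi> in lborel. norm (LINT y|lborel. weyl_integrand a f x (vjoin y \<xi>)) \<le> norm (C * (1 / (1 + (norm \<xi>)\<^sup>2)^DIM(real^'n)))"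
      unfolding real_norm_def by (intro AE_I2 order_trans[OF C(2)[unfolded mult_1] abs_ge_self])
  qed
qed

text \<open>With this symbol the integrand is a product of one Weyl integrand in the first halves of
  the variables and a conjugated one in the second halves, at the reflected frequency. Inner and
  outer integrals both factor, and the reflection leaves the outer one unchanged.\<close>

lemma weyl_fun_tensor:
  fixes a :: "real^('n::finite + 'n) \<Rightarrow> complex"
  assumes a: "a \<in> S000" and f: "f \<in> schwartz" and g: "g \<in> schwartz"
  shows "weyl_fun (tensor_symbol a) (tensor f (\<lambda>y. cnj (g y))) = tensor (weyl_fun a f) (\<lambda>y. cnj (weyl_fun a g y))"
proof
  fix z :: "real^('n + 'n)"
  let ?A = "\<lambda>\<xi> y. weyl_integrand a f (vfst z) (vjoin y \<xi>)"
  let ?B = "\<lambda>\<xi> y. weyl_integrand a g (vsnd z) (vjoin y \<xi>)"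
  have prod: "weyl_integrand (tensor_symbol a) (tensor f (\<lambda>y. cnj (g y))) z (vjoin Y \<Xi>) = ?A (vfst \<Xi>) (vfst Y) * cnj (?B (- vsnd \<Xi>) (vsnd Y))" for Y \<Xi>
  proof -
    have "cis (2 * pi * ((z - Y) \<bullet> \<Xi>)) = cis (2 * pi * ((vfst z - vfst Y) \<bullet> vfst \<Xi>)) * cnj (cis (2 * pi * ((vsnd z - vsnd Y) \<bullet> (- vsnd \<Xi>))))"
      by (simp add: cis_cnj cis_mult inner_vsplit[of "z - Y"] inner_vsplit[of z] inner_vsplit[of Y] algebra_simps)
    then show ?thesis
      by (simp add: weyl_integrand_vjoin tensor_symbol_def tensor_def mult_ac)
  qed
  have cB: "integrable lborel (\<lambda>y. cnj (?B \<xi> y))" for \<xi>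
    using weyl_inner_integrable(1)[OF a g] by (simp only: integrable_cnj)
  have inner: "(LINT Y|lborel. weyl_integrand (tensor_symbol a) (tensor f (\<lambda>y. cnj (g y))) z (vjoin Y \<Xi>)) =
      (LINT y|lborel. ?A (vfst \<Xi>) y) * cnj (LINT y|lborel. ?B (- vsnd \<Xi>) y)" for \<Xi>
    unfolding prod integral_vsplit_mult[OF weyl_inner_integrable(1)[OF a f] cB]
    by (simp only: Bochner_Integration.integral_cnj)
  let ?I = "\<lambda>\<xi>. LINT y|lborel. ?B \<xi> y"
  have I: "integrable lborel ?I" by (rule weyl_inner_integrable(2)[OF a g])
  have mI: "?I \<in> borel_measurable borel" using borel_measurable_integrable[OF I] by simp
  have Ir: "integrable lborel (\<lambda>\<xi>. ?I (- \<xi>))"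
    using lborel_integrable_scale[OF I, of "-1"] by simp
  have "weyl_fun (tensor_symbol a) (tensor f (\<lambda>y. cnj (g y))) z = weyl_fun a f (vfst z) * (LINT \<xi>|lborel. cnj (?I (- \<xi>)))"
    unfolding weyl_fun_def inner
    by (rule integral_vsplit_mult[OF weyl_inner_integrable(2)[OF a f]]) (use Ir in \<open>simp only: integrable_cnj\<close>)
  also have "(LINT \<xi>|lborel. cnj (?I (- \<xi>))) = cnj (weyl_fun a g (vsnd z))"
    using lborel_integral_reflect[OF mI, of 0] by (simp only: Bochner_Integration.integral_cnj weyl_fun_def diff_0)
  finally show "weyl_fun (tensor_symbol a) (tensor f (\<lambda>y. cnj (g y))) z = tensor (weyl_fun a f) (\<lambda>y. cnj (weyl_fun a g y)) z"
    unfolding tensor_def[of "weyl_fun a f"] .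
qed

lemma L2_norm_cnj_diff: "L2_norm (\<lambda>x. cnj (f x) - cnj (g x)) = L2_norm (\<lambda>x. f x - g x)"
  unfolding L2_norm_def complex_cnj_diff[symmetric] complex_mod_cnj ..

text \<open>\<open>weyl_fun_tensor\<close> settles the Schwartz case; both sides are continuous in
  \<open>f\<close> for the L2 norm, so density extends it.\<close>

lemma weyl_op_tensor_inner:
  fixes a :: "real^('n::finite + 'n) \<Rightarrow> complex"
  assumes a: "a \<in> S000" and f: "f \<in> L2" and H: "H \<in> L2"
  shows "L2_inner (tensor (weyl_op a f) (\<lambda>y. cnj (weyl_op a f y))) H = weyl_form (tensor_symbol a) (tensor f (\<lambda>y. cnj (f y))) H"
proof -
  obtain s where s: "\<And>n. s n \<in> schwartz" "(\<lambda>n. L2_norm (\<lambda>x. s n x - f x)) \<longlonglongrightarrow> 0"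
    using schwartz_dense[OF f] by blast
  note sL = schwartz_L2[OF s(1)] and wL = weyl_fun_L2[OF a s(1)] and TL = weyl_op_L2[OF a f]
  obtain C where C: "\<And>f g. f \<in> L2 \<Longrightarrow> g \<in> L2 \<Longrightarrow> L2_norm (\<lambda>x. weyl_op a f x - weyl_op a g x) \<le> C * L2_norm (\<lambda>x. f x - g x)"
    using weyl_op_diff_bound[OF a] by blast
  have wlim: "(\<lambda>n. L2_norm (\<lambda>x. weyl_fun a (s n) x - weyl_op a f x)) \<longlonglongrightarrow> 0"
  proof (rule Lim_null_comparison)
    have "L2_norm (\<lambda>x. weyl_fun a (s n) x - weyl_op a f x) \<le> C * L2_norm (\<lambda>x. s n x - f x)" for n
    proof -
      have "ae_eq (\<lambda>x. weyl_fun a (s n) x - weyl_op a f x) (\<lambda>x. weyl_op a (s n) x - weyl_op a f x)"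
        using ae_eq_sym[OF weyl_op_schwartz[OF a s(1)[of n]]] by (rule ae_eq_diff) simp
      then have "L2_norm (\<lambda>x. weyl_fun a (s n) x - weyl_op a f x) = L2_norm (\<lambda>x. weyl_op a (s n) x - weyl_op a f x)"
        by (intro L2_norm_cong_AE L2_diff wL TL weyl_op_L2[OF a sL])
      then show ?thesis using C[OF sL f, of n] by simp
    qed
    then show "\<forall>\<^sub>F n in sequentially. norm (L2_norm (\<lambda>x. weyl_fun a (s n) x - weyl_op a f x)) \<le> C * L2_norm (\<lambda>x. s n x - f x)"
      by simp
    show "(\<lambda>n. C * L2_norm (\<lambda>x. s n x - f x)) \<longlonglongrightarrow> 0"
      using tendsto_mult_left[OF s(2), of C] by simp
  qed
  let ?w = "\<lambda>n. tensor (weyl_fun a (s n)) (\<lambda>y. cnj (weyl_fun a (s n) y))"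
  let ?t = "\<lambda>n. tensor (s n) (\<lambda>y. cnj (s n y))"
  have cs: "(\<lambda>y. cnj (s n y)) \<in> schwartz" for n
    using s(1)[of n] unfolding schwartz_iff by (rule unif_smooth_cnj)
  have "L2_inner (?w n) H = weyl_form (tensor_symbol a) (?t n) H" for n
    unfolding weyl_fun_tensor[OF a s(1) s(1), symmetric]
    by (rule weyl_fun_inner[OF tensor_symbol_S000[OF a] tensor_schwartz[OF s(1) cs] H])
  moreover have "(\<lambda>n. L2_inner (?w n) H) \<longlonglongrightarrow> L2_inner (tensor (weyl_op a f) (\<lambda>y. cnj (weyl_op a f y))) H"
    by (intro L2_inner_tendsto_left tensor_L2 wL TL L2_cnj H tensor_tendsto wlim) (simp only: L2_norm_cnj_diff wlim)
  moreover have "(\<lambda>n. weyl_form (tensor_symbol a) (?t n) H) \<longlonglongrightarrow> weyl_form (tensor_symbol a) (tensor f (\<lambda>y. cnj (f y))) H"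
    by (intro weyl_form_tendsto_left tensor_symbol_S000 a tensor_L2 sL f L2_cnj H tensor_tendsto s) (simp only: L2_norm_cnj_diff s(2))
  ultimately show ?thesis by (simp only: LIMSEQ_unique)
qed

section \<open>Conjugation by a metaplectic operator\<close>

text \<open>A preimage selected by choice. For a unitary operator it is determined only up to null
  sets, so its algebraic rules are stated with \<open>ae_eq\<close>; by
  \<open>weyl_form_cong_AE\<close> forms do not see the difference.\<close>

definition unitary_inv :: "'a::euclidean_space operator \<Rightarrow> 'a operator" where
  "unitary_inv A g = (SOME f. f \<in> L2 \<and> ae_eq (A f) g)"

context
  fixes A :: "'a::euclidean_space operator"
  assumes A: "L2_unitary A"
begin

lemma unitary_L2: "f \<in> L2 \<Longrightarrow> A f \<in> L2"
  using A unfolding L2_unitary_def L2_linear_def by simp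

lemma unitary_add: "f \<in> L2 \<Longrightarrow> g \<in> L2 \<Longrightarrow> ae_eq (A (\<lambda>x. f x + g x)) (\<lambda>x. A f x + A g x)"
  using A unfolding L2_unitary_def L2_linear_def by simp

lemma unitary_cmult: "f \<in> L2 \<Longrightarrow> ae_eq (A (\<lambda>x. c * f x)) (\<lambda>x. c * A f x)"
  using A unfolding L2_unitary_def L2_linear_def by simp

lemma unitary_inner: "f \<in> L2 \<Longrightarrow> g \<in> L2 \<Longrightarrow> L2_inner (A f) (A g) = L2_inner f g"
  using A unfolding L2_unitary_def by simp

lemma unitary_norm:
  assumes f: "f \<in> L2" shows "L2_norm (A f) = L2_norm f"
proof -
  have "complex_of_real ((L2_norm (A f))\<^sup>2) = of_real ((L2_norm f)\<^sup>2)"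
    using unitary_inner[OF f f] by (simp only: L2_inner_self)
  then have "(L2_norm (A f))\<^sup>2 = (L2_norm f)\<^sup>2" by (simp only: of_real_eq_iff)
  then show ?thesis by simp
qed

lemma unitary_diff:
  assumes f: "f \<in> L2" and g: "g \<in> L2"
  shows "ae_eq (A (\<lambda>x. f x - g x)) (\<lambda>x. A f x - A g x)"
proof -
  have "ae_eq (A f) (\<lambda>x. A (\<lambda>x. f x - g x) x + A g x)"
    using unitary_add[OF L2_diff[OF f g] g] by simp
  then show ?thesis unfolding ae_eq_def by eventually_elim simp
qed

lemma unitary_inj:
  assumes f: "f \<in> L2" and g: "g \<in> L2" and eq: "ae_eq (A f) (A g)"
  shows "ae_eq f g"
proof -
  have "L2_norm (\<lambda>x. f x - g x) = L2_norm (A (\<lambda>x. f x - g x))"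
    by (simp add: unitary_norm L2_diff f g)
  also have "\<dots> = L2_norm (\<lambda>x. A f x - A g x)"
    by (intro L2_norm_cong_AE unitary_L2 L2_diff f g unitary_diff)
  also have "\<dots> = 0"
    using ae_eq_iff_L2_norm[OF unitary_L2[OF f] unitary_L2[OF g]] eq by simp
  finally show ?thesis by (simp add: ae_eq_iff_L2_norm f g)
qed

lemma
  assumes "g \<in> L2"
  shows unitary_inv_L2: "unitary_inv A g \<in> L2" and unitary_inv_right: "ae_eq (A (unitary_inv A g)) g"
proof -
  have "\<exists>f. f \<in> L2 \<and> ae_eq (A f) g"
    using A assms unfolding L2_unitary_def by blast
  from someI_ex[OF this] show "unitary_inv A g \<in> L2" "ae_eq (A (unitary_inv A g)) g"
    unfolding unitary_inv_def by simp_all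
qed

lemma unitary_inv_eqI:
  assumes f: "f \<in> L2" and g: "g \<in> L2" and eq: "ae_eq (A f) g"
  shows "ae_eq (unitary_inv A g) f"
  by (rule unitary_inj[OF unitary_inv_L2[OF g] f ae_eq_trans[OF unitary_inv_right[OF g] ae_eq_sym[OF eq]]])

lemma unitary_inv_add:
  assumes f: "f \<in> L2" and g: "g \<in> L2"
  shows "ae_eq (unitary_inv A (\<lambda>x. f x + g x)) (\<lambda>x. unitary_inv A f x + unitary_inv A g x)"
  by (intro unitary_inv_eqI L2_add unitary_inv_L2 f g
      ae_eq_trans[OF unitary_add ae_eq_add[OF unitary_inv_right unitary_inv_right]])

lemma unitary_inv_diff:
  assumes f: "f \<in> L2" and g: "g \<in> L2"
  shows "ae_eq (unitary_inv A (\<lambda>x. f x - g x)) (\<lambda>x. unitary_inv A f x - unitary_inv A g x)"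
  by (intro unitary_inv_eqI L2_diff unitary_inv_L2 f g
      ae_eq_trans[OF unitary_diff ae_eq_diff[OF unitary_inv_right unitary_inv_right]])

lemma unitary_inv_cmult:
  assumes f: "f \<in> L2"
  shows "ae_eq (unitary_inv A (\<lambda>x. c * f x)) (\<lambda>x. c * unitary_inv A f x)"
  by (intro unitary_inv_eqI L2_cmult unitary_inv_L2 f
      ae_eq_trans[OF unitary_cmult ae_eq_cmult[OF unitary_inv_right]])

lemma unitary_inv_norm:
  assumes g: "g \<in> L2" shows "L2_norm (unitary_inv A g) = L2_norm g"
  using L2_norm_cong_AE[OF unitary_L2[OF unitary_inv_L2[OF g]] g unitary_inv_right[OF g]]
  by (simp add: unitary_norm unitary_inv_L2 g)

end

text \<open>For unitary \<open>A\<close> this is the form of A Op(b) A^-1, since <A Op(b) A^-1 p, q>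
  = <Op(b) A^-1 p, A^-1 q>.\<close>

definition conj_form :: "(real^'m::finite) operator \<Rightarrow> (real^('m + 'm) \<Rightarrow> complex) \<Rightarrow>
    (real^'m \<Rightarrow> complex) \<Rightarrow> (real^'m \<Rightarrow> complex) \<Rightarrow> complex" where
  "conj_form A b p q = weyl_form b (unitary_inv A p) (unitary_inv A q)"

context
  fixes A :: "(real^'m::finite) operator" and b :: "real^('m + 'm) \<Rightarrow> complex"
  assumes A: "L2_unitary A" and b: "b \<in> S000"
begin

lemma conj_form_bound:
  "\<exists>C\<ge>0. \<forall>p\<in>L2. \<forall>q\<in>L2. cmod (conj_form A b p q) \<le> C * (L2_norm p * L2_norm q)"
proof -
  obtain C where C: "C \<ge> 0" "\<And>P H. P \<in> L2 \<Longrightarrow> H \<in> L2 \<Longrightarrow> cmod (weyl_form b P H) \<le> C * (L2_norm P * L2_norm H)"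
    using weyl_form_bound[OF b] by blast
  have "cmod (conj_form A b p q) \<le> C * (L2_norm p * L2_norm q)" if "p \<in> L2" "q \<in> L2" for p q
    using C(2)[OF unitary_inv_L2[OF A that(1)] unitary_inv_L2[OF A that(2)]]
    by (simp only: conj_form_def unitary_inv_norm[OF A] that)
  with C(1) show ?thesis by blast
qed

lemma conj_form_add_left:
  assumes p: "p \<in> L2" "p' \<in> L2" and q: "q \<in> L2"
  shows "conj_form A b (\<lambda>x. p x + p' x) q = conj_form A b p q + conj_form A b p' q"
  unfolding conj_form_def weyl_form_add_left[OF b unitary_inv_L2[OF A p(1)] unitary_inv_L2[OF A p(2)] unitary_inv_L2[OF A q], symmetric]
  by (intro weyl_form_cong_AE unitary_inv_L2 A L2_add p q unitary_inv_add ae_eq_refl)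

lemma conj_form_diff_left:
  assumes p: "p \<in> L2" "p' \<in> L2" and q: "q \<in> L2"
  shows "conj_form A b (\<lambda>x. p x - p' x) q = conj_form A b p q - conj_form A b p' q"
  unfolding conj_form_def weyl_form_diff_left[OF b unitary_inv_L2[OF A p(1)] unitary_inv_L2[OF A p(2)] unitary_inv_L2[OF A q], symmetric]
  by (intro weyl_form_cong_AE unitary_inv_L2 A L2_diff p q unitary_inv_diff ae_eq_refl)

lemma conj_form_add_right:
  assumes p: "p \<in> L2" and q: "q \<in> L2" "q' \<in> L2"
  shows "conj_form A b p (\<lambda>x. q x + q' x) = conj_form A b p q + conj_form A b p q'"
  unfolding conj_form_def weyl_form_add_right[OF b unitary_inv_L2[OF A p] unitary_inv_L2[OF A q(1)] unitary_inv_L2[OF A q(2)], symmetric]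
  by (intro weyl_form_cong_AE unitary_inv_L2 A L2_add p q unitary_inv_add ae_eq_refl)

lemma conj_form_diff_right:
  assumes p: "p \<in> L2" and q: "q \<in> L2" "q' \<in> L2"
  shows "conj_form A b p (\<lambda>x. q x - q' x) = conj_form A b p q - conj_form A b p q'"
  unfolding conj_form_def weyl_form_diff_right[OF b unitary_inv_L2[OF A p] unitary_inv_L2[OF A q(1)] unitary_inv_L2[OF A q(2)], symmetric]
  by (intro weyl_form_cong_AE unitary_inv_L2 A L2_diff p q unitary_inv_diff ae_eq_refl)

lemma conj_form_cmult_left:
  assumes p: "p \<in> L2" and q: "q \<in> L2"
  shows "conj_form A b (\<lambda>x. c * p x) q = c * conj_form A b p q"
  unfolding conj_form_def weyl_form_cmult_left[symmetric]
  by (intro weyl_form_cong_AE unitary_inv_L2 A L2_cmult p q unitary_inv_cmult ae_eq_refl)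

lemma conj_form_cmult_right:
  assumes p: "p \<in> L2" and q: "q \<in> L2"
  shows "conj_form A b p (\<lambda>x. c * q x) = cnj c * conj_form A b p q"
  unfolding conj_form_def weyl_form_cmult_right[symmetric]
  by (intro weyl_form_cong_AE unitary_inv_L2 A L2_cmult p q unitary_inv_cmult ae_eq_refl)

lemma conj_form_tendsto:
  assumes s: "\<And>n. s n \<in> L2" "f \<in> L2" "(\<lambda>n. L2_norm (\<lambda>x. s n x - f x)) \<longlonglongrightarrow> 0"
    and t: "\<And>n. t n \<in> L2" "g \<in> L2" "(\<lambda>n. L2_norm (\<lambda>x. t n x - g x)) \<longlonglongrightarrow> 0"
  shows "(\<lambda>n. conj_form A b (s n) (t n)) \<longlonglongrightarrow> conj_form A b f g"
proof -
  let ?u = "\<lambda>n. L2_norm (\<lambda>x. s n x - f x)" and ?v = "\<lambda>n. L2_norm (\<lambda>x. t n x - g x)"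
  obtain C where C0: "C \<ge> 0" and C: "\<And>p q. p \<in> L2 \<Longrightarrow> q \<in> L2 \<Longrightarrow> cmod (conj_form A b p q) \<le> C * (L2_norm p * L2_norm q)"
    using conj_form_bound by blast
  have le: "cmod (conj_form A b (s n) (t n) - conj_form A b f g) \<le> C * (?u n * (L2_norm g + ?v n)) + C * (L2_norm f * ?v n)" for n
  proof -
    have "conj_form A b (s n) (t n) - conj_form A b f g = conj_form A b (\<lambda>x. s n x - f x) (t n) + conj_form A b f (\<lambda>x. t n x - g x)"
      by (simp add: conj_form_diff_left conj_form_diff_right s t)
    also have "cmod \<dots> \<le> C * (?u n * L2_norm (t n)) + C * (L2_norm f * ?v n)"
      by (intro norm_triangle_le add_mono C L2_diff s t)
    also have "C * (?u n * L2_norm (t n)) \<le> C * (?u n * (L2_norm g + ?v n))"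
      by (intro mult_left_mono C0 L2_norm_le_diff t) simp
    finally show ?thesis by simp
  qed
  have "(\<lambda>n. C * (?u n * (L2_norm g + ?v n)) + C * (L2_norm f * ?v n)) \<longlonglongrightarrow> C * (0 * (L2_norm g + 0)) + C * (L2_norm f * 0)"
    by (intro tendsto_intros s t)
  then have lim: "(\<lambda>n. C * (?u n * (L2_norm g + ?v n)) + C * (L2_norm f * ?v n)) \<longlonglongrightarrow> 0" by simp
  show ?thesis
  proof (rule Lim_null_comparison[THEN Lim_null[THEN iffD2]])
    show "\<forall>\<^sub>F n in sequentially. norm (conj_form A b (s n) (t n) - conj_form A b f g) \<le> C * (?u n * (L2_norm g + ?v n)) + C * (L2_norm f * ?v n)"
      by (intro always_eventually allI le)
  qed (rule lim)
qed

end

section \<open>Symplectic covariance and the commutator identity\<close>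

lemma symplectic_J_vjoin: "symplectic_J *v z = vjoin (vsnd z) (- vfst z)"
proof -
  have "(symplectic_J *v z) $ i = vjoin (vsnd z) (- vfst z) $ i" for i
    by (cases i) (simp_all add: matrix_vector_mult_def symplectic_J_def vjoin_def vfst_def vsnd_def
        UNIV_Plus_UNIV[symmetric] sum.Plus if_distrib[where f="\<lambda>c. c * _"] cong: if_cong del: UNIV_Plus_UNIV)
  then show ?thesis by (simp add: vec_eq_iff)
qed

text \<open>The symplectic relation sends the kernel of \<open>S\<close> into the kernel of
  \<open>symplectic_J\<close>, which is trivial, and an injective linear endomorphism in finite
  dimension is onto.\<close>

lemma Sp_surj:
  fixes S :: "real^('m::finite + 'm)^('m + 'm)"
  assumes "S \<in> Sp"
  shows "\<exists>z. S *v z = w"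
proof -
  have J: "transpose S ** symplectic_J ** S = symplectic_J" using assms by (simp add: Sp_def)
  have "inj ((*v) S)"
    unfolding linear_injective_0[OF matrix_vector_mul_linear]
  proof (intro allI impI)
    fix x assume "S *v x = 0"
    then have "symplectic_J *v x = 0"
      by (subst J[symmetric]) (simp add: matrix_vector_mul_assoc[symmetric])
    then have "vjoin (vsnd x) (- vfst x) = vjoin 0 0"
      unfolding symplectic_J_vjoin by (simp add: vec_eq_iff vjoin_def split: sum.split)
    from arg_cong[OF this, of vfst] arg_cong[OF this, of vsnd] have "vfst x = 0" "vsnd x = 0" by simp_all
    then have "x $ i = 0" for i
      by (cases i) (simp_all add: vfst_def vsnd_def vec_eq_iff)
    then show "x = 0" by (simp add: vec_eq_iff)
  qed
  then have "surj ((*v) S)"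
    by (rule linear_injective_imp_surjective[OF matrix_vector_mul_linear]) simp
  then show ?thesis by (metis surjD)
qed

lemma cmod_cis_minus_one: "cmod (cis \<theta> - 1) \<le> \<bar>\<theta>\<bar>"
proof -
  have "cmod (cis \<theta> - 1) = 2 * \<bar>sin (\<theta> / 2)\<bar>"
    using dist_exp_i_1[of \<theta>] by (simp add: cis_conv_exp)
  also have "\<dots> \<le> \<bar>\<theta>\<bar>" using abs_sin_x_le_abs_x[of "\<theta> / 2"] by simp
  finally show ?thesis .
qed

lemma cis_difference_quotient:
  assumes t: "\<And>n::nat. t n \<noteq> 0" "t \<longlonglongrightarrow> 0"
  shows "(\<lambda>n. of_real (1 / t n) * (cis (t n * c) - 1)) \<longlonglongrightarrow> \<i> * of_real c"
proof -
  have "((\<lambda>h. exp (\<i> * of_real c * h)) has_field_derivative \<i> * of_real c) (at 0)"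
    by (auto intro!: derivative_eq_intros)
  then have "(\<lambda>h. (exp (\<i> * of_real c * h) - 1) / h) \<midarrow>0\<rightarrow> \<i> * of_real c"
    by (simp add: DERIV_def)
  moreover have "filterlim (\<lambda>n. complex_of_real (t n)) (at 0) sequentially"
    unfolding filterlim_at using tendsto_of_real[OF t(2), where 'a=complex] t(1) by simp
  ultimately have "(\<lambda>n. (exp (\<i> * of_real c * of_real (t n)) - 1) / of_real (t n)) \<longlonglongrightarrow> \<i> * of_real c"
    by (rule filterlim_compose)
  moreover have "of_real (1 / t n) * (cis (t n * c) - 1) = (exp (\<i> * of_real c * of_real (t n)) - 1) / of_real (t n)" for n
    by (simp add: cis_conv_exp mult.commute mult.left_commute)
  ultimately show ?thesis by (simp only:)
qed

context
  fixes S :: "real^('m::finite + 'm)^('m + 'm)" and A :: "(real^'m) operator"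
  assumes SA: "metaplectic_operator S A"
begin

lemma metaplectic_unitary: "L2_unitary A"
  using SA unfolding metaplectic_operator_def by simp

text \<open>As S z = (0, e_j), the operator \<open>rho\<close> at S(t z) has no translation part and
  is multiplication by cis(2 pi t x_j). Covariance moves it through \<open>A\<close>.\<close>

lemma unitary_inv_modulation:
  assumes z: "S *v z = vjoin 0 (axis j 1)" and p: "p \<in> L2"
  shows "ae_eq (unitary_inv A (\<lambda>x. cis (2 * pi * t * x $ j) * p x)) (rho (t *\<^sub>R z) 0 (unitary_inv A p))"
proof (rule unitary_inv_eqI[OF metaplectic_unitary rho_L2[OF unitary_inv_L2[OF metaplectic_unitary p]]])
  have rho: "rho (S *v (t *\<^sub>R z)) 0 g = (\<lambda>x. cis (2 * pi * t * x $ j) * g x)" for g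
  proof -
    have "S *v (t *\<^sub>R z) = vjoin 0 (t *\<^sub>R axis j 1)"
      unfolding matrix_vector_mult_scaleR z by (simp add: vec_eq_iff vjoin_def split: sum.split)
    then show ?thesis by (simp add: rho_def fun_eq_iff inner_axis' mult.assoc)
  qed
  show "(\<lambda>x. cis (2 * pi * t * x $ j) * p x) \<in> L2"
    by (rule L2_mult_bounded[OF p, where C=1]) simp_all
  have "ae_eq (A (rho (t *\<^sub>R z) 0 (unitary_inv A p))) (rho (S *v (t *\<^sub>R z)) 0 (A (unitary_inv A p)))"
    using SA unitary_inv_L2[OF metaplectic_unitary p] unfolding metaplectic_operator_def by blast
  also have "ae_eq \<dots> (\<lambda>x. cis (2 * pi * t * x $ j) * p x)"
    unfolding rho using unitary_inv_right[OF metaplectic_unitary p] unfolding ae_eq_def by eventually_elim simp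
  finally show "ae_eq (A (rho (t *\<^sub>R z) 0 (unitary_inv A p))) (\<lambda>x. cis (2 * pi * t * x $ j) * p x)" .
qed

lemma modulation_tendsto:
  fixes p :: "real^'m \<Rightarrow> complex"
  assumes p: "p \<in> L2" and t: "t \<longlonglongrightarrow> 0"
  shows "(\<lambda>n. L2_norm (\<lambda>x. cis (2 * pi * t n * x $ j) * p x - p x)) \<longlonglongrightarrow> 0"
proof (rule L2_dominated_convergence[OF _ _ L2_cmult[OF p, of 2]])
  note [measurable] = L2_measurable[OF p]
  show "(\<lambda>x. cis (2 * pi * t n * x $ j) * p x) \<in> borel_measurable borel" for n by measurable
  show "p \<in> borel_measurable borel" by measurable
  have "(\<lambda>n. cis (2 * pi * t n * x $ j) * p x) \<longlonglongrightarrow> cis (2 * pi * 0 * x $ j) * p x" for x :: "real^'m"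
    by (intro tendsto_intros t)
  then show "AE x::real^'m in lborel. (\<lambda>n. cis (2 * pi * t n * x $ j) * p x) \<longlonglongrightarrow> p x" by simp
  show "cmod (cis (2 * pi * t n * x $ j) * p x - p x) \<le> cmod (2 * p x)" for n x
    by (rule order_trans[OF norm_triangle_ineq4]) (simp add: norm_mult)
qed

lemma modulation_derivative:
  fixes p :: "real^'m \<Rightarrow> complex"
  assumes p: "p \<in> L2" "(\<lambda>x. of_real (x $ j) * p x) \<in> L2" and t: "\<And>n. t n \<noteq> 0" "t \<longlonglongrightarrow> 0"
  shows "(\<lambda>n. L2_norm (\<lambda>x. of_real (1 / t n) * (cis (2 * pi * t n * x $ j) * p x - p x)
      - 2 * pi * \<i> * (of_real (x $ j) * p x))) \<longlonglongrightarrow> 0"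
\<comment> \<open>4 pi is the sum of two contributions 2 pi |x_j|, one from |cis \<theta> - 1| <=
  |\<theta>| and one from the limit itself.\<close>
proof (rule L2_dominated_convergence[OF _ _ L2_cmult[OF p(2), of "4 * pi"]])
  note [measurable] = L2_measurable[OF p(1)]
  show "(\<lambda>x. of_real (1 / t n) * (cis (2 * pi * t n * x $ j) * p x - p x)) \<in> borel_measurable borel" for n by measurable
  show "(\<lambda>x. 2 * pi * \<i> * (of_real (x $ j) * p x)) \<in> borel_measurable borel" by measurable
  have eq: "of_real (1 / t n) * (cis (2 * pi * t n * x $ j) * p x - p x) = of_real (1 / t n) * (cis (t n * (2 * pi * x $ j)) - 1) * p x" for n and x :: "real^'m"
    by (simp add: algebra_simps)
  show "AE x::real^'m in lborel. (\<lambda>n. of_real (1 / t n) * (cis (2 * pi * t n * x $ j) * p x - p x)) \<longlonglongrightarrow> 2 * pi * \<i> * (of_real (x $ j) * p x)"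
    unfolding eq
  proof (intro AE_I2)
    fix x :: "real^'m"
    show "(\<lambda>n. of_real (1 / t n) * (cis (t n * (2 * pi * x $ j)) - 1) * p x) \<longlonglongrightarrow> 2 * pi * \<i> * (of_real (x $ j) * p x)"
      using tendsto_mult_right[OF cis_difference_quotient[OF t, of "2 * pi * x $ j"], of "p x"] by (simp only: of_real_mult of_real_numeral mult_ac)
  qed
  show "cmod (of_real (1 / t n) * (cis (2 * pi * t n * x $ j) * p x - p x) - 2 * pi * \<i> * (of_real (x $ j) * p x)) \<le> cmod (4 * pi * (of_real (x $ j) * p x))" for n x
  proof -
    have "cmod (of_real (1 / t n) * (cis (t n * (2 * pi * x $ j)) - 1)) \<le> \<bar>1 / t n\<bar> * \<bar>t n * (2 * pi * x $ j)\<bar>"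
      unfolding norm_mult norm_of_real by (intro mult_left_mono cmod_cis_minus_one) simp
    also have "\<dots> = 2 * pi * \<bar>x $ j\<bar>" using t(1)[of n] by (simp add: abs_mult)
    finally have "cmod (of_real (1 / t n) * (cis (t n * (2 * pi * x $ j)) - 1)) * cmod (p x) \<le> 2 * pi * \<bar>x $ j\<bar> * cmod (p x)"
      by (rule mult_right_mono) simp
    moreover have "cmod (of_real (1 / t n) * (cis (t n * (2 * pi * x $ j)) - 1) * p x - 2 * pi * \<i> * (of_real (x $ j) * p x))
        \<le> cmod (of_real (1 / t n) * (cis (t n * (2 * pi * x $ j)) - 1)) * cmod (p x) + cmod (2 * pi * \<i> * (of_real (x $ j) * p x))"
      unfolding norm_mult[symmetric] by (rule norm_triangle_ineq4)
    moreover have "cmod (2 * pi * \<i> * (of_real (x $ j) * p x)) = 2 * pi * \<bar>x $ j\<bar> * cmod (p x)"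
      "cmod (4 * pi * (of_real (x $ j) * p x)) = 4 * pi * \<bar>x $ j\<bar> * cmod (p x)"
      by (simp_all add: norm_mult)
    ultimately show ?thesis unfolding eq by linarith
  qed
qed

text \<open>The form with both arguments modulated by cis(2 pi t x_j) is differentiated at t = 0 in
  two ways: through the symbol, as translation by t z, and through the arguments, by the product
  rule. Conjugation in the second argument turns the sum into a commutator. The quantifier on
  \<open>z\<close> comes first, so that one direction serves all symbols.\<close>

lemma conj_form_commutator:
  "\<exists>z. \<forall>b\<in>S000. \<forall>p\<in>L2. \<forall>q\<in>L2. (\<lambda>x::real^'m. of_real (x $ j) * p x) \<in> L2 \<longrightarrow> (\<lambda>x. of_real (x $ j) * q x) \<in> L2 \<longrightarrow>
     conj_form A (dir_deriv z b) p q =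
       2 * pi * \<i> * (conj_form A b (\<lambda>x. of_real (x $ j) * p x) q - conj_form A b p (\<lambda>x. of_real (x $ j) * q x))"
proof -
  have "S \<in> Sp" using SA unfolding metaplectic_operator_def by simp
  then obtain z where z: "S *v z = vjoin 0 (axis j 1)" using Sp_surj by blast
  note U = metaplectic_unitary
  show ?thesis
  proof (intro exI[of _ z] ballI impI)
    fix b :: "real^('m + 'm) \<Rightarrow> complex" and p q :: "real^'m \<Rightarrow> complex"
    assume b: "b \<in> S000" and p: "p \<in> L2" and q: "q \<in> L2"
      and xp: "(\<lambda>x. of_real (x $ j) * p x) \<in> L2" and xq: "(\<lambda>x. of_real (x $ j) * q x) \<in> L2"
    define t :: "nat \<Rightarrow> real" where "t n = 1 / real (Suc n)" for n
    have t: "t n \<noteq> 0" "t \<longlonglongrightarrow> 0" for n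
      unfolding t_def using LIMSEQ_inverse_real_of_nat by (simp_all add: inverse_eq_divide)
    define M :: "nat \<Rightarrow> (real^'m \<Rightarrow> complex) \<Rightarrow> real^'m \<Rightarrow> complex" where
      "M n p = (\<lambda>x. cis (2 * pi * t n * x $ j) * p x)" for n p
    have M_L2: "M n p \<in> L2" if "p \<in> L2" for n p
      unfolding M_def by (rule L2_mult_bounded[OF that, where C=1]) simp_all
    have Mrho: "conj_form A b (M n p) (M n q) = weyl_form b (rho (t n *\<^sub>R z) 0 (unitary_inv A p)) (rho (t n *\<^sub>R z) 0 (unitary_inv A q))" for n
      unfolding conj_form_def M_def
      by (intro weyl_form_cong_AE unitary_inv_modulation[OF z] p q rho_L2 unitary_inv_L2 U M_L2[unfolded M_def])
    let ?dp = "\<lambda>n x. of_real (1 / t n) * (M n p x - p x)" and ?dq = "\<lambda>n x. of_real (1 / t n) * (M n q x - q x)"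
    have dL: "?dp n \<in> L2" "?dq n \<in> L2" for n by (intro L2_cmult L2_diff M_L2 p q)+
    have "of_real (1 / t n) * (conj_form A b (M n p) (M n q) - conj_form A b p q) = conj_form A b (?dp n) (M n q) + conj_form A b p (?dq n)" for n
    proof -
      have "conj_form A b (?dp n) (M n q) = of_real (1 / t n) * (conj_form A b (M n p) (M n q) - conj_form A b p (M n q))"
        unfolding conj_form_cmult_left[OF U b L2_diff[OF M_L2[OF p] p] M_L2[OF q]] conj_form_diff_left[OF U b M_L2[OF p] p M_L2[OF q]] ..
      moreover have "conj_form A b p (?dq n) = of_real (1 / t n) * (conj_form A b p (M n q) - conj_form A b p q)"
        unfolding conj_form_cmult_right[OF U b p L2_diff[OF M_L2[OF q] q]] conj_form_diff_right[OF U b p M_L2[OF q] q] complex_cnj_complex_of_real ..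
      ultimately show ?thesis by (simp only: distrib_left[symmetric] diff_add_eq_diff_diff_swap[symmetric]) (simp add: algebra_simps)
    qed
    moreover have "(\<lambda>n. of_real (1 / t n) * (conj_form A b (M n p) (M n q) - conj_form A b p q)) \<longlonglongrightarrow> conj_form A (dir_deriv z b) p q"
      unfolding Mrho unfolding conj_form_def
      by (rule weyl_form_rho_derivative[OF b unitary_inv_L2[OF U p] unitary_inv_L2[OF U q] t])
    moreover have "(\<lambda>n. conj_form A b (?dp n) (M n q) + conj_form A b p (?dq n)) \<longlonglongrightarrow>
        conj_form A b (\<lambda>x. 2 * pi * \<i> * (of_real (x $ j) * p x)) q + conj_form A b p (\<lambda>x. 2 * pi * \<i> * (of_real (x $ j) * q x))"
    proof (intro tendsto_add conj_form_tendsto U b dL M_L2 L2_cmult p q xp xq)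
      show "(\<lambda>n. L2_norm (\<lambda>x. ?dp n x - 2 * pi * \<i> * (of_real (x $ j) * p x))) \<longlonglongrightarrow> 0"
        unfolding M_def by (rule modulation_derivative[OF p xp t])
      show "(\<lambda>n. L2_norm (\<lambda>x. ?dq n x - 2 * pi * \<i> * (of_real (x $ j) * q x))) \<longlonglongrightarrow> 0"
        unfolding M_def by (rule modulation_derivative[OF q xq t])
      show "(\<lambda>n. L2_norm (\<lambda>x. M n q x - q x)) \<longlonglongrightarrow> 0"
        unfolding M_def by (rule modulation_tendsto[OF q t(2)])
      show "(\<lambda>n::nat. L2_norm (\<lambda>x. p x - p x)) \<longlonglongrightarrow> 0"
        by (simp add: L2_norm_def)
    qed
    ultimately have "conj_form A (dir_deriv z b) p q =
        conj_form A b (\<lambda>x. 2 * pi * \<i> * (of_real (x $ j) * p x)) q + conj_form A b p (\<lambda>x. 2 * pi * \<i> * (of_real (x $ j) * q x))"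
      by (simp only: LIMSEQ_unique)
    also have "\<dots> = 2 * pi * \<i> * (conj_form A b (\<lambda>x. of_real (x $ j) * p x) q - conj_form A b p (\<lambda>x. of_real (x $ j) * q x))"
      unfolding conj_form_cmult_left[OF U b xp q] conj_form_cmult_right[OF U b p xq] by (simp add: algebra_simps)
    finally show "conj_form A (dir_deriv z b) p q =
        2 * pi * \<i> * (conj_form A b (\<lambda>x. of_real (x $ j) * p x) q - conj_form A b p (\<lambda>x. of_real (x $ j) * q x))" .
  qed
qed

end

section \<open>Off-diagonal decay\<close>

context
  fixes S :: "real^('m::finite + 'm)^('m + 'm)" and A :: "(real^'m) operator"
  assumes SA: "metaplectic_operator S A"
begin

private lemmas U = metaplectic_unitary[OF SA]

text \<open>The commutator identity is applied to p' = p / (x_j - \<kappa>) and q. With q' = (x_j -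
  \<kappa>) q one has x_j p' = p + \<kappa> p' and x_j q = q' + \<kappa> q, so the terms with
  \<kappa> cancel and the forms of (p, q) and (p', q') remain. The product of the norms of p' and q'
  is at most half that of p and q.\<close>

lemma conj_form_commutator_step:
  assumes comm: "\<forall>b\<in>S000. \<forall>p\<in>L2. \<forall>q\<in>L2. (\<lambda>x::real^'m. of_real (x $ j) * p x) \<in> L2 \<longrightarrow> (\<lambda>x. of_real (x $ j) * q x) \<in> L2 \<longrightarrow>
     conj_form A (dir_deriv z b) p q =
       2 * pi * \<i> * (conj_form A b (\<lambda>x. of_real (x $ j) * p x) q - conj_form A b p (\<lambda>x. of_real (x $ j) * q x))"
    and b: "b \<in> S000" and p: "p \<in> L2" and q: "q \<in> L2" and r: "0 < r"
    and q_supp: "\<And>x. q x \<noteq> 0 \<Longrightarrow> \<bar>x $ j - \<kappa>\<bar> \<le> r" and p_supp: "\<And>x. p x \<noteq> 0 \<Longrightarrow> 2 * r \<le> \<bar>x $ j - \<kappa>\<bar>"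
  obtains p' q' where "p' \<in> L2" "q' \<in> L2" "L2_norm p' \<le> L2_norm p / (2 * r)" "L2_norm q' \<le> r * L2_norm q"
    "\<And>x. q' x \<noteq> 0 \<Longrightarrow> q x \<noteq> 0" "\<And>x. p' x \<noteq> 0 \<Longrightarrow> p x \<noteq> 0"
    "cmod (conj_form A b p q) \<le> cmod (conj_form A b p' q') + cmod (conj_form A (dir_deriv z b) p' q) / (2 * pi)"
proof -
  \<comment> \<open>The multipliers are set to 0 off the sets that carry \<open>p\<close> and
    \<open>q\<close>; this makes them bounded everywhere and leaves the products \<open>p'\<close>
    and \<open>q'\<close> as intended.\<close>
  define u :: "real^'m \<Rightarrow> complex" where "u x = (if 2 * r \<le> \<bar>x $ j - \<kappa>\<bar> then of_real (1 / (x $ j - \<kappa>)) else 0)" for x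
  define v :: "real^'m \<Rightarrow> complex" where "v x = (if \<bar>x $ j - \<kappa>\<bar> \<le> r then of_real (x $ j - \<kappa>) else 0)" for x
  define p' where "p' x = u x * p x" for x
  define q' where "q' x = v x * q x" for x
  have u: "u \<in> borel_measurable borel" "cmod (u x) \<le> 1 / (2 * r)" for x
  proof -
    show "u \<in> borel_measurable borel" unfolding u_def[abs_def] by measurable
    show "cmod (u x) \<le> 1 / (2 * r)"
    proof (cases "2 * r \<le> \<bar>x $ j - \<kappa>\<bar>")
      case True
      then have "1 / \<bar>x $ j - \<kappa>\<bar> \<le> 1 / (2 * r)" using r by (intro divide_left_mono) auto
      then show ?thesis using True by (simp only: u_def if_True norm_of_real abs_divide abs_one)
    qed (use r in \<open>simp add: u_def\<close>)
  qed
  have v: "v \<in> borel_measurable borel" "cmod (v x) \<le> r" for x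
  proof -
    show "v \<in> borel_measurable borel" unfolding v_def[abs_def] by measurable
    show "cmod (v x) \<le> r"
      unfolding v_def using r by (cases "\<bar>x $ j - \<kappa>\<bar> \<le> r") (simp_all only: if_True if_False norm_of_real norm_zero less_imp_le)
  qed
  have p'L: "p' \<in> L2" and q'L: "q' \<in> L2"
    unfolding p'_def[abs_def] q'_def[abs_def] by (rule L2_mult_bounded[OF p u], rule L2_mult_bounded[OF q v])
  have p'n: "L2_norm p' \<le> L2_norm p / (2 * r)"
    using L2_norm_mult_le[OF p u] r unfolding p'_def[abs_def] by simp
  have q'n: "L2_norm q' \<le> r * L2_norm q"
    using L2_norm_mult_le[OF q v] r unfolding q'_def[abs_def] by simp
  have pe: "(\<lambda>x. of_real (x $ j) * p' x) = (\<lambda>x. p x + of_real \<kappa> * p' x)"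
  proof
    fix x
    show "of_real (x $ j) * p' x = p x + of_real \<kappa> * p' x"
    proof (cases "p x = 0")
      case False
      have le: "2 * r \<le> \<bar>x $ j - \<kappa>\<bar>" by (rule p_supp[OF False])
      then have ne: "x $ j - \<kappa> \<noteq> 0" using r by auto
      have "of_real (x $ j - \<kappa>) * u x = 1"
        using ne unfolding u_def if_P[OF le] of_real_mult[symmetric] by simp
      then have "of_real (x $ j - \<kappa>) * p' x = p x" unfolding p'_def mult.assoc[symmetric] by simp
      then show ?thesis by (simp add: algebra_simps)
    qed (simp add: p'_def)
  qed
  have qe: "(\<lambda>x. of_real (x $ j) * q x) = (\<lambda>x. q' x + of_real \<kappa> * q x)"
  proof
    fix x
    show "of_real (x $ j) * q x = q' x + of_real \<kappa> * q x"
    proof (cases "q x = 0")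
      case False
      show ?thesis unfolding q'_def v_def if_P[OF q_supp[OF False]] by (simp add: algebra_simps)
    qed (simp add: q'_def)
  qed
  have peL: "(\<lambda>x. of_real (x $ j) * p' x) \<in> L2" unfolding pe by (intro L2_add L2_cmult p p'L)
  have qeL: "(\<lambda>x. of_real (x $ j) * q x) \<in> L2" unfolding qe by (intro L2_add L2_cmult q q'L)
  have "conj_form A (dir_deriv z b) p' q = 2 * pi * \<i> *
      (conj_form A b (\<lambda>x. of_real (x $ j) * p' x) q - conj_form A b p' (\<lambda>x. of_real (x $ j) * q x))"
    using comm b p'L q peL qeL by simp
  also have "conj_form A b (\<lambda>x. of_real (x $ j) * p' x) q = conj_form A b p q + of_real \<kappa> * conj_form A b p' q"
    unfolding pe conj_form_add_left[OF U b p L2_cmult[OF p'L] q] conj_form_cmult_left[OF U b p'L q] ..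
  also have "conj_form A b p' (\<lambda>x. of_real (x $ j) * q x) = conj_form A b p' q' + of_real \<kappa> * conj_form A b p' q"
    unfolding qe conj_form_add_right[OF U b p'L q'L L2_cmult[OF q]] conj_form_cmult_right[OF U b p'L q] complex_cnj_complex_of_real ..
  finally have "conj_form A (dir_deriv z b) p' q = 2 * pi * \<i> * (conj_form A b p q - conj_form A b p' q')" by simp
  then have "cmod (conj_form A (dir_deriv z b) p' q) / (2 * pi) = cmod (conj_form A b p q - conj_form A b p' q')"
    by (simp add: norm_mult)
  then have le: "cmod (conj_form A b p q) \<le> cmod (conj_form A b p' q') + cmod (conj_form A (dir_deriv z b) p' q) / (2 * pi)"
    using norm_triangle_ineq2[of "conj_form A b p q" "conj_form A b p' q'"] by linarith
  show thesis
    by (rule that[OF p'L q'L p'n q'n _ _ le]) (auto simp: p'_def q'_def)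
qed

text \<open>The symbol is quantified inside the induction, since the step for \<open>b\<close> uses
  the estimate of order \<open>N\<close> for the symbol \<open>dir_deriv z b\<close>. The constant
  depends neither on the position \<kappa> nor on the scale \<open>r\<close>, so that it serves all
  cubes at once.\<close>

lemma conj_form_decay_coordinate:
  "\<forall>b\<in>S000. \<exists>C\<ge>0. \<forall>\<kappa> r p q. 0 < r \<longrightarrow> p \<in> L2 \<longrightarrow> q \<in> L2 \<longrightarrow> (\<forall>x. q x \<noteq> 0 \<longrightarrow> \<bar>x $ j - \<kappa>\<bar> \<le> r) \<longrightarrow>
     (\<forall>x. p x \<noteq> 0 \<longrightarrow> 2 * r \<le> \<bar>x $ j - \<kappa>\<bar>) \<longrightarrow> r ^ N * cmod (conj_form A b p q) \<le> C * (L2_norm p * L2_norm q)"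
proof (induction N)
  case 0
  show ?case
  proof
    fix b :: "real^('m + 'm) \<Rightarrow> complex" assume "b \<in> S000"
    from conj_form_bound[OF U this]
    show "\<exists>C\<ge>0. \<forall>\<kappa> r p q. 0 < r \<longrightarrow> p \<in> L2 \<longrightarrow> q \<in> L2 \<longrightarrow> (\<forall>x. q x \<noteq> 0 \<longrightarrow> \<bar>x $ j - \<kappa>\<bar> \<le> r) \<longrightarrow>
     (\<forall>x. p x \<noteq> 0 \<longrightarrow> 2 * r \<le> \<bar>x $ j - \<kappa>\<bar>) \<longrightarrow> r ^ 0 * cmod (conj_form A b p q) \<le> C * (L2_norm p * L2_norm q)"
      by (auto simp: mult_1)
  qed
next
  case (Suc N)
  obtain z where comm: "\<forall>b\<in>S000. \<forall>p\<in>L2. \<forall>q\<in>L2. (\<lambda>x::real^'m. of_real (x $ j) * p x) \<in> L2 \<longrightarrow> (\<lambda>x. of_real (x $ j) * q x) \<in> L2 \<longrightarrow>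
     conj_form A (dir_deriv z b) p q =
       2 * pi * \<i> * (conj_form A b (\<lambda>x. of_real (x $ j) * p x) q - conj_form A b p (\<lambda>x. of_real (x $ j) * q x))"
    using conj_form_commutator[OF SA, of j] by blast
  show ?case
  proof
    fix b :: "real^('m + 'm) \<Rightarrow> complex" assume b: "b \<in> S000"
    obtain C0 where C0: "0 \<le> C0" "\<And>p q. p \<in> L2 \<Longrightarrow> q \<in> L2 \<Longrightarrow> cmod (conj_form A b p q) \<le> C0 * (L2_norm p * L2_norm q)"
      using conj_form_bound[OF U b] by blast
    obtain C1 where C1: "0 \<le> C1" and decay: "\<forall>\<kappa> r p q. 0 < r \<longrightarrow> p \<in> L2 \<longrightarrow> q \<in> L2 \<longrightarrow> (\<forall>x. q x \<noteq> 0 \<longrightarrow> \<bar>x $ j - \<kappa>\<bar> \<le> r) \<longrightarrow>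
     (\<forall>x. p x \<noteq> 0 \<longrightarrow> 2 * r \<le> \<bar>x $ j - \<kappa>\<bar>) \<longrightarrow> r ^ N * cmod (conj_form A (dir_deriv z b) p q) \<le> C1 * (L2_norm p * L2_norm q)"
      using Suc.IH S000_dir_deriv[OF b, of z] by blast
    have main: "r ^ Suc N * cmod (conj_form A b p q) \<le> C1 / (2 * pi) * (L2_norm p * L2_norm q)"
      if r: "0 < r" and pq: "p \<in> L2" "q \<in> L2" "\<And>x. q x \<noteq> 0 \<Longrightarrow> \<bar>x $ j - \<kappa>\<bar> \<le> r" "\<And>x. p x \<noteq> 0 \<Longrightarrow> 2 * r \<le> \<bar>x $ j - \<kappa>\<bar>"
      for \<kappa> r p q
    proof -
      \<comment> \<open>\<open>K\<close> solves K = K / 2 + C1 / (4 pi r^(N+1)): half of it from the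
        main term with halved norms, the rest from the derivative of the symbol.\<close>
      define K where "K = C1 / (2 * pi * r ^ Suc N)"
      have K: "0 \<le> K" using C1 r by (simp add: K_def)
      \<comment> \<open>Dividing \<open>p\<close> and multiplying \<open>q\<close> by \<open>x $ j - \<kappa>\<close> halves the product of the norms, so the a priori
        bound \<open>C0\<close> is halved at each step.\<close>
      have iter: "cmod (conj_form A b p q) \<le> (C0 / 2^n + K) * (L2_norm p * L2_norm q)"
        if "p \<in> L2" "q \<in> L2" "\<And>x. q x \<noteq> 0 \<Longrightarrow> \<bar>x $ j - \<kappa>\<bar> \<le> r" "\<And>x. p x \<noteq> 0 \<Longrightarrow> 2 * r \<le> \<bar>x $ j - \<kappa>\<bar>" for n p q
        using that
      proof (induction n arbitrary: p q)
        case 0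
        have "0 \<le> K * (L2_norm p * L2_norm q)" using K by simp
        then show ?case using C0(2)[OF 0(1,2)] by (simp add: distrib_right)
      next
        case (Suc n)
        note p = Suc.prems(1) and q = Suc.prems(2) and qs = Suc.prems(3) and ps = Suc.prems(4)
        obtain p' q' where pq': "p' \<in> L2" "q' \<in> L2" "L2_norm p' \<le> L2_norm p / (2 * r)" "L2_norm q' \<le> r * L2_norm q"
          "\<And>x. q' x \<noteq> 0 \<Longrightarrow> q x \<noteq> 0" "\<And>x. p' x \<noteq> 0 \<Longrightarrow> p x \<noteq> 0"
          and le: "cmod (conj_form A b p q) \<le> cmod (conj_form A b p' q') + cmod (conj_form A (dir_deriv z b) p' q) / (2 * pi)"
          using conj_form_commutator_step[OF comm b p q r qs ps] by metis
        have "cmod (conj_form A b p' q') \<le> (C0 / 2^n + K) * (L2_norm p' * L2_norm q')"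
          by (rule Suc.IH[OF pq'(1,2) qs[OF pq'(5)] ps[OF pq'(6)]])
        also have "\<dots> \<le> (C0 / 2^n + K) * (L2_norm p / (2 * r) * (r * L2_norm q))"
          using C0(1) K r by (intro mult_left_mono mult_mono pq' add_nonneg_nonneg) simp_all
        also have "\<dots> = (C0 / 2^Suc n + K / 2) * (L2_norm p * L2_norm q)"
          using r by (simp add: field_simps)
        finally have 1: "cmod (conj_form A b p' q') \<le> (C0 / 2^Suc n + K / 2) * (L2_norm p * L2_norm q)" .
        have "r ^ N * cmod (conj_form A (dir_deriv z b) p' q) \<le> C1 * (L2_norm p' * L2_norm q)"
          using decay[rule_format, OF r pq'(1) q qs ps[OF pq'(6)]] .
        also have "\<dots> \<le> C1 * (L2_norm p / (2 * r) * L2_norm q)"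
          using C1 r by (intro mult_left_mono mult_right_mono pq') simp_all
        also have "\<dots> = r ^ N * (2 * pi) * (K / 2 * (L2_norm p * L2_norm q))"
          unfolding K_def using r by (simp add: field_simps)
        finally have 2: "cmod (conj_form A (dir_deriv z b) p' q) / (2 * pi) \<le> K / 2 * (L2_norm p * L2_norm q)"
          using r by (simp add: pos_divide_le_eq mult_ac)
        have "cmod (conj_form A b p q) \<le> (C0 / 2^Suc n + K / 2) * (L2_norm p * L2_norm q) + K / 2 * (L2_norm p * L2_norm q)"
          using le 1 2 by linarith
        also have "\<dots> = (C0 / 2^Suc n + K) * (L2_norm p * L2_norm q)" by (simp add: algebra_simps)
        finally show ?case .
      qed
      \<comment> \<open>As n grows the a priori bound drops out and \<open>K\<close>
        remains.\<close>
      have "(\<lambda>n. (C0 * (1/2)^n + K) * (L2_norm p * L2_norm q)) \<longlonglongrightarrow> (C0 * 0 + K) * (L2_norm p * L2_norm q)"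
        by (intro tendsto_intros LIMSEQ_power_zero) simp
      then have "cmod (conj_form A b p q) \<le> (C0 * 0 + K) * (L2_norm p * L2_norm q)"
        by (rule LIMSEQ_le_const) (use iter[OF pq] in \<open>auto simp: power_divide\<close>)
      then have "r ^ Suc N * cmod (conj_form A b p q) \<le> r ^ Suc N * (K * (L2_norm p * L2_norm q))"
        using r by (intro mult_left_mono) simp_all
      also have "\<dots> = C1 / (2 * pi) * (L2_norm p * L2_norm q)" unfolding K_def using r by (simp add: field_simps)
      finally show ?thesis .
    qed
    show "\<exists>C\<ge>0. \<forall>\<kappa> r p q. 0 < r \<longrightarrow> p \<in> L2 \<longrightarrow> q \<in> L2 \<longrightarrow> (\<forall>x. q x \<noteq> 0 \<longrightarrow> \<bar>x $ j - \<kappa>\<bar> \<le> r) \<longrightarrow>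
     (\<forall>x. p x \<noteq> 0 \<longrightarrow> 2 * r \<le> \<bar>x $ j - \<kappa>\<bar>) \<longrightarrow> r ^ Suc N * cmod (conj_form A b p q) \<le> C * (L2_norm p * L2_norm q)"
      by (intro exI[of _ "C1 / (2 * pi)"] conjI allI impI main) (use C1 in auto)
  qed
qed

text \<open>Induction on the set of coordinates in which separation may occur. The part of
  \<open>p\<close> separated in coordinate \<open>i\<close> falls under
  \<open>conj_form_decay_coordinate\<close>; the rest is separated in a coordinate of
  \<open>J\<close>. For an empty set only \<open>p = 0\<close> is left.\<close>

lemma conj_form_decay:
  assumes b: "b \<in> S000" and J: "finite J"
  shows "\<exists>C\<ge>0. \<forall>c::real^'m. \<forall>r p q. 0 < r \<longrightarrow> p \<in> L2 \<longrightarrow> q \<in> L2 \<longrightarrow> (\<forall>x. q x \<noteq> 0 \<longrightarrow> (\<forall>j. \<bar>x $ j - c $ j\<bar> \<le> r)) \<longrightarrow>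
     (\<forall>x. p x \<noteq> 0 \<longrightarrow> (\<exists>j\<in>J. 2 * r \<le> \<bar>x $ j - c $ j\<bar>)) \<longrightarrow> r ^ N * cmod (conj_form A b p q) \<le> C * (L2_norm p * L2_norm q)"
  using J
proof (induction J)
  case empty
  have "r ^ N * cmod (conj_form A b p q) \<le> 0 * (L2_norm p * L2_norm q)"
    if "q \<in> L2" "\<forall>x. p x \<noteq> 0 \<longrightarrow> (\<exists>j\<in>{}. 2 * r \<le> \<bar>x $ j - c $ j\<bar>)" for c :: "real^'m" and r p q
  proof -
    have "p = (\<lambda>x. 0 * (\<lambda>x. 0) x)" using that(2) by auto
    then show ?thesis using conj_form_cmult_left[OF U b L2_zero that(1), of 0] by simp
  qed
  then show ?case by (intro exI[of _ 0]) auto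
next
  case (insert i J)
  obtain C1 where C1: "0 \<le> C1" and 1: "\<And>c r p q. 0 < r \<Longrightarrow> p \<in> L2 \<Longrightarrow> q \<in> L2 \<Longrightarrow> (\<And>x. q x \<noteq> 0 \<Longrightarrow> (\<forall>j. \<bar>x $ j - c $ j\<bar> \<le> r)) \<Longrightarrow>
     (\<And>x. p x \<noteq> 0 \<Longrightarrow> (\<exists>j\<in>J. 2 * r \<le> \<bar>x $ j - c $ j\<bar>)) \<Longrightarrow> r ^ N * cmod (conj_form A b p q) \<le> C1 * (L2_norm p * L2_norm q)"
    using insert.IH by metis
  obtain C2 where C2: "0 \<le> C2" and 2: "\<And>\<kappa> r p q. 0 < r \<Longrightarrow> p \<in> L2 \<Longrightarrow> q \<in> L2 \<Longrightarrow> (\<And>x. q x \<noteq> 0 \<Longrightarrow> \<bar>x $ i - \<kappa>\<bar> \<le> r) \<Longrightarrow>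
     (\<And>x. p x \<noteq> 0 \<Longrightarrow> 2 * r \<le> \<bar>x $ i - \<kappa>\<bar>) \<Longrightarrow> r ^ N * cmod (conj_form A b p q) \<le> C2 * (L2_norm p * L2_norm q)"
    using conj_form_decay_coordinate[of i N, THEN bspec, OF b] by metis
  have "r ^ N * cmod (conj_form A b p q) \<le> (C1 + C2) * (L2_norm p * L2_norm q)"
    if r: "0 < r" and p: "p \<in> L2" and q: "q \<in> L2" and qs: "\<And>x. q x \<noteq> 0 \<Longrightarrow> (\<forall>j. \<bar>x $ j - c $ j\<bar> \<le> r)"
      and ps: "\<And>x. p x \<noteq> 0 \<Longrightarrow> (\<exists>j\<in>insert i J. 2 * r \<le> \<bar>x $ j - c $ j\<bar>)" for c :: "real^'m" and r p q
  proof -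
    define u :: "real^'m \<Rightarrow> complex" where "u x = (if 2 * r \<le> \<bar>x $ i - c $ i\<bar> then 0 else 1)" for x
    define v :: "real^'m \<Rightarrow> complex" where "v x = (if 2 * r \<le> \<bar>x $ i - c $ i\<bar> then 1 else 0)" for x
    have um: "u \<in> borel_measurable borel" "v \<in> borel_measurable borel" unfolding u_def[abs_def] v_def[abs_def] by measurable
    have ub: "cmod (u x) \<le> 1" "cmod (v x) \<le> 1" for x by (simp_all add: u_def v_def)
    have L: "(\<lambda>x. u x * p x) \<in> L2" "(\<lambda>x. v x * p x) \<in> L2"
      by (rule L2_mult_bounded[OF p um(1) ub(1)], rule L2_mult_bounded[OF p um(2) ub(2)])
    have n: "L2_norm (\<lambda>x. u x * p x) \<le> L2_norm p" "L2_norm (\<lambda>x. v x * p x) \<le> L2_norm p"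
      using L2_norm_mult_le[OF p um(1) ub(1)] L2_norm_mult_le[OF p um(2) ub(2)] by simp_all
    have "p = (\<lambda>x. u x * p x + v x * p x)" by (simp add: u_def v_def fun_eq_iff)
    then have "conj_form A b p q = conj_form A b (\<lambda>x. u x * p x + v x * p x) q" by (rule arg_cong)
    also have "\<dots> = conj_form A b (\<lambda>x. u x * p x) q + conj_form A b (\<lambda>x. v x * p x) q"
      by (rule conj_form_add_left[OF U b L q])
    finally have "r ^ N * cmod (conj_form A b p q) \<le> r ^ N * (cmod (conj_form A b (\<lambda>x. u x * p x) q) + cmod (conj_form A b (\<lambda>x. v x * p x) q))"
      using r by (intro mult_left_mono) (simp_all add: norm_triangle_ineq)
    also have "\<dots> = r ^ N * cmod (conj_form A b (\<lambda>x. u x * p x) q) + r ^ N * cmod (conj_form A b (\<lambda>x. v x * p x) q)"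
      by (rule distrib_left)
    also have "\<dots> \<le> C1 * (L2_norm (\<lambda>x. u x * p x) * L2_norm q) + C2 * (L2_norm (\<lambda>x. v x * p x) * L2_norm q)"
    proof (intro add_mono)
      show "r ^ N * cmod (conj_form A b (\<lambda>x. u x * p x) q) \<le> C1 * (L2_norm (\<lambda>x. u x * p x) * L2_norm q)"
      proof (rule 1[OF r L(1) q qs])
        fix x assume "u x * p x \<noteq> 0"
        then have "\<not> 2 * r \<le> \<bar>x $ i - c $ i\<bar>" "p x \<noteq> 0" by (auto simp: u_def split: if_splits)
        then show "\<exists>j\<in>J. 2 * r \<le> \<bar>x $ j - c $ j\<bar>" using ps[of x] by auto
      qed
      show "r ^ N * cmod (conj_form A b (\<lambda>x. v x * p x) q) \<le> C2 * (L2_norm (\<lambda>x. v x * p x) * L2_norm q)"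
      proof (rule 2[OF r L(2) q, where \<kappa>="c $ i"])
        show "\<bar>x $ i - c $ i\<bar> \<le> r" if "q x \<noteq> 0" for x using qs[OF that] by simp
        show "2 * r \<le> \<bar>x $ i - c $ i\<bar>" if "v x * p x \<noteq> 0" for x using that by (auto simp: v_def split: if_splits)
      qed
    qed
    also have "\<dots> \<le> C1 * (L2_norm p * L2_norm q) + C2 * (L2_norm p * L2_norm q)"
      using C1 C2 n by (intro add_mono mult_left_mono mult_right_mono) simp_all
    finally show ?thesis by (simp add: distrib_right)
  qed
  moreover have "0 \<le> C1 + C2" using C1 C2 by simp
  ultimately show ?case by blast
qed

text \<open>\<open>FG\<close> says weakly that G is the conjugated operator applied to F. Testing
  with q, the restriction of G to E, produces the squared norm of q. The part of F in the doubled
  cube is paired by the uniform bound of the form, the part outside by its decay; one factor of the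
  norm of q is then cancelled.\<close>

lemma conj_form_localization:
  assumes b: "b \<in> S000" and F: "F \<in> L2" and G: "G \<in> L2"
    and FG: "\<And>q. q \<in> L2 \<Longrightarrow> L2_inner G q = conj_form A b F q"
  shows "\<exists>C\<ge>0. \<forall>c::real^'m. \<forall>r E. 0 < r \<longrightarrow> E \<in> sets borel \<longrightarrow> E \<subseteq> {x. \<forall>j. \<bar>x $ j - c $ j\<bar> \<le> r} \<longrightarrow>
    L2_norm (\<lambda>x. indicator E x * G x) \<le> C * (L2_norm (\<lambda>x. indicator {x. \<forall>j. \<bar>x $ j - c $ j\<bar> < 2 * r} x * F x) + L2_norm F / r ^ N)"
proof -
  obtain C0 where C0: "0 \<le> C0" "\<And>p q. p \<in> L2 \<Longrightarrow> q \<in> L2 \<Longrightarrow> cmod (conj_form A b p q) \<le> C0 * (L2_norm p * L2_norm q)"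
    using conj_form_bound[OF U b] by blast
  obtain C1 where C1: "0 \<le> C1" and decay: "\<And>c::real^'m. \<And>r p q. 0 < r \<Longrightarrow> p \<in> L2 \<Longrightarrow> q \<in> L2 \<Longrightarrow> (\<And>x. q x \<noteq> 0 \<Longrightarrow> (\<forall>j. \<bar>x $ j - c $ j\<bar> \<le> r)) \<Longrightarrow>
     (\<And>x. p x \<noteq> 0 \<Longrightarrow> (\<exists>j\<in>UNIV. 2 * r \<le> \<bar>x $ j - c $ j\<bar>)) \<Longrightarrow> r ^ N * cmod (conj_form A b p q) \<le> C1 * (L2_norm p * L2_norm q)"
    using conj_form_decay[OF b finite[of UNIV], of N] by metis
  have "L2_norm (\<lambda>x. indicator E x * G x) \<le> (C0 + C1) * (L2_norm (\<lambda>x. indicator {x. \<forall>j. \<bar>x $ j - c $ j\<bar> < 2 * r} x * F x) + L2_norm F / r ^ N)"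
    if r: "0 < r" and E: "E \<in> sets borel" and Es: "E \<subseteq> {x. \<forall>j. \<bar>x $ j - c $ j\<bar> \<le> r}" for c :: "real^'m" and r E
  proof -
    define Q where "Q = {x::real^'m. \<forall>j. \<bar>x $ j - c $ j\<bar> < 2 * r}"
    have Q: "Q \<in> sets borel" unfolding Q_def by measurable
    define q where "q x = indicator E x * G x" for x
    have ind: "(\<lambda>x. indicator B x :: complex) \<in> borel_measurable borel" if "B \<in> sets borel" for B :: "(real^'m) set"
      using that by simp
    have ib: "cmod (indicator B x) \<le> 1" for B and x :: "real^'m" by (simp add: indicator_def)
    have q: "q \<in> L2" unfolding q_def[abs_def] by (rule L2_mult_bounded[OF G ind[OF E] ib])
    have p1: "(\<lambda>x. indicator Q x * F x) \<in> L2" by (rule L2_mult_bounded[OF F ind[OF Q] ib])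
    have Q': "- Q \<in> sets borel" using Q by simp
    have p2: "(\<lambda>x. indicator (- Q) x * F x) \<in> L2" by (rule L2_mult_bounded[OF F ind[OF Q'] ib])
    have "q x * cnj (q x) = G x * cnj (q x)" for x by (simp add: q_def indicator_def)
    then have "L2_inner q q = L2_inner G q" unfolding L2_inner_def by (simp only:)
    then have "complex_of_real ((L2_norm q)\<^sup>2) = conj_form A b F q" by (simp only: L2_inner_self FG[OF q])
    also have "F = (\<lambda>x. indicator Q x * F x + indicator (- Q) x * F x)" by (simp add: indicator_def fun_eq_iff)
    also have "conj_form A b (\<lambda>x. indicator Q x * F x + indicator (- Q) x * F x) q = conj_form A b (\<lambda>x. indicator Q x * F x) q + conj_form A b (\<lambda>x. indicator (- Q) x * F x) q"
      by (rule conj_form_add_left[OF U b p1 p2 q])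
    finally have eq: "complex_of_real ((L2_norm q)\<^sup>2) = conj_form A b (\<lambda>x. indicator Q x * F x) q + conj_form A b (\<lambda>x. indicator (- Q) x * F x) q" .
    have "(L2_norm q)\<^sup>2 = cmod (complex_of_real ((L2_norm q)\<^sup>2))" by (simp only: norm_of_real abs_power2)
    also have "\<dots> \<le> cmod (conj_form A b (\<lambda>x. indicator Q x * F x) q) + cmod (conj_form A b (\<lambda>x. indicator (- Q) x * F x) q)"
      unfolding eq by (rule norm_triangle_ineq)
    also have "\<dots> \<le> C0 * (L2_norm (\<lambda>x. indicator Q x * F x) * L2_norm q) + C1 * (L2_norm F / r ^ N * L2_norm q)"
    proof (intro add_mono C0(2) p1 q)
      have "r ^ N * cmod (conj_form A b (\<lambda>x. indicator (- Q) x * F x) q) \<le> C1 * (L2_norm (\<lambda>x. indicator (- Q) x * F x) * L2_norm q)"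
      proof (rule decay[OF r p2 q])
        show "\<forall>j. \<bar>x $ j - c $ j\<bar> \<le> r" if "q x \<noteq> 0" for x using that Es by (auto simp: q_def indicator_def split: if_splits)
        show "\<exists>j\<in>UNIV. 2 * r \<le> \<bar>x $ j - c $ j\<bar>" if "indicator (- Q) x * F x \<noteq> 0" for x
          using that by (auto simp: Q_def indicator_def not_less split: if_splits)
      qed
      also have "\<dots> \<le> C1 * (L2_norm F * L2_norm q)"
        using C1 L2_norm_mult_le[OF F ind[OF Q'] ib] by (intro mult_left_mono mult_right_mono) simp_all
      finally show "cmod (conj_form A b (\<lambda>x. indicator (- Q) x * F x) q) \<le> C1 * (L2_norm F / r ^ N * L2_norm q)"
        using r by (simp add: field_simps)
    qed
    finally have "L2_norm q * L2_norm q \<le> (C0 * L2_norm (\<lambda>x. indicator Q x * F x) + C1 * (L2_norm F / r ^ N)) * L2_norm q"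
      by (simp add: power2_eq_square algebra_simps)
    then have "L2_norm q \<le> C0 * L2_norm (\<lambda>x. indicator Q x * F x) + C1 * (L2_norm F / r ^ N)"
    proof (cases "L2_norm q = 0")
      case True
      then show ?thesis using C0(1) C1 r by simp
    next
      case False
      then have "0 < L2_norm q" using L2_norm_nonneg[of q] by linarith
      with \<open>L2_norm q * L2_norm q \<le> _\<close> show ?thesis by (simp only: mult_le_cancel_right_pos)
    qed
    also have "\<dots> \<le> (C0 + C1) * L2_norm (\<lambda>x. indicator Q x * F x) + (C0 + C1) * (L2_norm F / r ^ N)"
      using C0(1) C1 r by (intro add_mono mult_right_mono) simp_all
    finally show ?thesis unfolding q_def[abs_def] Q_def by (simp add: distrib_left)
  qed
  moreover have "0 \<le> C0 + C1" using C0(1) C1 by simp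
  ultimately show ?thesis by blast
qed

end

section \<open>Propagation of decay in cones\<close>

lemma japanese_measurable [measurable]: "japanese \<in> borel_measurable borel"
  unfolding japanese_def[abs_def] by measurable

lemma norm_le_japanese: "norm X \<le> japanese X"
  unfolding japanese_def by (rule real_le_rsqrt) simp

lemma japanese_le: "japanese X \<le> 1 + norm X"
  unfolding japanese_def by (rule real_le_lsqrt) (simp_all add: power2_sum)

lemma japanese_pos: "0 < japanese X"
  unfolding japanese_def by (simp add: add_pos_nonneg)

lemma L2_indicator_mult:
  assumes "F \<in> L2" "E \<in> sets borel"
  shows "(\<lambda>x. indicator E x * F x) \<in> L2"
  by (rule L2_mult_bounded[OF assms(1), where C=1]) (use assms(2) in \<open>simp_all add: indicator_def\<close>)

lemma nn_integral_indicator_L2: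
  assumes F: "F \<in> L2" and E: "E \<in> sets borel"
  shows "(\<integral>\<^sup>+x\<in>E. ennreal ((cmod (F x))\<^sup>2) \<partial>lborel) = ennreal ((L2_norm (\<lambda>x. indicator E x * F x))\<^sup>2)"
  unfolding L2_norm_nn[OF L2_indicator_mult[OF F E], symmetric]
  by (intro nn_integral_cong) (simp add: indicator_def ennreal_power)

text \<open>Chebyshev: on \<open>Q\<close> the weight is at least \<rho>^(2N), so the square root of
  the weighted integral serves as \<open>M\<close>.\<close>

lemma L2_norm_indicator_weighted:
  fixes F :: "'a::euclidean_space \<Rightarrow> complex"
  assumes F: "F \<in> L2" and w: "weighted_L2_on (real N) \<Gamma> F"
  shows "\<exists>M\<ge>0. \<forall>Q\<in>sets borel. \<forall>\<rho>>0. Q \<subseteq> \<Gamma> \<inter> {x. \<rho> \<le> norm x} \<longrightarrow> L2_norm (\<lambda>x. indicator Q x * F x) \<le> M / \<rho> ^ N"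
proof -
  note [measurable] = L2_measurable[OF F]
  define I where "I = (\<integral>\<^sup>+X\<in>\<Gamma>. ennreal (japanese X powr (2 * real N) * (cmod (F X))\<^sup>2) \<partial>lborel)"
  have I: "I < \<infinity>" using w unfolding weighted_L2_on_def I_def .
  have "L2_norm (\<lambda>x. indicator Q x * F x) \<le> sqrt (enn2real I) / \<rho> ^ N"
    if Q: "Q \<in> sets borel" and \<rho>: "0 < \<rho>" and sub: "Q \<subseteq> \<Gamma> \<inter> {x. \<rho> \<le> norm x}" for Q \<rho>
  proof -
    have pt: "ennreal (\<rho> ^ (2 * N)) * (ennreal ((cmod (F x))\<^sup>2) * indicator Q x) \<le> ennreal (japanese x powr (2 * real N) * (cmod (F x))\<^sup>2) * indicator \<Gamma> x" for x
    proof (cases "x \<in> Q")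
      case True
      then have x: "x \<in> \<Gamma>" "\<rho> \<le> norm x" using sub by auto
      have "\<rho> ^ (2 * N) \<le> japanese x ^ (2 * N)"
        using \<rho> x(2) norm_le_japanese[of x] by (intro power_mono) linarith+
      also have "\<dots> = japanese x powr (2 * real N)"
        using powr_realpow[OF japanese_pos, of x "2 * N"] by simp
      finally have "\<rho> ^ (2 * N) * (cmod (F x))\<^sup>2 \<le> japanese x powr (2 * real N) * (cmod (F x))\<^sup>2"
        by (rule mult_right_mono) simp
      then show ?thesis using True x(1) \<rho> by (simp add: ennreal_mult[symmetric] ennreal_leI)
    qed simp
    have "ennreal (\<rho> ^ (2 * N) * (L2_norm (\<lambda>x. indicator Q x * F x))\<^sup>2) = (\<integral>\<^sup>+x. ennreal (\<rho> ^ (2 * N)) * (ennreal ((cmod (F x))\<^sup>2) * indicator Q x) \<partial>lborel)"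
      using \<rho> Q by (subst nn_integral_cmult) (simp_all add: nn_integral_indicator_L2[OF F Q] ennreal_mult)
    also have "\<dots> \<le> I" unfolding I_def by (intro nn_integral_mono pt)
    also have "\<dots> = ennreal (enn2real I)" using I by simp
    finally have "(\<rho> ^ N * L2_norm (\<lambda>x. indicator Q x * F x))\<^sup>2 \<le> enn2real I"
      by (simp add: power_mult_distrib power_mult[symmetric] mult.commute)
    then have "\<rho> ^ N * L2_norm (\<lambda>x. indicator Q x * F x) \<le> sqrt (enn2real I)"
      by (rule real_le_rsqrt)
    then show ?thesis using \<rho> by (simp add: field_simps)
  qed
  then show ?thesis by (intro exI[of _ "sqrt (enn2real I)"]) auto
qed

text \<open>On the shell k <= |x| < k + 1 the weight is at most of order k^(2s), and with N >= s + 1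
  the shell contributes at most a multiple of k^(2s - 2N) <= k^-2, which is summable. Below radius
  \<open>K\<close> the weight is bounded and \<open>G \<in> L2\<close> suffices.\<close>

lemma decay_imp_weighted_L2_on:
  fixes G :: "'a::euclidean_space \<Rightarrow> complex"
  assumes G: "G \<in> L2" and \<Gamma>: "\<Gamma> \<in> sets borel" and s: "0 \<le> s" and N: "s + 1 \<le> real N" and K: "1 \<le> K" and B: "0 \<le> B"
    and decay: "\<And>k. K \<le> k \<Longrightarrow> L2_norm (\<lambda>x. indicator (\<Gamma> \<inter> {x. real k \<le> norm x \<and> norm x < real k + 1}) x * G x) \<le> B / real k ^ N"
  shows "weighted_L2_on s \<Gamma> G"
proof -
  note [measurable] = L2_measurable[OF G] \<Gamma>
  define E where "E k = \<Gamma> \<inter> {x. real k \<le> norm x \<and> norm x < real k + 1}" for k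
  have E [measurable]: "E k \<in> sets borel" for k unfolding E_def by measurable
  define h where "h x = ennreal (japanese x powr (2 * s) * (cmod (G x))\<^sup>2)" for x
  have h [measurable]: "h \<in> borel_measurable borel" unfolding h_def[abs_def] by measurable
  have hle: "h x \<le> ennreal (R powr (2 * s)) * ennreal ((cmod (G x))\<^sup>2)" if "1 + norm x \<le> R" for x R
  proof -
    have "japanese x powr (2 * s) \<le> R powr (2 * s)"
      using s that japanese_le[of x] japanese_pos[of x] by (intro powr_mono2) linarith+
    then show ?thesis unfolding h_def by (simp add: ennreal_mult[symmetric] ennreal_leI mult_right_mono)
  qed
  define L where "L = {x::'a. norm x < real K}"
  have L [measurable]: "L \<in> sets borel" unfolding L_def by measurable
  have cover: "h x * indicator \<Gamma> x \<le> h x * indicator L x + (\<Sum>k. h x * indicator (E (k + K)) x)" for x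
  proof (cases "x \<in> \<Gamma> \<and> x \<notin> L")
    case True
    \<comment> \<open>The index is shifted because the sum over shells starts at
      \<open>K\<close>.\<close>
    define k where "k = nat \<lfloor>norm x\<rfloor> - K"
    have "real K \<le> norm x" using True by (simp add: L_def)
    then have "k + K = nat \<lfloor>norm x\<rfloor>" unfolding k_def by (simp add: le_nat_iff le_floor_iff)
    then have "x \<in> E (k + K)" using True unfolding E_def by simp
    then have "h x * indicator \<Gamma> x \<le> (\<Sum>i\<in>{k}. h x * indicator (E (i + K)) x)" using True by simp
    also have "\<dots> \<le> (\<Sum>k. h x * indicator (E (k + K)) x)" by (rule sum_le_suminf) simp_all
    finally show ?thesis by (rule order_trans) simp
  qed (auto simp: indicator_def)
  have shell: "(\<integral>\<^sup>+x. h x * indicator (E k) x \<partial>lborel) \<le> ennreal (3 powr (2 * s) * B\<^sup>2 * (1 / real k ^ 2))" if k: "K \<le> k" for k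
  proof -
    have k0: "1 \<le> real k" using k K by simp
    have "(\<integral>\<^sup>+x. h x * indicator (E k) x \<partial>lborel) \<le> (\<integral>\<^sup>+x. ennreal ((3 * real k) powr (2 * s)) * (ennreal ((cmod (G x))\<^sup>2) * indicator (E k) x) \<partial>lborel)"
    proof (intro nn_integral_mono)
      fix x
      show "h x * indicator (E k) x \<le> ennreal ((3 * real k) powr (2 * s)) * (ennreal ((cmod (G x))\<^sup>2) * indicator (E k) x)"
      proof (cases "x \<in> E k")
        case True
        \<comment> \<open>1 + |x| < k + 2 <= 3 k for k >= 1.\<close>
        then have "1 + norm x \<le> 3 * real k" using k0 unfolding E_def by auto
        from hle[OF this] True show ?thesis by simp
      qed simp
    qed
    also have "\<dots> = ennreal ((3 * real k) powr (2 * s) * (L2_norm (\<lambda>x. indicator (E k) x * G x))\<^sup>2)"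
      by (subst nn_integral_cmult) (simp_all add: nn_integral_indicator_L2[OF G E] ennreal_mult)
    also have "\<dots> \<le> ennreal (3 powr (2 * s) * B\<^sup>2 * (1 / real k ^ 2))"
    proof (rule ennreal_leI)
      have "(3 * real k) powr (2 * s) * (L2_norm (\<lambda>x. indicator (E k) x * G x))\<^sup>2 \<le> (3 * real k) powr (2 * s) * (B / real k ^ N)\<^sup>2"
        using decay[OF k] unfolding E_def by (intro mult_left_mono power_mono) simp_all
      also have "\<dots> = 3 powr (2 * s) * B\<^sup>2 * (real k powr (2 * s) / real k ^ (2 * N))"
        by (simp add: powr_mult power_divide power_mult[symmetric] mult.commute)
      also have "real k powr (2 * s) / real k ^ (2 * N) = real k powr (2 * s - 2 * real N)"
        using powr_realpow[of "real k" "2 * N"] k0 by (simp add: powr_diff)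
      also have "3 powr (2 * s) * B\<^sup>2 * real k powr (2 * s - 2 * real N) \<le> 3 powr (2 * s) * B\<^sup>2 * real k powr (- 2)"
        using k0 N by (intro mult_left_mono powr_mono) simp_all
      also have "real k powr (- 2) = 1 / real k ^ 2"
        using powr_realpow[of "real k" 2] k0 by (simp add: powr_minus_divide)
      finally show "(3 * real k) powr (2 * s) * (L2_norm (\<lambda>x. indicator (E k) x * G x))\<^sup>2 \<le> 3 powr (2 * s) * B\<^sup>2 * (1 / real k ^ 2)" .
    qed
    finally show ?thesis .
  qed
  have summ: "summable (\<lambda>k. 3 powr (2 * s) * B\<^sup>2 * (1 / real (k + K) ^ 2))"
    using summable_ignore_initial_segment[OF inverse_power_summable[of 2], of K]
    by (intro summable_mult) (simp add: inverse_eq_divide)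
  have low: "(\<integral>\<^sup>+x. h x * indicator L x \<partial>lborel) < \<infinity>"
  proof -
    have "(\<integral>\<^sup>+x. h x * indicator L x \<partial>lborel) \<le> (\<integral>\<^sup>+x. ennreal ((1 + real K) powr (2 * s)) * (ennreal ((cmod (G x))\<^sup>2) * indicator L x) \<partial>lborel)"
    proof (intro nn_integral_mono)
      fix x
      show "h x * indicator L x \<le> ennreal ((1 + real K) powr (2 * s)) * (ennreal ((cmod (G x))\<^sup>2) * indicator L x)"
      proof (cases "x \<in> L")
        case True
        then have "1 + norm x \<le> 1 + real K" unfolding L_def by auto
        from hle[OF this] True show ?thesis by simp
      qed simp
    qed
    also have "\<dots> = ennreal ((1 + real K) powr (2 * s) * (L2_norm (\<lambda>x. indicator L x * G x))\<^sup>2)"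
      by (subst nn_integral_cmult) (simp_all add: nn_integral_indicator_L2[OF G L] ennreal_mult)
    finally show ?thesis by (rule le_less_trans) simp
  qed
  have "(\<integral>\<^sup>+x\<in>\<Gamma>. h x \<partial>lborel) \<le> (\<integral>\<^sup>+x. h x * indicator L x + (\<Sum>k. h x * indicator (E (k + K)) x) \<partial>lborel)"
    by (intro nn_integral_mono cover)
  also have "\<dots> = (\<integral>\<^sup>+x. h x * indicator L x \<partial>lborel) + (\<integral>\<^sup>+x. (\<Sum>k. h x * indicator (E (k + K)) x) \<partial>lborel)"
    by (rule nn_integral_add) measurable
  also have "(\<integral>\<^sup>+x. (\<Sum>k. h x * indicator (E (k + K)) x) \<partial>lborel) = (\<Sum>k. \<integral>\<^sup>+x. h x * indicator (E (k + K)) x \<partial>lborel)"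
    by (rule nn_integral_suminf) measurable
  also have "\<dots> \<le> (\<Sum>k. ennreal (3 powr (2 * s) * B\<^sup>2 * (1 / real (k + K) ^ 2)))"
    by (intro suminf_le shell summableI) simp
  also have "\<dots> = ennreal (\<Sum>k. 3 powr (2 * s) * B\<^sup>2 * (1 / real (k + K) ^ 2))"
    by (rule suminf_ennreal2[OF _ summ]) simp
  finally have "(\<integral>\<^sup>+x\<in>\<Gamma>. h x \<partial>lborel) < \<infinity>"
    using low by (auto intro: le_less_trans simp: add_left_mono)
  then show ?thesis unfolding weighted_L2_on_def h_def .
qed

text \<open>The part of a thin cone at distance about k lies in a cube around k v of half-side r = 3
  \<delta> k, and the doubled cube still lies in \<open>\<Gamma>\<close>, at distance at least k / 2
  from the origin. So decay of \<open>F\<close> in \<open>\<Gamma>\<close> controls the first term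
  of \<open>loc\<close>, while the remainder is of order k^-N because r is proportional to
  k.\<close>

lemma microlocal_decay_transfer:
  fixes F G :: "real^'d::finite \<Rightarrow> complex"
  assumes F: "F \<in> L2" and G: "G \<in> L2"
    and loc: "\<And>N. \<exists>C\<ge>0. \<forall>c::real^'d. \<forall>r E. 0 < r \<longrightarrow> E \<in> sets borel \<longrightarrow> E \<subseteq> {x. \<forall>j. \<bar>x $ j - c $ j\<bar> \<le> r} \<longrightarrow>
      L2_norm (\<lambda>x. indicator E x * G x) \<le> C * (L2_norm (\<lambda>x. indicator {x. \<forall>j. \<bar>x $ j - c $ j\<bar> < 2 * r} x * F x) + L2_norm F / r ^ N)"
    and \<Gamma>: "open \<Gamma>" "punctured_cone \<Gamma>" "X\<^sub>0 \<in> \<Gamma>" and FW: "\<And>s. 0 \<le> s \<Longrightarrow> weighted_L2_on s \<Gamma> F"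
  shows "\<exists>\<Gamma>'. open \<Gamma>' \<and> punctured_cone \<Gamma>' \<and> X\<^sub>0 \<in> \<Gamma>' \<and> (\<forall>s\<ge>0. weighted_L2_on s \<Gamma>' G)"
proof -
  have cone: "c *\<^sub>R X \<in> \<Gamma>" if "X \<in> \<Gamma>" "0 < c" for c X using \<Gamma>(2) that unfolding punctured_cone_def by blast
  have X0: "X\<^sub>0 \<noteq> 0" using \<Gamma>(2,3) unfolding punctured_cone_def by blast
  define v where "v = (1 / norm X\<^sub>0) *\<^sub>R X\<^sub>0"
  have v: "norm v = 1" "v \<in> \<Gamma>" "norm X\<^sub>0 *\<^sub>R v = X\<^sub>0" using X0 cone[OF \<Gamma>(3)] by (simp_all add: v_def)
  obtain \<eta>0 where \<eta>0: "0 < \<eta>0" "ball v \<eta>0 \<subseteq> \<Gamma>" using \<Gamma>(1) v(2) open_contains_ball by blast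
  \<comment> \<open>A radius of at most 1 keeps the doubled cubes at distance at least k / 2 from
    the origin.\<close>
  define \<eta> where "\<eta> = min \<eta>0 1"
  have \<eta>: "0 < \<eta>" "\<eta> \<le> 1" "ball v \<eta> \<subseteq> \<Gamma>" using \<eta>0 by (auto simp: \<eta>_def)
  define D where "D = real CARD('d)"
  have D: "1 \<le> D" unfolding D_def using zero_less_card_finite[where 'a='d] by simp
  \<comment> \<open>The doubled cube has half-side 6 \<delta> k, so its points are within 6 D
    \<delta> k = \<eta> k / 2 of k v; after division by k it lies in
    \<open>ball v \<eta>\<close>.\<close>
  define \<delta> where "\<delta> = \<eta> / (12 * D)"
  have \<delta>: "0 < \<delta>" "D * (6 * \<delta>) = \<eta> / 2" using \<eta> D by (simp_all add: \<delta>_def)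
  have "\<delta> \<le> D * (6 * \<delta>)" using D \<delta>(1) by (simp add: mult_mono[of 1 D \<delta> "6 * \<delta>", simplified])
  then have \<delta>1: "\<delta> \<le> 1" using \<delta>(2) \<eta>(2) by linarith
  define \<Gamma>' where "\<Gamma>' = {X. norm (X - norm X *\<^sub>R v) < \<delta> * norm X}"
  have op: "open \<Gamma>'" unfolding \<Gamma>'_def by (intro open_Collect_less continuous_intros)
  have pc: "punctured_cone \<Gamma>'"
    unfolding punctured_cone_def
  proof (intro conjI ballI allI impI)
    show "0 \<notin> \<Gamma>'" by (simp add: \<Gamma>'_def)
    fix X c assume X: "X \<in> \<Gamma>'" and c: "(0::real) < c"
    have "c *\<^sub>R X - norm (c *\<^sub>R X) *\<^sub>R v = c *\<^sub>R (X - norm X *\<^sub>R v)" using c by (simp add: algebra_simps)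
    then show "c *\<^sub>R X \<in> \<Gamma>'" using X c by (simp add: \<Gamma>'_def)
  qed
  have X0': "X\<^sub>0 \<in> \<Gamma>'" using X0 \<delta>(1) by (simp add: \<Gamma>'_def v(3))
  \<comment> \<open>For k >= K one has 1 <= \<delta> k, which absorbs the thickness 1 of a
    shell.\<close>
  obtain K :: nat where K0: "1 / \<delta> \<le> real K" using real_arch_simple by blast
  have K1: "1 \<le> real k" "1 \<le> \<delta> * real k" if "K \<le> k" for k
  proof -
    have "1 / \<delta> \<le> real k" using K0 that by linarith
    then show "1 \<le> \<delta> * real k" using \<delta>(1) by (simp add: field_simps)
    have "1 \<le> 1 / \<delta>" using \<delta>(1) \<delta>1 by simp
    with \<open>1 / \<delta> \<le> real k\<close> show "1 \<le> real k" by linarith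
  qed
  have shell: "\<Gamma>' \<inter> {x. real k \<le> norm x \<and> norm x < real k + 1} \<subseteq> {x. \<forall>j. \<bar>x $ j - (real k *\<^sub>R v) $ j\<bar> \<le> 3 * \<delta> * real k}" if k: "K \<le> k" for k
  proof (intro subsetI CollectI allI)
    fix X j assume "X \<in> \<Gamma>' \<inter> {x. real k \<le> norm x \<and> norm x < real k + 1}"
    then have X: "norm (X - norm X *\<^sub>R v) < \<delta> * norm X" "real k \<le> norm X" "norm X < real k + 1" by (simp_all add: \<Gamma>'_def)
    have "X - real k *\<^sub>R v = (X - norm X *\<^sub>R v) + (norm X - real k) *\<^sub>R v" by (simp add: algebra_simps)
    from arg_cong[OF this, of norm] have "norm (X - real k *\<^sub>R v) \<le> norm (X - norm X *\<^sub>R v) + \<bar>norm X - real k\<bar>"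
      using norm_triangle_ineq[of "X - norm X *\<^sub>R v" "(norm X - real k) *\<^sub>R v"] unfolding norm_scaleR v(1) mult_1_right by (simp only:)
    moreover have "\<delta> * norm X \<le> \<delta> * (real k + 1)" using X(3) \<delta>(1) by simp
    moreover have "\<delta> \<le> \<delta> * real k" using K1(1)[OF k] \<delta>(1) by simp
    \<comment> \<open>Of the three multiples of \<delta> k, two come from \<delta> |X| <= \<delta>
      (k + 1) <= 2 \<delta> k and one from the difference of |X| and k, which is below 1 <= \<delta>
      k.\<close>
    ultimately have "norm (X - real k *\<^sub>R v) \<le> 3 * (\<delta> * real k)"
      using X K1(2)[OF k] \<delta>1 by (simp add: distrib_left)
    moreover have "\<bar>(X - real k *\<^sub>R v) $ j\<bar> \<le> norm (X - real k *\<^sub>R v)" by (rule component_le_norm_cart)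
    ultimately show "\<bar>X $ j - (real k *\<^sub>R v) $ j\<bar> \<le> 3 * \<delta> * real k" by simp
  qed
  have cube: "{x. \<forall>j. \<bar>x $ j - (real k *\<^sub>R v) $ j\<bar> < 2 * (3 * \<delta> * real k)} \<subseteq> \<Gamma> \<inter> {x. real k / 2 \<le> norm x}" if k: "K \<le> k" for k
  proof (intro subsetI IntI CollectI)
    fix x assume "x \<in> {x. \<forall>j. \<bar>x $ j - (real k *\<^sub>R v) $ j\<bar> < 2 * (3 * \<delta> * real k)}"
    then have x: "\<bar>(x - real k *\<^sub>R v) $ j\<bar> \<le> 6 * \<delta> * real k" for j by (simp add: less_imp_le mult.assoc)
    have k1: "0 < real k" using K1(1)[OF k] by linarith
    have "norm (x - real k *\<^sub>R v) \<le> (\<Sum>j\<in>UNIV. \<bar>(x - real k *\<^sub>R v) $ j\<bar>)" by (rule norm_le_l1_cart)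
    also have "\<dots> \<le> (\<Sum>j\<in>(UNIV::'d set). 6 * \<delta> * real k)" by (intro sum_mono x)
    also have "\<dots> = D * (6 * \<delta>) * real k" by (simp add: D_def)
    also have "\<dots> = \<eta> / 2 * real k" by (simp only: \<delta>(2))
    finally have n: "norm (x - real k *\<^sub>R v) \<le> \<eta> / 2 * real k" .
    have "(1 / real k) *\<^sub>R x \<in> ball v \<eta>"
    proof -
      have "v - (1 / real k) *\<^sub>R x = - ((1 / real k) *\<^sub>R (x - real k *\<^sub>R v))" using k1 by (simp add: algebra_simps)
      then have "dist v ((1 / real k) *\<^sub>R x) = norm (x - real k *\<^sub>R v) / real k" using k1 by (simp add: dist_norm norm_minus_commute)
      also have "\<dots> \<le> \<eta> / 2" using n k1 by (simp add: field_simps)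
      finally show ?thesis using \<eta>(1) by simp
    qed
    then have "real k *\<^sub>R ((1 / real k) *\<^sub>R x) \<in> \<Gamma>" by (intro cone k1 subsetD[OF \<eta>(3)])
    then show "x \<in> \<Gamma>" using k1 by simp
    have "norm (real k *\<^sub>R v) = real k" using v(1) by simp
    moreover have "norm (real k *\<^sub>R v) \<le> norm x + norm (x - real k *\<^sub>R v)"
      using norm_triangle_sub[of "real k *\<^sub>R v" x] by (simp add: norm_minus_commute)
    moreover have "\<eta> / 2 * real k \<le> 1 / 2 * real k" using \<eta>(2) by (intro mult_right_mono) simp_all
    ultimately show "real k / 2 \<le> norm x" using n by linarith
  qed
  have "weighted_L2_on s \<Gamma>' G" if s: "0 \<le> s" for s
  proof -
    define N where "N = nat \<lceil>s + 1\<rceil>"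
    have N: "s + 1 \<le> real N" unfolding N_def using s by linarith
    obtain M where M: "0 \<le> M" "\<And>Q \<rho>. Q \<in> sets borel \<Longrightarrow> 0 < \<rho> \<Longrightarrow> Q \<subseteq> \<Gamma> \<inter> {x. \<rho> \<le> norm x} \<Longrightarrow> L2_norm (\<lambda>x. indicator Q x * F x) \<le> M / \<rho> ^ N"
      using L2_norm_indicator_weighted[OF F FW, of N] by auto
    obtain C where C: "0 \<le> C" "\<And>c r E. 0 < r \<Longrightarrow> E \<in> sets borel \<Longrightarrow> E \<subseteq> {x. \<forall>j. \<bar>x $ j - c $ j\<bar> \<le> r} \<Longrightarrow>
      L2_norm (\<lambda>x. indicator E x * G x) \<le> C * (L2_norm (\<lambda>x. indicator {x. \<forall>j. \<bar>x $ j - c $ j\<bar> < 2 * r} x * F x) + L2_norm F / r ^ N)"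
      using loc[of N] by auto
    \<comment> \<open>The factor 2^N comes from the distance k / 2 of the doubled cube, the divisor
      (3 \<delta>)^N from r = 3 \<delta> k.\<close>
    define B where "B = C * (M * 2 ^ N + L2_norm F / (3 * \<delta>) ^ N)"
    show ?thesis
    proof (rule decay_imp_weighted_L2_on[OF G _ s N, where K="max K 1" and B=B])
      show "\<Gamma>' \<in> sets borel" using op by simp
      show "0 \<le> B" unfolding B_def using C(1) M(1) \<delta>(1) by (intro mult_nonneg_nonneg add_nonneg_nonneg divide_nonneg_nonneg) simp_all
      fix k assume "max K 1 \<le> k"
      then have k: "K \<le> k" by simp
      have k1: "0 < real k" using K1(1)[OF k] by linarith
      have r: "0 < 3 * \<delta> * real k" using \<delta>(1) k1 by simp
      have Em: "\<Gamma>' \<inter> {x. real k \<le> norm x \<and> norm x < real k + 1} \<in> sets borel"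
        using op by (intro sets.Int) (simp, measurable)
      have Qm: "{x. \<forall>j. \<bar>x $ j - (real k *\<^sub>R v) $ j\<bar> < 2 * (3 * \<delta> * real k)} \<in> sets borel" by measurable
      have "L2_norm (\<lambda>x. indicator (\<Gamma>' \<inter> {x. real k \<le> norm x \<and> norm x < real k + 1}) x * G x)
          \<le> C * (L2_norm (\<lambda>x. indicator {x. \<forall>j. \<bar>x $ j - (real k *\<^sub>R v) $ j\<bar> < 2 * (3 * \<delta> * real k)} x * F x) + L2_norm F / (3 * \<delta> * real k) ^ N)"
        by (rule C(2)[OF r Em shell[OF k]])
      also have "\<dots> \<le> C * (M / (real k / 2) ^ N + L2_norm F / (3 * \<delta> * real k) ^ N)"
        using k1 by (intro mult_left_mono add_right_mono C(1) M(2) Qm cube[OF k]) simp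
      also have "\<dots> = B / real k ^ N"
        unfolding B_def by (simp add: power_divide power_mult_distrib add_divide_distrib distrib_left)
      finally show "L2_norm (\<lambda>x. indicator (\<Gamma>' \<inter> {x. real k \<le> norm x \<and> norm x < real k + 1}) x * G x) \<le> B / real k ^ N" .
    qed simp
  qed
  then show ?thesis using op pc X0' by blast
qed

theorem theorem1p6:
  fixes a :: "real^('n::finite + 'n) \<Rightarrow> complex"
    and A :: "(real^('n + 'n)) operator"
    and f :: "real^'n \<Rightarrow> complex"
  assumes "a \<in> S000"
    and "A \<in> Mp"
    and "f \<in> L2"
  shows "WF A (weyl_op a f) \<subseteq> WF A f"
proof -
  obtain S where SA: "metaplectic_operator S A"
    using assms(2) unfolding Mp_def metaplectic_double_cover_def by blast
  note U = metaplectic_unitary[OF SA]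
  let ?t = "tensor f (\<lambda>y. cnj (f y))" and ?T = "tensor (weyl_op a f) (\<lambda>y. cnj (weyl_op a f y))"
  have tL: "?t \<in> L2" by (intro tensor_L2 L2_cnj assms(3))
  have TL: "?T \<in> L2" by (intro tensor_L2 L2_cnj weyl_op_L2 assms(1,3))
  have FL: "A ?t \<in> L2" and GL: "A ?T \<in> L2" by (intro unitary_L2[OF U] tL TL)+
  note b = tensor_symbol_S000[OF assms(1)]
  \<comment> \<open>Unitarity moves \<open>A\<close> from the tensor product onto the test function,
    and \<open>weyl_op_tensor_inner\<close> supplies the symbol. This is the weak form of the
    relation between the two Wigner distributions that \<open>conj_form_localization\<close> asks
    for.\<close>
  have FG: "L2_inner (A ?T) q = conj_form A (tensor_symbol a) (A ?t) q" if q: "q \<in> L2" for q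
  proof -
    note qi = unitary_inv_L2[OF U q]
    have "L2_inner (A ?T) q = L2_inner (A ?T) (A (unitary_inv A q))"
      by (intro L2_inner_cong_AE GL q unitary_L2[OF U] qi ae_eq_refl ae_eq_sym[OF unitary_inv_right[OF U q]])
    also have "\<dots> = L2_inner ?T (unitary_inv A q)" by (rule unitary_inner[OF U TL qi])
    also have "\<dots> = weyl_form (tensor_symbol a) ?t (unitary_inv A q)" by (rule weyl_op_tensor_inner[OF assms(1,3) qi])
    also have "\<dots> = conj_form A (tensor_symbol a) (A ?t) q"
      unfolding conj_form_def
      by (intro weyl_form_cong_AE tL qi unitary_inv_L2[OF U FL] ae_eq_refl ae_eq_sym[OF unitary_inv_eqI[OF U tL FL ae_eq_refl]])
    finally show ?thesis .
  qed
  show ?thesis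
  proof
    fix X assume X: "X \<in> WF A (weyl_op a f)"
    show "X \<in> WF A f"
    proof (rule ccontr)
      assume "X \<notin> WF A f"
      with X obtain \<Gamma> where \<Gamma>: "open \<Gamma>" "punctured_cone \<Gamma>" "X \<in> \<Gamma>" "\<And>s. 0 \<le> s \<Longrightarrow> weighted_L2_on s \<Gamma> (A ?t)"
        unfolding WF_def wigner_def by blast
      from microlocal_decay_transfer[OF FL GL conj_form_localization[OF SA b FL GL] \<Gamma>] FG
      have "\<exists>\<Gamma>'. open \<Gamma>' \<and> punctured_cone \<Gamma>' \<and> X \<in> \<Gamma>' \<and> (\<forall>s\<ge>0. weighted_L2_on s \<Gamma>' (A ?T))" by simp
      with X show False unfolding WF_def wigner_def by blast
    qed
  qed
qed

end
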